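(* Let $\mathcal{E}$ be a category with finite limits and with reflexive coequalizers that are preserved by pullback functors. Then the double category of profunctors $\mathbb{P}\mathrm{rof}(\mathcal{E})=\mathbf{Mod}(\mathbb{S}\mathrm{pan}(\mathcal{E}))$ is Cartesian.
   Context: A (pseudo) double category $\mathbb D$ consists of: a category $D_0$ (objects and vertical arrows of $\mathbb D$); a category $D_1$ (its objects are called horizontal arrows, its arrows cells); functors $S,T:D_1\to D_0$, $U:D_0\to D_1$ and $\odot:D_1\times_{D_0}D_1\to D_1$ (defined on pairs $(M,N)$ with $SM=TN$) such that $SU=TU=\mathrm{id}$, $S(M\odot N)=SN$, $T(M\odot N)=TM$; and natural isomorphisms $(M\odot N)\odot P\cong M\odot(N\odot P)$, $U_{TM}\odot M\cong M$, $M\odot U_{SM}\cong M$ in $D_1$ whose components have identity source and target under $S,T$ and satisfy the pentagon and triangle axioms. Write $M:A\nrightarrow B$ if $SM=A$, $TM=B$. A cell $\alpha:M\to N$ with $S\alpha=f$, $T\alpha=g$ has sides $(f,g)$; it is globular if both sides are identities. A lax double functor $F:\mathbb B\to\mathbb D$ consists of functors $F_0:B_0\to D_0$, $F_1:B_1\to D_1$ commuting with $S,T$ and natural globular cells $F_1M\odot F_1N\to F_1(M\odot N)$, $U_{F_0A}\to F_1U_A$ satisfying the usual coherence axioms; it is a (pseudo) double functor if these are invertible. A vertical natural transformation $F\to G$ is a pair of natural transformations $\phi_0:F_0\to G_0$, $\phi_1:F_1\to G_1$ with $S\phi_M=\phi_{SM}$, $T\phi_M=\phi_{TM}$, compatible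 with the structure cells. $\mathbf{DblCat}$ is the 2-category of double categories, double functors and vertical natural transformations. $\mathbb D$ is Cartesian if the diagonal $\Delta:\mathbb D\to\mathbb D\times\mathbb D$ and the unique $!:\mathbb D\to\mathbb 1$ have right adjoints in $\mathbf{DblCat}$. $\mathbb{S}\mathrm{pan}(\mathcal E)$: objects and vertical arrows are the objects and arrows of $\mathcal E$; a horizontal arrow $A\nrightarrow B$ is a span $A\xleftarrow{r_0}R\xrightarrow{r_1}B$; a cell from $(r_0,R,r_1)$ to $(s_0,S,s_1)$ with sides $(f,g)$ is an arrow $\alpha:R\to S$ with $s_0\alpha=fr_0$, $s_1\alpha=gr_1$; $\odot$ is given by pullback, units are identity spans. $\mathbf{Mod}(\mathbb D)$: objects are monads $(A,S:A\nrightarrow A)$ with globular unit $\eta:U_A\to S$ and multiplication $\mu:S\odot S\to S$ satisfying the unit and associativity laws. Vertical arrows $(A,S)\to(B,T)$ are monad morphisms: vertical $f:A\to B$ with a cell $\phi:S\to T$ with sides $(f,f)$ compatible with units and multiplications. Horizontal arrows $(A,S)\nrightarrow(B,T)$ are modules: $M:A\nrightarrow B$ with globular actions $\rho:M\odot S\to M$, $\lambda:T\odot M\to M$ that are unital, associative and compatible with each other. A cell $M\to N$ with sides $(f,\phi),(g,\psi)$ is a cell $\alpha:M\to N$ of $\mathbb D$ with sides $(f,g)$ compatible with the actions: $\alpha\circ\rho_M=\rho_N\circ(\alpha\odot\phi)$, $\alpha\circ\lambda_M=\lambda_N\circ(\psi\odot\alpha)$. The horizontal composite of modules $M:(A,S)\nrightarrow(B,T)$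 and $N:(B,T)\nrightarrow(C,V)$ is the coequalizer of the reflexive pair $N\odot T\odot M\rightrightarrows N\odot M$ given by the actions of $T$ on $N$ and $M$; the unit on $(A,S)$ is $S$ with actions $\mu$. Thus the objects and vertical arrows of $\mathbb{P}\mathrm{rof}(\mathcal E)$ are the internal categories and internal functors in $\mathcal E$, and the horizontal arrows are internal profunctors. *)

theory Defs
  imports Main
begin

section \<open>Categories and functors\<close>

record ('o, 'a) cat =
  Ob :: "'o set"
  Ar :: "'a set"
  Dom :: "'a \<Rightarrow> 'o"
  Cod :: "'a \<Rightarrow> 'o"
  Idt :: "'o \<Rightarrow> 'a"
  Comp :: "'a \<Rightarrow> 'a \<Rightarrow> 'a" (infixl "\<cdot>\<index>" 70)

definition hom :: "('o, 'a) cat \<Rightarrow> 'o \<Rightarrow> 'o \<Rightarrow> 'a set" where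
  "hom C A B = {f \<in> Ar C. Dom C f = A \<and> Cod C f = B}"

locale category =
  fixes C :: "('o, 'a) cat" (structure)
  assumes dom_ob: "f \<in> Ar C \<Longrightarrow> Dom C f \<in> Ob C"
    and cod_ob: "f \<in> Ar C \<Longrightarrow> Cod C f \<in> Ob C"
    and idt_hom: "A \<in> Ob C \<Longrightarrow> Idt C A \<in> hom C A A"
    and comp_hom: "\<lbrakk>f \<in> hom C X Y; g \<in> hom C Y Z\<rbrakk> \<Longrightarrow> g \<cdot> f \<in> hom C X Z"
    and comp_idt_left: "f \<in> hom C X Y \<Longrightarrow> Idt C Y \<cdot> f = f"
    and comp_idt_right: "f \<in> hom C X Y \<Longrightarrow> f \<cdot> Idt C X = f"
    and comp_assoc: "\<lbrakk>f \<in> hom C W X; g \<in> hom C X Y; h \<in> hom C Y Z\<rbrakk>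
      \<Longrightarrow> (h \<cdot> g) \<cdot> f = h \<cdot> (g \<cdot> f)"

definition is_iso :: "('o, 'a) cat \<Rightarrow> 'a \<Rightarrow> bool" where
  "is_iso C f \<longleftrightarrow> f \<in> Ar C \<and>
    (\<exists>g \<in> hom C (Cod C f) (Dom C f).
      g \<cdot>\<^bsub>C\<^esub> f = Idt C (Dom C f) \<and> f \<cdot>\<^bsub>C\<^esub> g = Idt C (Cod C f))"

record ('o, 'a, 'p, 'b) fct =
  onO :: "'o \<Rightarrow> 'p"
  onA :: "'a \<Rightarrow> 'b"

locale cat_functor =
  fixes C :: "('o, 'a) cat" and D :: "('p, 'b) cat" and F :: "('o, 'a, 'p, 'b) fct"
  assumes source_category: "category C"
    and target_category: "category D"
    and onO_ob: "A \<in> Ob C \<Longrightarrow> onO F A \<in> Ob D"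
    and onA_hom: "f \<in> hom C X Y \<Longrightarrow> onA F f \<in> hom D (onO F X) (onO F Y)"
    and onA_idt: "A \<in> Ob C \<Longrightarrow> onA F (Idt C A) = Idt D (onO F A)"
    and onA_comp: "\<lbrakk>f \<in> hom C X Y; g \<in> hom C Y Z\<rbrakk>
      \<Longrightarrow> onA F (g \<cdot>\<^bsub>C\<^esub> f) = onA F g \<cdot>\<^bsub>D\<^esub> onA F f"

definition id_fct :: "('o, 'a, 'o, 'a) fct" where
  "id_fct = \<lparr>onO = (\<lambda>A. A), onA = (\<lambda>f. f)\<rparr>"

definition comp_fct :: "('p, 'b, 'q, 'c) fct \<Rightarrow> ('o, 'a, 'p, 'b) fct \<Rightarrow> ('o, 'a, 'q, 'c) fct" where
  "comp_fct G F = \<lparr>onO = (\<lambda>A. onO G (onO F A)), onA = (\<lambda>f. onA G (onA F f))\<rparr>"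

definition prod_cat :: "('o, 'a) cat \<Rightarrow> ('p, 'b) cat \<Rightarrow> ('o \<times> 'p, 'a \<times> 'b) cat" where
  "prod_cat C D = \<lparr>
     Ob = Ob C \<times> Ob D,
     Ar = Ar C \<times> Ar D,
     Dom = map_prod (Dom C) (Dom D),
     Cod = map_prod (Cod C) (Cod D),
     Idt = map_prod (Idt C) (Idt D),
     Comp = (\<lambda>(g, g') (f, f'). (g \<cdot>\<^bsub>C\<^esub> f, g' \<cdot>\<^bsub>D\<^esub> f'))\<rparr>"

definition unit_cat :: "(unit, unit) cat" where
  "unit_cat = \<lparr>Ob = UNIV, Ar = UNIV, Dom = (\<lambda>_. ()), Cod = (\<lambda>_. ()), Idt = (\<lambda>_. ()),
     Comp = (\<lambda>_ _. ())\<rparr>"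

definition prod_fct :: "('o, 'a, 'p, 'b) fct \<Rightarrow> ('o1, 'a1, 'p1, 'b1) fct
    \<Rightarrow> ('o \<times> 'o1, 'a \<times> 'a1, 'p \<times> 'p1, 'b \<times> 'b1) fct" where
  "prod_fct F G = \<lparr>onO = map_prod (onO F) (onO G), onA = map_prod (onA F) (onA G)\<rparr>"

definition diag_fct :: "('o, 'a, 'o \<times> 'o, 'a \<times> 'a) fct" where
  "diag_fct = \<lparr>onO = (\<lambda>A. (A, A)), onA = (\<lambda>f. (f, f))\<rparr>"

definition unit_fct :: "('o, 'a, unit, unit) fct" where
  "unit_fct = \<lparr>onO = (\<lambda>_. ()), onA = (\<lambda>_. ())\<rparr>"


section \<open>Limits and coequalizers\<close>

definition is_cone ::
  "('j, 'k) cat \<Rightarrow> ('o, 'a) cat \<Rightarrow> ('j, 'k, 'o, 'a) fct \<Rightarrow> 'o \<Rightarrow> ('j \<Rightarrow> 'a) \<Rightarrow> bool" where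
  "is_cone J C F L p \<longleftrightarrow> L \<in> Ob C \<and>
     (\<forall>j \<in> Ob J. p j \<in> hom C L (onO F j)) \<and>
     (\<forall>u \<in> Ar J. onA F u \<cdot>\<^bsub>C\<^esub> p (Dom J u) = p (Cod J u))"

definition is_limit ::
  "('j, 'k) cat \<Rightarrow> ('o, 'a) cat \<Rightarrow> ('j, 'k, 'o, 'a) fct \<Rightarrow> 'o \<Rightarrow> ('j \<Rightarrow> 'a) \<Rightarrow> bool" where
  "is_limit J C F L p \<longleftrightarrow> is_cone J C F L p \<and>
     (\<forall>X x. is_cone J C F X x \<longrightarrow>
       (\<exists>!m. m \<in> hom C X L \<and> (\<forall>j \<in> Ob J. p j \<cdot>\<^bsub>C\<^esub> m = x j)))"

text \<open>Every finite category is isomorphic to one whose objects and arrows are natural numbers,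
  so it suffices to quantify over diagram shapes of this type.\<close>

definition has_finite_limits :: "('o, 'a) cat \<Rightarrow> bool" where
  "has_finite_limits C \<longleftrightarrow>
     (\<forall>(J :: (nat, nat) cat) F. finite (Ob J) \<and> finite (Ar J) \<and> cat_functor J C F \<longrightarrow>
       (\<exists>L p. is_limit J C F L p))"

definition is_pullback :: "('o, 'a) cat \<Rightarrow> 'a \<Rightarrow> 'a \<Rightarrow> 'a \<Rightarrow> 'a \<Rightarrow> bool" where
  "is_pullback C f g p q \<longleftrightarrow>
     f \<in> Ar C \<and> g \<in> Ar C \<and> Cod C f = Cod C g \<and>
     p \<in> hom C (Dom C p) (Dom C f) \<and> q \<in> hom C (Dom C p) (Dom C g) \<and>
     f \<cdot>\<^bsub>C\<^esub> p = g \<cdot>\<^bsub>C\<^esub> q \<and>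
     (\<forall>X. \<forall>x \<in> hom C X (Dom C f). \<forall>y \<in> hom C X (Dom C g). f \<cdot>\<^bsub>C\<^esub> x = g \<cdot>\<^bsub>C\<^esub> y \<longrightarrow>
       (\<exists>!m. m \<in> hom C X (Dom C p) \<and> p \<cdot>\<^bsub>C\<^esub> m = x \<and> q \<cdot>\<^bsub>C\<^esub> m = y))"

text \<open>The projections of a chosen pullback of \<open>f\<close> and \<open>g\<close>, and the mediating arrow into it.\<close>

definition pb :: "('o, 'a) cat \<Rightarrow> 'a \<Rightarrow> 'a \<Rightarrow> 'a \<times> 'a" where
  "pb C f g = (SOME (p, q). is_pullback C f g p q)"

definition pb1 :: "('o, 'a) cat \<Rightarrow> 'a \<Rightarrow> 'a \<Rightarrow> 'a" where
  "pb1 C f g = fst (pb C f g)"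

definition pb2 :: "('o, 'a) cat \<Rightarrow> 'a \<Rightarrow> 'a \<Rightarrow> 'a" where
  "pb2 C f g = snd (pb C f g)"

definition pb_med :: "('o, 'a) cat \<Rightarrow> 'a \<Rightarrow> 'a \<Rightarrow> 'a \<Rightarrow> 'a \<Rightarrow> 'a" where
  "pb_med C f g x y = (THE m. m \<in> hom C (Dom C x) (Dom C (pb1 C f g)) \<and>
     pb1 C f g \<cdot>\<^bsub>C\<^esub> m = x \<and> pb2 C f g \<cdot>\<^bsub>C\<^esub> m = y)"

definition is_coequalizer :: "('o, 'a) cat \<Rightarrow> 'a \<Rightarrow> 'a \<Rightarrow> 'a \<Rightarrow> bool" where
  "is_coequalizer C f g q \<longleftrightarrow>
     f \<in> Ar C \<and> g \<in> hom C (Dom C f) (Cod C f) \<and> q \<in> hom C (Cod C f) (Cod C q) \<and>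
     q \<cdot>\<^bsub>C\<^esub> f = q \<cdot>\<^bsub>C\<^esub> g \<and>
     (\<forall>Z. \<forall>h \<in> hom C (Cod C f) Z. h \<cdot>\<^bsub>C\<^esub> f = h \<cdot>\<^bsub>C\<^esub> g \<longrightarrow>
       (\<exists>!k. k \<in> hom C (Cod C q) Z \<and> k \<cdot>\<^bsub>C\<^esub> q = h))"

text \<open>The factorization of \<open>h\<close> through an epimorphism \<open>q\<close>, if there is one.\<close>

definition factor :: "('o, 'a) cat \<Rightarrow> 'a \<Rightarrow> 'a \<Rightarrow> 'a" where
  "factor C q h = (THE k. k \<in> hom C (Cod C q) (Cod C h) \<and> k \<cdot>\<^bsub>C\<^esub> q = h)"

definition reflexive_pair :: "('o, 'a) cat \<Rightarrow> 'a \<Rightarrow> 'a \<Rightarrow> bool" where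
  "reflexive_pair C f g \<longleftrightarrow> f \<in> Ar C \<and> g \<in> hom C (Dom C f) (Cod C f) \<and>
     (\<exists>s \<in> hom C (Cod C f) (Dom C f).
       f \<cdot>\<^bsub>C\<^esub> s = Idt C (Cod C f) \<and> g \<cdot>\<^bsub>C\<^esub> s = Idt C (Cod C f))"

definition has_reflexive_coequalizers :: "('o, 'a) cat \<Rightarrow> bool" where
  "has_reflexive_coequalizers C \<longleftrightarrow>
     (\<forall>f g. reflexive_pair C f g \<longrightarrow> (\<exists>q. is_coequalizer C f g q))"

definition preserves_reflexive_coequalizers ::
  "('o, 'a) cat \<Rightarrow> ('p, 'b) cat \<Rightarrow> ('o, 'a, 'p, 'b) fct \<Rightarrow> bool" where
  "preserves_reflexive_coequalizers C D F \<longleftrightarrow>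
     (\<forall>f g q. reflexive_pair C f g \<and> is_coequalizer C f g q \<longrightarrow>
       is_coequalizer D (onA F f) (onA F g) (onA F q))"

text \<open>An arrow of the slice over \<open>B\<close> from \<open>p\<close> to \<open>p'\<close> is the triple of \<open>p\<close>, \<open>p'\<close> and an arrow
  \<open>k\<close> with \<open>p' \<cdot> k = p\<close>.\<close>

definition slice :: "('o, 'a) cat \<Rightarrow> 'o \<Rightarrow> ('a, 'a \<times> 'a \<times> 'a) cat" where
  "slice C B = \<lparr>
     Ob = {p \<in> Ar C. Cod C p = B},
     Ar = {(p, p', k). p \<in> Ar C \<and> Cod C p = B \<and> p' \<in> Ar C \<and> Cod C p' = B \<and>
            k \<in> hom C (Dom C p) (Dom C p') \<and> p' \<cdot>\<^bsub>C\<^esub> k = p},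
     Dom = (\<lambda>(p, p', k). p),
     Cod = (\<lambda>(p, p', k). p'),
     Idt = (\<lambda>p. (p, p, Idt C (Dom C p))),
     Comp = (\<lambda>(_, p'', l) (p, _, k). (p, p'', l \<cdot>\<^bsub>C\<^esub> k))\<rparr>"

text \<open>For \<open>h : A \<rightarrow> B\<close>, the functor from the slice over \<open>B\<close> to the slice over \<open>A\<close>.\<close>

definition pullback_functor :: "('o, 'a) cat \<Rightarrow> 'a \<Rightarrow> ('a, 'a \<times> 'a \<times> 'a, 'a, 'a \<times> 'a \<times> 'a) fct" where
  "pullback_functor C h = \<lparr>
     onO = (\<lambda>p. pb1 C h p),
     onA = (\<lambda>(p, p', k).
       (pb1 C h p, pb1 C h p', pb_med C h p' (pb1 C h p) (k \<cdot>\<^bsub>C\<^esub> pb2 C h p)))\<rparr>"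


section \<open>Double categories\<close>

text \<open>\<open>VCat\<close> consists of objects and vertical arrows, \<open>HCat\<close> of horizontal arrows and cells.
  Horizontal composition is \<open>\<odot>\<close> on horizontal arrows and \<open>\<star>\<close> on cells, in the order
  in which \<open>M \<odot> N\<close> requires the source of \<open>M\<close> to be the target of \<open>N\<close>.\<close>

record ('o, 'v, 'h, 'c) dblcat =
  VCat :: "('o, 'v) cat"
  HCat :: "('h, 'c) cat"
  Src :: "('h, 'c, 'o, 'v) fct"
  Tgt :: "('h, 'c, 'o, 'v) fct"
  Unt :: "('o, 'v, 'h, 'c) fct"
  HComp :: "'h \<Rightarrow> 'h \<Rightarrow> 'h" (infixl "\<odot>\<index>" 80)
  CComp :: "'c \<Rightarrow> 'c \<Rightarrow> 'c" (infixl "\<star>\<index>" 80)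
  Assoc :: "'h \<Rightarrow> 'h \<Rightarrow> 'h \<Rightarrow> 'c"
  LUnit :: "'h \<Rightarrow> 'c"
  RUnit :: "'h \<Rightarrow> 'c"

abbreviation HOb :: "('o, 'v, 'h, 'c) dblcat \<Rightarrow> 'h set" where
  "HOb D \<equiv> Ob (HCat D)"

abbreviation Cells :: "('o, 'v, 'h, 'c) dblcat \<Rightarrow> 'c set" where
  "Cells D \<equiv> Ar (HCat D)"

abbreviation cell_comp :: "('o, 'v, 'h, 'c) dblcat \<Rightarrow> 'c \<Rightarrow> 'c \<Rightarrow> 'c" (infixl "\<bullet>\<index>" 70) where
  "\<beta> \<bullet>\<^bsub>D\<^esub> \<alpha> \<equiv> Comp (HCat D) \<beta> \<alpha>"

abbreviation cell_id :: "('o, 'v, 'h, 'c) dblcat \<Rightarrow> 'h \<Rightarrow> 'c" where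
  "cell_id D M \<equiv> Idt (HCat D) M"

abbreviation hsrc :: "('o, 'v, 'h, 'c) dblcat \<Rightarrow> 'h \<Rightarrow> 'o" where "hsrc D \<equiv> onO (Src D)"
abbreviation htgt :: "('o, 'v, 'h, 'c) dblcat \<Rightarrow> 'h \<Rightarrow> 'o" where "htgt D \<equiv> onO (Tgt D)"
abbreviation csrc :: "('o, 'v, 'h, 'c) dblcat \<Rightarrow> 'c \<Rightarrow> 'v" where "csrc D \<equiv> onA (Src D)"
abbreviation ctgt :: "('o, 'v, 'h, 'c) dblcat \<Rightarrow> 'c \<Rightarrow> 'v" where "ctgt D \<equiv> onA (Tgt D)"
abbreviation hunit :: "('o, 'v, 'h, 'c) dblcat \<Rightarrow> 'o \<Rightarrow> 'h" where "hunit D \<equiv> onO (Unt D)"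
abbreviation cunit :: "('o, 'v, 'h, 'c) dblcat \<Rightarrow> 'v \<Rightarrow> 'c" where "cunit D \<equiv> onA (Unt D)"

definition globular :: "('o, 'v, 'h, 'c) dblcat \<Rightarrow> 'h \<Rightarrow> 'h \<Rightarrow> 'c set" where
  "globular D M N = {\<alpha> \<in> hom (HCat D) M N.
     csrc D \<alpha> = Idt (VCat D) (hsrc D M) \<and> ctgt D \<alpha> = Idt (VCat D) (htgt D M)}"

text \<open>The pullback of categories on which horizontal composition is defined.\<close>

definition composable_cat :: "('o, 'v, 'h, 'c) dblcat \<Rightarrow> ('h \<times> 'h, 'c \<times> 'c) cat" where
  "composable_cat D = (prod_cat (HCat D) (HCat D))\<lparr>
     Ob := {(M, N). M \<in> HOb D \<and> N \<in> HOb D \<and> hsrc D M = htgt D N},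
     Ar := {(\<alpha>, \<beta>). \<alpha> \<in> Cells D \<and> \<beta> \<in> Cells D \<and> csrc D \<alpha> = ctgt D \<beta>}\<rparr>"

definition hcomp_fct :: "('o, 'v, 'h, 'c) dblcat \<Rightarrow> ('h \<times> 'h, 'c \<times> 'c, 'h, 'c) fct" where
  "hcomp_fct D = \<lparr>onO = (\<lambda>(M, N). M \<odot>\<^bsub>D\<^esub> N), onA = (\<lambda>(\<alpha>, \<beta>). \<alpha> \<star>\<^bsub>D\<^esub> \<beta>)\<rparr>"

locale double_category =
  fixes D :: "('o, 'v, 'h, 'c) dblcat" (structure)
  assumes VCat_category: "category (VCat D)"
    and HCat_category: "category (HCat D)"
    and Src_functor: "cat_functor (HCat D) (VCat D) (Src D)"
    and Tgt_functor: "cat_functor (HCat D) (VCat D) (Tgt D)"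
    and Unt_functor: "cat_functor (VCat D) (HCat D) (Unt D)"
    and hcomp_functor: "cat_functor (composable_cat D) (HCat D) (hcomp_fct D)"
    and hsrc_hunit: "A \<in> Ob (VCat D) \<Longrightarrow> hsrc D (hunit D A) = A"
    and htgt_hunit: "A \<in> Ob (VCat D) \<Longrightarrow> htgt D (hunit D A) = A"
    and csrc_cunit: "f \<in> Ar (VCat D) \<Longrightarrow> csrc D (cunit D f) = f"
    and ctgt_cunit: "f \<in> Ar (VCat D) \<Longrightarrow> ctgt D (cunit D f) = f"
    and hsrc_hcomp: "(M, N) \<in> Ob (composable_cat D) \<Longrightarrow> hsrc D (M \<odot> N) = hsrc D N"
    and htgt_hcomp: "(M, N) \<in> Ob (composable_cat D) \<Longrightarrow> htgt D (M \<odot> N) = htgt D M"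
    and csrc_ccomp: "(\<alpha>, \<beta>) \<in> Ar (composable_cat D) \<Longrightarrow> csrc D (\<alpha> \<star> \<beta>) = csrc D \<beta>"
    and ctgt_ccomp: "(\<alpha>, \<beta>) \<in> Ar (composable_cat D) \<Longrightarrow> ctgt D (\<alpha> \<star> \<beta>) = ctgt D \<alpha>"
    and Assoc_globular:
      "\<lbrakk>(M, N) \<in> Ob (composable_cat D); (N, P) \<in> Ob (composable_cat D)\<rbrakk>
        \<Longrightarrow> Assoc D M N P \<in> globular D ((M \<odot> N) \<odot> P) (M \<odot> (N \<odot> P))"
    and Assoc_iso:
      "\<lbrakk>(M, N) \<in> Ob (composable_cat D); (N, P) \<in> Ob (composable_cat D)\<rbrakk>
        \<Longrightarrow> is_iso (HCat D) (Assoc D M N P)"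
    and Assoc_natural:
      "\<lbrakk>\<alpha> \<in> hom (HCat D) M M'; \<beta> \<in> hom (HCat D) N N'; \<gamma> \<in> hom (HCat D) P P';
        (\<alpha>, \<beta>) \<in> Ar (composable_cat D); (\<beta>, \<gamma>) \<in> Ar (composable_cat D)\<rbrakk>
        \<Longrightarrow> Assoc D M' N' P' \<bullet> ((\<alpha> \<star> \<beta>) \<star> \<gamma>) = (\<alpha> \<star> (\<beta> \<star> \<gamma>)) \<bullet> Assoc D M N P"
    and LUnit_globular:
      "M \<in> HOb D \<Longrightarrow> LUnit D M \<in> globular D (hunit D (htgt D M) \<odot> M) M"
    and LUnit_iso: "M \<in> HOb D \<Longrightarrow> is_iso (HCat D) (LUnit D M)"
    and LUnit_natural:
      "\<alpha> \<in> hom (HCat D) M M'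
        \<Longrightarrow> LUnit D M' \<bullet> (cunit D (ctgt D \<alpha>) \<star> \<alpha>) = \<alpha> \<bullet> LUnit D M"
    and RUnit_globular:
      "M \<in> HOb D \<Longrightarrow> RUnit D M \<in> globular D (M \<odot> hunit D (hsrc D M)) M"
    and RUnit_iso: "M \<in> HOb D \<Longrightarrow> is_iso (HCat D) (RUnit D M)"
    and RUnit_natural:
      "\<alpha> \<in> hom (HCat D) M M'
        \<Longrightarrow> RUnit D M' \<bullet> (\<alpha> \<star> cunit D (csrc D \<alpha>)) = \<alpha> \<bullet> RUnit D M"
    and pentagon:
      "\<lbrakk>(M, N) \<in> Ob (composable_cat D); (N, P) \<in> Ob (composable_cat D);
        (P, Q) \<in> Ob (composable_cat D)\<rbrakk>
        \<Longrightarrow> (cell_id D M \<star> Assoc D N P Q) \<bullet> Assoc D M (N \<odot> P) Q \<bullet> (Assoc D M N P \<star> cell_id D Q)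
          = Assoc D M N (P \<odot> Q) \<bullet> Assoc D (M \<odot> N) P Q"
    and triangle:
      "(M, N) \<in> Ob (composable_cat D)
        \<Longrightarrow> (cell_id D M \<star> LUnit D N) \<bullet> Assoc D M (hunit D (hsrc D M)) N
          = RUnit D M \<star> cell_id D N"


section \<open>The 2-category of double categories\<close>

text \<open>\<open>FComp F M N\<close> is the comparison cell from \<open>F M \<odot> F N\<close> to \<open>F (M \<odot> N)\<close>, and
  \<open>FUnit F A\<close> the one from the unit on \<open>F A\<close> to \<open>F\<close> of the unit on \<open>A\<close>.\<close>

record ('o, 'v, 'h, 'c, 'o1, 'v1, 'h1, 'c1) dblfun =
  F0 :: "('o, 'v, 'o1, 'v1) fct"
  F1 :: "('h, 'c, 'h1, 'c1) fct"
  FComp :: "'h \<Rightarrow> 'h \<Rightarrow> 'c1"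
  FUnit :: "'o \<Rightarrow> 'c1"

locale lax_double_functor =
  fixes D :: "('o, 'v, 'h, 'c) dblcat" and E :: "('o1, 'v1, 'h1, 'c1) dblcat"
    and F :: "('o, 'v, 'h, 'c, 'o1, 'v1, 'h1, 'c1) dblfun"
  assumes source_double_category: "double_category D"
    and target_double_category: "double_category E"
    and F0_functor: "cat_functor (VCat D) (VCat E) (F0 F)"
    and F1_functor: "cat_functor (HCat D) (HCat E) (F1 F)"
    and hsrc_F1: "M \<in> HOb D \<Longrightarrow> hsrc E (onO (F1 F) M) = onO (F0 F) (hsrc D M)"
    and htgt_F1: "M \<in> HOb D \<Longrightarrow> htgt E (onO (F1 F) M) = onO (F0 F) (htgt D M)"
    and csrc_F1: "\<alpha> \<in> Cells D \<Longrightarrow> csrc E (onA (F1 F) \<alpha>) = onA (F0 F) (csrc D \<alpha>)"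
    and ctgt_F1: "\<alpha> \<in> Cells D \<Longrightarrow> ctgt E (onA (F1 F) \<alpha>) = onA (F0 F) (ctgt D \<alpha>)"
    and FComp_globular:
      "(M, N) \<in> Ob (composable_cat D)
        \<Longrightarrow> FComp F M N \<in> globular E (onO (F1 F) M \<odot>\<^bsub>E\<^esub> onO (F1 F) N) (onO (F1 F) (M \<odot>\<^bsub>D\<^esub> N))"
    and FComp_natural:
      "\<lbrakk>\<alpha> \<in> hom (HCat D) M M'; \<beta> \<in> hom (HCat D) N N'; (\<alpha>, \<beta>) \<in> Ar (composable_cat D)\<rbrakk>
        \<Longrightarrow> FComp F M' N' \<bullet>\<^bsub>E\<^esub> (onA (F1 F) \<alpha> \<star>\<^bsub>E\<^esub> onA (F1 F) \<beta>)
          = onA (F1 F) (\<alpha> \<star>\<^bsub>D\<^esub> \<beta>) \<bullet>\<^bsub>E\<^esub> FComp F M N"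
    and FUnit_globular:
      "A \<in> Ob (VCat D)
        \<Longrightarrow> FUnit F A \<in> globular E (hunit E (onO (F0 F) A)) (onO (F1 F) (hunit D A))"
    and FUnit_natural:
      "f \<in> hom (VCat D) A B
        \<Longrightarrow> FUnit F B \<bullet>\<^bsub>E\<^esub> cunit E (onA (F0 F) f) = onA (F1 F) (cunit D f) \<bullet>\<^bsub>E\<^esub> FUnit F A"
    and FComp_assoc:
      "\<lbrakk>(M, N) \<in> Ob (composable_cat D); (N, P) \<in> Ob (composable_cat D)\<rbrakk>
        \<Longrightarrow> onA (F1 F) (Assoc D M N P)
            \<bullet>\<^bsub>E\<^esub> FComp F (M \<odot>\<^bsub>D\<^esub> N) P
            \<bullet>\<^bsub>E\<^esub> (FComp F M N \<star>\<^bsub>E\<^esub> cell_id E (onO (F1 F) P))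
          = FComp F M (N \<odot>\<^bsub>D\<^esub> P)
            \<bullet>\<^bsub>E\<^esub> (cell_id E (onO (F1 F) M) \<star>\<^bsub>E\<^esub> FComp F N P)
            \<bullet>\<^bsub>E\<^esub> Assoc E (onO (F1 F) M) (onO (F1 F) N) (onO (F1 F) P)"
    and FComp_LUnit:
      "M \<in> HOb D
        \<Longrightarrow> onA (F1 F) (LUnit D M)
            \<bullet>\<^bsub>E\<^esub> FComp F (hunit D (htgt D M)) M
            \<bullet>\<^bsub>E\<^esub> (FUnit F (htgt D M) \<star>\<^bsub>E\<^esub> cell_id E (onO (F1 F) M))
          = LUnit E (onO (F1 F) M)"
    and FComp_RUnit:
      "M \<in> HOb D
        \<Longrightarrow> onA (F1 F) (RUnit D M)
            \<bullet>\<^bsub>E\<^esub> FComp F M (hunit D (hsrc D M))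
            \<bullet>\<^bsub>E\<^esub> (cell_id E (onO (F1 F) M) \<star>\<^bsub>E\<^esub> FUnit F (hsrc D M))
          = RUnit E (onO (F1 F) M)"

locale double_functor = lax_double_functor +
  assumes FComp_iso: "(M, N) \<in> Ob (composable_cat D) \<Longrightarrow> is_iso (HCat E) (FComp F M N)"
    and FUnit_iso: "A \<in> Ob (VCat D) \<Longrightarrow> is_iso (HCat E) (FUnit F A)"

definition id_dblfun ::
  "('o, 'v, 'h, 'c) dblcat \<Rightarrow> ('o, 'v, 'h, 'c, 'o, 'v, 'h, 'c) dblfun" where
  "id_dblfun D = \<lparr>
     F0 = id_fct,
     F1 = id_fct,
     FComp = (\<lambda>M N. cell_id D (M \<odot>\<^bsub>D\<^esub> N)),
     FUnit = (\<lambda>A. cell_id D (hunit D A))\<rparr>"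

text \<open>The composite \<open>G \<circ> F\<close>, where \<open>G\<close> takes values in \<open>E\<close>.\<close>

definition comp_dblfun ::
  "('o2, 'v2, 'h2, 'c2) dblcat \<Rightarrow> ('o1, 'v1, 'h1, 'c1, 'o2, 'v2, 'h2, 'c2) dblfun
    \<Rightarrow> ('o, 'v, 'h, 'c, 'o1, 'v1, 'h1, 'c1) dblfun
    \<Rightarrow> ('o, 'v, 'h, 'c, 'o2, 'v2, 'h2, 'c2) dblfun" where
  "comp_dblfun E G F = \<lparr>
     F0 = comp_fct (F0 G) (F0 F),
     F1 = comp_fct (F1 G) (F1 F),
     FComp = (\<lambda>M N. onA (F1 G) (FComp F M N) \<bullet>\<^bsub>E\<^esub> FComp G (onO (F1 F) M) (onO (F1 F) N)),
     FUnit = (\<lambda>A. onA (F1 G) (FUnit F A) \<bullet>\<^bsub>E\<^esub> FUnit G (onO (F0 F) A))\<rparr>"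

record ('o, 'h, 'v1, 'c1) vtrans =
  vt0 :: "'o \<Rightarrow> 'v1"
  vt1 :: "'h \<Rightarrow> 'c1"

locale vertical_transformation =
  fixes D :: "('o, 'v, 'h, 'c) dblcat" and E :: "('o1, 'v1, 'h1, 'c1) dblcat"
    and F G :: "('o, 'v, 'h, 'c, 'o1, 'v1, 'h1, 'c1) dblfun"
    and \<phi> :: "('o, 'h, 'v1, 'c1) vtrans"
  assumes F_functor: "lax_double_functor D E F"
    and G_functor: "lax_double_functor D E G"
    and vt0_hom: "A \<in> Ob (VCat D) \<Longrightarrow> vt0 \<phi> A \<in> hom (VCat E) (onO (F0 F) A) (onO (F0 G) A)"
    and vt0_natural:
      "f \<in> hom (VCat D) A B
        \<Longrightarrow> vt0 \<phi> B \<cdot>\<^bsub>VCat E\<^esub> onA (F0 F) f = onA (F0 G) f \<cdot>\<^bsub>VCat E\<^esub> vt0 \<phi> A"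
    and vt1_hom: "M \<in> HOb D \<Longrightarrow> vt1 \<phi> M \<in> hom (HCat E) (onO (F1 F) M) (onO (F1 G) M)"
    and vt1_natural:
      "\<alpha> \<in> hom (HCat D) M N
        \<Longrightarrow> vt1 \<phi> N \<bullet>\<^bsub>E\<^esub> onA (F1 F) \<alpha> = onA (F1 G) \<alpha> \<bullet>\<^bsub>E\<^esub> vt1 \<phi> M"
    and csrc_vt1: "M \<in> HOb D \<Longrightarrow> csrc E (vt1 \<phi> M) = vt0 \<phi> (hsrc D M)"
    and ctgt_vt1: "M \<in> HOb D \<Longrightarrow> ctgt E (vt1 \<phi> M) = vt0 \<phi> (htgt D M)"
    and vt1_hcomp:
      "(M, N) \<in> Ob (composable_cat D)
        \<Longrightarrow> vt1 \<phi> (M \<odot>\<^bsub>D\<^esub> N) \<bullet>\<^bsub>E\<^esub> FComp F M N = FComp G M N \<bullet>\<^bsub>E\<^esub> (vt1 \<phi> M \<star>\<^bsub>E\<^esub> vt1 \<phi> N)"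
    and vt1_hunit:
      "A \<in> Ob (VCat D)
        \<Longrightarrow> vt1 \<phi> (hunit D A) \<bullet>\<^bsub>E\<^esub> FUnit F A = FUnit G A \<bullet>\<^bsub>E\<^esub> cunit E (vt0 \<phi> A)"

text \<open>An adjunction in the 2-category of double categories, double functors and vertical
  transformations. The last four assumptions are the triangle identities
  \<open>\<epsilon> F \<circ> F \<eta> = 1\<close> and \<open>G \<epsilon> \<circ> \<eta> G = 1\<close>, written on components.\<close>

locale double_adjunction =
  fixes D :: "('o, 'v, 'h, 'c) dblcat" and E :: "('o1, 'v1, 'h1, 'c1) dblcat"
    and F :: "('o, 'v, 'h, 'c, 'o1, 'v1, 'h1, 'c1) dblfun"
    and G :: "('o1, 'v1, 'h1, 'c1, 'o, 'v, 'h, 'c) dblfun"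
    and \<eta> :: "('o, 'h, 'v, 'c) vtrans"
    and \<epsilon> :: "('o1, 'h1, 'v1, 'c1) vtrans"
  assumes left_adjoint: "double_functor D E F"
    and right_adjoint: "double_functor E D G"
    and unit: "vertical_transformation D D (id_dblfun D) (comp_dblfun D G F) \<eta>"
    and counit: "vertical_transformation E E (comp_dblfun E F G) (id_dblfun E) \<epsilon>"
    and triangle_left0:
      "A \<in> Ob (VCat D) \<Longrightarrow>
        vt0 \<epsilon> (onO (F0 F) A) \<cdot>\<^bsub>VCat E\<^esub> onA (F0 F) (vt0 \<eta> A) = Idt (VCat E) (onO (F0 F) A)"
    and triangle_left1:
      "M \<in> HOb D \<Longrightarrow>
        vt1 \<epsilon> (onO (F1 F) M) \<bullet>\<^bsub>E\<^esub> onA (F1 F) (vt1 \<eta> M) = cell_id E (onO (F1 F) M)"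
    and triangle_right0:
      "B \<in> Ob (VCat E) \<Longrightarrow>
        onA (F0 G) (vt0 \<epsilon> B) \<cdot>\<^bsub>VCat D\<^esub> vt0 \<eta> (onO (F0 G) B) = Idt (VCat D) (onO (F0 G) B)"
    and triangle_right1:
      "N \<in> HOb E \<Longrightarrow>
        onA (F1 G) (vt1 \<epsilon> N) \<bullet>\<^bsub>D\<^esub> vt1 \<eta> (onO (F1 G) N) = cell_id D (onO (F1 G) N)"

definition has_right_adjoint :: "('o, 'v, 'h, 'c) dblcat \<Rightarrow> ('o1, 'v1, 'h1, 'c1) dblcat
    \<Rightarrow> ('o, 'v, 'h, 'c, 'o1, 'v1, 'h1, 'c1) dblfun \<Rightarrow> bool" where
  "has_right_adjoint D E F \<longleftrightarrow> (\<exists>G \<eta> \<epsilon>. double_adjunction D E F G \<eta> \<epsilon>)"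

definition prod_dblcat :: "('o, 'v, 'h, 'c) dblcat \<Rightarrow> ('o1, 'v1, 'h1, 'c1) dblcat
    \<Rightarrow> ('o \<times> 'o1, 'v \<times> 'v1, 'h \<times> 'h1, 'c \<times> 'c1) dblcat" where
  "prod_dblcat D E = \<lparr>
     VCat = prod_cat (VCat D) (VCat E),
     HCat = prod_cat (HCat D) (HCat E),
     Src = prod_fct (Src D) (Src E),
     Tgt = prod_fct (Tgt D) (Tgt E),
     Unt = prod_fct (Unt D) (Unt E),
     HComp = (\<lambda>(M, M') (N, N'). (M \<odot>\<^bsub>D\<^esub> N, M' \<odot>\<^bsub>E\<^esub> N')),
     CComp = (\<lambda>(\<alpha>, \<alpha>') (\<beta>, \<beta>'). (\<alpha> \<star>\<^bsub>D\<^esub> \<beta>, \<alpha>' \<star>\<^bsub>E\<^esub> \<beta>')),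
     Assoc = (\<lambda>(M, M') (N, N') (P, P'). (Assoc D M N P, Assoc E M' N' P')),
     LUnit = map_prod (LUnit D) (LUnit E),
     RUnit = map_prod (RUnit D) (RUnit E)\<rparr>"

definition unit_dblcat :: "(unit, unit, unit, unit) dblcat" where
  "unit_dblcat = \<lparr>
     VCat = unit_cat,
     HCat = unit_cat,
     Src = unit_fct,
     Tgt = unit_fct,
     Unt = unit_fct,
     HComp = (\<lambda>_ _. ()),
     CComp = (\<lambda>_ _. ()),
     Assoc = (\<lambda>_ _ _. ()),
     LUnit = (\<lambda>_. ()),
     RUnit = (\<lambda>_. ())\<rparr>"

definition diag_dblfun :: "('o, 'v, 'h, 'c) dblcat
    \<Rightarrow> ('o, 'v, 'h, 'c, 'o \<times> 'o, 'v \<times> 'v, 'h \<times> 'h, 'c \<times> 'c) dblfun" where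
  "diag_dblfun D = \<lparr>
     F0 = diag_fct,
     F1 = diag_fct,
     FComp = (\<lambda>M N. (cell_id D (M \<odot>\<^bsub>D\<^esub> N), cell_id D (M \<odot>\<^bsub>D\<^esub> N))),
     FUnit = (\<lambda>A. (cell_id D (hunit D A), cell_id D (hunit D A)))\<rparr>"

definition unit_dblfun :: "('o, 'v, 'h, 'c, unit, unit, unit, unit) dblfun" where
  "unit_dblfun = \<lparr>F0 = unit_fct, F1 = unit_fct, FComp = (\<lambda>_ _. ()), FUnit = (\<lambda>_. ())\<rparr>"

definition cartesian_double_category :: "('o, 'v, 'h, 'c) dblcat \<Rightarrow> bool" where
  "cartesian_double_category D \<longleftrightarrow> double_category D \<and>
     has_right_adjoint D (prod_dblcat D D) (diag_dblfun D) \<and>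
     has_right_adjoint D unit_dblcat unit_dblfun"


section \<open>Spans\<close>

datatype ('o, 'a) span = Span (apex: 'o) (leg0: 'a) (leg1: 'a)

text \<open>A cell of spans carries its source and target spans and its sides, which the arrow
  between the apexes does not determine.\<close>

datatype ('o, 'a) span_cell =
  SpanCell (sc_dom: "('o, 'a) span") (sc_cod: "('o, 'a) span")
    (side0: 'a) (side1: 'a) (sc_map: 'a)

definition is_span :: "('o, 'a) cat \<Rightarrow> ('o, 'a) span \<Rightarrow> bool" where
  "is_span E R \<longleftrightarrow> leg0 R \<in> Ar E \<and> leg1 R \<in> Ar E \<and>
     Dom E (leg0 R) = apex R \<and> Dom E (leg1 R) = apex R"

definition is_span_cell :: "('o, 'a) cat \<Rightarrow> ('o, 'a) span_cell \<Rightarrow> bool" where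
  "is_span_cell E \<alpha> \<longleftrightarrow> (let R = sc_dom \<alpha>; S = sc_cod \<alpha> in
     is_span E R \<and> is_span E S \<and>
     side0 \<alpha> \<in> hom E (Cod E (leg0 R)) (Cod E (leg0 S)) \<and>
     side1 \<alpha> \<in> hom E (Cod E (leg1 R)) (Cod E (leg1 S)) \<and>
     sc_map \<alpha> \<in> hom E (apex R) (apex S) \<and>
     leg0 S \<cdot>\<^bsub>E\<^esub> sc_map \<alpha> = side0 \<alpha> \<cdot>\<^bsub>E\<^esub> leg0 R \<and>
     leg1 S \<cdot>\<^bsub>E\<^esub> sc_map \<alpha> = side1 \<alpha> \<cdot>\<^bsub>E\<^esub> leg1 R)"

definition span_cat :: "('o, 'a) cat \<Rightarrow> (('o, 'a) span, ('o, 'a) span_cell) cat" where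
  "span_cat E = \<lparr>
     Ob = Collect (is_span E),
     Ar = Collect (is_span_cell E),
     Dom = sc_dom,
     Cod = sc_cod,
     Idt = (\<lambda>R. SpanCell R R (Idt E (Cod E (leg0 R))) (Idt E (Cod E (leg1 R))) (Idt E (apex R))),
     Comp = (\<lambda>\<beta> \<alpha>. SpanCell (sc_dom \<alpha>) (sc_cod \<beta>) (side0 \<beta> \<cdot>\<^bsub>E\<^esub> side0 \<alpha>) (side1 \<beta> \<cdot>\<^bsub>E\<^esub> side1 \<alpha>)
       (sc_map \<beta> \<cdot>\<^bsub>E\<^esub> sc_map \<alpha>))\<rparr>"

definition span_unit :: "('o, 'a) cat \<Rightarrow> 'o \<Rightarrow> ('o, 'a) span" where
  "span_unit E A = Span A (Idt E A) (Idt E A)"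

text \<open>The apex of \<open>X \<odot> Y\<close> is the pullback of \<open>leg1 Y\<close> and \<open>leg0 X\<close>; \<open>span_pr2 E X Y\<close> and
  \<open>span_pr1 E X Y\<close> are its projections to the apexes of \<open>Y\<close> and \<open>X\<close>, and
  \<open>span_pair E X Y y x\<close> is the arrow into it with components \<open>y\<close> and \<open>x\<close>.\<close>

definition span_pr2 :: "('o, 'a) cat \<Rightarrow> ('o, 'a) span \<Rightarrow> ('o, 'a) span \<Rightarrow> 'a" where
  "span_pr2 E X Y = pb1 E (leg1 Y) (leg0 X)"

definition span_pr1 :: "('o, 'a) cat \<Rightarrow> ('o, 'a) span \<Rightarrow> ('o, 'a) span \<Rightarrow> 'a" where
  "span_pr1 E X Y = pb2 E (leg1 Y) (leg0 X)"

definition span_pair :: "('o, 'a) cat \<Rightarrow> ('o, 'a) span \<Rightarrow> ('o, 'a) span \<Rightarrow> 'a \<Rightarrow> 'a \<Rightarrow> 'a" where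
  "span_pair E X Y y x = pb_med E (leg1 Y) (leg0 X) y x"

definition span_hcomp :: "('o, 'a) cat \<Rightarrow> ('o, 'a) span \<Rightarrow> ('o, 'a) span \<Rightarrow> ('o, 'a) span" where
  "span_hcomp E X Y = Span (Dom E (span_pr2 E X Y))
     (leg0 Y \<cdot>\<^bsub>E\<^esub> span_pr2 E X Y) (leg1 X \<cdot>\<^bsub>E\<^esub> span_pr1 E X Y)"

definition span_ccomp ::
  "('o, 'a) cat \<Rightarrow> ('o, 'a) span_cell \<Rightarrow> ('o, 'a) span_cell \<Rightarrow> ('o, 'a) span_cell" where
  "span_ccomp E \<alpha> \<beta> = (let X = sc_dom \<alpha>; Y = sc_dom \<beta>; X' = sc_cod \<alpha>; Y' = sc_cod \<beta> in
     SpanCell (span_hcomp E X Y) (span_hcomp E X' Y') (side0 \<beta>) (side1 \<alpha>)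
       (span_pair E X' Y' (sc_map \<beta> \<cdot>\<^bsub>E\<^esub> span_pr2 E X Y) (sc_map \<alpha> \<cdot>\<^bsub>E\<^esub> span_pr1 E X Y)))"

definition span_globular_cell ::
  "('o, 'a) cat \<Rightarrow> ('o, 'a) span \<Rightarrow> ('o, 'a) span \<Rightarrow> 'a \<Rightarrow> ('o, 'a) span_cell" where
  "span_globular_cell E R S k =
     SpanCell R S (Idt E (Cod E (leg0 R))) (Idt E (Cod E (leg1 R))) k"

definition span_assoc ::
  "('o, 'a) cat \<Rightarrow> ('o, 'a) span \<Rightarrow> ('o, 'a) span \<Rightarrow> ('o, 'a) span \<Rightarrow> ('o, 'a) span_cell" where
  "span_assoc E X Y Z = (let XY = span_hcomp E X Y; YZ = span_hcomp E Y Z in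
     span_globular_cell E (span_hcomp E XY Z) (span_hcomp E X YZ)
       (span_pair E X YZ
          (span_pair E Y Z (span_pr2 E XY Z) (span_pr2 E X Y \<cdot>\<^bsub>E\<^esub> span_pr1 E XY Z))
          (span_pr1 E X Y \<cdot>\<^bsub>E\<^esub> span_pr1 E XY Z)))"

definition Span_dbl ::
  "('o, 'a) cat \<Rightarrow> ('o, 'a, ('o, 'a) span, ('o, 'a) span_cell) dblcat" where
  "Span_dbl E = \<lparr>
     VCat = E,
     HCat = span_cat E,
     Src = \<lparr>onO = (\<lambda>R. Cod E (leg0 R)), onA = side0\<rparr>,
     Tgt = \<lparr>onO = (\<lambda>R. Cod E (leg1 R)), onA = side1\<rparr>,
     Unt = \<lparr>onO = span_unit E,
            onA = (\<lambda>f. SpanCell (span_unit E (Dom E f)) (span_unit E (Cod E f)) f f f)\<rparr>,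
     HComp = span_hcomp E,
     CComp = span_ccomp E,
     Assoc = span_assoc E,
     LUnit = (\<lambda>R. let U = span_unit E (Cod E (leg1 R)) in
       span_globular_cell E (span_hcomp E U R) R (span_pr2 E U R)),
     RUnit = (\<lambda>R. let U = span_unit E (Cod E (leg0 R)) in
       span_globular_cell E (span_hcomp E R U) R (span_pr1 E R U))\<rparr>"


section \<open>Monads and modules\<close>

datatype ('o, 'h, 'c) monad =
  Monad (mon_ob: 'o) (mon_hor: 'h) (mon_unit: 'c) (mon_mult: 'c)

datatype ('o, 'h, 'v, 'c) monad_mor =
  MonadMor (mor_dom: "('o, 'h, 'c) monad") (mor_cod: "('o, 'h, 'c) monad")
    (mor_side: 'v) (mor_cell: 'c)

datatype ('o, 'h, 'c) bimodule =
  Bimodule (mod_src: "('o, 'h, 'c) monad") (mod_tgt: "('o, 'h, 'c) monad")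
    (mod_hor: 'h) (mod_ract: 'c) (mod_lact: 'c)

datatype ('o, 'h, 'v, 'c) mod_cell =
  ModCell (mc_dom: "('o, 'h, 'c) bimodule") (mc_cod: "('o, 'h, 'c) bimodule")
    (mc_src: "('o, 'h, 'v, 'c) monad_mor") (mc_tgt: "('o, 'h, 'v, 'c) monad_mor")
    (mc_cell: 'c)

definition is_monad :: "('o, 'v, 'h, 'c) dblcat \<Rightarrow> ('o, 'h, 'c) monad \<Rightarrow> bool" where
  "is_monad D X \<longleftrightarrow> (let A = mon_ob X; S = mon_hor X; \<eta> = mon_unit X; \<mu> = mon_mult X in
     A \<in> Ob (VCat D) \<and> S \<in> HOb D \<and> hsrc D S = A \<and> htgt D S = A \<and>
     \<eta> \<in> globular D (hunit D A) S \<and> \<mu> \<in> globular D (S \<odot>\<^bsub>D\<^esub> S) S \<and>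
     \<mu> \<bullet>\<^bsub>D\<^esub> (\<eta> \<star>\<^bsub>D\<^esub> cell_id D S) = LUnit D S \<and>
     \<mu> \<bullet>\<^bsub>D\<^esub> (cell_id D S \<star>\<^bsub>D\<^esub> \<eta>) = RUnit D S \<and>
     \<mu> \<bullet>\<^bsub>D\<^esub> (\<mu> \<star>\<^bsub>D\<^esub> cell_id D S) = \<mu> \<bullet>\<^bsub>D\<^esub> (cell_id D S \<star>\<^bsub>D\<^esub> \<mu>) \<bullet>\<^bsub>D\<^esub> Assoc D S S S)"

definition is_monad_mor :: "('o, 'v, 'h, 'c) dblcat \<Rightarrow> ('o, 'h, 'v, 'c) monad_mor \<Rightarrow> bool" where
  "is_monad_mor D m \<longleftrightarrow> (let X = mor_dom m; Y = mor_cod m; f = mor_side m; \<phi> = mor_cell m in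
     is_monad D X \<and> is_monad D Y \<and>
     f \<in> hom (VCat D) (mon_ob X) (mon_ob Y) \<and>
     \<phi> \<in> hom (HCat D) (mon_hor X) (mon_hor Y) \<and> csrc D \<phi> = f \<and> ctgt D \<phi> = f \<and>
     \<phi> \<bullet>\<^bsub>D\<^esub> mon_unit X = mon_unit Y \<bullet>\<^bsub>D\<^esub> cunit D f \<and>
     \<phi> \<bullet>\<^bsub>D\<^esub> mon_mult X = mon_mult Y \<bullet>\<^bsub>D\<^esub> (\<phi> \<star>\<^bsub>D\<^esub> \<phi>))"

definition is_bimodule :: "('o, 'v, 'h, 'c) dblcat \<Rightarrow> ('o, 'h, 'c) bimodule \<Rightarrow> bool" where
  "is_bimodule D B \<longleftrightarrow>
    (let X = mod_src B; Y = mod_tgt B; S = mon_hor X; T = mon_hor Y;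
         M = mod_hor B; \<rho> = mod_ract B; \<kappa> = mod_lact B in
     is_monad D X \<and> is_monad D Y \<and>
     M \<in> HOb D \<and> hsrc D M = mon_ob X \<and> htgt D M = mon_ob Y \<and>
     \<rho> \<in> globular D (M \<odot>\<^bsub>D\<^esub> S) M \<and> \<kappa> \<in> globular D (T \<odot>\<^bsub>D\<^esub> M) M \<and>
     \<rho> \<bullet>\<^bsub>D\<^esub> (cell_id D M \<star>\<^bsub>D\<^esub> mon_unit X) = RUnit D M \<and>
     \<kappa> \<bullet>\<^bsub>D\<^esub> (mon_unit Y \<star>\<^bsub>D\<^esub> cell_id D M) = LUnit D M \<and>
     \<rho> \<bullet>\<^bsub>D\<^esub> (\<rho> \<star>\<^bsub>D\<^esub> cell_id D S) = \<rho> \<bullet>\<^bsub>D\<^esub> (cell_id D M \<star>\<^bsub>D\<^esub> mon_mult X) \<bullet>\<^bsub>D\<^esub> Assoc D M S S \<and>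
     \<kappa> \<bullet>\<^bsub>D\<^esub> (mon_mult Y \<star>\<^bsub>D\<^esub> cell_id D M) = \<kappa> \<bullet>\<^bsub>D\<^esub> (cell_id D T \<star>\<^bsub>D\<^esub> \<kappa>) \<bullet>\<^bsub>D\<^esub> Assoc D T T M \<and>
     \<rho> \<bullet>\<^bsub>D\<^esub> (\<kappa> \<star>\<^bsub>D\<^esub> cell_id D S) = \<kappa> \<bullet>\<^bsub>D\<^esub> (cell_id D T \<star>\<^bsub>D\<^esub> \<rho>) \<bullet>\<^bsub>D\<^esub> Assoc D T M S)"

definition is_mod_cell :: "('o, 'v, 'h, 'c) dblcat \<Rightarrow> ('o, 'h, 'v, 'c) mod_cell \<Rightarrow> bool" where
  "is_mod_cell D a \<longleftrightarrow>
    (let M = mc_dom a; N = mc_cod a; m = mc_src a; n = mc_tgt a; \<alpha> = mc_cell a in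
     is_bimodule D M \<and> is_bimodule D N \<and> is_monad_mor D m \<and> is_monad_mor D n \<and>
     mor_dom m = mod_src M \<and> mor_cod m = mod_src N \<and>
     mor_dom n = mod_tgt M \<and> mor_cod n = mod_tgt N \<and>
     \<alpha> \<in> hom (HCat D) (mod_hor M) (mod_hor N) \<and>
     csrc D \<alpha> = mor_side m \<and> ctgt D \<alpha> = mor_side n \<and>
     \<alpha> \<bullet>\<^bsub>D\<^esub> mod_ract M = mod_ract N \<bullet>\<^bsub>D\<^esub> (\<alpha> \<star>\<^bsub>D\<^esub> mor_cell m) \<and>
     \<alpha> \<bullet>\<^bsub>D\<^esub> mod_lact M = mod_lact N \<bullet>\<^bsub>D\<^esub> (mor_cell n \<star>\<^bsub>D\<^esub> \<alpha>))"

definition monad_id :: "('o, 'v, 'h, 'c) dblcat \<Rightarrow> ('o, 'h, 'c) monad \<Rightarrow> ('o, 'h, 'v, 'c) monad_mor" where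
  "monad_id D X = MonadMor X X (Idt (VCat D) (mon_ob X)) (cell_id D (mon_hor X))"

definition monad_cat ::
  "('o, 'v, 'h, 'c) dblcat \<Rightarrow> (('o, 'h, 'c) monad, ('o, 'h, 'v, 'c) monad_mor) cat" where
  "monad_cat D = \<lparr>
     Ob = Collect (is_monad D),
     Ar = Collect (is_monad_mor D),
     Dom = mor_dom,
     Cod = mor_cod,
     Idt = monad_id D,
     Comp = (\<lambda>n m. MonadMor (mor_dom m) (mor_cod n)
       (mor_side n \<cdot>\<^bsub>VCat D\<^esub> mor_side m) (mor_cell n \<bullet>\<^bsub>D\<^esub> mor_cell m))\<rparr>"

definition mod_globular_cell :: "('o, 'v, 'h, 'c) dblcat
    \<Rightarrow> ('o, 'h, 'c) bimodule \<Rightarrow> ('o, 'h, 'c) bimodule \<Rightarrow> 'c \<Rightarrow> ('o, 'h, 'v, 'c) mod_cell" where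
  "mod_globular_cell D M N \<alpha> =
     ModCell M N (monad_id D (mod_src M)) (monad_id D (mod_tgt M)) \<alpha>"

definition bimodule_cat ::
  "('o, 'v, 'h, 'c) dblcat \<Rightarrow> (('o, 'h, 'c) bimodule, ('o, 'h, 'v, 'c) mod_cell) cat" where
  "bimodule_cat D = \<lparr>
     Ob = Collect (is_bimodule D),
     Ar = Collect (is_mod_cell D),
     Dom = mc_dom,
     Cod = mc_cod,
     Idt = (\<lambda>M. mod_globular_cell D M M (cell_id D (mod_hor M))),
     Comp = (\<lambda>b a. ModCell (mc_dom a) (mc_cod b)
       (mc_src b \<cdot>\<^bsub>monad_cat D\<^esub> mc_src a) (mc_tgt b \<cdot>\<^bsub>monad_cat D\<^esub> mc_tgt a)
       (mc_cell b \<bullet>\<^bsub>D\<^esub> mc_cell a))\<rparr>"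

definition mod_unit :: "('o, 'h, 'c) monad \<Rightarrow> ('o, 'h, 'c) bimodule" where
  "mod_unit X = Bimodule X X (mon_hor X) (mon_mult X) (mon_mult X)"

text \<open>The quotient cell from \<open>N \<odot> M\<close> to the composite of the modules \<open>M\<close> and \<open>N\<close>: a chosen
  coequalizer of the two actions of the middle monad \<open>T\<close> on \<open>(N \<odot> T) \<odot> M\<close>. The coequalizer is
  taken among all cells, so that it also has the universal property for cells whose sides are not
  identities, and it is required to be globular.\<close>

definition mod_quot :: "('o, 'v, 'h, 'c) dblcat
    \<Rightarrow> ('o, 'h, 'c) bimodule \<Rightarrow> ('o, 'h, 'c) bimodule \<Rightarrow> 'c" where
  "mod_quot D N M =
    (let T = mon_hor (mod_tgt M); m = mod_hor M; n = mod_hor N in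
     SOME q. q \<in> globular D (n \<odot>\<^bsub>D\<^esub> m) (Cod (HCat D) q) \<and>
       is_coequalizer (HCat D)
         (mod_ract N \<star>\<^bsub>D\<^esub> cell_id D m)
         ((cell_id D n \<star>\<^bsub>D\<^esub> mod_lact M) \<bullet>\<^bsub>D\<^esub> Assoc D n T m)
         q)"

text \<open>The actions on the composite are the ones induced on the quotient by the right action on
  \<open>M\<close> and the left action on \<open>N\<close>.\<close>

definition mod_hcomp :: "('o, 'v, 'h, 'c) dblcat
    \<Rightarrow> ('o, 'h, 'c) bimodule \<Rightarrow> ('o, 'h, 'c) bimodule \<Rightarrow> ('o, 'h, 'c) bimodule" where
  "mod_hcomp D N M =
    (let X = mod_src M; Z = mod_tgt N; S = mon_hor X; V = mon_hor Z;
         m = mod_hor M; n = mod_hor N; q = mod_quot D N M in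
     Bimodule X Z (Cod (HCat D) q)
       (factor (HCat D)
         (q \<star>\<^bsub>D\<^esub> cell_id D S)
         (q \<bullet>\<^bsub>D\<^esub> (cell_id D n \<star>\<^bsub>D\<^esub> mod_ract M) \<bullet>\<^bsub>D\<^esub> Assoc D n m S))
       (factor (HCat D)
         ((cell_id D V \<star>\<^bsub>D\<^esub> q) \<bullet>\<^bsub>D\<^esub> Assoc D V n m)
         (q \<bullet>\<^bsub>D\<^esub> (mod_lact N \<star>\<^bsub>D\<^esub> cell_id D m))))"

definition mod_ccomp :: "('o, 'v, 'h, 'c) dblcat
    \<Rightarrow> ('o, 'h, 'v, 'c) mod_cell \<Rightarrow> ('o, 'h, 'v, 'c) mod_cell \<Rightarrow> ('o, 'h, 'v, 'c) mod_cell" where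
  "mod_ccomp D b a =
    (let N = mc_dom b; M = mc_dom a; N' = mc_cod b; M' = mc_cod a in
     ModCell (mod_hcomp D N M) (mod_hcomp D N' M') (mc_src a) (mc_tgt b)
       (factor (HCat D) (mod_quot D N M)
         (mod_quot D N' M' \<bullet>\<^bsub>D\<^esub> (mc_cell b \<star>\<^bsub>D\<^esub> mc_cell a))))"

text \<open>The structure cells are induced by those of \<open>D\<close> and by the module actions.\<close>

definition mod_assoc :: "('o, 'v, 'h, 'c) dblcat \<Rightarrow> ('o, 'h, 'c) bimodule
    \<Rightarrow> ('o, 'h, 'c) bimodule \<Rightarrow> ('o, 'h, 'c) bimodule \<Rightarrow> ('o, 'h, 'v, 'c) mod_cell" where
  "mod_assoc D P N M =
    (let PN = mod_hcomp D P N; NM = mod_hcomp D N M in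
     mod_globular_cell D (mod_hcomp D PN M) (mod_hcomp D P NM)
       (factor (HCat D)
         (mod_quot D PN M \<bullet>\<^bsub>D\<^esub> (mod_quot D P N \<star>\<^bsub>D\<^esub> cell_id D (mod_hor M)))
         (mod_quot D P NM \<bullet>\<^bsub>D\<^esub> (cell_id D (mod_hor P) \<star>\<^bsub>D\<^esub> mod_quot D N M)
           \<bullet>\<^bsub>D\<^esub> Assoc D (mod_hor P) (mod_hor N) (mod_hor M))))"

definition Mod_dbl :: "('o, 'v, 'h, 'c) dblcat \<Rightarrow>
    (('o, 'h, 'c) monad, ('o, 'h, 'v, 'c) monad_mor,
     ('o, 'h, 'c) bimodule, ('o, 'h, 'v, 'c) mod_cell) dblcat" where
  "Mod_dbl D = \<lparr>
     VCat = monad_cat D,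
     HCat = bimodule_cat D,
     Src = \<lparr>onO = mod_src, onA = mc_src\<rparr>,
     Tgt = \<lparr>onO = mod_tgt, onA = mc_tgt\<rparr>,
     Unt = \<lparr>onO = mod_unit,
            onA = (\<lambda>m. ModCell (mod_unit (mor_dom m)) (mod_unit (mor_cod m)) m m (mor_cell m))\<rparr>,
     HComp = mod_hcomp D,
     CComp = mod_ccomp D,
     Assoc = mod_assoc D,
     LUnit = (\<lambda>M. let U = mod_unit (mod_tgt M) in
       mod_globular_cell D (mod_hcomp D U M) M (factor (HCat D) (mod_quot D U M) (mod_lact M))),
     RUnit = (\<lambda>M. let U = mod_unit (mod_src M) in
       mod_globular_cell D (mod_hcomp D M U) M (factor (HCat D) (mod_quot D M U) (mod_ract M)))\<rparr>"

definition Prof_dbl :: "('o, 'a) cat \<Rightarrow>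
    (('o, ('o, 'a) span, ('o, 'a) span_cell) monad,
     ('o, ('o, 'a) span, 'a, ('o, 'a) span_cell) monad_mor,
     ('o, ('o, 'a) span, ('o, 'a) span_cell) bimodule,
     ('o, ('o, 'a) span, 'a, ('o, 'a) span_cell) mod_cell) dblcat" where
  "Prof_dbl E = Mod_dbl (Span_dbl E)"

end

theory Submission
  imports Defs
begin

text \<open>The argument splits into one about modules and one about spans. Call a double category good if
  horizontal composition preserves reflexive coequalizers of globular cells. In a good double category
  the unit constraints and the associativity of the composition of modules follow from the universal
  properties of the defining coequalizers, because whiskering a quotient cell gives another
  coequalizer. If moreover the vertical category and the category of horizontal arrows have finite
  products that are compatible with sources, targets, units and \<open>\<odot>\<close>, then products of monads and of
  modules are formed on the underlying data. The composite of two product modules is again a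
  product, because a product of reflexive coequalizers is a coequalizer. Such products amount to
  right adjoints of the diagonal and of the functor to the terminal double category.

  For spans, both whiskering and products are computed by pullbacks, so the two kinds of coequalizers
  are preserved by the stability of reflexive coequalizers under pullback functors.\<close>

section \<open>Categories\<close>

text \<open>A composite of modules is known only up to the choice of a coequalizer, so nothing about
  it can be computed: a cell out of it is determined by what it does after a quotient cell. Every
  law is therefore tested after an epimorphism onto its domain that is built from whiskered
  quotients, where it turns into a law of the underlying double category. Rebracketing would bring
  inverse associators into these tests; they are avoided by composing the epimorphisms themselves
  with associators. The quotients are coequalizers among all cells, because cells between modules
  over different monads must descend to composites too. For products, a lax right adjoint of the
  diagonal results from universal properties alone. The real content is that its comparison cells
  are invertible, and there reflexivity is decisive: common sections split a condition on a product
  of two parallel pairs into one condition per factor. The stability hypothesis on \<open>E\<close>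
  speaks of slices, so coequalizers have to be carried from \<open>E\<close> to a slice and
  back.\<close>

lemma in_hom_iff [simp]: "f \<in> hom C A B \<longleftrightarrow> f \<in> Ar C \<and> Dom C f = A \<and> Cod C f = B"
  by (auto simp: hom_def)

section \<open>Composition, isomorphisms, epimorphisms and coequalizers in a category\<close>

context category
begin

lemma idt_simps [simp]:
  assumes "A \<in> Ob C"
  shows "Idt C A \<in> Ar C" and "Dom C (Idt C A) = A" and "Cod C (Idt C A) = A"
  using idt_hom[OF assms] by simp_all

lemma comp_simps [simp]:
  assumes "f \<in> Ar C" and "g \<in> Ar C" and "Dom C g = Cod C f"
  shows "g \<cdot> f \<in> Ar C" and "Dom C (g \<cdot> f) = Dom C f" and "Cod C (g \<cdot> f) = Cod C g"
  using comp_hom[of f "Dom C f" "Cod C f" g "Cod C g"] assms by simp_all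

lemma idt_left [simp]: "f \<in> Ar C \<Longrightarrow> Cod C f = B \<Longrightarrow> Idt C B \<cdot> f = f"
  using comp_idt_left[of f "Dom C f" B] by simp

lemma idt_right [simp]: "f \<in> Ar C \<Longrightarrow> Dom C f = A \<Longrightarrow> f \<cdot> Idt C A = f"
  using comp_idt_right[of f A "Cod C f"] by simp

lemma assoc [simp]:
  "f \<in> Ar C \<Longrightarrow> g \<in> Ar C \<Longrightarrow> h \<in> Ar C \<Longrightarrow> Dom C g = Cod C f \<Longrightarrow> Dom C h = Cod C g
    \<Longrightarrow> (h \<cdot> g) \<cdot> f = h \<cdot> (g \<cdot> f)"
  using comp_assoc[of f "Dom C f" "Cod C f" g "Cod C g" h "Cod C h"] by simp

text \<open>The simp rule \<open>assoc\<close> keeps composites right-nested, and then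
  \<open>b \<cdot> a\<close> is no subterm of \<open>b \<cdot> (a \<cdot> x)\<close>. This form
  makes an equation available inside a longer composite; the rules with \<open>tail\<close> in their
  names below serve the same purpose.\<close>

lemma comp_tail:
  assumes "b \<cdot> a = c" and "a \<in> Ar C" and "b \<in> Ar C" and "Dom C b = Cod C a"
    and "x \<in> Ar C" and "Dom C a = Cod C x"
  shows "b \<cdot> (a \<cdot> x) = c \<cdot> x"
  using assms by (metis assoc)

lemmas obs [simp] = dom_ob cod_ob

lemma is_isoE:
  assumes "is_iso C f"
  obtains g where "f \<in> Ar C" "g \<in> Ar C" "Dom C g = Cod C f" "Cod C g = Dom C f"
    "g \<cdot> f = Idt C (Dom C f)" "f \<cdot> g = Idt C (Cod C f)"
  using assms by (auto simp: is_iso_def)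

lemma is_isoI:
  assumes "f \<in> Ar C" "g \<in> Ar C" "Dom C g = Cod C f" "Cod C g = Dom C f"
    "g \<cdot> f = Idt C (Dom C f)" "f \<cdot> g = Idt C (Cod C f)"
  shows "is_iso C f"
  using assms by (auto simp: is_iso_def)

lemma is_iso_arr: "is_iso C f \<Longrightarrow> f \<in> Ar C"
  by (simp add: is_iso_def)

lemma is_iso_idt: "A \<in> Ob C \<Longrightarrow> is_iso C (Idt C A)"
  by (rule is_isoI[where g = "Idt C A"]) auto

lemma is_iso_comp:
  assumes "is_iso C f" and "is_iso C g" and "Dom C g = Cod C f"
  shows "is_iso C (g \<cdot> f)"
proof -
  obtain f' where f: "f \<in> Ar C" "f' \<in> Ar C" "Dom C f' = Cod C f" "Cod C f' = Dom C f"
    "f' \<cdot> f = Idt C (Dom C f)" "f \<cdot> f' = Idt C (Cod C f)"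
    using assms(1) by (rule is_isoE)
  obtain g' where g: "g \<in> Ar C" "g' \<in> Ar C" "Dom C g' = Cod C g" "Cod C g' = Dom C g"
    "g' \<cdot> g = Idt C (Dom C g)" "g \<cdot> g' = Idt C (Cod C g)"
    using assms(2) by (rule is_isoE)
  have 1: "g' \<cdot> (g \<cdot> f) = f"
    using f(1-4) g(1-4) assms(3) comp_tail[OF g(5)] by simp
  have 2: "f \<cdot> (f' \<cdot> g') = g'"
    using f(1-4) g(1-4) assms(3) comp_tail[OF f(6)] by simp
  show ?thesis
    by (rule is_isoI[where g = "f' \<cdot> g'"]) (use f g assms(3) 1 2 in auto)
qed

definition epi where
  "epi e \<longleftrightarrow> e \<in> Ar C \<and> (\<forall>h \<in> Ar C. \<forall>k \<in> Ar C. Dom C h = Cod C e \<longrightarrow> Dom C k = Cod C e \<longrightarrow> Cod C h = Cod C k \<longrightarrow>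
     h \<cdot> e = k \<cdot> e \<longrightarrow> h = k)"

text \<open>The condition \<open>Cod C h = Cod C k\<close> in \<open>epi\<close> is recovered from
  the equation, since the codomain of a composite is that of the arrow applied last.\<close>

lemma epiD:
  assumes "epi e" and "h \<cdot> e = k \<cdot> e" and "h \<in> Ar C" and "k \<in> Ar C"
    and "Dom C h = Cod C e" and "Dom C k = Cod C e"
  shows "h = k"
proof -
  have "Cod C h = Cod C (h \<cdot> e)" using assms(1,3,5) by (simp add: epi_def)
  also have "\<dots> = Cod C k" unfolding assms(2) using assms(1,4,6) by (simp add: epi_def)
  finally show ?thesis using assms by (auto simp: epi_def)
qed

lemma epi_comp:
  assumes "epi e" and "epi d" and "Dom C d = Cod C e"
  shows "epi (d \<cdot> e)"
proof -
  have a: "e \<in> Ar C" "d \<in> Ar C" using assms by (auto simp: epi_def)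
  have "h = k" if "h \<in> Ar C" "k \<in> Ar C" "Dom C h = Cod C d" "Dom C k = Cod C d"
    "h \<cdot> (d \<cdot> e) = k \<cdot> (d \<cdot> e)" for h k
  proof -
    have "(h \<cdot> d) \<cdot> e = (k \<cdot> d) \<cdot> e" using that a assms(3) by simp
    then have "h \<cdot> d = k \<cdot> d" by (rule epiD[OF assms(1)]) (use that a assms(3) in simp_all)
    then show ?thesis by (rule epiD[OF assms(2)]) (use that in simp_all)
  qed
  then show ?thesis using a assms(3) by (simp add: epi_def)
qed

lemma iso_epi:
  assumes "is_iso C e"
  shows "epi e"
proof -
  obtain g where g: "e \<in> Ar C" "g \<in> Ar C" "Dom C g = Cod C e" "Cod C g = Dom C e"
    "g \<cdot> e = Idt C (Dom C e)" "e \<cdot> g = Idt C (Cod C e)"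
    using assms by (rule is_isoE)
  have "h = k" if "h \<in> Ar C" "k \<in> Ar C" "Dom C h = Cod C e" "Dom C k = Cod C e"
    "h \<cdot> e = k \<cdot> e" for h k
  proof -
    have "(h \<cdot> e) \<cdot> g = (k \<cdot> e) \<cdot> g" using that by simp
    then show ?thesis using that(1-4) g by simp
  qed
  then show ?thesis using g by (simp add: epi_def)
qed

lemma is_coequalizerD:
  assumes "is_coequalizer C f g q"
  shows "f \<in> Ar C" "g \<in> Ar C" "Dom C g = Dom C f" "Cod C g = Cod C f"
    "q \<in> Ar C" "Dom C q = Cod C f" "q \<cdot> f = q \<cdot> g"
  using assms by (auto simp: is_coequalizer_def)

lemma coequalizer_factor:
  assumes "is_coequalizer C f g q" and "h \<in> Ar C" and "Dom C h = Cod C f" and "h \<cdot> f = h \<cdot> g"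
  shows "factor C q h \<in> Ar C" "Dom C (factor C q h) = Cod C q" "Cod C (factor C q h) = Cod C h"
    "factor C q h \<cdot> q = h"
proof -
  have "\<exists>!k. k \<in> hom C (Cod C q) (Cod C h) \<and> k \<cdot> q = h"
    using assms unfolding is_coequalizer_def by (metis in_hom_iff)
  from theI'[OF this] show "factor C q h \<in> Ar C" "Dom C (factor C q h) = Cod C q"
    "Cod C (factor C q h) = Cod C h" "factor C q h \<cdot> q = h"
    unfolding factor_def by auto
qed

lemma coequalizer_epi:
  assumes "is_coequalizer C f g q"
  shows "epi q"
proof -
  note D = is_coequalizerD[OF assms]
  have "h = k" if "h \<in> Ar C" "k \<in> Ar C" "Dom C h = Cod C q" "Dom C k = Cod C q"
    "Cod C h = Cod C k" "h \<cdot> q = k \<cdot> q" for h k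
  proof -
    have "\<exists>!m. m \<in> hom C (Cod C q) (Cod C h) \<and> m \<cdot> q = h \<cdot> q"
    proof -
      have "(h \<cdot> q) \<cdot> f = (h \<cdot> q) \<cdot> g" using D that by simp
      moreover have "h \<cdot> q \<in> hom C (Cod C f) (Cod C h)" using D that by simp
      ultimately show ?thesis using assms unfolding is_coequalizer_def by blast
    qed
    then show ?thesis using that by (metis in_hom_iff)
  qed
  then show ?thesis using D by (simp add: epi_def)
qed

text \<open>Uniqueness of factorizations is packaged as \<open>epi q\<close>, which leaves only
  their existence; the codomain of a factorization \<open>k\<close> can be read off from
  \<open>k \<cdot> q = h\<close>.\<close>

lemma is_coequalizerI:
  assumes "f \<in> Ar C" "g \<in> Ar C" "Dom C g = Dom C f" "Cod C g = Cod C f"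
    "epi q" "Dom C q = Cod C f" "q \<cdot> f = q \<cdot> g"
    and ex: "\<And>h. h \<in> Ar C \<Longrightarrow> Dom C h = Cod C f \<Longrightarrow> h \<cdot> f = h \<cdot> g \<Longrightarrow>
      \<exists>k \<in> Ar C. Dom C k = Cod C q \<and> k \<cdot> q = h"
  shows "is_coequalizer C f g q"
  unfolding is_coequalizer_def
proof (intro conjI allI ballI impI)
  fix Z h assume h: "h \<in> hom C (Cod C f) Z" "h \<cdot> f = h \<cdot> g"
  have q: "q \<in> Ar C" using assms(5) by (simp add: epi_def)
  obtain k where k: "k \<in> Ar C" "Dom C k = Cod C q" "k \<cdot> q = h" using ex[of h] h by auto
  have "Cod C k = Z" using k h q comp_simps(3)[of q k] by simp
  then show "\<exists>!k. k \<in> hom C (Cod C q) Z \<and> k \<cdot> q = h"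
    using k h epiD[OF assms(5)] by (auto intro!: ex1I[of _ k])
qed (use assms in \<open>auto simp: epi_def\<close>)

text \<open>An epimorphism determines its factorizations, so \<open>factor\<close> can be evaluated
  along composites of quotients such as the one in \<open>mod_assoc\<close>, for which no parallel
  pair is given.\<close>

lemma factor_eq:
  assumes "epi q" and "k \<in> Ar C" and "Dom C k = Cod C q"
  shows "factor C q (k \<cdot> q) = k"
  unfolding factor_def
proof (rule the_equality)
  have q: "q \<in> Ar C" using assms(1) by (simp add: epi_def)
  show "k \<in> hom C (Cod C q) (Cod C (k \<cdot> q)) \<and> k \<cdot> q = k \<cdot> q" using assms q by simp
  fix l assume "l \<in> hom C (Cod C q) (Cod C (k \<cdot> q)) \<and> l \<cdot> q = k \<cdot> q"
  then show "l = k" using epiD[OF assms(1)] assms by auto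
qed

text \<open>The arrows \<open>c\<close> and \<open>d\<close> form an isomorphism of parallel pairs
  from \<open>F\<close>, \<open>G\<close> to \<open>f\<close>, \<open>g\<close>. Later instances are
  the rebracketing of whiskered quotients, the comparison of a composite of products with a product
  of composites, and the exchange of the two arguments of a pullback.\<close>

lemma coequalizer_transport:
  assumes q: "is_coequalizer C f g q" and c: "is_iso C c" "Cod C c = Dom C f"
    and d: "is_iso C d" "Cod C d = Cod C f"
    and F: "F \<in> Ar C" "Dom C F = Dom C c" "Cod C F = Dom C d" "d \<cdot> F = f \<cdot> c"
    and G: "G \<in> Ar C" "Dom C G = Dom C c" "Cod C G = Dom C d" "d \<cdot> G = g \<cdot> c"
  shows "is_coequalizer C F G (q \<cdot> d)"
proof -
  note D = is_coequalizerD[OF q]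
  obtain d' where d': "d \<in> Ar C" "d' \<in> Ar C" "Dom C d' = Cod C d" "Cod C d' = Dom C d"
    "d' \<cdot> d = Idt C (Dom C d)" "d \<cdot> d' = Idt C (Cod C d)"
    using d(1) by (rule is_isoE)
  have cA: "c \<in> Ar C" using c by (simp add: is_iso_arr)
  note facts = D(1-6) d'(1-4) cA c(2) d(2) F(1-3) G(1-3)
  show ?thesis
  proof (rule is_coequalizerI)
    show "epi (q \<cdot> d)" using epi_comp[OF iso_epi[OF d(1)] coequalizer_epi[OF q]] facts by simp
    have "q \<cdot> (d \<cdot> F) = q \<cdot> (d \<cdot> G)"
      unfolding F(4) G(4) using comp_tail[OF D(7), of c] facts comp_tail[OF refl, of q g c] by simp
    then show "(q \<cdot> d) \<cdot> F = (q \<cdot> d) \<cdot> G" using facts by simp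
    fix h assume h: "h \<in> Ar C" "Dom C h = Cod C F" "h \<cdot> F = h \<cdot> G"
    have hd: "h \<cdot> (d' \<cdot> (d \<cdot> x)) = h \<cdot> x" if "x \<in> Ar C" "Cod C x = Dom C d" for x
      using that facts h comp_tail[OF d'(5), of x] by simp
    have "(h \<cdot> d') \<cdot> (f \<cdot> c) = (h \<cdot> d') \<cdot> (g \<cdot> c)"
      using hd[of F] hd[of G] h facts unfolding F(4)[symmetric] G(4)[symmetric] by simp
    then have "((h \<cdot> d') \<cdot> f) \<cdot> c = ((h \<cdot> d') \<cdot> g) \<cdot> c" using facts h by simp
    then have eq: "(h \<cdot> d') \<cdot> f = (h \<cdot> d') \<cdot> g"
      by (rule epiD[OF iso_epi[OF c(1)]]) (use facts h in simp_all)
    note k = coequalizer_factor[OF q _ _ eq]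
    have "factor C q (h \<cdot> d') \<cdot> (q \<cdot> d) = h"
      using comp_tail[OF k(4), of d] facts h k(1-3) d' by simp
    then show "\<exists>k \<in> Ar C. Dom C k = Cod C (q \<cdot> d) \<and> k \<cdot> (q \<cdot> d) = h"
      using facts h k(1-3) by (intro bexI[of _ "factor C q (h \<cdot> d')"]) auto
  qed (use facts in auto)
qed

text \<open>Both composites of \<open>k\<close> and \<open>l\<close> are cancelled against the
  epimorphisms. The associator and the unit cells of modules obtain their invertibility from
  this.\<close>

lemma mutual_factor_iso:
  assumes "epi d" and "epi e" and "k \<in> Ar C" "Dom C k = Cod C d" "k \<cdot> d = e"
    and "l \<in> Ar C" "Dom C l = Cod C e" "l \<cdot> e = d"
  shows "is_iso C k"
proof -
  have a: "d \<in> Ar C" "e \<in> Ar C" using assms by (auto simp: epi_def)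
  have ck: "Cod C k = Cod C e" "Dom C e = Dom C d" using comp_simps[of d k] a assms by simp_all
  have cl: "Cod C l = Cod C d" using comp_simps[of e l] a assms by simp
  have 1: "(l \<cdot> k) \<cdot> d = Idt C (Cod C d) \<cdot> d" using assms a ck cl by simp
  have 2: "(k \<cdot> l) \<cdot> e = Idt C (Cod C e) \<cdot> e" using assms a ck cl by simp
  show ?thesis
    by (rule is_isoI[where g = l])
       (use a ck cl assms epiD[OF assms(1) 1] epiD[OF assms(2) 2] in auto)
qed

lemma coequalizer_unique:
  assumes "is_coequalizer C f g q" and "is_coequalizer C f g q'"
  shows "is_iso C (factor C q q')" and "factor C q q' \<cdot> q = q'"
    and "Dom C (factor C q q') = Cod C q" "Cod C (factor C q q') = Cod C q'"
proof -
  note D = is_coequalizerD[OF assms(1)] and D' = is_coequalizerD[OF assms(2)]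
  note k = coequalizer_factor[OF assms(1) D'(5) D'(6) D'(7)]
  note l = coequalizer_factor[OF assms(2) D(5) D(6) D(7)]
  show "is_iso C (factor C q q')"
    by (rule mutual_factor_iso[OF coequalizer_epi[OF assms(1)] coequalizer_epi[OF assms(2)]
        k(1) k(2) k(4) l(1) l(2) l(4)])
  show "factor C q q' \<cdot> q = q'" "Dom C (factor C q q') = Cod C q" "Cod C (factor C q q') = Cod C q'"
    using k by auto
qed

lemma coequalizer_iso_post:
  assumes q: "is_coequalizer C f g q" and k: "is_iso C k" "Dom C k = Cod C q"
  shows "is_coequalizer C f g (k \<cdot> q)"
proof -
  note D = is_coequalizerD[OF q]
  obtain l where l: "k \<in> Ar C" "l \<in> Ar C" "Dom C l = Cod C k" "Cod C l = Dom C k"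
    "l \<cdot> k = Idt C (Dom C k)" "k \<cdot> l = Idt C (Cod C k)"
    using k(1) by (rule is_isoE)
  show ?thesis
  proof (rule is_coequalizerI)
    show "epi (k \<cdot> q)" using epi_comp[OF coequalizer_epi[OF q] iso_epi[OF k(1)] k(2)] .
    show "(k \<cdot> q) \<cdot> f = (k \<cdot> q) \<cdot> g" using D l k(2) by simp
    fix h assume h: "h \<in> Ar C" "Dom C h = Cod C f" "h \<cdot> f = h \<cdot> g"
    note m = coequalizer_factor[OF q h]
    have "(factor C q h \<cdot> l) \<cdot> (k \<cdot> q) = h"
      using m D l k(2) comp_tail[OF l(5), of q] by simp
    then show "\<exists>m \<in> Ar C. Dom C m = Cod C (k \<cdot> q) \<and> m \<cdot> (k \<cdot> q) = h"
      using m D l k(2) by (intro bexI[of _ "factor C q h \<cdot> l"]) auto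
  qed (use D l k(2) in auto)
qed

end

section \<open>Binary products and terminal objects as universal properties\<close>

definition is_product :: "('o, 'a) cat \<Rightarrow> 'o \<Rightarrow> 'o \<Rightarrow> 'o \<Rightarrow> 'a \<Rightarrow> 'a \<Rightarrow> bool" where
  "is_product C A B P p q \<longleftrightarrow> P \<in> Ob C \<and> p \<in> hom C P A \<and> q \<in> hom C P B \<and>
     (\<forall>f \<in> Ar C. \<forall>g \<in> Ar C. Dom C f = Dom C g \<longrightarrow> Cod C f = A \<longrightarrow> Cod C g = B \<longrightarrow>
       (\<exists>!m. m \<in> hom C (Dom C f) P \<and> p \<cdot>\<^bsub>C\<^esub> m = f \<and> q \<cdot>\<^bsub>C\<^esub> m = g))"

definition prod_med :: "('o, 'a) cat \<Rightarrow> 'o \<Rightarrow> 'a \<Rightarrow> 'a \<Rightarrow> 'a \<Rightarrow> 'a \<Rightarrow> 'a" where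
  "prod_med C P p q f g = (THE m. m \<in> hom C (Dom C f) P \<and> p \<cdot>\<^bsub>C\<^esub> m = f \<and> q \<cdot>\<^bsub>C\<^esub> m = g)"

definition is_terminal :: "('o, 'a) cat \<Rightarrow> 'o \<Rightarrow> bool" where
  "is_terminal C T \<longleftrightarrow> T \<in> Ob C \<and> (\<forall>X \<in> Ob C. \<exists>!m. m \<in> hom C X T)"

context category
begin

lemma is_productD:
  assumes "is_product C A B P p q"
  shows "P \<in> Ob C" "A \<in> Ob C" "B \<in> Ob C" "p \<in> Ar C" "Dom C p = P" "Cod C p = A"
    "q \<in> Ar C" "Dom C q = P" "Cod C q = B"
  using assms cod_ob by (auto simp: is_product_def)

lemma prod_med:
  assumes "is_product C A B P p q" and "f \<in> Ar C" "g \<in> Ar C" "Dom C f = Dom C g" "Cod C f = A" "Cod C g = B"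
  shows "prod_med C P p q f g \<in> Ar C" "Dom C (prod_med C P p q f g) = Dom C g"
    "Cod C (prod_med C P p q f g) = P"
    "p \<cdot> prod_med C P p q f g = f" "q \<cdot> prod_med C P p q f g = g"
proof -
  have "\<exists>!m. m \<in> hom C (Dom C f) P \<and> p \<cdot> m = f \<and> q \<cdot> m = g"
    using assms unfolding is_product_def by blast
  from theI'[OF this] show "prod_med C P p q f g \<in> Ar C" "Dom C (prod_med C P p q f g) = Dom C g"
    "Cod C (prod_med C P p q f g) = P"
    "p \<cdot> prod_med C P p q f g = f" "q \<cdot> prod_med C P p q f g = g"
    unfolding prod_med_def using assms(4) by auto
qed

lemma prod_eqI:
  assumes "is_product C A B P p q" and "p \<cdot> h = p \<cdot> k" "q \<cdot> h = q \<cdot> k"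
    and "h \<in> Ar C" "k \<in> Ar C" "Cod C h = P" "Cod C k = P" "Dom C h = Dom C k"
  shows "h = k"
proof -
  note D = is_productD[OF assms(1)]
  have "\<exists>!m. m \<in> hom C (Dom C h) P \<and> p \<cdot> m = p \<cdot> h \<and> q \<cdot> m = q \<cdot> h"
    using assms(1) unfolding is_product_def
  proof (elim conjE)
    assume a: "\<forall>f\<in>Ar C. \<forall>g\<in>Ar C. Dom C f = Dom C g \<longrightarrow> Cod C f = A \<longrightarrow> Cod C g = B \<longrightarrow>
       (\<exists>!m. m \<in> hom C (Dom C f) P \<and> p \<cdot> m = f \<and> q \<cdot> m = g)"
    have e: "p \<cdot> h \<in> Ar C" "q \<cdot> h \<in> Ar C" "Dom C (p \<cdot> h) = Dom C (q \<cdot> h)" "Cod C (p \<cdot> h) = A"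
      "Cod C (q \<cdot> h) = B" "Dom C (p \<cdot> h) = Dom C h" using D assms(2-) by simp_all
    from a[rule_format, OF e(1) e(2) e(3) e(4) e(5)] show ?thesis unfolding e(6) .
  qed
  then show ?thesis using assms by (metis in_hom_iff)
qed

lemma is_productI:
  assumes "p \<in> Ar C" "Dom C p = P" "Cod C p = A" "q \<in> Ar C" "Dom C q = P" "Cod C q = B"
    and ex: "\<And>f g. f \<in> Ar C \<Longrightarrow> g \<in> Ar C \<Longrightarrow> Dom C f = Dom C g \<Longrightarrow> Cod C f = A \<Longrightarrow> Cod C g = B \<Longrightarrow>
      \<exists>m \<in> Ar C. Dom C m = Dom C g \<and> Cod C m = P \<and> p \<cdot> m = f \<and> q \<cdot> m = g"
    and un: "\<And>h k. h \<in> Ar C \<Longrightarrow> k \<in> Ar C \<Longrightarrow> Cod C h = P \<Longrightarrow> Cod C k = P \<Longrightarrow> Dom C h = Dom C k \<Longrightarrow>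
      p \<cdot> h = p \<cdot> k \<Longrightarrow> q \<cdot> h = q \<cdot> k \<Longrightarrow> h = k"
  shows "is_product C A B P p q"
  unfolding is_product_def
proof (intro conjI ballI impI)
  show "P \<in> Ob C" using dom_ob[OF assms(1)] assms(2) by simp
  fix f g assume fg: "f \<in> Ar C" "g \<in> Ar C" "Dom C f = Dom C g" "Cod C f = A" "Cod C g = B"
  from ex[OF fg] obtain m where "m \<in> Ar C" "Dom C m = Dom C g" "Cod C m = P" "p \<cdot> m = f" "q \<cdot> m = g"
    by auto
  then show "\<exists>!m. m \<in> hom C (Dom C f) P \<and> p \<cdot> m = f \<and> q \<cdot> m = g"
    using fg un by (intro ex1I[of _ m]) auto
qed (use assms in auto)

lemma product_unique_iso:
  assumes "is_product C A B P p q" and "is_product C A B P' p' q'"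
  shows "is_iso C (prod_med C P p q p' q')"
proof -
  note D = is_productD[OF assms(1)] and D' = is_productD[OF assms(2)]
  have k: "prod_med C P p q p' q' \<in> Ar C" "Dom C (prod_med C P p q p' q') = P'"
    "Cod C (prod_med C P p q p' q') = P"
    "p \<cdot> prod_med C P p q p' q' = p'" "q \<cdot> prod_med C P p q p' q' = q'"
    using prod_med[OF assms(1), of p' q'] D' by auto
  have l: "prod_med C P' p' q' p q \<in> Ar C" "Dom C (prod_med C P' p' q' p q) = P"
    "Cod C (prod_med C P' p' q' p q) = P'"
    "p' \<cdot> prod_med C P' p' q' p q = p" "q' \<cdot> prod_med C P' p' q' p q = q"
    using prod_med[OF assms(2), of p q] D by auto
  note t = comp_tail[OF k(4)] comp_tail[OF k(5)] comp_tail[OF l(4)] comp_tail[OF l(5)]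
  show ?thesis
  proof (rule is_isoI)
    show "prod_med C P' p' q' p q \<cdot> prod_med C P p q p' q' = Idt C (Dom C (prod_med C P p q p' q'))"
      by (rule prod_eqI[OF assms(2)]) (use k l D D' t in simp_all)
    show "prod_med C P p q p' q' \<cdot> prod_med C P' p' q' p q = Idt C (Cod C (prod_med C P p q p' q'))"
      by (rule prod_eqI[OF assms(1)]) (use k l D D' t in simp_all)
  qed (use k l in auto)
qed

lemma product_iso_pre:
  assumes "is_product C A B P p q" and k: "is_iso C k" "Cod C k = P"
  shows "is_product C A B (Dom C k) (p \<cdot> k) (q \<cdot> k)"
proof -
  note D = is_productD[OF assms(1)]
  obtain l where l: "k \<in> Ar C" "l \<in> Ar C" "Dom C l = Cod C k" "Cod C l = Dom C k"
    "l \<cdot> k = Idt C (Dom C k)" "k \<cdot> l = Idt C (Cod C k)"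
    using k(1) by (rule is_isoE)
  note t = comp_tail[OF l(5)] comp_tail[OF l(6)]
  show ?thesis
  proof (rule is_productI)
    fix f g assume fg: "f \<in> Ar C" "g \<in> Ar C" "Dom C f = Dom C g" "Cod C f = A" "Cod C g = B"
    note m = prod_med[OF assms(1) fg]
    show "\<exists>m\<in>Ar C. Dom C m = Dom C g \<and> Cod C m = Dom C k \<and> p \<cdot> k \<cdot> m = f \<and> q \<cdot> k \<cdot> m = g"
      by (rule bexI[of _ "l \<cdot> prod_med C P p q f g"]) (use m l k(2) t D in simp_all)
  next
    fix h h' assume h: "h \<in> Ar C" "h' \<in> Ar C" "Cod C h = Dom C k" "Cod C h' = Dom C k"
      "Dom C h = Dom C h'" "p \<cdot> k \<cdot> h = p \<cdot> k \<cdot> h'" "q \<cdot> k \<cdot> h = q \<cdot> k \<cdot> h'"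
    have "k \<cdot> h = k \<cdot> h'" by (rule prod_eqI[OF assms(1)]) (use h D l k(2) in simp_all)
    then have "l \<cdot> (k \<cdot> h) = l \<cdot> (k \<cdot> h')" by simp
    then show "h = h'" using t(1)[of h] t(1)[of h'] h l k(2) by simp
  qed (use D l k(2) in simp_all)
qed

lemma is_terminalD:
  assumes "is_terminal C T"
  shows "T \<in> Ob C"
    and "\<And>h k. h \<in> Ar C \<Longrightarrow> k \<in> Ar C \<Longrightarrow> Cod C h = T \<Longrightarrow> Cod C k = T \<Longrightarrow> Dom C h = Dom C k \<Longrightarrow> h = k"
    and "\<And>X. X \<in> Ob C \<Longrightarrow> \<exists>m \<in> Ar C. Dom C m = X \<and> Cod C m = T"
proof -
  show "T \<in> Ob C" using assms by (simp add: is_terminal_def)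
  show "\<exists>m \<in> Ar C. Dom C m = X \<and> Cod C m = T" if "X \<in> Ob C" for X
    using that assms by (auto simp: is_terminal_def)
  fix h k assume "h \<in> Ar C" "k \<in> Ar C" "Cod C h = T" "Cod C k = T" "Dom C h = Dom C k"
  then show "h = k" using assms dom_ob[of h] unfolding is_terminal_def by (metis in_hom_iff)
qed

end

context cat_functor
begin

sublocale C: category C by (rule source_category)
sublocale D: category D by (rule target_category)

lemma onA_simps [simp]:
  assumes "f \<in> Ar C"
  shows "onA F f \<in> Ar D" "Dom D (onA F f) = onO F (Dom C f)" "Cod D (onA F f) = onO F (Cod C f)"
  using onA_hom[of f "Dom C f" "Cod C f"] assms by simp_all

lemmas [simp] = onO_ob onA_idt

lemma onA_comp' [simp]:
  "f \<in> Ar C \<Longrightarrow> g \<in> Ar C \<Longrightarrow> Dom C g = Cod C f \<Longrightarrow> onA F (g \<cdot>\<^bsub>C\<^esub> f) = onA F g \<cdot>\<^bsub>D\<^esub> onA F f"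
  using onA_comp[of f "Dom C f" "Cod C f" g "Cod C g"] by simp

end

lemma cat_functorI:
  assumes "category C" "category D" "\<And>A. A \<in> Ob C \<Longrightarrow> onO F A \<in> Ob D"
    and "\<And>f. f \<in> Ar C \<Longrightarrow> onA F f \<in> Ar D \<and> Dom D (onA F f) = onO F (Dom C f) \<and> Cod D (onA F f) = onO F (Cod C f)"
    and "\<And>A. A \<in> Ob C \<Longrightarrow> onA F (Idt C A) = Idt D (onO F A)"
    and "\<And>f g. f \<in> Ar C \<Longrightarrow> g \<in> Ar C \<Longrightarrow> Dom C g = Cod C f \<Longrightarrow> onA F (g \<cdot>\<^bsub>C\<^esub> f) = onA F g \<cdot>\<^bsub>D\<^esub> onA F f"
  shows "cat_functor C D F"
  using assms by (auto simp: cat_functor_def)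

section \<open>Cells of a double category\<close>

lemma composable_cat_simps [simp]:
  "(M, N) \<in> Ob (composable_cat D) \<longleftrightarrow> M \<in> HOb D \<and> N \<in> HOb D \<and> hsrc D M = htgt D N"
  "(\<alpha>, \<beta>) \<in> Ar (composable_cat D) \<longleftrightarrow> \<alpha> \<in> Cells D \<and> \<beta> \<in> Cells D \<and> csrc D \<alpha> = ctgt D \<beta>"
  "Dom (composable_cat D) (\<alpha>, \<beta>) = (Dom (HCat D) \<alpha>, Dom (HCat D) \<beta>)"
  "Cod (composable_cat D) (\<alpha>, \<beta>) = (Cod (HCat D) \<alpha>, Cod (HCat D) \<beta>)"
  "Idt (composable_cat D) (M, N) = (cell_id D M, cell_id D N)"
  "Comp (composable_cat D) (\<alpha>', \<beta>') (\<alpha>, \<beta>) = (\<alpha>' \<bullet>\<^bsub>D\<^esub> \<alpha>, \<beta>' \<bullet>\<^bsub>D\<^esub> \<beta>)"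
  by (auto simp: composable_cat_def prod_cat_def)

lemma hcomp_fct_simps [simp]:
  "onO (hcomp_fct D) (M, N) = M \<odot>\<^bsub>D\<^esub> N" "onA (hcomp_fct D) (\<alpha>, \<beta>) = \<alpha> \<star>\<^bsub>D\<^esub> \<beta>"
  by (simp_all add: hcomp_fct_def)

lemma globular_simps:
  assumes "\<alpha> \<in> globular D M N"
  shows "\<alpha> \<in> Cells D" "Dom (HCat D) \<alpha> = M" "Cod (HCat D) \<alpha> = N"
    "csrc D \<alpha> = Idt (VCat D) (hsrc D M)" "ctgt D \<alpha> = Idt (VCat D) (htgt D M)"
  using assms by (auto simp: globular_def)

lemma globularI:
  assumes "\<alpha> \<in> Cells D" "Dom (HCat D) \<alpha> = M" "Cod (HCat D) \<alpha> = N"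
    "csrc D \<alpha> = Idt (VCat D) (hsrc D M)" "ctgt D \<alpha> = Idt (VCat D) (htgt D M)"
  shows "\<alpha> \<in> globular D M N"
  using assms by (auto simp: globular_def)

context double_category
begin

sublocale V: category "VCat D" by (rule VCat_category)
sublocale H: category "HCat D" by (rule HCat_category)
sublocale S: cat_functor "HCat D" "VCat D" "Src D" by (rule Src_functor)
sublocale T: cat_functor "HCat D" "VCat D" "Tgt D" by (rule Tgt_functor)
sublocale U: cat_functor "VCat D" "HCat D" "Unt D" by (rule Unt_functor)
sublocale HC: cat_functor "composable_cat D" "HCat D" "hcomp_fct D" by (rule hcomp_functor)

declare hsrc_hunit [simp] htgt_hunit [simp] csrc_cunit [simp] ctgt_cunit [simp]

lemma hcomp_simps [simp]:
  assumes "M \<in> HOb D" "N \<in> HOb D" "hsrc D M = htgt D N"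
  shows "M \<odot> N \<in> HOb D" "hsrc D (M \<odot> N) = hsrc D N" "htgt D (M \<odot> N) = htgt D M"
  using HC.onO_ob[of "(M, N)"] hsrc_hcomp[of M N] htgt_hcomp[of M N] assms by simp_all

lemma ccomp_simps [simp]:
  assumes "\<alpha> \<in> Cells D" "\<beta> \<in> Cells D" "csrc D \<alpha> = ctgt D \<beta>"
  shows "\<alpha> \<star> \<beta> \<in> Cells D" "Dom (HCat D) (\<alpha> \<star> \<beta>) = Dom (HCat D) \<alpha> \<odot> Dom (HCat D) \<beta>"
    "Cod (HCat D) (\<alpha> \<star> \<beta>) = Cod (HCat D) \<alpha> \<odot> Cod (HCat D) \<beta>"
    "csrc D (\<alpha> \<star> \<beta>) = csrc D \<beta>" "ctgt D (\<alpha> \<star> \<beta>) = ctgt D \<alpha>"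
  using HC.onA_simps[of "(\<alpha>, \<beta>)"] csrc_ccomp[of \<alpha> \<beta>] ctgt_ccomp[of \<alpha> \<beta>] assms by simp_all

lemma ccomp_idt [simp]:
  assumes "M \<in> HOb D" "N \<in> HOb D" "hsrc D M = htgt D N"
  shows "cell_id D M \<star> cell_id D N = cell_id D (M \<odot> N)"
  using HC.onA_idt[of "(M, N)"] assms by simp

lemma interchange:
  assumes "\<alpha> \<in> Cells D" "\<beta> \<in> Cells D" "\<gamma> \<in> Cells D" "\<delta> \<in> Cells D"
    and "Dom (HCat D) \<beta> = Cod (HCat D) \<alpha>" "Dom (HCat D) \<delta> = Cod (HCat D) \<gamma>"
    and "csrc D \<alpha> = ctgt D \<gamma>" "csrc D \<beta> = ctgt D \<delta>"
  shows "(\<beta> \<star> \<delta>) \<bullet> (\<alpha> \<star> \<gamma>) = (\<beta> \<bullet> \<alpha>) \<star> (\<delta> \<bullet> \<gamma>)"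
  using HC.onA_comp'[of "(\<alpha>, \<gamma>)" "(\<beta>, \<delta>)"] assms by simp

lemma interchange_tail:
  assumes "\<alpha> \<in> Cells D" "\<beta> \<in> Cells D" "\<gamma> \<in> Cells D" "\<delta> \<in> Cells D" "\<xi> \<in> Cells D"
    and "Dom (HCat D) \<beta> = Cod (HCat D) \<alpha>" "Dom (HCat D) \<delta> = Cod (HCat D) \<gamma>"
    and "csrc D \<alpha> = ctgt D \<gamma>" "csrc D \<beta> = ctgt D \<delta>"
    and "Dom (HCat D) \<alpha> \<odot> Dom (HCat D) \<gamma> = Cod (HCat D) \<xi>"
  shows "(\<beta> \<star> \<delta>) \<bullet> ((\<alpha> \<star> \<gamma>) \<bullet> \<xi>) = ((\<beta> \<bullet> \<alpha>) \<star> (\<delta> \<bullet> \<gamma>)) \<bullet> \<xi>"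
  by (rule H.comp_tail[OF interchange]) (use assms in auto)

lemma Assoc_simps [simp]:
  assumes "M \<in> HOb D" "N \<in> HOb D" "P \<in> HOb D" "hsrc D M = htgt D N" "hsrc D N = htgt D P"
  shows "Assoc D M N P \<in> Cells D" "Dom (HCat D) (Assoc D M N P) = (M \<odot> N) \<odot> P"
    "Cod (HCat D) (Assoc D M N P) = M \<odot> (N \<odot> P)"
    "csrc D (Assoc D M N P) = Idt (VCat D) (hsrc D P)"
    "ctgt D (Assoc D M N P) = Idt (VCat D) (htgt D M)"
    "is_iso (HCat D) (Assoc D M N P)"
  using globular_simps[OF Assoc_globular[of M N P]] Assoc_iso[of M N P] assms by simp_all

lemma LUnit_simps [simp]:
  assumes "M \<in> HOb D"
  shows "LUnit D M \<in> Cells D" "Dom (HCat D) (LUnit D M) = hunit D (htgt D M) \<odot> M"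
    "Cod (HCat D) (LUnit D M) = M"
    "csrc D (LUnit D M) = Idt (VCat D) (hsrc D M)" "ctgt D (LUnit D M) = Idt (VCat D) (htgt D M)"
    "is_iso (HCat D) (LUnit D M)"
  using globular_simps[OF LUnit_globular[of M]] LUnit_iso[of M] assms by simp_all

lemma RUnit_simps [simp]:
  assumes "M \<in> HOb D"
  shows "RUnit D M \<in> Cells D" "Dom (HCat D) (RUnit D M) = M \<odot> hunit D (hsrc D M)"
    "Cod (HCat D) (RUnit D M) = M"
    "csrc D (RUnit D M) = Idt (VCat D) (hsrc D M)" "ctgt D (RUnit D M) = Idt (VCat D) (htgt D M)"
    "is_iso (HCat D) (RUnit D M)"
  using globular_simps[OF RUnit_globular[of M]] RUnit_iso[of M] assms by simp_all

lemma Assoc_nat: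
  assumes "\<alpha> \<in> Cells D" "\<beta> \<in> Cells D" "\<gamma> \<in> Cells D" "csrc D \<alpha> = ctgt D \<beta>" "csrc D \<beta> = ctgt D \<gamma>"
    and "Cod (HCat D) \<alpha> = M" "Cod (HCat D) \<beta> = N" "Cod (HCat D) \<gamma> = P"
  shows "Assoc D M N P \<bullet> ((\<alpha> \<star> \<beta>) \<star> \<gamma>)
    = (\<alpha> \<star> (\<beta> \<star> \<gamma>)) \<bullet> Assoc D (Dom (HCat D) \<alpha>) (Dom (HCat D) \<beta>) (Dom (HCat D) \<gamma>)"
  using Assoc_natural[of \<alpha> "Dom (HCat D) \<alpha>" M \<beta> "Dom (HCat D) \<beta>" N \<gamma> "Dom (HCat D) \<gamma>" P] assms
  by simp

text \<open>Composability of cells is a condition on vertical arrows, that of horizontal arrows a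
  condition on objects; functoriality of source and target leads from the first to the
  second.\<close>

lemma cells_composable:
  assumes "\<alpha> \<in> Cells D" "\<beta> \<in> Cells D" "csrc D \<alpha> = ctgt D \<beta>"
  shows "hsrc D (Dom (HCat D) \<alpha>) = htgt D (Dom (HCat D) \<beta>)"
    "hsrc D (Cod (HCat D) \<alpha>) = htgt D (Cod (HCat D) \<beta>)"
  using S.onA_simps(2,3)[of \<alpha>] T.onA_simps(2,3)[of \<beta>] assms by simp_all

lemma Assoc_nat_tail:
  assumes "\<alpha> \<in> Cells D" "\<beta> \<in> Cells D" "\<gamma> \<in> Cells D" "csrc D \<alpha> = ctgt D \<beta>" "csrc D \<beta> = ctgt D \<gamma>"
    and "Cod (HCat D) \<alpha> = M" "Cod (HCat D) \<beta> = N" "Cod (HCat D) \<gamma> = P"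
    and "\<xi> \<in> Cells D" "(Dom (HCat D) \<alpha> \<odot> Dom (HCat D) \<beta>) \<odot> Dom (HCat D) \<gamma> = Cod (HCat D) \<xi>"
  shows "Assoc D M N P \<bullet> (((\<alpha> \<star> \<beta>) \<star> \<gamma>) \<bullet> \<xi>)
    = (\<alpha> \<star> (\<beta> \<star> \<gamma>)) \<bullet> (Assoc D (Dom (HCat D) \<alpha>) (Dom (HCat D) \<beta>) (Dom (HCat D) \<gamma>) \<bullet> \<xi>)"
proof -
  note c = cells_composable[OF assms(1,2,4)] cells_composable[OF assms(2,3,5)]
  have "Assoc D M N P \<bullet> (((\<alpha> \<star> \<beta>) \<star> \<gamma>) \<bullet> \<xi>)
    = ((\<alpha> \<star> (\<beta> \<star> \<gamma>)) \<bullet> Assoc D (Dom (HCat D) \<alpha>) (Dom (HCat D) \<beta>) (Dom (HCat D) \<gamma>)) \<bullet> \<xi>"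
    by (rule H.comp_tail[OF Assoc_nat]) (use assms c in auto)
  then show ?thesis using assms c by simp
qed

text \<open>Variants for the normal form in which identity cells on composites are not split.\<close>

lemma Assoc_nat_whisker:
  assumes "M \<in> HOb D" "N \<in> HOb D" "\<gamma> \<in> Cells D" "hsrc D M = htgt D N"
    "ctgt D \<gamma> = Idt (VCat D) (hsrc D N)" "Cod (HCat D) \<gamma> = P"
  shows "Assoc D M N P \<bullet> (cell_id D (M \<odot> N) \<star> \<gamma>)
    = (cell_id D M \<star> (cell_id D N \<star> \<gamma>)) \<bullet> Assoc D M N (Dom (HCat D) \<gamma>)"
  using Assoc_nat[of "cell_id D M" "cell_id D N" \<gamma> M N P] assms by simp

lemma globular_tgt:
  assumes "\<gamma> \<in> Cells D" "ctgt D \<gamma> = Idt (VCat D) A" "A \<in> Ob (VCat D)"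
  shows "htgt D (Dom (HCat D) \<gamma>) = A" "htgt D (Cod (HCat D) \<gamma>) = A"
  using T.onA_simps(2,3)[of \<gamma>] assms by simp_all

lemma globular_src:
  assumes "\<gamma> \<in> Cells D" "csrc D \<gamma> = Idt (VCat D) A" "A \<in> Ob (VCat D)"
  shows "hsrc D (Dom (HCat D) \<gamma>) = A" "hsrc D (Cod (HCat D) \<gamma>) = A"
  using S.onA_simps(2,3)[of \<gamma>] assms by simp_all

lemma Assoc_nat_whisker_tail:
  assumes "M \<in> HOb D" "N \<in> HOb D" "\<gamma> \<in> Cells D" "hsrc D M = htgt D N"
    "ctgt D \<gamma> = Idt (VCat D) (hsrc D N)" "Cod (HCat D) \<gamma> = P"
    and "\<xi> \<in> Cells D" "(M \<odot> N) \<odot> Dom (HCat D) \<gamma> = Cod (HCat D) \<xi>"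
  shows "Assoc D M N P \<bullet> ((cell_id D (M \<odot> N) \<star> \<gamma>) \<bullet> \<xi>)
    = (cell_id D M \<star> (cell_id D N \<star> \<gamma>)) \<bullet> (Assoc D M N (Dom (HCat D) \<gamma>) \<bullet> \<xi>)"
  using Assoc_nat_tail[of "cell_id D M" "cell_id D N" \<gamma> M N P \<xi>] assms by simp

lemma whisker_left:
  assumes "\<alpha> \<in> Cells D" "\<beta> \<in> Cells D" "Dom (HCat D) \<beta> = Cod (HCat D) \<alpha>" "M \<in> HOb D"
    and "ctgt D \<alpha> = Idt (VCat D) (hsrc D M)" "ctgt D \<beta> = Idt (VCat D) (hsrc D M)"
  shows "cell_id D M \<star> (\<beta> \<bullet> \<alpha>) = (cell_id D M \<star> \<beta>) \<bullet> (cell_id D M \<star> \<alpha>)"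
  using interchange[of "cell_id D M" "cell_id D M" \<alpha> \<beta>] assms by simp

lemma whisker_right:
  assumes "\<alpha> \<in> Cells D" "\<beta> \<in> Cells D" "Dom (HCat D) \<beta> = Cod (HCat D) \<alpha>" "M \<in> HOb D"
    and "csrc D \<alpha> = Idt (VCat D) (htgt D M)" "csrc D \<beta> = Idt (VCat D) (htgt D M)"
  shows "(\<beta> \<bullet> \<alpha>) \<star> cell_id D M = (\<beta> \<star> cell_id D M) \<bullet> (\<alpha> \<star> cell_id D M)"
  using interchange[of \<alpha> \<beta> "cell_id D M" "cell_id D M"] assms by simp

lemma pentagon':
  assumes "M \<in> HOb D" "N \<in> HOb D" "P \<in> HOb D" "Q \<in> HOb D"
    "hsrc D M = htgt D N" "hsrc D N = htgt D P" "hsrc D P = htgt D Q"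
  shows "(cell_id D M \<star> Assoc D N P Q) \<bullet> (Assoc D M (N \<odot> P) Q \<bullet> (Assoc D M N P \<star> cell_id D Q))
          = Assoc D M N (P \<odot> Q) \<bullet> Assoc D (M \<odot> N) P Q"
  using pentagon[of M N P Q] assms by simp

text \<open>The inverse is \<open>\<alpha>' \<star> \<beta>'\<close>. It is defined because
  \<open>csrc D \<alpha>'\<close> and \<open>ctgt D \<beta>'\<close> are inverse to the same
  vertical arrow, the common side of \<alpha> and \<beta>, and therefore equal.\<close>

lemma whisker_iso:
  assumes "is_iso (HCat D) \<alpha>" "is_iso (HCat D) \<beta>" "csrc D \<alpha> = ctgt D \<beta>"
  shows "is_iso (HCat D) (\<alpha> \<star> \<beta>)"
proof -
  obtain \<alpha>' where a: "\<alpha> \<in> Cells D" "\<alpha>' \<in> Cells D" "Dom (HCat D) \<alpha>' = Cod (HCat D) \<alpha>"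
    "Cod (HCat D) \<alpha>' = Dom (HCat D) \<alpha>" "\<alpha>' \<bullet> \<alpha> = cell_id D (Dom (HCat D) \<alpha>)"
    "\<alpha> \<bullet> \<alpha>' = cell_id D (Cod (HCat D) \<alpha>)"
    using H.is_isoE[OF assms(1)] by blast
  obtain \<beta>' where b: "\<beta> \<in> Cells D" "\<beta>' \<in> Cells D" "Dom (HCat D) \<beta>' = Cod (HCat D) \<beta>"
    "Cod (HCat D) \<beta>' = Dom (HCat D) \<beta>" "\<beta>' \<bullet> \<beta> = cell_id D (Dom (HCat D) \<beta>)"
    "\<beta> \<bullet> \<beta>' = cell_id D (Cod (HCat D) \<beta>)"
    using H.is_isoE[OF assms(2)] by blast
  note ab = cells_composable[OF a(1) b(1) assms(3)]
  have sa: "csrc D \<alpha>' \<in> Ar (VCat D)" "Dom (VCat D) (csrc D \<alpha>') = Cod (VCat D) (csrc D \<alpha>)"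
    "Cod (VCat D) (csrc D \<alpha>') = Dom (VCat D) (csrc D \<alpha>)" using a by auto
  have tb: "ctgt D \<beta>' \<in> Ar (VCat D)" "Dom (VCat D) (ctgt D \<beta>') = Cod (VCat D) (csrc D \<alpha>)"
    "Cod (VCat D) (ctgt D \<beta>') = Dom (VCat D) (csrc D \<alpha>)" unfolding assms(3) using b by auto
  have 1: "csrc D \<alpha>' \<cdot>\<^bsub>VCat D\<^esub> csrc D \<alpha> = Idt (VCat D) (hsrc D (Dom (HCat D) \<alpha>))"
    using S.onA_comp'[of \<alpha> \<alpha>'] a S.onA_idt[of "Dom (HCat D) \<alpha>"] by simp
  have 2: "csrc D \<alpha> \<cdot>\<^bsub>VCat D\<^esub> ctgt D \<beta>' = Idt (VCat D) (htgt D (Cod (HCat D) \<beta>))"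
    unfolding assms(3) using T.onA_comp'[of \<beta>' \<beta>] b T.onA_idt[of "Cod (HCat D) \<beta>"] by simp
  have "csrc D \<alpha>' = csrc D \<alpha>' \<cdot>\<^bsub>VCat D\<^esub> (csrc D \<alpha> \<cdot>\<^bsub>VCat D\<^esub> ctgt D \<beta>')"
    unfolding 2 using a b ab by simp
  also have "\<dots> = Idt (VCat D) (hsrc D (Dom (HCat D) \<alpha>)) \<cdot>\<^bsub>VCat D\<^esub> ctgt D \<beta>'"
    by (rule V.comp_tail[OF 1]) (use sa tb a in auto)
  also have "\<dots> = ctgt D \<beta>'" using b ab by simp
  finally have c: "csrc D \<alpha>' = ctgt D \<beta>'" .
  show ?thesis
    by (rule H.is_isoI[where g = "\<alpha>' \<star> \<beta>'"]) (use a b c assms(3) ab interchange in auto)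
qed

end

section \<open>Monads and modules\<close>

context double_category
begin

lemma is_monad_simps [simp]:
  assumes "is_monad D X"
  shows "mon_ob X \<in> Ob (VCat D)" "mon_hor X \<in> HOb D" "hsrc D (mon_hor X) = mon_ob X"
    "htgt D (mon_hor X) = mon_ob X"
    "mon_unit X \<in> Cells D" "Dom (HCat D) (mon_unit X) = hunit D (mon_ob X)"
    "Cod (HCat D) (mon_unit X) = mon_hor X"
    "csrc D (mon_unit X) = Idt (VCat D) (mon_ob X)" "ctgt D (mon_unit X) = Idt (VCat D) (mon_ob X)"
    "mon_mult X \<in> Cells D" "Dom (HCat D) (mon_mult X) = mon_hor X \<odot> mon_hor X"
    "Cod (HCat D) (mon_mult X) = mon_hor X"
    "csrc D (mon_mult X) = Idt (VCat D) (mon_ob X)" "ctgt D (mon_mult X) = Idt (VCat D) (mon_ob X)"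
  using assms by (auto simp: is_monad_def Let_def globular_def)

text \<open>The definition nests composites to the left. The associativity law is restated in the
  right-nested form that the simplifier produces; the same is done for modules below.\<close>

lemma is_monad_laws:
  assumes "is_monad D X"
  shows "mon_mult X \<bullet> (mon_unit X \<star> cell_id D (mon_hor X)) = LUnit D (mon_hor X)"
    "mon_mult X \<bullet> (cell_id D (mon_hor X) \<star> mon_unit X) = RUnit D (mon_hor X)"
    "mon_mult X \<bullet> (mon_mult X \<star> cell_id D (mon_hor X))
      = mon_mult X \<bullet> ((cell_id D (mon_hor X) \<star> mon_mult X) \<bullet> Assoc D (mon_hor X) (mon_hor X) (mon_hor X))"
proof -
  have "mon_mult X \<bullet> (mon_mult X \<star> cell_id D (mon_hor X))
      = mon_mult X \<bullet> (cell_id D (mon_hor X) \<star> mon_mult X) \<bullet> Assoc D (mon_hor X) (mon_hor X) (mon_hor X)"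
    using assms unfolding is_monad_def Let_def by blast
  then show "mon_mult X \<bullet> (mon_mult X \<star> cell_id D (mon_hor X))
      = mon_mult X \<bullet> ((cell_id D (mon_hor X) \<star> mon_mult X) \<bullet> Assoc D (mon_hor X) (mon_hor X) (mon_hor X))"
    using assms by simp
  show "mon_mult X \<bullet> (mon_unit X \<star> cell_id D (mon_hor X)) = LUnit D (mon_hor X)"
    "mon_mult X \<bullet> (cell_id D (mon_hor X) \<star> mon_unit X) = RUnit D (mon_hor X)"
    using assms unfolding is_monad_def Let_def by blast+
qed

lemma is_monad_mor_simps [simp]:
  assumes "is_monad_mor D m"
  shows "is_monad D (mor_dom m)" "is_monad D (mor_cod m)" "mor_side m \<in> Ar (VCat D)"
    "Dom (VCat D) (mor_side m) = mon_ob (mor_dom m)" "Cod (VCat D) (mor_side m) = mon_ob (mor_cod m)"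
    "mor_cell m \<in> Cells D"
    "Dom (HCat D) (mor_cell m) = mon_hor (mor_dom m)" "Cod (HCat D) (mor_cell m) = mon_hor (mor_cod m)"
    "csrc D (mor_cell m) = mor_side m" "ctgt D (mor_cell m) = mor_side m"
  using assms by (auto simp: is_monad_mor_def Let_def)

lemma is_monad_mor_laws:
  assumes "is_monad_mor D m"
  shows "mor_cell m \<bullet> mon_unit (mor_dom m) = mon_unit (mor_cod m) \<bullet> cunit D (mor_side m)"
    "mor_cell m \<bullet> mon_mult (mor_dom m) = mon_mult (mor_cod m) \<bullet> (mor_cell m \<star> mor_cell m)"
  using assms unfolding is_monad_mor_def Let_def by blast+

lemma is_monad_morI:
  assumes "is_monad D (mor_dom m)" "is_monad D (mor_cod m)" "mor_side m \<in> Ar (VCat D)"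
    "Dom (VCat D) (mor_side m) = mon_ob (mor_dom m)" "Cod (VCat D) (mor_side m) = mon_ob (mor_cod m)"
    "mor_cell m \<in> Cells D"
    "Dom (HCat D) (mor_cell m) = mon_hor (mor_dom m)" "Cod (HCat D) (mor_cell m) = mon_hor (mor_cod m)"
    "csrc D (mor_cell m) = mor_side m" "ctgt D (mor_cell m) = mor_side m"
    "mor_cell m \<bullet> mon_unit (mor_dom m) = mon_unit (mor_cod m) \<bullet> cunit D (mor_side m)"
    "mor_cell m \<bullet> mon_mult (mor_dom m) = mon_mult (mor_cod m) \<bullet> (mor_cell m \<star> mor_cell m)"
  shows "is_monad_mor D m"
  unfolding is_monad_mor_def Let_def in_hom_iff using assms by blast

lemma is_bimodule_simps [simp]:
  assumes "is_bimodule D B"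
  shows "is_monad D (mod_src B)" "is_monad D (mod_tgt B)" "mod_hor B \<in> HOb D"
    "hsrc D (mod_hor B) = mon_ob (mod_src B)" "htgt D (mod_hor B) = mon_ob (mod_tgt B)"
    "mod_ract B \<in> Cells D" "Dom (HCat D) (mod_ract B) = mod_hor B \<odot> mon_hor (mod_src B)"
    "Cod (HCat D) (mod_ract B) = mod_hor B"
    "csrc D (mod_ract B) = Idt (VCat D) (mon_ob (mod_src B))"
    "ctgt D (mod_ract B) = Idt (VCat D) (mon_ob (mod_tgt B))"
    "mod_lact B \<in> Cells D" "Dom (HCat D) (mod_lact B) = mon_hor (mod_tgt B) \<odot> mod_hor B"
    "Cod (HCat D) (mod_lact B) = mod_hor B"
    "csrc D (mod_lact B) = Idt (VCat D) (mon_ob (mod_src B))"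
    "ctgt D (mod_lact B) = Idt (VCat D) (mon_ob (mod_tgt B))"
  using assms by (auto simp: is_bimodule_def Let_def globular_def)

lemma is_bimodule_laws:
  fixes B defines "S \<equiv> mon_hor (mod_src B)" and "T \<equiv> mon_hor (mod_tgt B)" and "M \<equiv> mod_hor B"
  assumes B: "is_bimodule D B"
  shows "mod_ract B \<bullet> (cell_id D M \<star> mon_unit (mod_src B)) = RUnit D M"
    "mod_lact B \<bullet> (mon_unit (mod_tgt B) \<star> cell_id D M) = LUnit D M"
    "mod_ract B \<bullet> (mod_ract B \<star> cell_id D S)
      = mod_ract B \<bullet> ((cell_id D M \<star> mon_mult (mod_src B)) \<bullet> Assoc D M S S)"
    "mod_lact B \<bullet> (mon_mult (mod_tgt B) \<star> cell_id D M)
      = mod_lact B \<bullet> ((cell_id D T \<star> mod_lact B) \<bullet> Assoc D T T M)"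
    "mod_ract B \<bullet> (mod_lact B \<star> cell_id D S)
      = mod_lact B \<bullet> ((cell_id D T \<star> mod_ract B) \<bullet> Assoc D T M S)"
proof -
  have 1: "mod_ract B \<bullet> (mod_ract B \<star> cell_id D S)
      = mod_ract B \<bullet> (cell_id D M \<star> mon_mult (mod_src B)) \<bullet> Assoc D M S S"
    "mod_lact B \<bullet> (mon_mult (mod_tgt B) \<star> cell_id D M)
      = mod_lact B \<bullet> (cell_id D T \<star> mod_lact B) \<bullet> Assoc D T T M"
    "mod_ract B \<bullet> (mod_lact B \<star> cell_id D S)
      = mod_lact B \<bullet> (cell_id D T \<star> mod_ract B) \<bullet> Assoc D T M S"
    using B unfolding is_bimodule_def Let_def S_def T_def M_def by blast+
  then show "mod_ract B \<bullet> (mod_ract B \<star> cell_id D S)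
      = mod_ract B \<bullet> ((cell_id D M \<star> mon_mult (mod_src B)) \<bullet> Assoc D M S S)"
    "mod_lact B \<bullet> (mon_mult (mod_tgt B) \<star> cell_id D M)
      = mod_lact B \<bullet> ((cell_id D T \<star> mod_lact B) \<bullet> Assoc D T T M)"
    "mod_ract B \<bullet> (mod_lact B \<star> cell_id D S)
      = mod_lact B \<bullet> ((cell_id D T \<star> mod_ract B) \<bullet> Assoc D T M S)"
    using B unfolding S_def T_def M_def by simp_all
  show "mod_ract B \<bullet> (cell_id D M \<star> mon_unit (mod_src B)) = RUnit D M"
    "mod_lact B \<bullet> (mon_unit (mod_tgt B) \<star> cell_id D M) = LUnit D M"
    using B unfolding is_bimodule_def Let_def S_def T_def M_def by blast+
qed

lemma is_bimoduleI:
  fixes B defines "S \<equiv> mon_hor (mod_src B)" and "T \<equiv> mon_hor (mod_tgt B)" and "M \<equiv> mod_hor B"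
  assumes "is_monad D (mod_src B)" "is_monad D (mod_tgt B)"
    "M \<in> HOb D" "hsrc D M = mon_ob (mod_src B)" "htgt D M = mon_ob (mod_tgt B)"
    "mod_ract B \<in> globular D (M \<odot> S) M" "mod_lact B \<in> globular D (T \<odot> M) M"
    "mod_ract B \<bullet> (cell_id D M \<star> mon_unit (mod_src B)) = RUnit D M"
    "mod_lact B \<bullet> (mon_unit (mod_tgt B) \<star> cell_id D M) = LUnit D M"
    "mod_ract B \<bullet> (mod_ract B \<star> cell_id D S)
      = mod_ract B \<bullet> ((cell_id D M \<star> mon_mult (mod_src B)) \<bullet> Assoc D M S S)"
    "mod_lact B \<bullet> (mon_mult (mod_tgt B) \<star> cell_id D M)
      = mod_lact B \<bullet> ((cell_id D T \<star> mod_lact B) \<bullet> Assoc D T T M)"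
    "mod_ract B \<bullet> (mod_lact B \<star> cell_id D S)
      = mod_lact B \<bullet> ((cell_id D T \<star> mod_ract B) \<bullet> Assoc D T M S)"
  shows "is_bimodule D B"
proof -
  note g = globular_simps[OF assms(9)] globular_simps[OF assms(10)]
  have "mod_ract B \<bullet> (mod_ract B \<star> cell_id D S)
      = mod_ract B \<bullet> (cell_id D M \<star> mon_mult (mod_src B)) \<bullet> Assoc D M S S"
    unfolding assms(13) using assms(4-8) g by (simp add: S_def T_def)
  moreover have "mod_lact B \<bullet> (mon_mult (mod_tgt B) \<star> cell_id D M)
      = mod_lact B \<bullet> (cell_id D T \<star> mod_lact B) \<bullet> Assoc D T T M"
    unfolding assms(14) using assms(4-8) g by (simp add: S_def T_def)
  moreover have "mod_ract B \<bullet> (mod_lact B \<star> cell_id D S)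
      = mod_lact B \<bullet> (cell_id D T \<star> mod_ract B) \<bullet> Assoc D T M S"
    unfolding assms(15) using assms(4-8) g by (simp add: S_def T_def)
  ultimately show ?thesis
    using assms(4-12) unfolding is_bimodule_def Let_def S_def T_def M_def by blast
qed

lemma is_mod_cell_simps [simp]:
  assumes "is_mod_cell D a"
  shows "is_bimodule D (mc_dom a)" "is_bimodule D (mc_cod a)"
    "is_monad_mor D (mc_src a)" "is_monad_mor D (mc_tgt a)"
    "mor_dom (mc_src a) = mod_src (mc_dom a)" "mor_cod (mc_src a) = mod_src (mc_cod a)"
    "mor_dom (mc_tgt a) = mod_tgt (mc_dom a)" "mor_cod (mc_tgt a) = mod_tgt (mc_cod a)"
    "mc_cell a \<in> Cells D" "Dom (HCat D) (mc_cell a) = mod_hor (mc_dom a)"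
    "Cod (HCat D) (mc_cell a) = mod_hor (mc_cod a)"
    "csrc D (mc_cell a) = mor_side (mc_src a)" "ctgt D (mc_cell a) = mor_side (mc_tgt a)"
  using assms by (auto simp: is_mod_cell_def Let_def)

lemma is_mod_cell_laws:
  assumes "is_mod_cell D a"
  shows "mc_cell a \<bullet> mod_ract (mc_dom a) = mod_ract (mc_cod a) \<bullet> (mc_cell a \<star> mor_cell (mc_src a))"
    "mc_cell a \<bullet> mod_lact (mc_dom a) = mod_lact (mc_cod a) \<bullet> (mor_cell (mc_tgt a) \<star> mc_cell a)"
  using assms unfolding is_mod_cell_def Let_def by blast+

lemma is_mod_cellI:
  assumes "is_bimodule D (mc_dom a)" "is_bimodule D (mc_cod a)"
    "is_monad_mor D (mc_src a)" "is_monad_mor D (mc_tgt a)"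
    "mor_dom (mc_src a) = mod_src (mc_dom a)" "mor_cod (mc_src a) = mod_src (mc_cod a)"
    "mor_dom (mc_tgt a) = mod_tgt (mc_dom a)" "mor_cod (mc_tgt a) = mod_tgt (mc_cod a)"
    "mc_cell a \<in> Cells D" "Dom (HCat D) (mc_cell a) = mod_hor (mc_dom a)"
    "Cod (HCat D) (mc_cell a) = mod_hor (mc_cod a)"
    "csrc D (mc_cell a) = mor_side (mc_src a)" "ctgt D (mc_cell a) = mor_side (mc_tgt a)"
    "mc_cell a \<bullet> mod_ract (mc_dom a) = mod_ract (mc_cod a) \<bullet> (mc_cell a \<star> mor_cell (mc_src a))"
    "mc_cell a \<bullet> mod_lact (mc_dom a) = mod_lact (mc_cod a) \<bullet> (mor_cell (mc_tgt a) \<star> mc_cell a)"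
  shows "is_mod_cell D a"
  unfolding is_mod_cell_def Let_def in_hom_iff using assms by blast

lemma monad_cat_simps [simp]:
  "X \<in> Ob (monad_cat D) \<longleftrightarrow> is_monad D X" "m \<in> Ar (monad_cat D) \<longleftrightarrow> is_monad_mor D m"
  "Dom (monad_cat D) = mor_dom" "Cod (monad_cat D) = mor_cod" "Idt (monad_cat D) = monad_id D"
  "mor_dom (Comp (monad_cat D) n m) = mor_dom m" "mor_cod (Comp (monad_cat D) n m) = mor_cod n"
  "mor_side (Comp (monad_cat D) n m) = mor_side n \<cdot>\<^bsub>VCat D\<^esub> mor_side m"
  "mor_cell (Comp (monad_cat D) n m) = mor_cell n \<bullet> mor_cell m"
  by (auto simp: monad_cat_def)

lemma monad_id_simps [simp]:
  "mor_dom (monad_id D X) = X" "mor_cod (monad_id D X) = X"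
  "mor_side (monad_id D X) = Idt (VCat D) (mon_ob X)" "mor_cell (monad_id D X) = cell_id D (mon_hor X)"
  by (auto simp: monad_id_def)

lemma is_monad_mor_id [simp]: "is_monad D X \<Longrightarrow> is_monad_mor D (monad_id D X)"
  by (rule is_monad_morI) auto

lemma is_monad_mor_comp [simp]:
  assumes "is_monad_mor D m" "is_monad_mor D n" "mor_dom n = mor_cod m"
  shows "is_monad_mor D (Comp (monad_cat D) n m)"
proof -
  note l = is_monad_mor_laws[OF assms(1)] is_monad_mor_laws[OF assms(2)]
  have "mor_cell n \<bullet> (mor_cell m \<bullet> mon_unit (mor_dom m))
    = mon_unit (mor_cod n) \<bullet> (cunit D (mor_side n) \<bullet> cunit D (mor_side m))"
    unfolding l(1) using H.comp_tail[OF l(3), of "cunit D (mor_side m)"] assms by simp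
  moreover have "mor_cell n \<bullet> (mor_cell m \<bullet> mon_mult (mor_dom m))
    = mon_mult (mor_cod n) \<bullet> ((mor_cell n \<bullet> mor_cell m) \<star> (mor_cell n \<bullet> mor_cell m))"
    unfolding l(2) using H.comp_tail[OF l(4), of "mor_cell m \<star> mor_cell m"] assms
    by (simp add: interchange)
  ultimately show ?thesis
    using assms by (intro is_monad_morI) simp_all
qed

lemma monad_mor_eqI:
  "mor_dom m = mor_dom n \<Longrightarrow> mor_cod m = mor_cod n \<Longrightarrow> mor_side m = mor_side n
    \<Longrightarrow> mor_cell m = mor_cell n \<Longrightarrow> m = n"
  by (cases m; cases n) simp

sublocale MC: category "monad_cat D"
proof
  fix A assume "A \<in> Ob (monad_cat D)"
  then show "Idt (monad_cat D) A \<in> hom (monad_cat D) A A" by simp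
next
  fix f X Y g Z assume "f \<in> hom (monad_cat D) X Y" "g \<in> hom (monad_cat D) Y Z"
  then show "Comp (monad_cat D) g f \<in> hom (monad_cat D) X Z" by simp
qed (auto intro!: monad_mor_eqI)

lemma bimodule_cat_simps [simp]:
  "X \<in> Ob (bimodule_cat D) \<longleftrightarrow> is_bimodule D X" "m \<in> Ar (bimodule_cat D) \<longleftrightarrow> is_mod_cell D m"
  "Dom (bimodule_cat D) = mc_dom" "Cod (bimodule_cat D) = mc_cod"
  "Idt (bimodule_cat D) M = mod_globular_cell D M M (cell_id D (mod_hor M))"
  "mc_dom (Comp (bimodule_cat D) b a) = mc_dom a" "mc_cod (Comp (bimodule_cat D) b a) = mc_cod b"
  "mc_src (Comp (bimodule_cat D) b a) = Comp (monad_cat D) (mc_src b) (mc_src a)"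
  "mc_tgt (Comp (bimodule_cat D) b a) = Comp (monad_cat D) (mc_tgt b) (mc_tgt a)"
  "mc_cell (Comp (bimodule_cat D) b a) = mc_cell b \<bullet> mc_cell a"
  by (auto simp: bimodule_cat_def)

lemma mod_globular_cell_simps [simp]:
  "mc_dom (mod_globular_cell D M N \<alpha>) = M" "mc_cod (mod_globular_cell D M N \<alpha>) = N"
  "mc_src (mod_globular_cell D M N \<alpha>) = monad_id D (mod_src M)"
  "mc_tgt (mod_globular_cell D M N \<alpha>) = monad_id D (mod_tgt M)"
  "mc_cell (mod_globular_cell D M N \<alpha>) = \<alpha>"
  by (auto simp: mod_globular_cell_def)

lemma mod_cell_eqI:
  "mc_dom m = mc_dom n \<Longrightarrow> mc_cod m = mc_cod n \<Longrightarrow> mc_src m = mc_src n \<Longrightarrow> mc_tgt m = mc_tgt n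
    \<Longrightarrow> mc_cell m = mc_cell n \<Longrightarrow> m = n"
  by (cases m; cases n) simp

lemma is_mod_cell_globularI:
  assumes "is_bimodule D M" "is_bimodule D N" "mod_src N = mod_src M" "mod_tgt N = mod_tgt M"
    and "\<alpha> \<in> globular D (mod_hor M) (mod_hor N)"
    and "\<alpha> \<bullet> mod_ract M = mod_ract N \<bullet> (\<alpha> \<star> cell_id D (mon_hor (mod_src M)))"
    and "\<alpha> \<bullet> mod_lact M = mod_lact N \<bullet> (cell_id D (mon_hor (mod_tgt M)) \<star> \<alpha>)"
  shows "is_mod_cell D (mod_globular_cell D M N \<alpha>)"
  using assms globular_simps[OF assms(5)] by (intro is_mod_cellI) simp_all

lemma is_mod_cell_id [simp]:
  "is_bimodule D M \<Longrightarrow> is_mod_cell D (mod_globular_cell D M M (cell_id D (mod_hor M)))"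
  by (rule is_mod_cell_globularI) (auto simp: globular_def)

lemma is_mod_cell_comp [simp]:
  assumes "is_mod_cell D a" "is_mod_cell D b" "mc_dom b = mc_cod a"
  shows "is_mod_cell D (Comp (bimodule_cat D) b a)"
proof -
  note l = is_mod_cell_laws[OF assms(1)] is_mod_cell_laws[OF assms(2)]
  have "mc_cell b \<bullet> (mc_cell a \<bullet> mod_ract (mc_dom a)) = mod_ract (mc_cod b) \<bullet>
    ((mc_cell b \<bullet> mc_cell a) \<star> (mor_cell (mc_src b) \<bullet> mor_cell (mc_src a)))"
    unfolding l(1) using H.comp_tail[OF l(3), of "mc_cell a \<star> mor_cell (mc_src a)"] assms
    by (simp add: interchange)
  moreover have "mc_cell b \<bullet> (mc_cell a \<bullet> mod_lact (mc_dom a)) = mod_lact (mc_cod b) \<bullet>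
    ((mor_cell (mc_tgt b) \<bullet> mor_cell (mc_tgt a)) \<star> (mc_cell b \<bullet> mc_cell a))"
    unfolding l(2) using H.comp_tail[OF l(4), of "mor_cell (mc_tgt a) \<star> mc_cell a"] assms
    by (simp add: interchange)
  ultimately show ?thesis
    using assms by (intro is_mod_cellI) simp_all
qed

sublocale BC: category "bimodule_cat D"
proof
  fix A assume "A \<in> Ob (bimodule_cat D)"
  then show "Idt (bimodule_cat D) A \<in> hom (bimodule_cat D) A A" by simp
next
  fix f X Y g Z assume "f \<in> hom (bimodule_cat D) X Y" "g \<in> hom (bimodule_cat D) Y Z"
  then show "Comp (bimodule_cat D) g f \<in> hom (bimodule_cat D) X Z" by simp
next
  fix f X Y assume "f \<in> hom (bimodule_cat D) X Y"
  then show "Comp (bimodule_cat D) (Idt (bimodule_cat D) Y) f = f"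
    "Comp (bimodule_cat D) f (Idt (bimodule_cat D) X) = f"
    using MC.idt_left[of "mc_src f"] MC.idt_left[of "mc_tgt f"]
      MC.idt_right[of "mc_src f"] MC.idt_right[of "mc_tgt f"]
    by (auto intro!: mod_cell_eqI)
next
  fix f W X g Y h Z
  assume "f \<in> hom (bimodule_cat D) W X" "g \<in> hom (bimodule_cat D) X Y" "h \<in> hom (bimodule_cat D) Y Z"
  then show "Comp (bimodule_cat D) (Comp (bimodule_cat D) h g) f
    = Comp (bimodule_cat D) h (Comp (bimodule_cat D) g f)"
    by (auto intro!: mod_cell_eqI)
qed (auto)

text \<open>The inverse cell \<beta> has identity sides because source and target are functors, and
  it respects the actions because \<alpha> does and can be cancelled.\<close>

lemma mod_cell_isoI:
  assumes a: "is_mod_cell D (mod_globular_cell D M N \<alpha>)" and i: "is_iso (HCat D) \<alpha>"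
  shows "is_iso (bimodule_cat D) (mod_globular_cell D M N \<alpha>)"
proof -
  obtain \<beta> where b: "\<alpha> \<in> Cells D" "\<beta> \<in> Cells D" "Dom (HCat D) \<beta> = Cod (HCat D) \<alpha>"
    "Cod (HCat D) \<beta> = Dom (HCat D) \<alpha>" "\<beta> \<bullet> \<alpha> = cell_id D (Dom (HCat D) \<alpha>)"
    "\<alpha> \<bullet> \<beta> = cell_id D (Cod (HCat D) \<alpha>)"
    using H.is_isoE[OF i] by blast
  note a' = is_mod_cell_simps(1,2,9-13)[OF a, simplified]
  have e: "mod_src N = mod_src M" "mod_tgt N = mod_tgt M"
    using is_mod_cell_simps(6,8)[OF a] by simp_all
  note l = is_mod_cell_laws[OF a, simplified]
  have s: "csrc D \<beta> = Idt (VCat D) (mon_ob (mod_src M))"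
  proof -
    have "csrc D \<alpha> \<cdot>\<^bsub>VCat D\<^esub> csrc D \<beta> = Idt (VCat D) (hsrc D (Cod (HCat D) \<alpha>))"
      using S.onA_comp'[of \<beta> \<alpha>] S.onA_idt[of "Cod (HCat D) \<alpha>"] b by simp
    then show ?thesis using a' b e by simp
  qed
  have t: "ctgt D \<beta> = Idt (VCat D) (mon_ob (mod_tgt M))"
  proof -
    have "ctgt D \<alpha> \<cdot>\<^bsub>VCat D\<^esub> ctgt D \<beta> = Idt (VCat D) (htgt D (Cod (HCat D) \<alpha>))"
      using T.onA_comp'[of \<beta> \<alpha>] T.onA_idt[of "Cod (HCat D) \<alpha>"] b by simp
    then show ?thesis using a' b e by simp
  qed
  have m: "is_mod_cell D (mod_globular_cell D N M \<beta>)"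
  proof (rule is_mod_cell_globularI)
    show "\<beta> \<in> globular D (mod_hor N) (mod_hor M)" using a' b s t e by (simp add: globular_def)
    have "\<beta> \<bullet> (mod_ract N \<bullet> ((\<alpha> \<star> cell_id D (mon_hor (mod_src M))) \<bullet> (\<beta> \<star> cell_id D (mon_hor (mod_src M)))))
      = mod_ract M \<bullet> (\<beta> \<star> cell_id D (mon_hor (mod_src M)))"
      using H.comp_tail[OF l(1), of "\<beta> \<star> cell_id D (mon_hor (mod_src M))"] a' b s t e
        H.comp_tail[OF b(5), of "mod_ract M \<bullet> (\<beta> \<star> cell_id D (mon_hor (mod_src M)))"] by simp
    then show "\<beta> \<bullet> mod_ract N = mod_ract M \<bullet> (\<beta> \<star> cell_id D (mon_hor (mod_src N)))"
      using a' b s t e by (simp add: interchange)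
    have "\<beta> \<bullet> (mod_lact N \<bullet> ((cell_id D (mon_hor (mod_tgt M)) \<star> \<alpha>) \<bullet> (cell_id D (mon_hor (mod_tgt M)) \<star> \<beta>)))
      = mod_lact M \<bullet> (cell_id D (mon_hor (mod_tgt M)) \<star> \<beta>)"
      using H.comp_tail[OF l(2), of "cell_id D (mon_hor (mod_tgt M)) \<star> \<beta>"] a' b s t e
        H.comp_tail[OF b(5), of "mod_lact M \<bullet> (cell_id D (mon_hor (mod_tgt M)) \<star> \<beta>)"] by simp
    then show "\<beta> \<bullet> mod_lact N = mod_lact M \<bullet> (cell_id D (mon_hor (mod_tgt N)) \<star> \<beta>)"
      using a' b s t e by (simp add: interchange)
  qed (use a' e in auto)
  show ?thesis
    by (rule BC.is_isoI[where g = "mod_globular_cell D N M \<beta>"])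
       (use a m a' b e MC.idt_left[of "monad_id D (mod_src M)"] MC.idt_left[of "monad_id D (mod_tgt M)"]
         in \<open>auto intro!: mod_cell_eqI\<close>)
qed

lemma mod_unit_simps [simp]:
  "mod_src (mod_unit X) = X" "mod_tgt (mod_unit X) = X" "mod_hor (mod_unit X) = mon_hor X"
  "mod_ract (mod_unit X) = mon_mult X" "mod_lact (mod_unit X) = mon_mult X"
  by (auto simp: mod_unit_def)

lemma is_bimodule_mod_unit [simp]:
  assumes "is_monad D X"
  shows "is_bimodule D (mod_unit X)"
  by (rule is_bimoduleI) (use assms is_monad_laws[OF assms] in \<open>auto simp: globular_def\<close>)

definition mod_unit_cell where
  "mod_unit_cell m = ModCell (mod_unit (mor_dom m)) (mod_unit (mor_cod m)) m m (mor_cell m)"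

lemma mod_unit_cell_simps [simp]:
  "mc_dom (mod_unit_cell m) = mod_unit (mor_dom m)" "mc_cod (mod_unit_cell m) = mod_unit (mor_cod m)"
  "mc_src (mod_unit_cell m) = m" "mc_tgt (mod_unit_cell m) = m" "mc_cell (mod_unit_cell m) = mor_cell m"
  by (auto simp: mod_unit_cell_def)

lemma is_mod_cell_unit [simp]:
  "is_monad_mor D m \<Longrightarrow> is_mod_cell D (mod_unit_cell m)"
  using is_monad_mor_laws[of m] by (intro is_mod_cellI) simp_all

end

section \<open>Local reflexive coequalizers\<close>

text \<open>A reflexive pair in the category of horizontal arrows with fixed ends and globular
  cells. Its coequalizer is nevertheless required below in all of \<open>HCat D\<close>, so that it
  also factors cells with arbitrary sides.\<close>

definition reflexive_globular_pair :: "('o, 'v, 'h, 'c) dblcat \<Rightarrow> 'h \<Rightarrow> 'h \<Rightarrow> 'c \<Rightarrow> 'c \<Rightarrow> bool" where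
  "reflexive_globular_pair D R X f g \<longleftrightarrow> f \<in> globular D R X \<and> g \<in> globular D R X \<and>
     (\<exists>s \<in> globular D X R. f \<bullet>\<^bsub>D\<^esub> s = cell_id D X \<and> g \<bullet>\<^bsub>D\<^esub> s = cell_id D X)"

text \<open>The first two assumptions hold in every double category; they are assumed because they are
  easier to verify for spans than to derive from the triangle and pentagon axioms.\<close>

locale quotient_double_category = double_category +
  assumes LUnit_hcomp: "\<lbrakk>M \<in> HOb D; N \<in> HOb D; hsrc D M = htgt D N\<rbrakk>
      \<Longrightarrow> LUnit D (M \<odot> N) \<bullet> Assoc D (hunit D (htgt D M)) M N = LUnit D M \<star> cell_id D N"
    and RUnit_hcomp: "\<lbrakk>M \<in> HOb D; N \<in> HOb D; hsrc D M = htgt D N\<rbrakk>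
      \<Longrightarrow> (cell_id D M \<star> RUnit D N) \<bullet> Assoc D M N (hunit D (hsrc D N)) = RUnit D (M \<odot> N)"
    and coequalizer_ex: "reflexive_globular_pair D R X f g
      \<Longrightarrow> \<exists>q. q \<in> globular D X (Cod (HCat D) q) \<and> is_coequalizer (HCat D) f g q"
    and coequalizer_left: "\<lbrakk>reflexive_globular_pair D R X f g; q \<in> globular D X Q;
        is_coequalizer (HCat D) f g q; Y \<in> HOb D; hsrc D Y = htgt D X\<rbrakk>
      \<Longrightarrow> is_coequalizer (HCat D) (cell_id D Y \<star> f) (cell_id D Y \<star> g) (cell_id D Y \<star> q)"
    and coequalizer_right: "\<lbrakk>reflexive_globular_pair D R X f g; q \<in> globular D X Q;
        is_coequalizer (HCat D) f g q; Y \<in> HOb D; hsrc D X = htgt D Y\<rbrakk>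
      \<Longrightarrow> is_coequalizer (HCat D) (f \<star> cell_id D Y) (g \<star> cell_id D Y) (q \<star> cell_id D Y)"

section \<open>Whiskering of reflexive pairs and exchange of whiskered cells\<close>

context double_category
begin

lemma globular_ends:
  assumes "\<alpha> \<in> globular D M N"
  shows "M \<in> HOb D" "N \<in> HOb D" "hsrc D N = hsrc D M" "htgt D N = htgt D M"
proof -
  note g = globular_simps[OF assms]
  show M: "M \<in> HOb D" and "N \<in> HOb D" using H.dom_ob[OF g(1)] H.cod_ob[OF g(1)] g by auto
  show "hsrc D N = hsrc D M" using globular_src[OF g(1) g(4)] M g by simp
  show "htgt D N = htgt D M" using globular_tgt[OF g(1) g(5)] M g by simp
qed

lemma reflexive_left:
  assumes "reflexive_globular_pair D R X f g" "Y \<in> HOb D" "hsrc D Y = htgt D X"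
  shows "reflexive_globular_pair D (Y \<odot> R) (Y \<odot> X) (cell_id D Y \<star> f) (cell_id D Y \<star> g)"
proof -
  obtain s where s: "s \<in> globular D X R" "f \<bullet> s = cell_id D X" "g \<bullet> s = cell_id D X"
    using assms by (auto simp: reflexive_globular_pair_def)
  have f: "f \<in> globular D R X" and g: "g \<in> globular D R X"
    using assms by (auto simp: reflexive_globular_pair_def)
  note ss = globular_simps[OF f] globular_simps[OF g] globular_simps[OF s(1)] globular_ends[OF s(1)]
  have "(cell_id D Y \<star> f) \<bullet> (cell_id D Y \<star> s) = cell_id D (Y \<odot> X)"
    "(cell_id D Y \<star> g) \<bullet> (cell_id D Y \<star> s) = cell_id D (Y \<odot> X)"
    using ss s assms by (simp_all add: interchange)
  then show ?thesis unfolding reflexive_globular_pair_def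
    using ss assms(2-) by (intro conjI bexI[of _ "cell_id D Y \<star> s"] globularI) simp_all
qed

lemma reflexive_right:
  assumes "reflexive_globular_pair D R X f g" "Y \<in> HOb D" "hsrc D X = htgt D Y"
  shows "reflexive_globular_pair D (R \<odot> Y) (X \<odot> Y) (f \<star> cell_id D Y) (g \<star> cell_id D Y)"
proof -
  obtain s where s: "s \<in> globular D X R" "f \<bullet> s = cell_id D X" "g \<bullet> s = cell_id D X"
    using assms by (auto simp: reflexive_globular_pair_def)
  have f: "f \<in> globular D R X" and g: "g \<in> globular D R X"
    using assms by (auto simp: reflexive_globular_pair_def)
  note ss = globular_simps[OF f] globular_simps[OF g] globular_simps[OF s(1)] globular_ends[OF s(1)]
  have "(f \<star> cell_id D Y) \<bullet> (s \<star> cell_id D Y) = cell_id D (X \<odot> Y)"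
    "(g \<star> cell_id D Y) \<bullet> (s \<star> cell_id D Y) = cell_id D (X \<odot> Y)"
    using ss s assms by (simp_all add: interchange)
  then show ?thesis unfolding reflexive_globular_pair_def
    using ss assms(2-) by (intro conjI bexI[of _ "s \<star> cell_id D Y"] globularI) simp_all
qed

text \<open>Both sides are \<open>\<alpha> \<star> \<beta>\<close>. As a rewrite rule this lets the
  cell on the left factor act last. The opposite orientation is \<open>exchange_RL\<close>; the two
  belong to different rule sets, since together they would loop.\<close>

lemma exchange_LR:
  assumes "\<alpha> \<in> Cells D" "\<beta> \<in> Cells D" "csrc D \<alpha> = Idt (VCat D) (htgt D N)"
    "ctgt D \<beta> = Idt (VCat D) (hsrc D M)" "Cod (HCat D) \<alpha> = M" "Dom (HCat D) \<beta> = N"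
  shows "(cell_id D M \<star> \<beta>) \<bullet> (\<alpha> \<star> cell_id D N)
    = (\<alpha> \<star> cell_id D (Cod (HCat D) \<beta>)) \<bullet> (cell_id D (Dom (HCat D) \<alpha>) \<star> \<beta>)"
    and "hsrc D M = htgt D N"
proof -
  have o: "M \<in> HOb D" "N \<in> HOb D" using assms H.cod_ob[of \<alpha>] H.dom_ob[of \<beta>] by auto
  note g = globular_src[OF assms(1,3) T.onO_ob[OF o(2)]] globular_tgt[OF assms(2,4) S.onO_ob[OF o(1)]]
  show "hsrc D M = htgt D N" using g assms by simp
  show "(cell_id D M \<star> \<beta>) \<bullet> (\<alpha> \<star> cell_id D N)
    = (\<alpha> \<star> cell_id D (Cod (HCat D) \<beta>)) \<bullet> (cell_id D (Dom (HCat D) \<alpha>) \<star> \<beta>)"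
    using assms g o by (simp add: interchange)
qed

lemma exchange_LR_tail:
  assumes "\<alpha> \<in> Cells D" "\<beta> \<in> Cells D" "csrc D \<alpha> = Idt (VCat D) (htgt D N)"
    "ctgt D \<beta> = Idt (VCat D) (hsrc D M)" "Cod (HCat D) \<alpha> = M" "Dom (HCat D) \<beta> = N"
    "\<xi> \<in> Cells D" "Dom (HCat D) \<alpha> \<odot> N = Cod (HCat D) \<xi>"
  shows "(cell_id D M \<star> \<beta>) \<bullet> ((\<alpha> \<star> cell_id D N) \<bullet> \<xi>)
    = (\<alpha> \<star> cell_id D (Cod (HCat D) \<beta>)) \<bullet> ((cell_id D (Dom (HCat D) \<alpha>) \<star> \<beta>) \<bullet> \<xi>)"
proof -
  have o: "M \<in> HOb D" "N \<in> HOb D" using assms H.cod_ob[of \<alpha>] H.dom_ob[of \<beta>] by auto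
  note g = globular_src[OF assms(1,3) T.onO_ob[OF o(2)]] globular_tgt[OF assms(2,4) S.onO_ob[OF o(1)]]
  have "(cell_id D M \<star> \<beta>) \<bullet> ((\<alpha> \<star> cell_id D N) \<bullet> \<xi>)
    = ((\<alpha> \<star> cell_id D (Cod (HCat D) \<beta>)) \<bullet> (cell_id D (Dom (HCat D) \<alpha>) \<star> \<beta>)) \<bullet> \<xi>"
    by (rule H.comp_tail[OF exchange_LR(1)[OF assms(1-6)]]) (use assms g o in simp_all)
  also have "\<dots> = (\<alpha> \<star> cell_id D (Cod (HCat D) \<beta>)) \<bullet> ((cell_id D (Dom (HCat D) \<alpha>) \<star> \<beta>) \<bullet> \<xi>)"
    using assms g o by simp
  finally show ?thesis .
qed

lemma whisker_left_eq:
  assumes "b \<bullet> a = c" "a \<in> Cells D" "b \<in> Cells D" "Dom (HCat D) b = Cod (HCat D) a" "M \<in> HOb D"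
    and "ctgt D a = Idt (VCat D) (hsrc D M)" "ctgt D b = Idt (VCat D) (hsrc D M)"
  shows "(cell_id D M \<star> b) \<bullet> (cell_id D M \<star> a) = cell_id D M \<star> c"
  using whisker_left[of a b M] assms by simp

lemma whisker_right_eq:
  assumes "b \<bullet> a = c" "a \<in> Cells D" "b \<in> Cells D" "Dom (HCat D) b = Cod (HCat D) a" "M \<in> HOb D"
    and "csrc D a = Idt (VCat D) (htgt D M)" "csrc D b = Idt (VCat D) (htgt D M)"
  shows "(b \<star> cell_id D M) \<bullet> (a \<star> cell_id D M) = c \<star> cell_id D M"
  using whisker_right[of a b M] assms by simp

lemmas whisker = whisker_left whisker_right
lemmas Assoc_norm = Assoc_nat Assoc_nat_tail Assoc_nat_whisker Assoc_nat_whisker_tail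

lemma mod_hcomp_simps [simp]:
  "mod_src (mod_hcomp D N M) = mod_src M" "mod_tgt (mod_hcomp D N M) = mod_tgt N"
  "mod_hor (mod_hcomp D N M) = Cod (HCat D) (mod_quot D N M)"
  by (auto simp: mod_hcomp_def Let_def)

end

section \<open>The quotients that define composites of modules\<close>

context quotient_double_category
begin

definition composable_mods where
  "composable_mods N M \<longleftrightarrow> is_bimodule D N \<and> is_bimodule D M \<and> mod_src N = mod_tgt M"

definition lpair where
  "lpair N M = mod_ract N \<star> cell_id D (mod_hor M)"

definition rpair where
  "rpair N M = (cell_id D (mod_hor N) \<star> mod_lact M) \<bullet> Assoc D (mod_hor N) (mon_hor (mod_tgt M)) (mod_hor M)"

text \<open>The common section inserts the unit of the middle monad: n \<odot> m is sent by the
  inverse right unitor of n to (n \<odot> U) \<odot> m and then into (n \<odot> T) \<odot> m.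
  Unitality of the right action of \<open>N\<close> and of the left action of \<open>M\<close> makes
  it a section of both arrows.\<close>

lemma lpair_rpair_reflexive:
  assumes N: "is_bimodule D N" and M: "is_bimodule D M" and e: "mod_src N = mod_tgt M"
  shows "reflexive_globular_pair D ((mod_hor N \<odot> mon_hor (mod_tgt M)) \<odot> mod_hor M)
    (mod_hor N \<odot> mod_hor M) (lpair N M) (rpair N M)"
proof -
  let ?n = "mod_hor N" and ?m = "mod_hor M" and ?T = "mod_tgt M"
  note ls = is_bimodule_laws[OF N] is_bimodule_laws[OF M]
  obtain r where r: "RUnit D ?n \<in> Cells D" "r \<in> Cells D"
    "Dom (HCat D) r = ?n" "Cod (HCat D) r = ?n \<odot> hunit D (mon_ob ?T)"
    "RUnit D ?n \<bullet> r = cell_id D ?n"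
    using H.is_isoE[OF RUnit_simps(6), of ?n] N M e by auto
  have sr: "csrc D r = Idt (VCat D) (mon_ob (mod_tgt M))"
    using S.onA_comp'[of r "RUnit D (mod_hor N)"] r N M e by simp
  have tr: "ctgt D r = Idt (VCat D) (mon_ob (mod_tgt N))"
    using T.onA_comp'[of r "RUnit D (mod_hor N)"] r N M e by simp
  define s where "s = ((cell_id D ?n \<star> mon_unit ?T) \<star> cell_id D ?m) \<bullet> (r \<star> cell_id D ?m)"
  have s: "s \<in> globular D (?n \<odot> ?m) ((?n \<odot> mon_hor ?T) \<odot> ?m)"
    unfolding s_def by (rule globularI) (use N M e r sr tr in simp_all)
  have l1: "(mod_ract N \<bullet> (cell_id D ?n \<star> mon_unit ?T)) = RUnit D ?n" using ls(1) e by simp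
  have 1: "lpair N M \<bullet> s = cell_id D (?n \<odot> ?m)"
  proof -
    have "lpair N M \<bullet> s = (RUnit D ?n \<star> cell_id D ?m) \<bullet> (r \<star> cell_id D ?m)"
      unfolding s_def lpair_def
      by (rule H.comp_tail[OF whisker_right_eq[OF l1]]) (use N M e r sr tr in simp_all)
    also have "\<dots> = cell_id D (?n \<odot> ?m)"
      using whisker_right_eq[OF r(5), of ?m] N M e r sr tr by simp
    finally show ?thesis .
  qed
  have 2: "rpair N M \<bullet> s = cell_id D (?n \<odot> ?m)"
  proof -
    have "rpair N M \<bullet> s = (cell_id D ?n \<star> mod_lact M) \<bullet> ((cell_id D ?n \<star> (mon_unit ?T \<star> cell_id D ?m)) \<bullet>
       (Assoc D ?n (hunit D (mon_ob ?T)) ?m \<bullet> (r \<star> cell_id D ?m)))"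
      unfolding s_def rpair_def using N M e r sr tr by (simp add: Assoc_norm)
    also have "\<dots> = (cell_id D ?n \<star> LUnit D ?m) \<bullet> (Assoc D ?n (hunit D (mon_ob ?T)) ?m \<bullet> (r \<star> cell_id D ?m))"
      by (rule H.comp_tail[OF whisker_left_eq[OF ls(7)]]) (use N M e r sr tr in simp_all)
    \<comment> \<open>The triangle axiom trades the left unitor of m for the right unitor of n,
      which \<open>r\<close> inverts.\<close>
    also have "\<dots> = (RUnit D ?n \<star> cell_id D ?m) \<bullet> (r \<star> cell_id D ?m)"
      by (rule H.comp_tail) (use triangle[of ?n ?m] N M e r sr tr in simp_all)
    also have "\<dots> = cell_id D (?n \<odot> ?m)"
      using whisker_right_eq[OF r(5), of ?m] N M e r sr tr by simp
    finally show ?thesis .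
  qed
  have "lpair N M \<in> globular D ((?n \<odot> mon_hor ?T) \<odot> ?m) (?n \<odot> ?m)"
    "rpair N M \<in> globular D ((?n \<odot> mon_hor ?T) \<odot> ?m) (?n \<odot> ?m)"
    unfolding lpair_def rpair_def by (rule globularI; use N M e in simp)+
  then show ?thesis unfolding reflexive_globular_pair_def using s 1 2 by blast
qed

lemma mod_quot:
  assumes N: "is_bimodule D N" and M: "is_bimodule D M" and e: "mod_src N = mod_tgt M"
  shows "mod_quot D N M \<in> globular D (mod_hor N \<odot> mod_hor M) (Cod (HCat D) (mod_quot D N M))"
    and "is_coequalizer (HCat D) (lpair N M) (rpair N M) (mod_quot D N M)"
proof -
  have "\<exists>q. q \<in> globular D (mod_hor N \<odot> mod_hor M) (Cod (HCat D) q) \<and>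
    is_coequalizer (HCat D) (lpair N M) (rpair N M) q"
    using coequalizer_ex[OF lpair_rpair_reflexive[OF assms]] .
  from someI_ex[OF this]
  show "mod_quot D N M \<in> globular D (mod_hor N \<odot> mod_hor M) (Cod (HCat D) (mod_quot D N M))"
    and "is_coequalizer (HCat D) (lpair N M) (rpair N M) (mod_quot D N M)"
    unfolding mod_quot_def Let_def lpair_def rpair_def by auto
qed

lemma mod_quot_simps [simp]:
  assumes N: "is_bimodule D N" and M: "is_bimodule D M" and e: "mod_src N = mod_tgt M"
  shows "mod_quot D N M \<in> Cells D" "Dom (HCat D) (mod_quot D N M) = mod_hor N \<odot> mod_hor M"
    "csrc D (mod_quot D N M) = Idt (VCat D) (mon_ob (mod_src M))"
    "ctgt D (mod_quot D N M) = Idt (VCat D) (mon_ob (mod_tgt N))"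
    "hsrc D (Cod (HCat D) (mod_quot D N M)) = mon_ob (mod_src M)"
    "htgt D (Cod (HCat D) (mod_quot D N M)) = mon_ob (mod_tgt N)"
    "is_coequalizer (HCat D) (lpair N M) (rpair N M) (mod_quot D N M)"
    "H.epi (mod_quot D N M)"
  using globular_simps[OF mod_quot(1)[OF assms]] globular_ends[OF mod_quot(1)[OF assms]]
    mod_quot(2)[OF assms] H.coequalizer_epi[OF mod_quot(2)[OF assms]] assms by simp_all

lemma mod_quot_balanced:
  assumes N: "is_bimodule D N" and M: "is_bimodule D M" and e: "mod_src N = mod_tgt M"
  shows "mod_quot D N M \<bullet> (mod_ract N \<star> cell_id D (mod_hor M)) = mod_quot D N M \<bullet>
    ((cell_id D (mod_hor N) \<star> mod_lact M) \<bullet> Assoc D (mod_hor N) (mon_hor (mod_tgt M)) (mod_hor M))"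
  using H.is_coequalizerD(7)[OF mod_quot(2)[OF assms]] by (simp add: lpair_def rpair_def)

section \<open>Whiskered quotients as coequalizers and epimorphisms\<close>

lemma quot_right:
  assumes N: "is_bimodule D N" and M: "is_bimodule D M" and e: "mod_src N = mod_tgt M"
    and Y: "Y \<in> HOb D" "htgt D Y = mon_ob (mod_src M)"
  shows "is_coequalizer (HCat D) (lpair N M \<star> cell_id D Y) (rpair N M \<star> cell_id D Y)
    (mod_quot D N M \<star> cell_id D Y)" "H.epi (mod_quot D N M \<star> cell_id D Y)"
proof -
  show "is_coequalizer (HCat D) (lpair N M \<star> cell_id D Y) (rpair N M \<star> cell_id D Y)
    (mod_quot D N M \<star> cell_id D Y)"
    by (rule coequalizer_right[OF lpair_rpair_reflexive[OF N M e] mod_quot(1)[OF N M e]])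
       (use assms in simp_all)
  then show "H.epi (mod_quot D N M \<star> cell_id D Y)" by (rule H.coequalizer_epi)
qed

lemma quot_left_epi:
  assumes N: "is_bimodule D N" and M: "is_bimodule D M" and e: "mod_src N = mod_tgt M"
    and Y: "Y \<in> HOb D" "hsrc D Y = mon_ob (mod_tgt N)"
  shows "is_coequalizer (HCat D) (cell_id D Y \<star> lpair N M) (cell_id D Y \<star> rpair N M)
    (cell_id D Y \<star> mod_quot D N M)" "H.epi (cell_id D Y \<star> mod_quot D N M)"
proof -
  show "is_coequalizer (HCat D) (cell_id D Y \<star> lpair N M) (cell_id D Y \<star> rpair N M)
    (cell_id D Y \<star> mod_quot D N M)"
    by (rule coequalizer_left[OF lpair_rpair_reflexive[OF N M e] mod_quot(1)[OF N M e]])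
       (use assms in simp_all)
  then show "H.epi (cell_id D Y \<star> mod_quot D N M)" by (rule H.coequalizer_epi)
qed

text \<open>Whiskering is only known to preserve coequalizers of reflexive pairs, not epimorphisms.
  Whiskering twice is possible because the whiskered pair is reflexive again, by
  \<open>reflexive_right\<close>.\<close>

lemma quot_right2_epi:
  assumes N: "is_bimodule D N" and M: "is_bimodule D M" and e: "mod_src N = mod_tgt M"
    and Y: "Y \<in> HOb D" "htgt D Y = mon_ob (mod_src M)" and Z: "Z \<in> HOb D" "htgt D Z = hsrc D Y"
  shows "H.epi ((mod_quot D N M \<star> cell_id D Y) \<star> cell_id D Z)"
proof -
  have g: "mod_quot D N M \<star> cell_id D Y \<in> globular D ((mod_hor N \<odot> mod_hor M) \<odot> Y)
      (Cod (HCat D) (mod_quot D N M) \<odot> Y)"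
    by (rule globularI) (use assms in simp_all)
  have "is_coequalizer (HCat D) ((lpair N M \<star> cell_id D Y) \<star> cell_id D Z)
    ((rpair N M \<star> cell_id D Y) \<star> cell_id D Z) ((mod_quot D N M \<star> cell_id D Y) \<star> cell_id D Z)"
    by (rule coequalizer_right[OF reflexive_right[OF lpair_rpair_reflexive[OF N M e]] g
          quot_right(1)[OF N M e]]) (use assms in simp_all)
  then show ?thesis by (rule H.coequalizer_epi)
qed

text \<open>As for two whiskerings on the right, but the first takes place on the left and uses
  \<open>reflexive_left\<close>.\<close>

lemma quot_mid_epi:
  assumes N: "is_bimodule D N" and M: "is_bimodule D M" and e: "mod_src N = mod_tgt M"
    and Y: "Y \<in> HOb D" "hsrc D Y = mon_ob (mod_tgt N)"
    and Z: "Z \<in> HOb D" "htgt D Z = mon_ob (mod_src M)"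
  shows "H.epi ((cell_id D Y \<star> mod_quot D N M) \<star> cell_id D Z)"
proof -
  have g: "cell_id D Y \<star> mod_quot D N M \<in> globular D (Y \<odot> (mod_hor N \<odot> mod_hor M))
      (Y \<odot> Cod (HCat D) (mod_quot D N M))"
    by (rule globularI) (use assms in simp_all)
  have "is_coequalizer (HCat D) ((cell_id D Y \<star> lpair N M) \<star> cell_id D Z)
    ((cell_id D Y \<star> rpair N M) \<star> cell_id D Z) ((cell_id D Y \<star> mod_quot D N M) \<star> cell_id D Z)"
    by (rule coequalizer_right[OF reflexive_left[OF lpair_rpair_reflexive[OF N M e]] g
          quot_left_epi(1)[OF N M e]]) (use assms in simp_all)
  then show ?thesis by (rule H.coequalizer_epi)
qed

text \<open>Transporting the coequalizer \<^term>\<open>cell_id D Y \<star> mod_quot D N M\<close> along associators gives one that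
  is described without inverse associators.\<close>

lemma quot_left:
  assumes N: "is_bimodule D N" and M: "is_bimodule D M" and e: "mod_src N = mod_tgt M"
    and Y: "Y \<in> HOb D" "hsrc D Y = mon_ob (mod_tgt N)"
  shows "is_coequalizer (HCat D)
      (((cell_id D Y \<star> mod_ract N) \<bullet> Assoc D Y (mod_hor N) (mon_hor (mod_tgt M))) \<star> cell_id D (mod_hor M))
      ((cell_id D (Y \<odot> mod_hor N) \<star> mod_lact M) \<bullet> Assoc D (Y \<odot> mod_hor N) (mon_hor (mod_tgt M)) (mod_hor M))
      ((cell_id D Y \<star> mod_quot D N M) \<bullet> Assoc D Y (mod_hor N) (mod_hor M))" (is "is_coequalizer _ ?F ?G _")
    "H.epi ((cell_id D Y \<star> mod_quot D N M) \<bullet> Assoc D Y (mod_hor N) (mod_hor M))"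
proof -
  let ?n = "mod_hor N" and ?m = "mod_hor M" and ?T = "mon_hor (mod_tgt M)"
  let ?c = "Assoc D Y (?n \<odot> ?T) ?m \<bullet> (Assoc D Y ?n ?T \<star> cell_id D ?m)"
  have c: "is_iso (HCat D) ?c"
    by (rule H.is_iso_comp) (use assms H.is_iso_idt in \<open>auto intro!: whisker_iso\<close>)
  show "is_coequalizer (HCat D) ?F ?G ((cell_id D Y \<star> mod_quot D N M) \<bullet> Assoc D Y ?n ?m)"
  proof (rule H.coequalizer_transport[OF quot_left_epi(1)[OF assms] c])
    show "Assoc D Y ?n ?m \<bullet> ?F = (cell_id D Y \<star> lpair N M) \<bullet> ?c"
      using assms by (simp add: lpair_def whisker Assoc_norm)
    have "Assoc D Y ?n ?m \<bullet> ?G = (cell_id D Y \<star> (cell_id D ?n \<star> mod_lact M)) \<bullet>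
      (Assoc D Y ?n (?T \<odot> ?m) \<bullet> Assoc D (Y \<odot> ?n) ?T ?m)"
      using assms by (simp add: Assoc_norm)
    \<comment> \<open>Read backwards, the pentagon replaces the two remaining associators by
      \<open>?c\<close> followed by the associator contained in \<open>rpair\<close>.\<close>
    also have "\<dots> = (cell_id D Y \<star> rpair N M) \<bullet> ?c"
      using assms by (simp add: rpair_def whisker pentagon'[symmetric])
    finally show "Assoc D Y ?n ?m \<bullet> ?G = (cell_id D Y \<star> rpair N M) \<bullet> ?c" .
  qed (use assms in \<open>simp_all add: lpair_def rpair_def\<close>)
  then show "H.epi ((cell_id D Y \<star> mod_quot D N M) \<bullet> Assoc D Y ?n ?m)" by (rule H.coequalizer_epi)
qed

end

section \<open>Rewrite rules that move cells to the right of associators\<close>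

context double_category
begin

lemma exchange_RL:
  assumes "\<alpha> \<in> Cells D" "\<beta> \<in> Cells D" "csrc D \<alpha> = Idt (VCat D) (htgt D N)"
    "ctgt D \<beta> = Idt (VCat D) (hsrc D M)" "Dom (HCat D) \<alpha> = M" "Cod (HCat D) \<beta> = N"
  shows "(\<alpha> \<star> cell_id D N) \<bullet> (cell_id D M \<star> \<beta>)
    = (cell_id D (Cod (HCat D) \<alpha>) \<star> \<beta>) \<bullet> (\<alpha> \<star> cell_id D (Dom (HCat D) \<beta>))"
    and "hsrc D M = htgt D N" "htgt D (Dom (HCat D) \<beta>) = hsrc D M" "hsrc D (Cod (HCat D) \<alpha>) = htgt D N"
proof -
  have o: "M \<in> HOb D" "N \<in> HOb D" using assms H.dom_ob[of \<alpha>] H.cod_ob[of \<beta>] by auto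
  note g = globular_src[OF assms(1,3) T.onO_ob[OF o(2)]] globular_tgt[OF assms(2,4) S.onO_ob[OF o(1)]]
  show "hsrc D M = htgt D N" "htgt D (Dom (HCat D) \<beta>) = hsrc D M" "hsrc D (Cod (HCat D) \<alpha>) = htgt D N"
    using g assms by simp_all
  show "(\<alpha> \<star> cell_id D N) \<bullet> (cell_id D M \<star> \<beta>)
    = (cell_id D (Cod (HCat D) \<alpha>) \<star> \<beta>) \<bullet> (\<alpha> \<star> cell_id D (Dom (HCat D) \<beta>))"
    using assms g o by (simp add: interchange)
qed

lemma exchange_RL_tail:
  assumes "\<alpha> \<in> Cells D" "\<beta> \<in> Cells D" "csrc D \<alpha> = Idt (VCat D) (htgt D N)"
    "ctgt D \<beta> = Idt (VCat D) (hsrc D M)" "Dom (HCat D) \<alpha> = M" "Cod (HCat D) \<beta> = N"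
    "\<xi> \<in> Cells D" "M \<odot> Dom (HCat D) \<beta> = Cod (HCat D) \<xi>"
  shows "(\<alpha> \<star> cell_id D N) \<bullet> ((cell_id D M \<star> \<beta>) \<bullet> \<xi>)
    = (cell_id D (Cod (HCat D) \<alpha>) \<star> \<beta>) \<bullet> ((\<alpha> \<star> cell_id D (Dom (HCat D) \<beta>)) \<bullet> \<xi>)"
proof -
  have o: "M \<in> HOb D" "N \<in> HOb D" using assms H.dom_ob[of \<alpha>] H.cod_ob[of \<beta>] by auto
  note g = exchange_RL(2-4)[OF assms(1-6)]
  have "(\<alpha> \<star> cell_id D N) \<bullet> ((cell_id D M \<star> \<beta>) \<bullet> \<xi>)
    = ((cell_id D (Cod (HCat D) \<alpha>) \<star> \<beta>) \<bullet> (\<alpha> \<star> cell_id D (Dom (HCat D) \<beta>))) \<bullet> \<xi>"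
    by (rule H.comp_tail[OF exchange_RL(1)[OF assms(1-6)]]) (use assms g o in simp_all)
  also have "\<dots> = (cell_id D (Cod (HCat D) \<alpha>) \<star> \<beta>) \<bullet> ((\<alpha> \<star> cell_id D (Dom (HCat D) \<beta>)) \<bullet> \<xi>)"
    using assms g o by simp
  finally show ?thesis .
qed

text \<open>Naturality of the associator against the orientation of \<open>Assoc_nat\<close>. Cells
  are pushed behind the associator so that a left action of a composite comes to stand directly in
  front of a whiskered quotient followed by an associator, the pattern of
  \<open>mod_lact_hcomp(6)\<close>.\<close>

lemma Assoc_pull1:
  assumes "\<alpha> \<in> Cells D" "N \<in> HOb D" "P \<in> HOb D" "hsrc D N = htgt D P"
    "csrc D \<alpha> = Idt (VCat D) (htgt D N)" "Dom (HCat D) \<alpha> = M"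
  shows "(\<alpha> \<star> cell_id D (N \<odot> P)) \<bullet> Assoc D M N P
    = Assoc D (Cod (HCat D) \<alpha>) N P \<bullet> ((\<alpha> \<star> cell_id D N) \<star> cell_id D P)"
  using Assoc_nat[of \<alpha> "cell_id D N" "cell_id D P" "Cod (HCat D) \<alpha>" N P] assms by simp

lemma Assoc_pull2:
  assumes "\<beta> \<in> Cells D" "M \<in> HOb D" "P \<in> HOb D"
    "csrc D \<beta> = Idt (VCat D) (htgt D P)" "ctgt D \<beta> = Idt (VCat D) (hsrc D M)" "Dom (HCat D) \<beta> = N"
  shows "(cell_id D M \<star> (\<beta> \<star> cell_id D P)) \<bullet> Assoc D M N P
    = Assoc D M (Cod (HCat D) \<beta>) P \<bullet> ((cell_id D M \<star> \<beta>) \<star> cell_id D P)"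
  using Assoc_nat[of "cell_id D M" \<beta> "cell_id D P" M "Cod (HCat D) \<beta>" P] assms by simp

lemma Assoc_pull1_tail:
  assumes "\<alpha> \<in> Cells D" "N \<in> HOb D" "P \<in> HOb D" "hsrc D N = htgt D P"
    "csrc D \<alpha> = Idt (VCat D) (htgt D N)" "Dom (HCat D) \<alpha> = M"
    "\<xi> \<in> Cells D" "(M \<odot> N) \<odot> P = Cod (HCat D) \<xi>"
  shows "(\<alpha> \<star> cell_id D (N \<odot> P)) \<bullet> (Assoc D M N P \<bullet> \<xi>)
    = Assoc D (Cod (HCat D) \<alpha>) N P \<bullet> (((\<alpha> \<star> cell_id D N) \<star> cell_id D P) \<bullet> \<xi>)"
proof -
  have g: "hsrc D M = htgt D N" "hsrc D (Cod (HCat D) \<alpha>) = htgt D N" "M \<in> HOb D"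
    using globular_src[OF assms(1,5)] assms H.dom_ob[of \<alpha>] by auto
  have "(\<alpha> \<star> cell_id D (N \<odot> P)) \<bullet> (Assoc D M N P \<bullet> \<xi>)
    = (Assoc D (Cod (HCat D) \<alpha>) N P \<bullet> ((\<alpha> \<star> cell_id D N) \<star> cell_id D P)) \<bullet> \<xi>"
    by (rule H.comp_tail[OF Assoc_pull1[OF assms(1-6)]]) (use assms g in simp_all)
  then show ?thesis using assms g by simp
qed

lemma Assoc_pull2_tail:
  assumes "\<beta> \<in> Cells D" "M \<in> HOb D" "P \<in> HOb D"
    "csrc D \<beta> = Idt (VCat D) (htgt D P)" "ctgt D \<beta> = Idt (VCat D) (hsrc D M)" "Dom (HCat D) \<beta> = N"
    "\<xi> \<in> Cells D" "(M \<odot> N) \<odot> P = Cod (HCat D) \<xi>"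
  shows "(cell_id D M \<star> (\<beta> \<star> cell_id D P)) \<bullet> (Assoc D M N P \<bullet> \<xi>)
    = Assoc D M (Cod (HCat D) \<beta>) P \<bullet> (((cell_id D M \<star> \<beta>) \<star> cell_id D P) \<bullet> \<xi>)"
proof -
  have g: "hsrc D M = htgt D N" "htgt D (Cod (HCat D) \<beta>) = hsrc D M" "hsrc D N = htgt D P"
     "hsrc D (Cod (HCat D) \<beta>) = htgt D P" "N \<in> HOb D"
    using globular_src[OF assms(1,4)] globular_tgt[OF assms(1,5)] assms H.dom_ob[of \<beta>] by auto
  have "(cell_id D M \<star> (\<beta> \<star> cell_id D P)) \<bullet> (Assoc D M N P \<bullet> \<xi>)
    = (Assoc D M (Cod (HCat D) \<beta>) P \<bullet> ((cell_id D M \<star> \<beta>) \<star> cell_id D P)) \<bullet> \<xi>"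
    by (rule H.comp_tail[OF Assoc_pull2[OF assms(1-6)]]) (use assms g in simp_all)
  then show ?thesis using assms g by simp
qed

lemmas Assoc_pull = Assoc_pull1 Assoc_pull2 Assoc_pull1_tail Assoc_pull2_tail

end

section \<open>Composition of modules\<close>

context quotient_double_category
begin

text \<open>The sides of the factorization are found by applying the source and target functors to
  \<open>factor (HCat D) q h \<bullet> q = h\<close>, where \<open>q\<close> contributes identities
  only.\<close>

lemma factor_globular:
  assumes q: "is_coequalizer (HCat D) f g q" and h: "h \<in> Cells D" and e: "h \<bullet> f = h \<bullet> g"
    and ends: "csrc D q = Idt (VCat D) A" "ctgt D q = Idt (VCat D) B"
    "csrc D h = Idt (VCat D) A" "ctgt D h = Idt (VCat D) B" "Dom (HCat D) h = Dom (HCat D) q"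
    and AB: "A \<in> Ob (VCat D)" "B \<in> Ob (VCat D)"
  shows "factor (HCat D) q h \<in> Cells D" "Dom (HCat D) (factor (HCat D) q h) = Cod (HCat D) q"
    "Cod (HCat D) (factor (HCat D) q h) = Cod (HCat D) h"
    "csrc D (factor (HCat D) q h) = Idt (VCat D) A" "ctgt D (factor (HCat D) q h) = Idt (VCat D) B"
    "factor (HCat D) q h \<bullet> q = h"
proof -
  note D = H.is_coequalizerD[OF q]
  have d: "Dom (HCat D) h = Cod (HCat D) f" using ends D by simp
  note k = H.coequalizer_factor[OF q h d e]
  then show "factor (HCat D) q h \<in> Cells D" "Dom (HCat D) (factor (HCat D) q h) = Cod (HCat D) q"
    "Cod (HCat D) (factor (HCat D) q h) = Cod (HCat D) h" "factor (HCat D) q h \<bullet> q = h" by auto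
  note c = globular_src[OF D(5) ends(1) AB(1)] globular_tgt[OF D(5) ends(2) AB(2)]
  show "csrc D (factor (HCat D) q h) = Idt (VCat D) A"
    using S.onA_comp'[of q "factor (HCat D) q h"] k c D ends by simp
  show "ctgt D (factor (HCat D) q h) = Idt (VCat D) B"
    using T.onA_comp'[of q "factor (HCat D) q h"] k c D ends by simp
qed

text \<open>A normal form for pastings with quotients and actions: whiskerings are split,
  associators are moved to the right, cells on a left factor act after those on a right factor, and
  a right action in front of which a quotient stands becomes a left action. Each rule occurs bare,
  in its tail form and, where pastings require it, whiskered.\<close>

lemmas act_norm = whisker Assoc_norm exchange_LR exchange_LR_tail
  mod_quot_balanced H.comp_tail[OF mod_quot_balanced]
  whisker_left_eq[OF mod_quot_balanced] H.comp_tail[OF whisker_left_eq[OF mod_quot_balanced]]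
  whisker_right_eq[OF mod_quot_balanced] H.comp_tail[OF whisker_right_eq[OF mod_quot_balanced]]
  is_bimodule_laws(3,4,5) H.comp_tail[OF is_bimodule_laws(3)]
  H.comp_tail[OF is_bimodule_laws(4)] H.comp_tail[OF is_bimodule_laws(5)]
  whisker_left_eq[OF is_bimodule_laws(3)] H.comp_tail[OF whisker_left_eq[OF is_bimodule_laws(3)]]
  whisker_left_eq[OF is_bimodule_laws(5)] H.comp_tail[OF whisker_left_eq[OF is_bimodule_laws(5)]]
  whisker_right_eq[OF is_bimodule_laws(4)] H.comp_tail[OF whisker_right_eq[OF is_bimodule_laws(4)]]
  whisker_right_eq[OF is_bimodule_laws(5)] H.comp_tail[OF whisker_right_eq[OF is_bimodule_laws(5)]]
  pentagon'

text \<open>The right action of \<open>M\<close> descends to the quotient because it commutes with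
  the left action of \<open>M\<close> by the middle monad, so that \<open>h\<close> coequalizes the
  whiskered pair. The last equation characterizes the action, since the whiskered quotient is
  epi.\<close>

lemma mod_ract_hcomp:
  assumes N: "is_bimodule D N" and M: "is_bimodule D M" and e: "mod_src N = mod_tgt M"
  defines "r \<equiv> mod_ract (mod_hcomp D N M)"
  shows "r \<in> Cells D" "Dom (HCat D) r = Cod (HCat D) (mod_quot D N M) \<odot> mon_hor (mod_src M)"
    "Cod (HCat D) r = Cod (HCat D) (mod_quot D N M)"
    "csrc D r = Idt (VCat D) (mon_ob (mod_src M))" "ctgt D r = Idt (VCat D) (mon_ob (mod_tgt N))"
    "r \<bullet> (mod_quot D N M \<star> cell_id D (mon_hor (mod_src M)))
      = mod_quot D N M \<bullet> ((cell_id D (mod_hor N) \<star> mod_ract M) \<bullet>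
          Assoc D (mod_hor N) (mod_hor M) (mon_hor (mod_src M)))"
proof -
  let ?S = "mon_hor (mod_src M)"
  define h where "h = mod_quot D N M \<bullet> ((cell_id D (mod_hor N) \<star> mod_ract M) \<bullet>
      Assoc D (mod_hor N) (mod_hor M) ?S)"
  have r: "r = factor (HCat D) (mod_quot D N M \<star> cell_id D ?S) h"
    unfolding r_def h_def using assms by (simp add: mod_hcomp_def Let_def)
  have h: "h \<bullet> (lpair N M \<star> cell_id D ?S) = h \<bullet> (rpair N M \<star> cell_id D ?S)"
    using assms by (simp add: h_def lpair_def rpair_def act_norm)
  have q: "is_coequalizer (HCat D) (lpair N M \<star> cell_id D ?S) (rpair N M \<star> cell_id D ?S)
    (mod_quot D N M \<star> cell_id D ?S)"
    by (rule quot_right(1)[OF N M e]) (use assms in auto)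
  have hh: "h \<in> Cells D" "Dom (HCat D) h = Dom (HCat D) (mod_quot D N M \<star> cell_id D ?S)"
    "Cod (HCat D) h = Cod (HCat D) (mod_quot D N M)"
    "csrc D h = Idt (VCat D) (mon_ob (mod_src M))" "ctgt D h = Idt (VCat D) (mon_ob (mod_tgt N))"
    unfolding h_def using N M e by simp_all
  have qq: "csrc D (mod_quot D N M \<star> cell_id D ?S) = Idt (VCat D) (mon_ob (mod_src M))"
    "ctgt D (mod_quot D N M \<star> cell_id D ?S) = Idt (VCat D) (mon_ob (mod_tgt N))"
    "mon_ob (mod_src M) \<in> Ob (VCat D)" "mon_ob (mod_tgt N) \<in> Ob (VCat D)"
    using N M e by simp_all
  note k = factor_globular[OF q hh(1) h qq(1,2) hh(4,5,2) qq(3,4), folded r]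
  then show "r \<in> Cells D" "Dom (HCat D) r = Cod (HCat D) (mod_quot D N M) \<odot> ?S"
    "Cod (HCat D) r = Cod (HCat D) (mod_quot D N M)"
    "csrc D r = Idt (VCat D) (mon_ob (mod_src M))" "ctgt D r = Idt (VCat D) (mon_ob (mod_tgt N))"
    "r \<bullet> (mod_quot D N M \<star> cell_id D ?S)
      = mod_quot D N M \<bullet> ((cell_id D (mod_hor N) \<star> mod_ract M) \<bullet> Assoc D (mod_hor N) (mod_hor M) ?S)"
    using N M e hh(3) by (simp_all add: h_def)
qed

text \<open>Here the two actions of \<open>N\<close> have to commute. The quotient is taken in the
  form of \<open>quot_left\<close>, with an associator attached, which keeps the inverse associator
  out of the characterizing equation.\<close>

lemma mod_lact_hcomp:
  assumes N: "is_bimodule D N" and M: "is_bimodule D M" and e: "mod_src N = mod_tgt M"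
  defines "l \<equiv> mod_lact (mod_hcomp D N M)"
  shows "l \<in> Cells D" "Dom (HCat D) l = mon_hor (mod_tgt N) \<odot> Cod (HCat D) (mod_quot D N M)"
    "Cod (HCat D) l = Cod (HCat D) (mod_quot D N M)"
    "csrc D l = Idt (VCat D) (mon_ob (mod_src M))" "ctgt D l = Idt (VCat D) (mon_ob (mod_tgt N))"
    "l \<bullet> ((cell_id D (mon_hor (mod_tgt N)) \<star> mod_quot D N M)
        \<bullet> Assoc D (mon_hor (mod_tgt N)) (mod_hor N) (mod_hor M))
      = mod_quot D N M \<bullet> (mod_lact N \<star> cell_id D (mod_hor M))"
proof -
  let ?V = "mon_hor (mod_tgt N)" and ?n = "mod_hor N" and ?m = "mod_hor M" and ?T = "mon_hor (mod_tgt M)"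
  let ?q = "(cell_id D ?V \<star> mod_quot D N M) \<bullet> Assoc D ?V ?n ?m"
  define h where "h = mod_quot D N M \<bullet> (mod_lact N \<star> cell_id D ?m)"
  have l: "l = factor (HCat D) ?q h"
    unfolding l_def h_def using assms by (simp add: mod_hcomp_def Let_def)
  have q: "is_coequalizer (HCat D) (((cell_id D ?V \<star> mod_ract N) \<bullet> Assoc D ?V ?n ?T) \<star> cell_id D ?m)
    ((cell_id D (?V \<odot> ?n) \<star> mod_lact M) \<bullet> Assoc D (?V \<odot> ?n) ?T ?m) ?q"
    by (rule quot_left(1)[OF N M e]) (use assms in auto)
  have h: "h \<bullet> (((cell_id D ?V \<star> mod_ract N) \<bullet> Assoc D ?V ?n ?T) \<star> cell_id D ?m)
    = h \<bullet> ((cell_id D (?V \<odot> ?n) \<star> mod_lact M) \<bullet> Assoc D (?V \<odot> ?n) ?T ?m)"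
  proof -
    have w: "(mod_lact N \<star> cell_id D ?m) \<bullet> (((cell_id D ?V \<star> mod_ract N) \<bullet> Assoc D ?V ?n ?T) \<star> cell_id D ?m)
      = (mod_ract N \<star> cell_id D ?m) \<bullet> ((mod_lact N \<star> cell_id D ?T) \<star> cell_id D ?m)"
      using N M e is_bimodule_laws(5)[OF N] by (simp add: interchange)
    have "h \<bullet> (((cell_id D ?V \<star> mod_ract N) \<bullet> Assoc D ?V ?n ?T) \<star> cell_id D ?m)
      = mod_quot D N M \<bullet> ((mod_ract N \<star> cell_id D ?m) \<bullet> ((mod_lact N \<star> cell_id D ?T) \<star> cell_id D ?m))"
      unfolding w[symmetric] h_def using N M e by simp
    also have "\<dots> = h \<bullet> ((cell_id D (?V \<odot> ?n) \<star> mod_lact M) \<bullet> Assoc D (?V \<odot> ?n) ?T ?m)"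
      using N M e by (simp add: h_def Assoc_norm exchange_LR_tail H.comp_tail[OF mod_quot_balanced])
    finally show ?thesis .
  qed
  have hh: "h \<in> Cells D" "Dom (HCat D) h = Dom (HCat D) ?q"
    "Cod (HCat D) h = Cod (HCat D) (mod_quot D N M)"
    "csrc D h = Idt (VCat D) (mon_ob (mod_src M))" "ctgt D h = Idt (VCat D) (mon_ob (mod_tgt N))"
    unfolding h_def using N M e by simp_all
  have qq: "csrc D ?q = Idt (VCat D) (mon_ob (mod_src M))"
    "ctgt D ?q = Idt (VCat D) (mon_ob (mod_tgt N))"
    "mon_ob (mod_src M) \<in> Ob (VCat D)" "mon_ob (mod_tgt N) \<in> Ob (VCat D)"
    using N M e by simp_all
  note k = factor_globular[OF q hh(1) h qq(1,2) hh(4,5,2) qq(3,4), folded l]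
  then show "l \<in> Cells D" "Dom (HCat D) l = ?V \<odot> Cod (HCat D) (mod_quot D N M)"
    "Cod (HCat D) l = Cod (HCat D) (mod_quot D N M)"
    "csrc D l = Idt (VCat D) (mon_ob (mod_src M))" "ctgt D l = Idt (VCat D) (mon_ob (mod_tgt N))"
    "l \<bullet> ?q = mod_quot D N M \<bullet> (mod_lact N \<star> cell_id D (mod_hor M))"
    using N M e hh(3) by (simp_all add: h_def)
qed

lemmas [simp] = mod_ract_hcomp(1-5) mod_lact_hcomp(1-5)

lemmas ract_hcomp_norm = mod_ract_hcomp(6) H.comp_tail[OF mod_ract_hcomp(6)]
  whisker_right_eq[OF mod_ract_hcomp(6)] H.comp_tail[OF whisker_right_eq[OF mod_ract_hcomp(6)]]
  whisker_left_eq[OF mod_ract_hcomp(6)] H.comp_tail[OF whisker_left_eq[OF mod_ract_hcomp(6)]]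

text \<open>The equation that characterizes a left action has three cells on its left-hand side, so
  it needs its own tail and whiskering rules.\<close>

lemma comp_tail3:
  assumes "c \<bullet> (b \<bullet> a) = d" and "a \<in> Cells D" and "b \<in> Cells D" and "Dom (HCat D) b = Cod (HCat D) a"
    and "c \<in> Cells D" and "Dom (HCat D) c = Cod (HCat D) b"
    and "x \<in> Cells D" and "Dom (HCat D) a = Cod (HCat D) x"
  shows "c \<bullet> (b \<bullet> (a \<bullet> x)) = d \<bullet> x"
  unfolding assms(1)[symmetric] using assms(2-) by simp

lemma whisker_left_eq3:
  assumes "c \<bullet> (b \<bullet> a) = d" and "a \<in> Cells D" and "b \<in> Cells D" and "Dom (HCat D) b = Cod (HCat D) a"
    and "c \<in> Cells D" and "Dom (HCat D) c = Cod (HCat D) b" "M \<in> HOb D"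
    and "ctgt D a = Idt (VCat D) (hsrc D M)" "ctgt D b = Idt (VCat D) (hsrc D M)"
    "ctgt D c = Idt (VCat D) (hsrc D M)"
  shows "(cell_id D M \<star> c) \<bullet> ((cell_id D M \<star> b) \<bullet> (cell_id D M \<star> a)) = cell_id D M \<star> d"
  unfolding assms(1)[symmetric] using assms(2-) by (simp add: whisker_left)

lemma whisker_right_eq3:
  assumes "c \<bullet> (b \<bullet> a) = d" and "a \<in> Cells D" and "b \<in> Cells D" and "Dom (HCat D) b = Cod (HCat D) a"
    and "c \<in> Cells D" and "Dom (HCat D) c = Cod (HCat D) b" "M \<in> HOb D"
    and "csrc D a = Idt (VCat D) (htgt D M)" "csrc D b = Idt (VCat D) (htgt D M)"
    "csrc D c = Idt (VCat D) (htgt D M)"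
  shows "(c \<star> cell_id D M) \<bullet> ((b \<star> cell_id D M) \<bullet> (a \<star> cell_id D M)) = d \<star> cell_id D M"
  unfolding assms(1)[symmetric] using assms(2-) by (simp add: whisker_right)

lemmas lact_hcomp_norm = mod_lact_hcomp(6) comp_tail3[OF mod_lact_hcomp(6)]
  whisker_right_eq3[OF mod_lact_hcomp(6)] comp_tail3[OF whisker_right_eq3[OF mod_lact_hcomp(6)]]
  whisker_left_eq3[OF mod_lact_hcomp(6)] comp_tail3[OF whisker_left_eq3[OF mod_lact_hcomp(6)]]

lemmas actL_norm = whisker Assoc_pull Assoc_nat_whisker Assoc_nat_whisker_tail exchange_RL(1) exchange_RL_tail
  is_bimodule_laws(3,4)
  H.comp_tail[OF is_bimodule_laws(4)]
  whisker_right_eq[OF is_bimodule_laws(4)] H.comp_tail[OF whisker_right_eq[OF is_bimodule_laws(4)]]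
  pentagon'[symmetric]

text \<open>Each law is an equation between cells out of a composite containing the quotient object.
  Precomposed with a suitably whiskered quotient it becomes the corresponding law of
  \<open>M\<close> for the right action, and of \<open>N\<close> for the left action. The
  compatibility of the two actions reduces to interchange, as they act on different factors.\<close>

lemma is_bimodule_hcomp:
  assumes N: "is_bimodule D N" and M: "is_bimodule D M" and e: "mod_src N = mod_tgt M"
  shows "is_bimodule D (mod_hcomp D N M)"
proof -
  let ?S = "mon_hor (mod_src M)" and ?V = "mon_hor (mod_tgt N)" and ?n = "mod_hor N" and ?m = "mod_hor M"
  let ?Q = "Cod (HCat D) (mod_quot D N M)" and ?q = "mod_quot D N M"
  let ?r = "mod_ract (mod_hcomp D N M)" and ?l = "mod_lact (mod_hcomp D N M)"
  have Q: "?Q \<in> HOb D" using N M e by simp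
  have 1: "?r \<bullet> (cell_id D ?Q \<star> mon_unit (mod_src M)) = RUnit D ?Q"
  proof (rule H.epiD)
    show "H.epi (?q \<star> cell_id D (hunit D (mon_ob (mod_src M))))"
      by (rule quot_right(2)[OF N M e]) (use N M in simp_all)
    show "(?r \<bullet> (cell_id D ?Q \<star> mon_unit (mod_src M))) \<bullet> (?q \<star> cell_id D (hunit D (mon_ob (mod_src M))))
      = RUnit D ?Q \<bullet> (?q \<star> cell_id D (hunit D (mon_ob (mod_src M))))"
      using N M e RUnit_natural[of ?q "?n \<odot> ?m" ?Q] RUnit_hcomp[of ?n ?m]
      by (simp add: act_norm ract_hcomp_norm H.comp_tail[OF whisker_left_eq[OF is_bimodule_laws(1)]])
  qed (use N M e Q in simp_all)
  have 2: "?l \<bullet> (mon_unit (mod_tgt N) \<star> cell_id D ?Q) = LUnit D ?Q"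
  proof (rule H.epiD)
    let ?U = "hunit D (mon_ob (mod_tgt N))"
    show "H.epi ((cell_id D ?U \<star> ?q) \<bullet> Assoc D ?U ?n ?m)"
      by (rule quot_left(2)[OF N M e]) (use N M in simp_all)
    have "LUnit D ?Q \<bullet> (cell_id D ?U \<star> ?q) = ?q \<bullet> LUnit D (?n \<odot> ?m)"
      using LUnit_natural[of ?q "?n \<odot> ?m" ?Q] N M e by simp
    from H.comp_tail[OF this, of "Assoc D ?U ?n ?m"]
    show "(?l \<bullet> (mon_unit (mod_tgt N) \<star> cell_id D ?Q)) \<bullet> ((cell_id D ?U \<star> ?q) \<bullet> Assoc D ?U ?n ?m)
      = LUnit D ?Q \<bullet> ((cell_id D ?U \<star> ?q) \<bullet> Assoc D ?U ?n ?m)"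
      using N M e LUnit_hcomp[of ?n ?m]
      by (simp add: actL_norm lact_hcomp_norm whisker_right_eq[OF is_bimodule_laws(2)])
  qed (use N M e Q in simp_all)
  have 3: "?r \<bullet> (?r \<star> cell_id D ?S) = ?r \<bullet> ((cell_id D ?Q \<star> mon_mult (mod_src M)) \<bullet> Assoc D ?Q ?S ?S)"
  proof (rule H.epiD)
    show "H.epi ((?q \<star> cell_id D ?S) \<star> cell_id D ?S)"
      by (rule quot_right2_epi[OF N M e]) (use N M in simp_all)
    show "(?r \<bullet> (?r \<star> cell_id D ?S)) \<bullet> ((?q \<star> cell_id D ?S) \<star> cell_id D ?S)
      = (?r \<bullet> ((cell_id D ?Q \<star> mon_mult (mod_src M)) \<bullet> Assoc D ?Q ?S ?S)) \<bullet> ((?q \<star> cell_id D ?S) \<star> cell_id D ?S)"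
      using N M e by (simp add: act_norm ract_hcomp_norm)
  qed (use N M e Q in simp_all)
  have 4: "?l \<bullet> (mon_mult (mod_tgt N) \<star> cell_id D ?Q) = ?l \<bullet> ((cell_id D ?V \<star> ?l) \<bullet> Assoc D ?V ?V ?Q)"
  proof (rule H.epiD)
    show "H.epi ((cell_id D (?V \<odot> ?V) \<star> ?q) \<bullet> Assoc D (?V \<odot> ?V) ?n ?m)"
      by (rule quot_left(2)[OF N M e]) (use N M in simp_all)
    show "(?l \<bullet> (mon_mult (mod_tgt N) \<star> cell_id D ?Q)) \<bullet> ((cell_id D (?V \<odot> ?V) \<star> ?q) \<bullet> Assoc D (?V \<odot> ?V) ?n ?m)
      = (?l \<bullet> ((cell_id D ?V \<star> ?l) \<bullet> Assoc D ?V ?V ?Q)) \<bullet> ((cell_id D (?V \<odot> ?V) \<star> ?q) \<bullet> Assoc D (?V \<odot> ?V) ?n ?m)"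
      using N M e by (simp add: actL_norm lact_hcomp_norm)
  qed (use N M e Q in simp_all)
  have 5: "?r \<bullet> (?l \<star> cell_id D ?S) = ?l \<bullet> ((cell_id D ?V \<star> ?r) \<bullet> Assoc D ?V ?Q ?S)"
  proof (rule H.epiD)
    \<comment> \<open>The associator in \<open>?e\<close> makes the test start at ((V \<odot> n)
      \<odot> m) \<odot> S, where the equation for the left action applies without inverting
      anything.\<close>
    let ?e = "((cell_id D ?V \<star> ?q) \<star> cell_id D ?S) \<bullet> (Assoc D ?V ?n ?m \<star> cell_id D ?S)"
    show "H.epi ?e"
      by (rule H.epi_comp[OF H.iso_epi quot_mid_epi[OF N M e]])
         (use N M e in \<open>auto intro!: whisker_iso H.is_iso_idt\<close>)
    have "(?r \<bullet> (?l \<star> cell_id D ?S)) \<bullet> ?e = ?q \<bullet> ((mod_lact N \<star> cell_id D ?m) \<bullet>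
      ((cell_id D (?V \<odot> ?n) \<star> mod_ract M) \<bullet> Assoc D (?V \<odot> ?n) ?m ?S))"
      using N M e by (simp add: act_norm ract_hcomp_norm lact_hcomp_norm)
    also have "\<dots> = ?l \<bullet> ((cell_id D ?V \<star> ?q) \<bullet> (Assoc D ?V ?n ?m \<bullet>
        ((cell_id D (?V \<odot> ?n) \<star> mod_ract M) \<bullet> Assoc D (?V \<odot> ?n) ?m ?S)))"
      using N M e by (simp add: lact_hcomp_norm)
    also have "\<dots> = (?l \<bullet> ((cell_id D ?V \<star> ?r) \<bullet> Assoc D ?V ?Q ?S)) \<bullet> ?e"
      using N M e by (simp add: act_norm ract_hcomp_norm)
    finally show "(?r \<bullet> (?l \<star> cell_id D ?S)) \<bullet> ?e = (?l \<bullet> ((cell_id D ?V \<star> ?r) \<bullet> Assoc D ?V ?Q ?S)) \<bullet> ?e" .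
  qed (use N M e Q in simp_all)
  show ?thesis
    by (rule is_bimoduleI) (use N M e 1 2 3 4 5 in \<open>auto intro!: globularI\<close>)
qed

end

context double_category
begin

lemma monad_id_comp [simp]:
  "is_monad_mor D m \<Longrightarrow> mor_cod m = X \<Longrightarrow> Comp (monad_cat D) (monad_id D X) m = m"
  "is_monad_mor D m \<Longrightarrow> mor_dom m = X \<Longrightarrow> Comp (monad_cat D) m (monad_id D X) = m"
  by (auto intro!: monad_mor_eqI)

lemma mod_ccomp_simps [simp]:
  "mc_dom (mod_ccomp D b a) = mod_hcomp D (mc_dom b) (mc_dom a)"
  "mc_cod (mod_ccomp D b a) = mod_hcomp D (mc_cod b) (mc_cod a)"
  "mc_src (mod_ccomp D b a) = mc_src a" "mc_tgt (mod_ccomp D b a) = mc_tgt b"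
  by (auto simp: mod_ccomp_def Let_def)

lemma mod_cells_composable:
  assumes "is_mod_cell D b" "is_mod_cell D a" "mc_src b = mc_tgt a"
  shows "mod_src (mc_dom b) = mod_tgt (mc_dom a)" "mod_src (mc_cod b) = mod_tgt (mc_cod a)"
  using assms is_mod_cell_simps(5,6)[OF assms(1)] is_mod_cell_simps(7,8)[OF assms(2)] by auto

end

context quotient_double_category
begin

text \<open>The counterpart of \<open>factor_globular\<close> for cells \<open>h\<close> with
  arbitrary sides, which occur when cells between modules are composed horizontally.\<close>

lemma factor_sides:
  assumes q: "is_coequalizer (HCat D) f g q" and h: "h \<in> Cells D" and e: "h \<bullet> f = h \<bullet> g"
    and ends: "csrc D q = Idt (VCat D) A" "ctgt D q = Idt (VCat D) B" "Dom (HCat D) h = Dom (HCat D) q"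
    and AB: "A \<in> Ob (VCat D)" "B \<in> Ob (VCat D)"
  shows "csrc D (factor (HCat D) q h) = csrc D h" "ctgt D (factor (HCat D) q h) = ctgt D h"
proof -
  note D = H.is_coequalizerD[OF q]
  have d: "Dom (HCat D) h = Cod (HCat D) f" using ends D by simp
  note k = H.coequalizer_factor[OF q h d e]
  note c = globular_src[OF D(5) ends(1) AB(1)] globular_tgt[OF D(5) ends(2) AB(2)]
  show "csrc D (factor (HCat D) q h) = csrc D h"
    using S.onA_comp'[of q "factor (HCat D) q h"] k c D ends by simp
  show "ctgt D (factor (HCat D) q h) = ctgt D h"
    using T.onA_comp'[of q "factor (HCat D) q h"] k c D ends by simp
qed

text \<open>The cell b \<star> a descends to the quotients: \<open>b\<close> respects the right
  action and \<open>a\<close> the left action of the middle monads along the same monad morphism,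
  and the target quotient is balanced over its middle monad.\<close>

lemma mod_ccomp_cell:
  assumes b: "is_mod_cell D b" and a: "is_mod_cell D a" and e: "mc_src b = mc_tgt a"
  defines "c \<equiv> mc_cell (mod_ccomp D b a)"
  shows "c \<in> Cells D" "Dom (HCat D) c = Cod (HCat D) (mod_quot D (mc_dom b) (mc_dom a))"
    "Cod (HCat D) c = Cod (HCat D) (mod_quot D (mc_cod b) (mc_cod a))"
    "csrc D c = mor_side (mc_src a)" "ctgt D c = mor_side (mc_tgt b)"
    "c \<bullet> mod_quot D (mc_dom b) (mc_dom a) = mod_quot D (mc_cod b) (mc_cod a) \<bullet> (mc_cell b \<star> mc_cell a)"
proof -
  let ?N = "mc_dom b" and ?M = "mc_dom a" and ?N' = "mc_cod b" and ?M' = "mc_cod a"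
  let ?s = "mor_cell (mc_tgt a)" and ?b = "mc_cell b" and ?a = "mc_cell a"
  note cc = mod_cells_composable[OF b a e]
  define h where "h = mod_quot D ?N' ?M' \<bullet> (?b \<star> ?a)"
  have c: "c = factor (HCat D) (mod_quot D ?N ?M) h"
    unfolding c_def h_def by (simp add: mod_ccomp_def Let_def)
  have "h \<bullet> lpair ?N ?M = mod_quot D ?N' ?M' \<bullet> ((?b \<bullet> mod_ract ?N) \<star> ?a)"
    using a b e cc by (simp add: h_def lpair_def interchange)
  also have "\<dots> = mod_quot D ?N' ?M' \<bullet> ((mod_ract ?N' \<star> cell_id D (mod_hor ?M')) \<bullet> ((?b \<star> ?s) \<star> ?a))"
    using a b e cc is_mod_cell_laws(1)[OF b] by (simp add: interchange)
  also have "\<dots> = mod_quot D ?N' ?M' \<bullet> ((cell_id D (mod_hor ?N') \<star> mod_lact ?M') \<bullet>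
     ((?b \<star> (?s \<star> ?a)) \<bullet> Assoc D (mod_hor ?N) (mon_hor (mod_tgt ?M)) (mod_hor ?M)))"
    using a b e cc by (simp add: Assoc_norm H.comp_tail[OF mod_quot_balanced])
  also have "\<dots> = mod_quot D ?N' ?M' \<bullet> ((?b \<star> (?a \<bullet> mod_lact ?M)) \<bullet> Assoc D (mod_hor ?N) (mon_hor (mod_tgt ?M)) (mod_hor ?M))"
    using a b e cc is_mod_cell_laws(2)[OF a] by (simp add: interchange_tail)
  also have "\<dots> = h \<bullet> rpair ?N ?M"
    using a b e cc by (simp add: h_def rpair_def interchange_tail)
  finally have h: "h \<bullet> lpair ?N ?M = h \<bullet> rpair ?N ?M" .
  have hh: "h \<in> Cells D" "Dom (HCat D) h = Dom (HCat D) (mod_quot D ?N ?M)"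
    "Cod (HCat D) h = Cod (HCat D) (mod_quot D ?N' ?M')"
    "csrc D h = mor_side (mc_src a)" "ctgt D h = mor_side (mc_tgt b)"
    unfolding h_def using a b e cc by simp_all
  have qq: "is_coequalizer (HCat D) (lpair ?N ?M) (rpair ?N ?M) (mod_quot D ?N ?M)"
    "csrc D (mod_quot D ?N ?M) = Idt (VCat D) (mon_ob (mod_src ?M))"
    "ctgt D (mod_quot D ?N ?M) = Idt (VCat D) (mon_ob (mod_tgt ?N))"
    "mon_ob (mod_src ?M) \<in> Ob (VCat D)" "mon_ob (mod_tgt ?N) \<in> Ob (VCat D)"
    using a b e cc by simp_all
  note s = factor_sides[OF qq(1) hh(1) h qq(2,3) hh(2) qq(4,5), folded c]
  have d: "Dom (HCat D) h = Cod (HCat D) (lpair ?N ?M)" using hh H.is_coequalizerD[OF qq(1)] by simp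
  note k = H.coequalizer_factor[OF qq(1) hh(1) d h, folded c]
  show "c \<in> Cells D" "Dom (HCat D) c = Cod (HCat D) (mod_quot D ?N ?M)"
    "Cod (HCat D) c = Cod (HCat D) (mod_quot D ?N' ?M')"
    "csrc D c = mor_side (mc_src a)" "ctgt D c = mor_side (mc_tgt b)"
    "c \<bullet> mod_quot D ?N ?M = mod_quot D ?N' ?M' \<bullet> (mc_cell b \<star> mc_cell a)"
    using k s hh by (simp_all add: h_def)
qed

lemmas [simp] = mod_ccomp_cell(1-5) is_bimodule_hcomp

lemma split_right:
  assumes "\<alpha> \<in> Cells D" "\<beta> \<in> Cells D" "\<gamma> \<in> Cells D" "Dom (HCat D) \<beta> = Cod (HCat D) \<alpha>"
    "csrc D \<alpha> = ctgt D \<gamma>" "csrc D \<beta> = Idt (VCat D) (htgt D (Cod (HCat D) \<gamma>))"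
  shows "(\<beta> \<bullet> \<alpha>) \<star> \<gamma> = (\<beta> \<star> cell_id D (Cod (HCat D) \<gamma>)) \<bullet> (\<alpha> \<star> \<gamma>)"
  using interchange[of \<alpha> \<beta> \<gamma> "cell_id D (Cod (HCat D) \<gamma>)"] assms by simp

lemma split_left:
  assumes "\<alpha> \<in> Cells D" "\<beta> \<in> Cells D" "\<gamma> \<in> Cells D" "Dom (HCat D) \<beta> = Cod (HCat D) \<alpha>"
    "csrc D \<gamma> = ctgt D \<alpha>" "ctgt D \<beta> = Idt (VCat D) (hsrc D (Cod (HCat D) \<gamma>))"
  shows "\<gamma> \<star> (\<beta> \<bullet> \<alpha>) = (cell_id D (Cod (HCat D) \<gamma>) \<star> \<beta>) \<bullet> (\<gamma> \<star> \<alpha>)"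
  using interchange[of \<gamma> "cell_id D (Cod (HCat D) \<gamma>)" \<alpha> \<beta>] assms by simp

lemma is_mod_cell_ccomp [simp]:
  assumes b: "is_mod_cell D b" and a: "is_mod_cell D a" and e: "mc_src b = mc_tgt a"
  shows "is_mod_cell D (mod_ccomp D b a)"
proof -
  let ?N = "mc_dom b" and ?M = "mc_dom a" and ?N' = "mc_cod b" and ?M' = "mc_cod a"
  let ?b = "mc_cell b" and ?a = "mc_cell a" and ?s = "mor_cell (mc_src a)" and ?t = "mor_cell (mc_tgt b)"
  let ?c = "mc_cell (mod_ccomp D b a)" and ?q = "mod_quot D ?N ?M" and ?q' = "mod_quot D ?N' ?M'"
  let ?S = "mon_hor (mod_src ?M)" and ?V = "mon_hor (mod_tgt ?N)"
  note cc = mod_cells_composable[OF b a e]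
  note c = mod_ccomp_cell[OF b a e]
  have 1: "?c \<bullet> mod_ract (mod_hcomp D ?N ?M) = mod_ract (mod_hcomp D ?N' ?M') \<bullet> (?c \<star> ?s)"
  proof (rule H.epiD)
    show "H.epi (?q \<star> cell_id D ?S)" by (rule quot_right(2)) (use a b cc in simp_all)
    have "(?c \<bullet> mod_ract (mod_hcomp D ?N ?M)) \<bullet> (?q \<star> cell_id D ?S)
      = ?q' \<bullet> ((?b \<star> (?a \<bullet> mod_ract ?M)) \<bullet> Assoc D (mod_hor ?N) (mod_hor ?M) ?S)"
      using a b e cc by (simp add: ract_hcomp_norm H.comp_tail[OF c(6)] interchange_tail)
    also have "\<dots> = ?q' \<bullet> ((cell_id D (mod_hor ?N') \<star> mod_ract ?M') \<bullet>
       ((?b \<star> (?a \<star> ?s)) \<bullet> Assoc D (mod_hor ?N) (mod_hor ?M) ?S))"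
      using a b e cc is_mod_cell_laws(1)[OF a] by (simp add: split_left)
    also have "\<dots> = mod_ract (mod_hcomp D ?N' ?M') \<bullet> (((?q' \<bullet> (?b \<star> ?a)) \<star> ?s))"
      using a b e cc by (simp add: split_right H.comp_tail[OF mod_ract_hcomp(6)] Assoc_nat)
    also have "\<dots> = (mod_ract (mod_hcomp D ?N' ?M') \<bullet> (?c \<star> ?s)) \<bullet> (?q \<star> cell_id D ?S)"
      using a b e cc by (simp add: interchange c(6))
    finally show "(?c \<bullet> mod_ract (mod_hcomp D ?N ?M)) \<bullet> (?q \<star> cell_id D ?S)
      = (mod_ract (mod_hcomp D ?N' ?M') \<bullet> (?c \<star> ?s)) \<bullet> (?q \<star> cell_id D ?S)" .
  qed (use a b e cc in simp_all)
  have 2: "?c \<bullet> mod_lact (mod_hcomp D ?N ?M) = mod_lact (mod_hcomp D ?N' ?M') \<bullet> (?t \<star> ?c)"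
  proof (rule H.epiD)
    let ?e = "(cell_id D ?V \<star> ?q) \<bullet> Assoc D ?V (mod_hor ?N) (mod_hor ?M)"
    show "H.epi ?e" by (rule quot_left(2)) (use a b cc in simp_all)
    have "(?c \<bullet> mod_lact (mod_hcomp D ?N ?M)) \<bullet> ?e = ?q' \<bullet> ((?b \<bullet> mod_lact ?N) \<star> ?a)"
      using a b e cc by (simp add: lact_hcomp_norm H.comp_tail[OF c(6)] interchange)
    also have "\<dots> = ?q' \<bullet> ((mod_lact ?N' \<star> cell_id D (mod_hor ?M')) \<bullet> ((?t \<star> ?b) \<star> ?a))"
      using a b e cc is_mod_cell_laws(2)[OF b] by (simp add: split_right)
    also have "\<dots> = mod_lact (mod_hcomp D ?N' ?M') \<bullet> ((cell_id D (mon_hor (mod_tgt ?N')) \<star> ?q') \<bullet>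
        (Assoc D (mon_hor (mod_tgt ?N')) (mod_hor ?N') (mod_hor ?M') \<bullet> ((?t \<star> ?b) \<star> ?a)))"
      using a b e cc by (simp add: comp_tail3[OF mod_lact_hcomp(6)])
    also have "\<dots> = mod_lact (mod_hcomp D ?N' ?M') \<bullet> ((?t \<star> (?q' \<bullet> (?b \<star> ?a))) \<bullet>
        Assoc D ?V (mod_hor ?N) (mod_hor ?M))"
      using a b e cc by (simp add: split_left Assoc_nat)
    also have "\<dots> = (mod_lact (mod_hcomp D ?N' ?M') \<bullet> (?t \<star> ?c)) \<bullet> ?e"
      using a b e cc by (simp add: interchange_tail c(6))
    finally show "(?c \<bullet> mod_lact (mod_hcomp D ?N ?M)) \<bullet> ?e
      = (mod_lact (mod_hcomp D ?N' ?M') \<bullet> (?t \<star> ?c)) \<bullet> ?e" .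
  qed (use a b e cc in simp_all)
  show ?thesis
    by (rule is_mod_cellI) (use a b e cc 1 2 in simp_all)
qed

text \<open>An instance in which \<open>mod_hor\<close> of the inner composite is already replaced
  by the codomain of its quotient. The simplifier meets terms only in this shape, which is also the
  reason for the similar instances for actions of threefold composites.\<close>

lemma mod_quot_balanced_hcomp:
  assumes "is_bimodule D P" "is_bimodule D N" "is_bimodule D M"
    and "mod_src P = mod_tgt N" "mod_src N = mod_tgt M"
  shows "mod_quot D P (mod_hcomp D N M) \<bullet> (mod_ract P \<star> cell_id D (Cod (HCat D) (mod_quot D N M)))
    = mod_quot D P (mod_hcomp D N M) \<bullet> ((cell_id D (mod_hor P) \<star> mod_lact (mod_hcomp D N M)) \<bullet>
        Assoc D (mod_hor P) (mon_hor (mod_tgt N)) (Cod (HCat D) (mod_quot D N M)))"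
  using mod_quot_balanced[of P "mod_hcomp D N M"] assms by simp

text \<open>Consequently a cell out of a threefold composite of modules is determined on the
  threefold composite of the underlying horizontal arrows; associativity and its coherence are
  checked there.\<close>

lemma factor2:
  assumes P: "is_bimodule D P" and N: "is_bimodule D N" and M: "is_bimodule D M"
    and e: "mod_src P = mod_tgt N" "mod_src N = mod_tgt M"
  shows "H.epi (mod_quot D (mod_hcomp D P N) M \<bullet> (mod_quot D P N \<star> cell_id D (mod_hor M)))"
    "H.epi (mod_quot D P (mod_hcomp D N M) \<bullet> ((cell_id D (mod_hor P) \<star> mod_quot D N M)
      \<bullet> Assoc D (mod_hor P) (mod_hor N) (mod_hor M)))"
    "H.epi (mod_quot D P (mod_hcomp D N M) \<bullet> (cell_id D (mod_hor P) \<star> mod_quot D N M))"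
proof -
  show "H.epi (mod_quot D (mod_hcomp D P N) M \<bullet> (mod_quot D P N \<star> cell_id D (mod_hor M)))"
    by (rule H.epi_comp[OF quot_right(2)]) (use assms in simp_all)
  show "H.epi (mod_quot D P (mod_hcomp D N M) \<bullet> ((cell_id D (mod_hor P) \<star> mod_quot D N M)
      \<bullet> Assoc D (mod_hor P) (mod_hor N) (mod_hor M)))"
    by (rule H.epi_comp[OF quot_left(2)]) (use assms in simp_all)
  show "H.epi (mod_quot D P (mod_hcomp D N M) \<bullet> (cell_id D (mod_hor P) \<star> mod_quot D N M))"
    by (rule H.epi_comp[OF quot_left_epi(2)]) (use assms in simp_all)
qed

text \<open>\<open>E1\<close> and \<open>E2\<close> are the two iterated quotients of (p \<odot> n)
  \<odot> m. Each factors through the other in two stages: first through the whiskered inner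
  quotient, giving \<open>w\<close> or \<open>w'\<close>, then through the outer quotient.\<close>

lemma assoc_factor:
  assumes P: "is_bimodule D P" and N: "is_bimodule D N" and M: "is_bimodule D M"
    and e: "mod_src P = mod_tgt N" "mod_src N = mod_tgt M"
  defines "E1 \<equiv> mod_quot D (mod_hcomp D P N) M \<bullet> (mod_quot D P N \<star> cell_id D (mod_hor M))"
    and "E2 \<equiv> mod_quot D P (mod_hcomp D N M) \<bullet> ((cell_id D (mod_hor P) \<star> mod_quot D N M)
      \<bullet> Assoc D (mod_hor P) (mod_hor N) (mod_hor M))"
  obtains k l where "k \<in> Cells D" "Dom (HCat D) k = Cod (HCat D) E1" "k \<bullet> E1 = E2"
    "Cod (HCat D) k = Cod (HCat D) E2" "csrc D k = Idt (VCat D) (mon_ob (mod_src M))"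
    "ctgt D k = Idt (VCat D) (mon_ob (mod_tgt P))"
    "l \<in> Cells D" "Dom (HCat D) l = Cod (HCat D) E2" "l \<bullet> E2 = E1"
proof -
  let ?p = "mod_hor P" and ?n = "mod_hor N" and ?m = "mod_hor M" and ?T = "mon_hor (mod_tgt M)"
  let ?PN = "mod_hcomp D P N" and ?NM = "mod_hcomp D N M" and ?W = "mon_hor (mod_tgt N)"
  let ?q1 = "mod_quot D P N" and ?q2 = "mod_quot D ?PN M" and ?q3 = "mod_quot D N M" and ?q4 = "mod_quot D P ?NM"
  note as = P N M e
  note r6 = mod_ract_hcomp(6)[OF P N e(1), unfolded e(2)]
  obtain w where w: "w \<in> Cells D" "Dom (HCat D) w = Cod (HCat D) ?q1 \<odot> ?m" "Cod (HCat D) w = Cod (HCat D) ?q4"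
    "csrc D w = Idt (VCat D) (mon_ob (mod_src M))" "ctgt D w = Idt (VCat D) (mon_ob (mod_tgt P))"
    "w \<bullet> (?q1 \<star> cell_id D ?m) = E2"
  proof
    \<comment> \<open>\<open>E2\<close> is balanced over the monad between \<open>P\<close> and
      \<open>N\<close> because its outer quotient is, the left action on \<open>?NM\<close> being
      induced from that on \<open>N\<close>.\<close>
    have b: "E2 \<bullet> (lpair P N \<star> cell_id D ?m) = E2 \<bullet> (rpair P N \<star> cell_id D ?m)"
      using as by (simp add: E2_def lpair_def rpair_def whisker Assoc_norm exchange_LR(1)
        exchange_LR_tail lact_hcomp_norm H.comp_tail[OF mod_quot_balanced_hcomp] pentagon'[symmetric])
    have q: "is_coequalizer (HCat D) (lpair P N \<star> cell_id D ?m) (rpair P N \<star> cell_id D ?m) (?q1 \<star> cell_id D ?m)"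
      by (rule quot_right(1)) (use as in simp_all)
    have E: "E2 \<in> Cells D" "csrc D (?q1 \<star> cell_id D ?m) = Idt (VCat D) (mon_ob (mod_src M))"
      "ctgt D (?q1 \<star> cell_id D ?m) = Idt (VCat D) (mon_ob (mod_tgt P))"
      "csrc D E2 = Idt (VCat D) (mon_ob (mod_src M))" "ctgt D E2 = Idt (VCat D) (mon_ob (mod_tgt P))"
      "Dom (HCat D) E2 = Dom (HCat D) (?q1 \<star> cell_id D ?m)"
      "mon_ob (mod_src M) \<in> Ob (VCat D)" "mon_ob (mod_tgt P) \<in> Ob (VCat D)"
      unfolding E2_def using as by simp_all
    let ?w = "factor (HCat D) (?q1 \<star> cell_id D ?m) E2"
    note k = factor_globular[OF q E(1) b E(2-8)]
    then show "?w \<in> Cells D" "Dom (HCat D) ?w = Cod (HCat D) ?q1 \<odot> ?m" "Cod (HCat D) ?w = Cod (HCat D) ?q4"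
     "csrc D ?w = Idt (VCat D) (mon_ob (mod_src M))" "ctgt D ?w = Idt (VCat D) (mon_ob (mod_tgt P))"
     "?w \<bullet> (?q1 \<star> cell_id D ?m) = E2"
      using as by (simp_all add: E2_def)
  qed
  obtain k where k: "k \<in> Cells D" "Dom (HCat D) k = Cod (HCat D) E1" "k \<bullet> E1 = E2"
    "Cod (HCat D) k = Cod (HCat D) E2" "csrc D k = Idt (VCat D) (mon_ob (mod_src M))"
    "ctgt D k = Idt (VCat D) (mon_ob (mod_tgt P))"
  proof
    \<comment> \<open>Balancing of \<open>w\<close> over the monad between \<open>N\<close> and
      \<open>M\<close> is tested on the quotient of p \<odot> n whiskered by T and m; there it is
      the balancing of the inner quotient of \<open>E2\<close>.\<close>
    have b: "w \<bullet> lpair ?PN M = w \<bullet> rpair ?PN M"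
    proof (rule H.epiD)
      show "H.epi ((?q1 \<star> cell_id D ?T) \<star> cell_id D ?m)" by (rule quot_right2_epi) (use as in simp_all)
      show "(w \<bullet> lpair ?PN M) \<bullet> ((?q1 \<star> cell_id D ?T) \<star> cell_id D ?m)
        = (w \<bullet> rpair ?PN M) \<bullet> ((?q1 \<star> cell_id D ?T) \<star> cell_id D ?m)"
        using as w(1-5) by (simp add: lpair_def rpair_def act_norm whisker_right_eq[OF r6] w(6)
            H.comp_tail[OF w(6)] E2_def)
    qed (use as w in \<open>simp_all add: lpair_def rpair_def\<close>)
    let ?k = "factor (HCat D) ?q2 w"
    have q: "is_coequalizer (HCat D) (lpair ?PN M) (rpair ?PN M) ?q2"
      by (rule mod_quot(2)) (use as in simp_all)
    have E: "csrc D ?q2 = Idt (VCat D) (mon_ob (mod_src M))" "ctgt D ?q2 = Idt (VCat D) (mon_ob (mod_tgt P))"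
      "Dom (HCat D) w = Dom (HCat D) ?q2" "mon_ob (mod_src M) \<in> Ob (VCat D)" "mon_ob (mod_tgt P) \<in> Ob (VCat D)"
      using as w by simp_all
    note k = factor_globular[OF q w(1) b E(1,2) w(4,5) E(3-5)]
    show "?k \<in> Cells D" "Dom (HCat D) ?k = Cod (HCat D) E1"
      "Cod (HCat D) ?k = Cod (HCat D) E2" "csrc D ?k = Idt (VCat D) (mon_ob (mod_src M))"
      "ctgt D ?k = Idt (VCat D) (mon_ob (mod_tgt P))"
      using k w as by (simp_all add: E1_def E2_def)
    show "?k \<bullet> E1 = E2"
      unfolding E1_def w(6)[symmetric] by (rule H.comp_tail[OF k(6)]) (use k w as in simp_all)
  qed
  obtain w' where w': "w' \<in> Cells D" "Dom (HCat D) w' = ?p \<odot> Cod (HCat D) ?q3" "Cod (HCat D) w' = Cod (HCat D) ?q2"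
    "csrc D w' = Idt (VCat D) (mon_ob (mod_src M))" "ctgt D w' = Idt (VCat D) (mon_ob (mod_tgt P))"
    "w' \<bullet> ((cell_id D ?p \<star> ?q3) \<bullet> Assoc D ?p ?n ?m) = E1"
  proof
    let ?F = "((cell_id D ?p \<star> mod_ract N) \<bullet> Assoc D ?p ?n ?T) \<star> cell_id D ?m"
      and ?G = "(cell_id D (?p \<odot> ?n) \<star> mod_lact M) \<bullet> Assoc D (?p \<odot> ?n) ?T ?m"
      and ?q = "(cell_id D ?p \<star> ?q3) \<bullet> Assoc D ?p ?n ?m"
    have q: "is_coequalizer (HCat D) ?F ?G ?q" by (rule quot_left(1)) (use as in simp_all)
    have "E1 \<bullet> ?F = ?q2 \<bullet> ((?q1 \<bullet> ((cell_id D ?p \<star> mod_ract N) \<bullet> Assoc D ?p ?n ?T)) \<star> cell_id D ?m)"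
      using as by (simp add: E1_def whisker)
    also have "\<dots> = ?q2 \<bullet> ((mod_ract ?PN \<star> cell_id D ?m) \<bullet> ((?q1 \<star> cell_id D ?T) \<star> cell_id D ?m))"
      using as mod_ract_hcomp(6)[OF P N e(1), symmetric] by (simp add: whisker_right)
    also have "\<dots> = E1 \<bullet> ?G"
      using as by (simp add: E1_def exchange_LR_tail Assoc_norm H.comp_tail[OF mod_quot_balanced])
    finally have b: "E1 \<bullet> ?F = E1 \<bullet> ?G" .
    have E: "E1 \<in> Cells D" "csrc D ?q = Idt (VCat D) (mon_ob (mod_src M))"
      "ctgt D ?q = Idt (VCat D) (mon_ob (mod_tgt P))"
      "csrc D E1 = Idt (VCat D) (mon_ob (mod_src M))" "ctgt D E1 = Idt (VCat D) (mon_ob (mod_tgt P))"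
      "Dom (HCat D) E1 = Dom (HCat D) ?q"
      "mon_ob (mod_src M) \<in> Ob (VCat D)" "mon_ob (mod_tgt P) \<in> Ob (VCat D)"
      unfolding E1_def using as by simp_all
    let ?w = "factor (HCat D) ?q E1"
    note k = factor_globular[OF q E(1) b E(2-8)]
    then show "?w \<in> Cells D" "Dom (HCat D) ?w = ?p \<odot> Cod (HCat D) ?q3" "Cod (HCat D) ?w = Cod (HCat D) ?q2"
     "csrc D ?w = Idt (VCat D) (mon_ob (mod_src M))" "ctgt D ?w = Idt (VCat D) (mon_ob (mod_tgt P))"
     "?w \<bullet> ?q = E1"
      using as by (simp_all add: E1_def)
  qed
  obtain l where l: "l \<in> Cells D" "Dom (HCat D) l = Cod (HCat D) E2" "l \<bullet> E2 = E1"
  proof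
    have b: "w' \<bullet> lpair P ?NM = w' \<bullet> rpair P ?NM"
    proof (rule H.epiD)
      \<comment> \<open>The test object is the inner quotient of n \<odot> m with p \<odot> W in
        front, where the claim reduces to the balancing of \<open>?q1\<close>.\<close>
      let ?e = "(cell_id D (?p \<odot> ?W) \<star> ?q3) \<bullet> Assoc D (?p \<odot> ?W) ?n ?m"
      show "H.epi ?e" by (rule quot_left(2)) (use as in simp_all)
      have "(w' \<bullet> lpair P ?NM) \<bullet> ?e = w' \<bullet> ((cell_id D ?p \<star> ?q3) \<bullet> (Assoc D ?p ?n ?m \<bullet> ((mod_ract P \<star> cell_id D ?n) \<star> cell_id D ?m)))"
        using as w'(1-5) by (simp add: lpair_def exchange_RL(1) exchange_RL_tail Assoc_pull)
      also have "\<dots> = E1 \<bullet> ((mod_ract P \<star> cell_id D ?n) \<star> cell_id D ?m)"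
        using as w'(1-5) by (simp add: comp_tail3[OF w'(6)])
      also have "\<dots> = ?q2 \<bullet> ((?q1 \<bullet> (mod_ract P \<star> cell_id D ?n)) \<star> cell_id D ?m)"
        using as by (simp add: E1_def whisker)
      also have "\<dots> = E1 \<bullet> (((cell_id D ?p \<star> mod_lact N) \<star> cell_id D ?m) \<bullet> (Assoc D ?p ?W ?n \<star> cell_id D ?m))"
        using as by (simp add: E1_def mod_quot_balanced whisker)
      also have "\<dots> = w' \<bullet> ((cell_id D ?p \<star> ?q3) \<bullet> (Assoc D ?p ?n ?m \<bullet> (((cell_id D ?p \<star> mod_lact N) \<star> cell_id D ?m) \<bullet> (Assoc D ?p ?W ?n \<star> cell_id D ?m))))"
        using as w'(1-5) by (simp add: comp_tail3[OF w'(6)])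
      also have "\<dots> = (w' \<bullet> rpair P ?NM) \<bullet> ?e"
        using as w'(1-5) by (simp add: rpair_def whisker Assoc_pull Assoc_nat_whisker_tail lact_hcomp_norm pentagon'[symmetric])
      finally show "(w' \<bullet> lpair P ?NM) \<bullet> ?e = (w' \<bullet> rpair P ?NM) \<bullet> ?e" .
    qed (use as w' in \<open>simp_all add: lpair_def rpair_def\<close>)
    let ?k = "factor (HCat D) ?q4 w'"
    have q: "is_coequalizer (HCat D) (lpair P ?NM) (rpair P ?NM) ?q4"
      by (rule mod_quot(2)) (use as in simp_all)
    have E: "csrc D ?q4 = Idt (VCat D) (mon_ob (mod_src M))" "ctgt D ?q4 = Idt (VCat D) (mon_ob (mod_tgt P))"
      "Dom (HCat D) w' = Dom (HCat D) ?q4" "mon_ob (mod_src M) \<in> Ob (VCat D)" "mon_ob (mod_tgt P) \<in> Ob (VCat D)"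
      using as w' by simp_all
    note k = factor_globular[OF q w'(1) b E(1,2) w'(4,5) E(3-5)]
    show "?k \<in> Cells D" "Dom (HCat D) ?k = Cod (HCat D) E2"
      using k w' as by (simp_all add: E1_def E2_def)
    show "?k \<bullet> E2 = E1"
      unfolding E2_def w'(6)[symmetric] by (rule H.comp_tail[OF k(6)]) (use k w' as in simp_all)
  qed
  show thesis using k l that by blast
qed

end

section \<open>Associativity and unit cells of modules\<close>

context quotient_double_category
begin

lemma mod_ract_hcomp_right:
  assumes "is_bimodule D P" "is_bimodule D N" "is_bimodule D M" "mod_src P = mod_tgt N" "mod_src N = mod_tgt M"
  shows "mod_ract (mod_hcomp D P (mod_hcomp D N M)) \<bullet> (mod_quot D P (mod_hcomp D N M) \<star> cell_id D (mon_hor (mod_src M)))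
    = mod_quot D P (mod_hcomp D N M) \<bullet> ((cell_id D (mod_hor P) \<star> mod_ract (mod_hcomp D N M)) \<bullet>
       Assoc D (mod_hor P) (Cod (HCat D) (mod_quot D N M)) (mon_hor (mod_src M)))"
  using mod_ract_hcomp(6)[of P "mod_hcomp D N M"] assms by simp

lemma mod_lact_hcomp_left:
  assumes "is_bimodule D P" "is_bimodule D N" "is_bimodule D M" "mod_src P = mod_tgt N" "mod_src N = mod_tgt M"
  shows "mod_lact (mod_hcomp D (mod_hcomp D P N) M) \<bullet> ((cell_id D (mon_hor (mod_tgt P)) \<star> mod_quot D (mod_hcomp D P N) M)
     \<bullet> Assoc D (mon_hor (mod_tgt P)) (Cod (HCat D) (mod_quot D P N)) (mod_hor M))
    = mod_quot D (mod_hcomp D P N) M \<bullet> (mod_lact (mod_hcomp D P N) \<star> cell_id D (mod_hor M))"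
  using mod_lact_hcomp(6)[of "mod_hcomp D P N" M] assms by simp

lemma mod_lact_hcomp_right:
  assumes "is_bimodule D P" "is_bimodule D N" "is_bimodule D M" "mod_src P = mod_tgt N" "mod_src N = mod_tgt M"
  shows "mod_lact (mod_hcomp D P (mod_hcomp D N M)) \<bullet> ((cell_id D (mon_hor (mod_tgt P)) \<star> mod_quot D P (mod_hcomp D N M))
     \<bullet> Assoc D (mon_hor (mod_tgt P)) (mod_hor P) (Cod (HCat D) (mod_quot D N M)))
    = mod_quot D P (mod_hcomp D N M) \<bullet> (mod_lact P \<star> cell_id D (Cod (HCat D) (mod_quot D N M)))"
  using mod_lact_hcomp(6)[of P "mod_hcomp D N M"] assms by simp

lemma mod_assoc_simps [simp]:
  "mc_dom (mod_assoc D P N M) = mod_hcomp D (mod_hcomp D P N) M"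
  "mc_cod (mod_assoc D P N M) = mod_hcomp D P (mod_hcomp D N M)"
  "mc_src (mod_assoc D P N M) = monad_id D (mod_src M)"
  "mc_tgt (mod_assoc D P N M) = monad_id D (mod_tgt P)"
  by (auto simp: mod_assoc_def Let_def)

text \<open>The value of \<open>factor\<close> in \<open>mod_assoc\<close> is the cell
  \<open>k\<close> of \<open>assoc_factor\<close>, because the iterated quotient is epi; it is
  invertible because the factorization also exists in the other direction.\<close>

lemma mod_assoc_cell:
  assumes P: "is_bimodule D P" and N: "is_bimodule D N" and M: "is_bimodule D M"
    and e: "mod_src P = mod_tgt N" "mod_src N = mod_tgt M"
  defines "a \<equiv> mc_cell (mod_assoc D P N M)"
  shows "a \<in> Cells D" "Dom (HCat D) a = Cod (HCat D) (mod_quot D (mod_hcomp D P N) M)"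
    "Cod (HCat D) a = Cod (HCat D) (mod_quot D P (mod_hcomp D N M))"
    "csrc D a = Idt (VCat D) (mon_ob (mod_src M))" "ctgt D a = Idt (VCat D) (mon_ob (mod_tgt P))"
    "a \<bullet> (mod_quot D (mod_hcomp D P N) M \<bullet> (mod_quot D P N \<star> cell_id D (mod_hor M)))
      = mod_quot D P (mod_hcomp D N M) \<bullet> ((cell_id D (mod_hor P) \<star> mod_quot D N M)
      \<bullet> Assoc D (mod_hor P) (mod_hor N) (mod_hor M))"
    "is_iso (HCat D) a"
proof -
  let ?E1 = "mod_quot D (mod_hcomp D P N) M \<bullet> (mod_quot D P N \<star> cell_id D (mod_hor M))"
  let ?E2 = "mod_quot D P (mod_hcomp D N M) \<bullet> ((cell_id D (mod_hor P) \<star> mod_quot D N M)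
      \<bullet> Assoc D (mod_hor P) (mod_hor N) (mod_hor M))"
  obtain k l where k: "k \<in> Cells D" "Dom (HCat D) k = Cod (HCat D) ?E1" "k \<bullet> ?E1 = ?E2"
    "Cod (HCat D) k = Cod (HCat D) ?E2" "csrc D k = Idt (VCat D) (mon_ob (mod_src M))"
    "ctgt D k = Idt (VCat D) (mon_ob (mod_tgt P))"
    "l \<in> Cells D" "Dom (HCat D) l = Cod (HCat D) ?E2" "l \<bullet> ?E2 = ?E1"
    using assoc_factor[OF P N M e] by blast
  note f = factor2[OF P N M e]
  have "a = factor (HCat D) ?E1 (k \<bullet> ?E1)"
    unfolding k(3) a_def mod_assoc_def Let_def using P N M e by simp
  then have a: "a = k" using H.factor_eq[OF f(1) k(1,2)] by simp
  show "is_iso (HCat D) a" unfolding a by (rule H.mutual_factor_iso[OF f(1,2) k(1-3) k(7-9)])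
  show "a \<in> Cells D" "Dom (HCat D) a = Cod (HCat D) (mod_quot D (mod_hcomp D P N) M)"
    "Cod (HCat D) a = Cod (HCat D) (mod_quot D P (mod_hcomp D N M))"
    "csrc D a = Idt (VCat D) (mon_ob (mod_src M))" "ctgt D a = Idt (VCat D) (mon_ob (mod_tgt P))"
    "a \<bullet> ?E1 = ?E2"
    unfolding a using k P N M e by simp_all
qed

lemmas [simp] = mod_assoc_cell(1-5)

lemmas assoc_norm = mod_assoc_cell(6) comp_tail3[OF mod_assoc_cell(6)]
  whisker_left_eq3[OF mod_assoc_cell(6)] comp_tail3[OF whisker_left_eq3[OF mod_assoc_cell(6)]]
  whisker_right_eq3[OF mod_assoc_cell(6)] comp_tail3[OF whisker_right_eq3[OF mod_assoc_cell(6)]]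

lemma is_mod_cell_assoc [simp]:
  assumes P: "is_bimodule D P" and N: "is_bimodule D N" and M: "is_bimodule D M"
    and e: "mod_src P = mod_tgt N" "mod_src N = mod_tgt M"
  shows "is_mod_cell D (mod_assoc D P N M)"
proof -
  let ?p = "mod_hor P" and ?n = "mod_hor N" and ?m = "mod_hor M"
  let ?S = "mon_hor (mod_src M)" and ?V = "mon_hor (mod_tgt P)"
  let ?PN = "mod_hcomp D P N" and ?NM = "mod_hcomp D N M"
  let ?q1 = "mod_quot D P N" and ?q2 = "mod_quot D ?PN M" and ?q3 = "mod_quot D N M" and ?q4 = "mod_quot D P ?NM"
  let ?a = "mc_cell (mod_assoc D P N M)"
  note as = P N M e
  have 1: "?a \<bullet> mod_ract (mod_hcomp D ?PN M) = mod_ract (mod_hcomp D P ?NM) \<bullet> (?a \<star> cell_id D ?S)"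
  proof (rule H.epiD)
    let ?e = "(?q2 \<star> cell_id D ?S) \<bullet> ((?q1 \<star> cell_id D ?m) \<star> cell_id D ?S)"
    show "H.epi ?e"
      by (rule H.epi_comp[OF quot_right2_epi quot_right(2)]) (use as in simp_all)
    show "(?a \<bullet> mod_ract (mod_hcomp D ?PN M)) \<bullet> ?e = (mod_ract (mod_hcomp D P ?NM) \<bullet> (?a \<star> cell_id D ?S)) \<bullet> ?e"
      using as by (simp add: act_norm ract_hcomp_norm assoc_norm H.comp_tail[OF mod_ract_hcomp_right])
  qed (use as in simp_all)
  have 2: "?a \<bullet> mod_lact (mod_hcomp D ?PN M) = mod_lact (mod_hcomp D P ?NM) \<bullet> (cell_id D ?V \<star> ?a)"
  proof (rule H.epiD)
    let ?e1 = "((cell_id D ?V \<star> ?q1) \<star> cell_id D ?m) \<bullet> (Assoc D ?V ?p ?n \<star> cell_id D ?m)"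
    let ?e2 = "(cell_id D ?V \<star> ?q2) \<bullet> Assoc D ?V (Cod (HCat D) ?q1) ?m"
    have e1: "H.epi ?e1"
      by (rule H.epi_comp[OF H.iso_epi quot_mid_epi])
         (use as in \<open>auto intro!: whisker_iso H.is_iso_idt\<close>)
    have e2: "H.epi ?e2" using quot_left(2)[of ?PN M ?V] as by simp
    \<comment> \<open>\<open>?e1\<close> passes to the inner quotient and \<open>?e2\<close> to the
      outer one, each preceded by an associator, so that the test starts at ((V \<odot> p) \<odot>
      n) \<odot> m.\<close>
    show "H.epi (?e2 \<bullet> ?e1)" by (rule H.epi_comp[OF e1 e2]) (use as in simp_all)
    have "(?a \<bullet> mod_lact (mod_hcomp D ?PN M)) \<bullet> (?e2 \<bullet> ?e1) = ?a \<bullet> (?q2 \<bullet> ((?q1 \<star> cell_id D ?m) \<bullet> ((mod_lact P \<star> cell_id D ?n) \<star> cell_id D ?m)))"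
      using as by (simp add: whisker lact_hcomp_norm comp_tail3[OF mod_lact_hcomp_left])
    also have "\<dots> = ?q4 \<bullet> ((mod_lact P \<star> cell_id D (Cod (HCat D) ?q3)) \<bullet>
      ((cell_id D (?V \<odot> ?p) \<star> ?q3) \<bullet> Assoc D (?V \<odot> ?p) ?n ?m))"
      using as by (simp add: Assoc_norm assoc_norm exchange_LR(1) exchange_LR_tail)
    also have "\<dots> = mod_lact (mod_hcomp D P ?NM) \<bullet> ((cell_id D ?V \<star> ?q4) \<bullet> (Assoc D ?V ?p (Cod (HCat D) ?q3) \<bullet>
      ((cell_id D (?V \<odot> ?p) \<star> ?q3) \<bullet> Assoc D (?V \<odot> ?p) ?n ?m)))"
      using as by (simp add: comp_tail3[OF mod_lact_hcomp_right])
    also have "\<dots> = (mod_lact (mod_hcomp D P ?NM) \<bullet> (cell_id D ?V \<star> ?a)) \<bullet> (?e2 \<bullet> ?e1)"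
      using as by (simp add: act_norm assoc_norm)
    finally show "(?a \<bullet> mod_lact (mod_hcomp D ?PN M)) \<bullet> (?e2 \<bullet> ?e1)
      = (mod_lact (mod_hcomp D P ?NM) \<bullet> (cell_id D ?V \<star> ?a)) \<bullet> (?e2 \<bullet> ?e1)" .
  qed (use as in simp_all)
  show ?thesis by (rule is_mod_cellI) (use as 1 2 in simp_all)
qed

lemma mod_assoc_iso:
  assumes "is_bimodule D P" "is_bimodule D N" "is_bimodule D M" "mod_src P = mod_tgt N" "mod_src N = mod_tgt M"
  shows "is_iso (bimodule_cat D) (mod_assoc D P N M)"
proof -
  have "mod_assoc D P N M = mod_globular_cell D (mod_hcomp D (mod_hcomp D P N) M)
    (mod_hcomp D P (mod_hcomp D N M)) (mc_cell (mod_assoc D P N M))"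
    by (rule mod_cell_eqI) simp_all
  then show ?thesis
    using mod_cell_isoI[OF _ mod_assoc_cell(7)[OF assms]] is_mod_cell_assoc[OF assms] by metis
qed

definition mod_lunit where
  "mod_lunit M = mod_globular_cell D (mod_hcomp D (mod_unit (mod_tgt M)) M) M
     (factor (HCat D) (mod_quot D (mod_unit (mod_tgt M)) M) (mod_lact M))"

definition mod_runit where
  "mod_runit M = mod_globular_cell D (mod_hcomp D M (mod_unit (mod_src M))) M
     (factor (HCat D) (mod_quot D M (mod_unit (mod_src M))) (mod_ract M))"

lemma mod_unit_cell_ends [simp]:
  "mc_dom (mod_lunit M) = mod_hcomp D (mod_unit (mod_tgt M)) M" "mc_cod (mod_lunit M) = M"
  "mc_src (mod_lunit M) = monad_id D (mod_src M)" "mc_tgt (mod_lunit M) = monad_id D (mod_tgt M)"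
  "mc_dom (mod_runit M) = mod_hcomp D M (mod_unit (mod_src M))" "mc_cod (mod_runit M) = M"
  "mc_src (mod_runit M) = monad_id D (mod_src M)" "mc_tgt (mod_runit M) = monad_id D (mod_tgt M)"
  by (simp_all add: mod_lunit_def mod_runit_def)

text \<open>The left action is balanced by its associativity and split epi by its unit law. The
  inverse of \<open>l\<close> is \<open>?k\<close>, which inserts the unit of the monad by the
  inverse left unitor and then passes to the quotient; it satisfies
  \<open>?k \<bullet> mod_lact M = ?q\<close> because the quotient is balanced and the monad
  unital.\<close>

lemma mod_lunit_cell:
  assumes M: "is_bimodule D M"
  defines "l \<equiv> mc_cell (mod_lunit M)" and "U \<equiv> mod_unit (mod_tgt M)"
  shows "l \<in> Cells D" "Dom (HCat D) l = Cod (HCat D) (mod_quot D (mod_unit (mod_tgt M)) M)"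
    "Cod (HCat D) l = mod_hor M"
    "csrc D l = Idt (VCat D) (mon_ob (mod_src M))" "ctgt D l = Idt (VCat D) (mon_ob (mod_tgt M))"
    "l \<bullet> mod_quot D (mod_unit (mod_tgt M)) M = mod_lact M"
    "is_iso (HCat D) l"
proof -
  let ?T = "mon_hor (mod_tgt M)" and ?m = "mod_hor M" and ?q = "mod_quot D U M"
  have U: "is_bimodule D U" "mod_src U = mod_tgt M" "mod_hor U = ?T" "mod_ract U = mon_mult (mod_tgt M)"
      "mod_lact U = mon_mult (mod_tgt M)" "mod_tgt U = mod_tgt M"
    using M by (simp_all add: U_def)
  note q = mod_quot(2)[OF U(1) M U(2)]
  have b: "mod_lact M \<bullet> lpair U M = mod_lact M \<bullet> rpair U M"
    using M U is_bimodule_laws(4)[OF M] by (simp add: lpair_def rpair_def)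
  have E: "mod_lact M \<in> Cells D" "csrc D ?q = Idt (VCat D) (mon_ob (mod_src M))"
    "ctgt D ?q = Idt (VCat D) (mon_ob (mod_tgt M))" "csrc D (mod_lact M) = Idt (VCat D) (mon_ob (mod_src M))"
    "ctgt D (mod_lact M) = Idt (VCat D) (mon_ob (mod_tgt M))" "Dom (HCat D) (mod_lact M) = Dom (HCat D) ?q"
    "mon_ob (mod_src M) \<in> Ob (VCat D)" "mon_ob (mod_tgt M) \<in> Ob (VCat D)"
    using M U by simp_all
  have l: "l = factor (HCat D) ?q (mod_lact M)" by (simp add: l_def mod_lunit_def U_def)
  note k = factor_globular[OF q E(1) b E(2-), folded l]
  show l1: "l \<in> Cells D" "Dom (HCat D) l = Cod (HCat D) (mod_quot D (mod_unit (mod_tgt M)) M)"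
    "Cod (HCat D) l = mod_hor M"
    "csrc D l = Idt (VCat D) (mon_ob (mod_src M))" "ctgt D l = Idt (VCat D) (mon_ob (mod_tgt M))"
    "l \<bullet> mod_quot D (mod_unit (mod_tgt M)) M = mod_lact M"
    using k M by (simp_all add: U_def)
  obtain s where s: "s \<in> Cells D" "Dom (HCat D) s = ?m" "Cod (HCat D) s = hunit D (mon_ob (mod_tgt M)) \<odot> ?m"
    "s \<bullet> LUnit D ?m = cell_id D (hunit D (mon_ob (mod_tgt M)) \<odot> ?m)" "LUnit D ?m \<bullet> s = cell_id D ?m"
    using H.is_isoE[OF LUnit_simps(6)[of ?m]] M by auto
  let ?k = "?q \<bullet> ((mon_unit (mod_tgt M) \<star> cell_id D ?m) \<bullet> s)"
  have epi: "H.epi (mod_lact M)"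
  proof -
    have r: "mod_lact M \<bullet> ((mon_unit (mod_tgt M) \<star> cell_id D ?m) \<bullet> s) = cell_id D ?m"
      using H.comp_tail[OF is_bimodule_laws(2)[OF M], of s] M s by simp
    have "h = h'" if "h \<in> Cells D" "h' \<in> Cells D" "Dom (HCat D) h = ?m" "Dom (HCat D) h' = ?m"
      "h \<bullet> mod_lact M = h' \<bullet> mod_lact M" for h h'
    proof -
      have "(h \<bullet> mod_lact M) \<bullet> ((mon_unit (mod_tgt M) \<star> cell_id D ?m) \<bullet> s)
        = (h' \<bullet> mod_lact M) \<bullet> ((mon_unit (mod_tgt M) \<star> cell_id D ?m) \<bullet> s)" using that by simp
      then show ?thesis using that(1-4) r M s by simp
    qed
    then show ?thesis using M by (simp add: H.epi_def)
  qed
  have kl: "?k \<bullet> mod_lact M = ?q"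
  proof (rule H.epiD)
    let ?UU = "hunit D (mon_ob (mod_tgt M))"
    \<comment> \<open>Testing after this isomorphism cancels the inverse unitor \<open>s\<close> by
      naturality, and \<open>LUnit_hcomp\<close> identifies the remaining left unitor.\<close>
    let ?e = "LUnit D (?T \<odot> ?m) \<bullet> Assoc D ?UU ?T ?m"
    show "H.epi ?e"
      by (rule H.iso_epi[OF H.is_iso_comp]) (use M in simp_all)
    have n: "LUnit D ?m \<bullet> (cell_id D ?UU \<star> mod_lact M) = mod_lact M \<bullet> LUnit D (?T \<odot> ?m)"
      using LUnit_natural[of "mod_lact M" "?T \<odot> ?m" ?m] M by simp
    have "(?k \<bullet> mod_lact M) \<bullet> ?e = ?q \<bullet> ((mon_unit (mod_tgt M) \<star> cell_id D ?m) \<bullet> (s \<bullet> (LUnit D ?m \<bullet> ((cell_id D ?UU \<star> mod_lact M) \<bullet> Assoc D ?UU ?T ?m))))"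
      using H.comp_tail[OF n, of "Assoc D ?UU ?T ?m"] M U s by simp
    also have "\<dots> = ?q \<bullet> ((mon_unit (mod_tgt M) \<star> cell_id D ?m) \<bullet> ((cell_id D ?UU \<star> mod_lact M) \<bullet> Assoc D ?UU ?T ?m))"
      using H.comp_tail[OF s(4), of "(cell_id D ?UU \<star> mod_lact M) \<bullet> Assoc D ?UU ?T ?m"] M U s by simp
    also have "\<dots> = ?q \<bullet> ((cell_id D ?T \<star> mod_lact M) \<bullet> (Assoc D ?T ?T ?m \<bullet> ((mon_unit (mod_tgt M) \<star> cell_id D ?T) \<star> cell_id D ?m)))"
      using M U by (simp add: exchange_RL_tail Assoc_pull)
    also have "\<dots> = ?q \<bullet> ((mon_mult (mod_tgt M) \<star> cell_id D ?m) \<bullet> ((mon_unit (mod_tgt M) \<star> cell_id D ?T) \<star> cell_id D ?m))"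
      using M U H.comp_tail[OF mod_quot_balanced[OF U(1) M U(2)], of "(mon_unit (mod_tgt M) \<star> cell_id D ?T) \<star> cell_id D ?m"]
      by simp
    also have "\<dots> = ?q \<bullet> (LUnit D ?T \<star> cell_id D ?m)"
      using M U whisker_right_eq[OF is_monad_laws(1), of "mod_tgt M" ?m] by simp
    also have "\<dots> = ?q \<bullet> ?e" using LUnit_hcomp[of ?T ?m] M U by simp
    finally show "(?k \<bullet> mod_lact M) \<bullet> ?e = ?q \<bullet> ?e" .
  qed (use M U s in simp_all)
  show "is_iso (HCat D) l"
    by (rule H.mutual_factor_iso[OF H.coequalizer_epi[OF q] epi, where l = ?k])
       (use l1 kl U M s in \<open>simp_all add: U_def\<close>)
qed

text \<open>The mirror image of \<open>mod_lunit_cell\<close>. Here the right unitor of m \<odot> S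
  already serves as the test isomorphism, and \<open>RUnit_hcomp\<close> brings in the associator at
  the end.\<close>

lemma mod_runit_cell:
  assumes M: "is_bimodule D M"
  defines "l \<equiv> mc_cell (mod_runit M)" and "U \<equiv> mod_unit (mod_src M)"
  shows "l \<in> Cells D" "Dom (HCat D) l = Cod (HCat D) (mod_quot D M (mod_unit (mod_src M)))"
    "Cod (HCat D) l = mod_hor M"
    "csrc D l = Idt (VCat D) (mon_ob (mod_src M))" "ctgt D l = Idt (VCat D) (mon_ob (mod_tgt M))"
    "l \<bullet> mod_quot D M (mod_unit (mod_src M)) = mod_ract M"
    "is_iso (HCat D) l"
proof -
  let ?S = "mon_hor (mod_src M)" and ?m = "mod_hor M" and ?q = "mod_quot D M U"
  have U: "is_bimodule D U" "mod_tgt U = mod_src M" "mod_hor U = ?S" "mod_ract U = mon_mult (mod_src M)"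
      "mod_lact U = mon_mult (mod_src M)" "mod_src U = mod_src M"
    using M by (simp_all add: U_def)
  note q = mod_quot(2)[OF M U(1) U(2)[symmetric]]
  have b: "mod_ract M \<bullet> lpair M U = mod_ract M \<bullet> rpair M U"
    using M U is_bimodule_laws(3)[OF M] by (simp add: lpair_def rpair_def)
  have E: "mod_ract M \<in> Cells D" "csrc D ?q = Idt (VCat D) (mon_ob (mod_src M))"
    "ctgt D ?q = Idt (VCat D) (mon_ob (mod_tgt M))" "csrc D (mod_ract M) = Idt (VCat D) (mon_ob (mod_src M))"
    "ctgt D (mod_ract M) = Idt (VCat D) (mon_ob (mod_tgt M))" "Dom (HCat D) (mod_ract M) = Dom (HCat D) ?q"
    "mon_ob (mod_src M) \<in> Ob (VCat D)" "mon_ob (mod_tgt M) \<in> Ob (VCat D)"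
    using M U by simp_all
  have l: "l = factor (HCat D) ?q (mod_ract M)" by (simp add: l_def mod_runit_def U_def)
  note k = factor_globular[OF q E(1) b E(2-), folded l]
  show l1: "l \<in> Cells D" "Dom (HCat D) l = Cod (HCat D) (mod_quot D M (mod_unit (mod_src M)))"
    "Cod (HCat D) l = mod_hor M"
    "csrc D l = Idt (VCat D) (mon_ob (mod_src M))" "ctgt D l = Idt (VCat D) (mon_ob (mod_tgt M))"
    "l \<bullet> mod_quot D M (mod_unit (mod_src M)) = mod_ract M"
    using k M by (simp_all add: U_def)
  obtain s where s: "s \<in> Cells D" "Dom (HCat D) s = ?m" "Cod (HCat D) s = ?m \<odot> hunit D (mon_ob (mod_src M))"
    "s \<bullet> RUnit D ?m = cell_id D (?m \<odot> hunit D (mon_ob (mod_src M)))" "RUnit D ?m \<bullet> s = cell_id D ?m"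
    using H.is_isoE[OF RUnit_simps(6)[of ?m]] M by auto
  let ?k = "?q \<bullet> ((cell_id D ?m \<star> mon_unit (mod_src M)) \<bullet> s)"
  have epi: "H.epi (mod_ract M)"
  proof -
    have r: "mod_ract M \<bullet> ((cell_id D ?m \<star> mon_unit (mod_src M)) \<bullet> s) = cell_id D ?m"
      using H.comp_tail[OF is_bimodule_laws(1)[OF M], of s] M s by simp
    have "h = h'" if "h \<in> Cells D" "h' \<in> Cells D" "Dom (HCat D) h = ?m" "Dom (HCat D) h' = ?m"
      "h \<bullet> mod_ract M = h' \<bullet> mod_ract M" for h h'
    proof -
      have "(h \<bullet> mod_ract M) \<bullet> ((cell_id D ?m \<star> mon_unit (mod_src M)) \<bullet> s)
        = (h' \<bullet> mod_ract M) \<bullet> ((cell_id D ?m \<star> mon_unit (mod_src M)) \<bullet> s)" using that by simp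
      then show ?thesis using that(1-4) r M s by simp
    qed
    then show ?thesis using M by (simp add: H.epi_def)
  qed
  have kl: "?k \<bullet> mod_ract M = ?q"
  proof (rule H.epiD)
    let ?UU = "hunit D (mon_ob (mod_src M))"
    let ?e = "RUnit D (?m \<odot> ?S)"
    show "H.epi ?e"
      by (rule H.iso_epi) (use M in simp_all)
    have n: "RUnit D ?m \<bullet> (mod_ract M \<star> cell_id D ?UU) = mod_ract M \<bullet> RUnit D (?m \<odot> ?S)"
      using RUnit_natural[of "mod_ract M" "?m \<odot> ?S" ?m] M by simp
    have "(?k \<bullet> mod_ract M) \<bullet> ?e = ?q \<bullet> ((cell_id D ?m \<star> mon_unit (mod_src M)) \<bullet> (s \<bullet> (RUnit D ?m \<bullet> (mod_ract M \<star> cell_id D ?UU))))"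
      using n M U s by simp
    also have "\<dots> = ?q \<bullet> ((cell_id D ?m \<star> mon_unit (mod_src M)) \<bullet> (mod_ract M \<star> cell_id D ?UU))"
      using H.comp_tail[OF s(4), of "(mod_ract M \<star> cell_id D ?UU)"] M U s by simp
    also have "\<dots> = ?q \<bullet> ((mod_ract M \<star> cell_id D ?S) \<bullet> (cell_id D (?m \<odot> ?S) \<star> mon_unit (mod_src M)))"
      using M U by (simp add: exchange_LR(1))
    also have "\<dots> = ?q \<bullet> ((cell_id D ?m \<star> mon_mult (mod_src M)) \<bullet> ((cell_id D ?m \<star> (cell_id D ?S \<star> mon_unit (mod_src M))) \<bullet> Assoc D ?m ?S ?UU))"
      using M U H.comp_tail[OF mod_quot_balanced[OF M U(1) U(2)[symmetric]], of "cell_id D (?m \<odot> ?S) \<star> mon_unit (mod_src M)"]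
      by (simp add: Assoc_norm)
    also have "\<dots> = ?q \<bullet> ((cell_id D ?m \<star> RUnit D ?S) \<bullet> Assoc D ?m ?S ?UU)"
      using M U H.comp_tail[OF whisker_left_eq[OF is_monad_laws(2), of "mod_src M" ?m], of "Assoc D ?m ?S ?UU"] by simp
    also have "\<dots> = ?q \<bullet> ?e" using RUnit_hcomp[of ?m ?S] M U by simp
    finally show "(?k \<bullet> mod_ract M) \<bullet> ?e = ?q \<bullet> ?e" .
  qed (use M U s in simp_all)
  show "is_iso (HCat D) l"
    by (rule H.mutual_factor_iso[OF H.coequalizer_epi[OF q] epi, where l = ?k])
       (use l1 kl U M s in \<open>simp_all add: U_def\<close>)
qed

lemmas [simp] = mod_lunit_cell(1-5) mod_runit_cell(1-5)

lemma is_mod_cell_lunit [simp]: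
  assumes M: "is_bimodule D M"
  shows "is_mod_cell D (mod_lunit M)"
proof -
  let ?U = "mod_unit (mod_tgt M)" and ?m = "mod_hor M" and ?T = "mon_hor (mod_tgt M)" and ?S = "mon_hor (mod_src M)"
  let ?l = "mc_cell (mod_lunit M)" and ?q = "mod_quot D (mod_unit (mod_tgt M)) M"
  note l = mod_lunit_cell(6)[OF M]
  have r6: "mod_ract (mod_hcomp D ?U M) \<bullet> (?q \<star> cell_id D ?S) = ?q \<bullet> ((cell_id D ?T \<star> mod_ract M) \<bullet> Assoc D ?T ?m ?S)"
    using mod_ract_hcomp(6)[of ?U M] M by simp
  have l6: "mod_lact (mod_hcomp D ?U M) \<bullet> ((cell_id D ?T \<star> ?q) \<bullet> Assoc D ?T ?T ?m) = ?q \<bullet> (mon_mult (mod_tgt M) \<star> cell_id D ?m)"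
    using mod_lact_hcomp(6)[of ?U M] M by simp
  have 1: "?l \<bullet> mod_ract (mod_hcomp D ?U M) = mod_ract M \<bullet> (?l \<star> cell_id D ?S)"
  proof (rule H.epiD)
    show "H.epi (?q \<star> cell_id D ?S)" by (rule quot_right(2)) (use M in simp_all)
    show "(?l \<bullet> mod_ract (mod_hcomp D ?U M)) \<bullet> (?q \<star> cell_id D ?S) = (mod_ract M \<bullet> (?l \<star> cell_id D ?S)) \<bullet> (?q \<star> cell_id D ?S)"
      using M by (simp add: r6 H.comp_tail[OF l] whisker_right_eq[OF l] is_bimodule_laws(5))
  qed (use M in simp_all)
  have 2: "?l \<bullet> mod_lact (mod_hcomp D ?U M) = mod_lact M \<bullet> (cell_id D ?T \<star> ?l)"
  proof (rule H.epiD)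
    show "H.epi ((cell_id D ?T \<star> ?q) \<bullet> Assoc D ?T ?T ?m)"
      using quot_left(2)[of ?U M ?T] M by simp
    show "(?l \<bullet> mod_lact (mod_hcomp D ?U M)) \<bullet> ((cell_id D ?T \<star> ?q) \<bullet> Assoc D ?T ?T ?m)
      = (mod_lact M \<bullet> (cell_id D ?T \<star> ?l)) \<bullet> ((cell_id D ?T \<star> ?q) \<bullet> Assoc D ?T ?T ?m)"
      using M by (simp add: l6 H.comp_tail[OF l] H.comp_tail[OF whisker_left_eq[OF l]] is_bimodule_laws(4))
  qed (use M in simp_all)
  show ?thesis by (rule is_mod_cellI) (use M 1 2 in simp_all)
qed

lemma is_mod_cell_runit [simp]:
  assumes M: "is_bimodule D M"
  shows "is_mod_cell D (mod_runit M)"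
proof -
  let ?U = "mod_unit (mod_src M)" and ?m = "mod_hor M" and ?T = "mon_hor (mod_tgt M)" and ?S = "mon_hor (mod_src M)"
  let ?l = "mc_cell (mod_runit M)" and ?q = "mod_quot D M (mod_unit (mod_src M))"
  note l = mod_runit_cell(6)[OF M]
  have r6: "mod_ract (mod_hcomp D M ?U) \<bullet> (?q \<star> cell_id D ?S) = ?q \<bullet> ((cell_id D ?m \<star> mon_mult (mod_src M)) \<bullet> Assoc D ?m ?S ?S)"
    using mod_ract_hcomp(6)[of M ?U] M by simp
  have l6: "mod_lact (mod_hcomp D M ?U) \<bullet> ((cell_id D ?T \<star> ?q) \<bullet> Assoc D ?T ?m ?S) = ?q \<bullet> (mod_lact M \<star> cell_id D ?S)"
    using mod_lact_hcomp(6)[of M ?U] M by simp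
  have 1: "?l \<bullet> mod_ract (mod_hcomp D M ?U) = mod_ract M \<bullet> (?l \<star> cell_id D ?S)"
  proof (rule H.epiD)
    show "H.epi (?q \<star> cell_id D ?S)" by (rule quot_right(2)) (use M in simp_all)
    show "(?l \<bullet> mod_ract (mod_hcomp D M ?U)) \<bullet> (?q \<star> cell_id D ?S) = (mod_ract M \<bullet> (?l \<star> cell_id D ?S)) \<bullet> (?q \<star> cell_id D ?S)"
      using M by (simp add: r6 H.comp_tail[OF l] whisker_right_eq[OF l] is_bimodule_laws(3))
  qed (use M in simp_all)
  have 2: "?l \<bullet> mod_lact (mod_hcomp D M ?U) = mod_lact M \<bullet> (cell_id D ?T \<star> ?l)"
  proof (rule H.epiD)
    show "H.epi ((cell_id D ?T \<star> ?q) \<bullet> Assoc D ?T ?m ?S)"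
      using quot_left(2)[of M ?U ?T] M by simp
    show "(?l \<bullet> mod_lact (mod_hcomp D M ?U)) \<bullet> ((cell_id D ?T \<star> ?q) \<bullet> Assoc D ?T ?m ?S)
      = (mod_lact M \<bullet> (cell_id D ?T \<star> ?l)) \<bullet> ((cell_id D ?T \<star> ?q) \<bullet> Assoc D ?T ?m ?S)"
      using M by (simp add: l6 H.comp_tail[OF l] H.comp_tail[OF whisker_left_eq[OF l]] is_bimodule_laws(5))
  qed (use M in simp_all)
  show ?thesis by (rule is_mod_cellI) (use M 1 2 in simp_all)
qed

lemma Mod_dbl_simps [simp]:
  "VCat (Mod_dbl D) = monad_cat D" "HCat (Mod_dbl D) = bimodule_cat D"
  "onO (Src (Mod_dbl D)) = mod_src" "onA (Src (Mod_dbl D)) = mc_src"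
  "onO (Tgt (Mod_dbl D)) = mod_tgt" "onA (Tgt (Mod_dbl D)) = mc_tgt"
  "onO (Unt (Mod_dbl D)) = mod_unit" "onA (Unt (Mod_dbl D)) = mod_unit_cell"
  "HComp (Mod_dbl D) = mod_hcomp D" "CComp (Mod_dbl D) = mod_ccomp D"
  "Assoc (Mod_dbl D) = mod_assoc D" "LUnit (Mod_dbl D) = mod_lunit" "RUnit (Mod_dbl D) = mod_runit"
  by (auto simp: Mod_dbl_def Let_def mod_unit_cell_def mod_lunit_def mod_runit_def fun_eq_iff)

lemma globular_Mod_dbl:
  "\<alpha> \<in> globular (Mod_dbl D) M N \<longleftrightarrow> is_mod_cell D \<alpha> \<and> mc_dom \<alpha> = M \<and> mc_cod \<alpha> = N \<and>
    mc_src \<alpha> = monad_id D (mod_src M) \<and> mc_tgt \<alpha> = monad_id D (mod_tgt M)"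
  by (auto simp: globular_def)

text \<open>The common end of the functoriality, naturality and coherence proofs: ends and sides
  agree by simplification, and the underlying cells are compared after an epimorphism.\<close>

lemma mod_ccomp_eqI:
  assumes "is_mod_cell D x" "is_mod_cell D y" "mc_dom x = mc_dom y" "mc_cod x = mc_cod y" "mc_src x = mc_src y" "mc_tgt x = mc_tgt y"
    and "H.epi e" "Cod (HCat D) e = mod_hor (mc_dom x)" "mc_cell x \<bullet> e = mc_cell y \<bullet> e"
  shows "x = y"
proof (rule mod_cell_eqI)
  show "mc_cell x = mc_cell y" by (rule H.epiD[OF assms(7,9)]) (use assms in auto)
qed (use assms in auto)

end

section \<open>The double category of modules\<close>

lemma composable_cat_category:
  assumes "cat_functor (HCat D) (VCat D) (Src D)" and "cat_functor (HCat D) (VCat D) (Tgt D)"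
  shows "category (composable_cat D)"
proof -
  interpret S: cat_functor "HCat D" "VCat D" "Src D" by (rule assms(1))
  interpret T: cat_functor "HCat D" "VCat D" "Tgt D" by (rule assms(2))
  show ?thesis
  proof
    fix f assume f: "f \<in> Ar (composable_cat D)"
    obtain a b where ab: "f = (a, b)" by (cases f)
    show "Dom (composable_cat D) f \<in> Ob (composable_cat D)" "Cod (composable_cat D) f \<in> Ob (composable_cat D)"
      using f S.onA_simps(2,3)[of a] T.onA_simps(2,3)[of b] by (simp_all add: ab)
  next
    fix A assume "A \<in> Ob (composable_cat D)"
    then show "Idt (composable_cat D) A \<in> hom (composable_cat D) A A" by (cases A) simp
  next
    fix f X Y g Z assume "f \<in> hom (composable_cat D) X Y" "g \<in> hom (composable_cat D) Y Z"
    then show "Comp (composable_cat D) g f \<in> hom (composable_cat D) X Z"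
      by (cases f; cases g; cases X; cases Y; cases Z) simp
  next
    fix f X Y assume "f \<in> hom (composable_cat D) X Y"
    then show "Comp (composable_cat D) (Idt (composable_cat D) Y) f = f"
      "Comp (composable_cat D) f (Idt (composable_cat D) X) = f"
      by (cases f; cases X; cases Y; simp)+
  next
    fix f W X g Y h Z
    assume "f \<in> hom (composable_cat D) W X" "g \<in> hom (composable_cat D) X Y" "h \<in> hom (composable_cat D) Y Z"
    then show "Comp (composable_cat D) (Comp (composable_cat D) h g) f
      = Comp (composable_cat D) h (Comp (composable_cat D) g f)"
      by (cases f; cases g; cases h; cases W; cases X; cases Y; cases Z) simp
  qed
qed

context quotient_double_category
begin

lemma mod_ccomp_comp:
  assumes "is_mod_cell D b" "is_mod_cell D a" "mc_src b = mc_tgt a"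
    "is_mod_cell D b'" "is_mod_cell D a'" "mc_src b' = mc_tgt a'"
    "mc_dom b' = mc_cod b" "mc_dom a' = mc_cod a"
  shows "mod_ccomp D (Comp (bimodule_cat D) b' b) (Comp (bimodule_cat D) a' a)
    = Comp (bimodule_cat D) (mod_ccomp D b' a') (mod_ccomp D b a)"
proof (rule mod_ccomp_eqI)
  note cc = mod_cells_composable[OF assms(1-3)] mod_cells_composable[OF assms(4-6)]
  let ?q = "mod_quot D (mc_dom b) (mc_dom a)"
  show "H.epi ?q" using assms cc by simp
  have 1: "mc_cell (mod_ccomp D (Comp (bimodule_cat D) b' b) (Comp (bimodule_cat D) a' a)) \<bullet> ?q
    = mod_quot D (mc_cod b') (mc_cod a') \<bullet> ((mc_cell b' \<bullet> mc_cell b) \<star> (mc_cell a' \<bullet> mc_cell a))"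
    using mod_ccomp_cell(6)[of "Comp (bimodule_cat D) b' b" "Comp (bimodule_cat D) a' a"] assms by simp
  show "mc_cell (mod_ccomp D (Comp (bimodule_cat D) b' b) (Comp (bimodule_cat D) a' a)) \<bullet> ?q
    = mc_cell (Comp (bimodule_cat D) (mod_ccomp D b' a') (mod_ccomp D b a)) \<bullet> ?q"
    unfolding 1 using assms cc mod_ccomp_cell(6)[OF assms(1-3)]
      H.comp_tail[OF mod_ccomp_cell(6)[OF assms(4-6)], of "mc_cell b \<star> mc_cell a"]
    by (simp add: interchange)
qed (use assms mod_cells_composable[OF assms(1-3)] mod_cells_composable[OF assms(4-6)] in simp_all)

lemma mod_ccomp_idt:
  assumes "is_bimodule D N" "is_bimodule D M" "mod_src N = mod_tgt M"
  shows "mod_ccomp D (mod_globular_cell D N N (cell_id D (mod_hor N))) (mod_globular_cell D M M (cell_id D (mod_hor M)))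
    = mod_globular_cell D (mod_hcomp D N M) (mod_hcomp D N M) (cell_id D (mod_hor (mod_hcomp D N M)))"
  by (rule mod_ccomp_eqI[where e = "mod_quot D N M"])
     (use assms mod_ccomp_cell(6)[of "mod_globular_cell D N N (cell_id D (mod_hor N))"
        "mod_globular_cell D M M (cell_id D (mod_hor M))"] is_mod_cell_id[of "mod_hcomp D N M"] in simp_all)

text \<open>On the threefold composite of the underlying arrows this is naturality of the associator
  of \<open>D\<close>.\<close>

lemma mod_assoc_natural:
  assumes a: "is_mod_cell D \<alpha>" "is_mod_cell D \<beta>" "is_mod_cell D \<gamma>" "mc_src \<alpha> = mc_tgt \<beta>" "mc_src \<beta> = mc_tgt \<gamma>"
  shows "Comp (bimodule_cat D) (mod_assoc D (mc_cod \<alpha>) (mc_cod \<beta>) (mc_cod \<gamma>)) (mod_ccomp D (mod_ccomp D \<alpha> \<beta>) \<gamma>)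
    = Comp (bimodule_cat D) (mod_ccomp D \<alpha> (mod_ccomp D \<beta> \<gamma>)) (mod_assoc D (mc_dom \<alpha>) (mc_dom \<beta>) (mc_dom \<gamma>))"
proof (rule mod_ccomp_eqI)
  note cc = mod_cells_composable[OF a(1,2,4)] mod_cells_composable[OF a(2,3,5)]
  let ?P = "mc_dom \<alpha>" and ?N = "mc_dom \<beta>" and ?M = "mc_dom \<gamma>"
  let ?P' = "mc_cod \<alpha>" and ?N' = "mc_cod \<beta>" and ?M' = "mc_cod \<gamma>"
  let ?e = "mod_quot D (mod_hcomp D ?P ?N) ?M \<bullet> (mod_quot D ?P ?N \<star> cell_id D (mod_hor ?M))"
  show "H.epi ?e" by (rule factor2(1)) (use a cc in simp_all)
  have c1: "mc_cell (mod_ccomp D (mod_ccomp D \<alpha> \<beta>) \<gamma>) \<bullet> mod_quot D (mod_hcomp D ?P ?N) ?M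
    = mod_quot D (mod_hcomp D ?P' ?N') ?M' \<bullet> (mc_cell (mod_ccomp D \<alpha> \<beta>) \<star> mc_cell \<gamma>)"
    using mod_ccomp_cell(6)[of "mod_ccomp D \<alpha> \<beta>" \<gamma>] a by simp
  have c2: "mc_cell (mod_ccomp D \<alpha> (mod_ccomp D \<beta> \<gamma>)) \<bullet> mod_quot D ?P (mod_hcomp D ?N ?M)
    = mod_quot D ?P' (mod_hcomp D ?N' ?M') \<bullet> (mc_cell \<alpha> \<star> mc_cell (mod_ccomp D \<beta> \<gamma>))"
    using mod_ccomp_cell(6)[of \<alpha> "mod_ccomp D \<beta> \<gamma>"] a by simp
  have "mc_cell (Comp (bimodule_cat D) (mod_assoc D ?P' ?N' ?M') (mod_ccomp D (mod_ccomp D \<alpha> \<beta>) \<gamma>)) \<bullet> ?e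
    = mc_cell (mod_assoc D ?P' ?N' ?M') \<bullet> (mod_quot D (mod_hcomp D ?P' ?N') ?M' \<bullet>
       ((mod_quot D ?P' ?N' \<star> cell_id D (mod_hor ?M')) \<bullet> ((mc_cell \<alpha> \<star> mc_cell \<beta>) \<star> mc_cell \<gamma>)))"
    using a cc by (simp add: H.comp_tail[OF c1] interchange mod_ccomp_cell(6))
  also have "\<dots> = mod_quot D ?P' (mod_hcomp D ?N' ?M') \<bullet> ((cell_id D (mod_hor ?P') \<star> mod_quot D ?N' ?M') \<bullet>
      ((mc_cell \<alpha> \<star> (mc_cell \<beta> \<star> mc_cell \<gamma>)) \<bullet> Assoc D (mod_hor ?P) (mod_hor ?N) (mod_hor ?M)))"
    using a cc by (simp add: comp_tail3[OF mod_assoc_cell(6)] Assoc_nat)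
  also have "\<dots> = mod_quot D ?P' (mod_hcomp D ?N' ?M') \<bullet> ((mc_cell \<alpha> \<star> (mc_cell (mod_ccomp D \<beta> \<gamma>) \<bullet> mod_quot D ?N ?M))
     \<bullet> Assoc D (mod_hor ?P) (mod_hor ?N) (mod_hor ?M))"
    using a cc by (simp add: mod_ccomp_cell(6) interchange_tail)
  also have "\<dots> = mc_cell (Comp (bimodule_cat D) (mod_ccomp D \<alpha> (mod_ccomp D \<beta> \<gamma>)) (mod_assoc D ?P ?N ?M)) \<bullet> ?e"
    using a cc by (simp add: assoc_norm H.comp_tail[OF c2] interchange_tail)
  finally show "mc_cell (Comp (bimodule_cat D) (mod_assoc D ?P' ?N' ?M') (mod_ccomp D (mod_ccomp D \<alpha> \<beta>) \<gamma>)) \<bullet> ?e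
    = mc_cell (Comp (bimodule_cat D) (mod_ccomp D \<alpha> (mod_ccomp D \<beta> \<gamma>)) (mod_assoc D ?P ?N ?M)) \<bullet> ?e" .
qed (use a mod_cells_composable[OF a(1,2,4)] mod_cells_composable[OF a(2,3,5)] in simp_all)

text \<open>After the quotient cell this is the compatibility of \<alpha> with the left
  actions.\<close>

lemma mod_lunit_natural:
  assumes a: "is_mod_cell D \<alpha>"
  shows "Comp (bimodule_cat D) (mod_lunit (mc_cod \<alpha>)) (mod_ccomp D (mod_unit_cell (mc_tgt \<alpha>)) \<alpha>)
    = Comp (bimodule_cat D) \<alpha> (mod_lunit (mc_dom \<alpha>))"
proof (rule mod_ccomp_eqI)
  let ?q = "mod_quot D (mod_unit (mod_tgt (mc_dom \<alpha>))) (mc_dom \<alpha>)"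
  show "H.epi ?q" using a by simp
  have c: "mc_cell (mod_ccomp D (mod_unit_cell (mc_tgt \<alpha>)) \<alpha>) \<bullet> ?q
    = mod_quot D (mod_unit (mod_tgt (mc_cod \<alpha>))) (mc_cod \<alpha>) \<bullet> (mor_cell (mc_tgt \<alpha>) \<star> mc_cell \<alpha>)"
    using mod_ccomp_cell(6)[of "mod_unit_cell (mc_tgt \<alpha>)" \<alpha>] a by simp
  show "mc_cell (Comp (bimodule_cat D) (mod_lunit (mc_cod \<alpha>)) (mod_ccomp D (mod_unit_cell (mc_tgt \<alpha>)) \<alpha>)) \<bullet> ?q
    = mc_cell (Comp (bimodule_cat D) \<alpha> (mod_lunit (mc_dom \<alpha>))) \<bullet> ?q"
    using a c H.comp_tail[OF mod_lunit_cell(6), of "mc_cod \<alpha>" "mor_cell (mc_tgt \<alpha>) \<star> mc_cell \<alpha>"]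
      mod_lunit_cell(6)[of "mc_dom \<alpha>"] is_mod_cell_laws(2)[OF a] by simp
qed (use a in simp_all)

lemma mod_runit_natural:
  assumes a: "is_mod_cell D \<alpha>"
  shows "Comp (bimodule_cat D) (mod_runit (mc_cod \<alpha>)) (mod_ccomp D \<alpha> (mod_unit_cell (mc_src \<alpha>)))
    = Comp (bimodule_cat D) \<alpha> (mod_runit (mc_dom \<alpha>))"
proof (rule mod_ccomp_eqI)
  let ?q = "mod_quot D (mc_dom \<alpha>) (mod_unit (mod_src (mc_dom \<alpha>)))"
  show "H.epi ?q" using a by simp
  have c: "mc_cell (mod_ccomp D \<alpha> (mod_unit_cell (mc_src \<alpha>))) \<bullet> ?q
    = mod_quot D (mc_cod \<alpha>) (mod_unit (mod_src (mc_cod \<alpha>))) \<bullet> (mc_cell \<alpha> \<star> mor_cell (mc_src \<alpha>))"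
    using mod_ccomp_cell(6)[of \<alpha> "mod_unit_cell (mc_src \<alpha>)"] a by simp
  show "mc_cell (Comp (bimodule_cat D) (mod_runit (mc_cod \<alpha>)) (mod_ccomp D \<alpha> (mod_unit_cell (mc_src \<alpha>)))) \<bullet> ?q
    = mc_cell (Comp (bimodule_cat D) \<alpha> (mod_runit (mc_dom \<alpha>))) \<bullet> ?q"
    using a c H.comp_tail[OF mod_runit_cell(6), of "mc_cod \<alpha>" "mc_cell \<alpha> \<star> mor_cell (mc_src \<alpha>)"]
      mod_runit_cell(6)[of "mc_dom \<alpha>"] is_mod_cell_laws(1)[OF a] by simp
qed (use a in simp_all)

abbreviation mod_id where
  "mod_id M \<equiv> mod_globular_cell D M M (cell_id D (mod_hor M))"

text \<open>Restricted to (n \<odot> T) \<odot> m, the two sides become the two ways of letting T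
  act, so the triangle is exactly the balancing of the quotient of n \<odot> m.\<close>

lemma mod_triangle:
  assumes a: "is_bimodule D N" "is_bimodule D M" "mod_src N = mod_tgt M"
  shows "Comp (bimodule_cat D) (mod_ccomp D (mod_id N) (mod_lunit M)) (mod_assoc D N (mod_unit (mod_tgt M)) M)
    = mod_ccomp D (mod_runit N) (mod_id M)"
proof (rule mod_ccomp_eqI)
  let ?U = "mod_unit (mod_tgt M)"
  have "is_bimodule D ?U" using a by simp
  note as = this a
  let ?e = "mod_quot D (mod_hcomp D N ?U) M \<bullet> (mod_quot D N ?U \<star> cell_id D (mod_hor M))"
  show "H.epi ?e" by (rule factor2(1)) (use a in simp_all)
  have l: "mc_cell (mod_lunit M) \<bullet> mod_quot D ?U M = mod_lact M" using mod_lunit_cell(6) as by simp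
  have r: "mc_cell (mod_runit N) \<bullet> mod_quot D N ?U = mod_ract N" using mod_runit_cell(6)[of N] as by simp
  have c1: "mc_cell (mod_ccomp D (mod_id N) (mod_lunit M)) \<bullet> mod_quot D N (mod_hcomp D ?U M)
    = mod_quot D N M \<bullet> (cell_id D (mod_hor N) \<star> mc_cell (mod_lunit M))"
    using mod_ccomp_cell(6)[of "mod_id N" "mod_lunit M"] as by simp
  have c2: "mc_cell (mod_ccomp D (mod_runit N) (mod_id M)) \<bullet> mod_quot D (mod_hcomp D N ?U) M
    = mod_quot D N M \<bullet> (mc_cell (mod_runit N) \<star> cell_id D (mod_hor M))"
    using mod_ccomp_cell(6)[of "mod_runit N" "mod_id M"] as by simp
  have as': "mc_cell (mod_assoc D N ?U M) \<bullet> (mod_quot D (mod_hcomp D N ?U) M \<bullet> (mod_quot D N ?U \<star> cell_id D (mod_hor M)))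
      = mod_quot D N (mod_hcomp D ?U M) \<bullet> ((cell_id D (mod_hor N) \<star> mod_quot D ?U M)
      \<bullet> Assoc D (mod_hor N) (mon_hor (mod_tgt M)) (mod_hor M))"
    using mod_assoc_cell(6)[of N ?U M] as by simp
  show "mc_cell (Comp (bimodule_cat D) (mod_ccomp D (mod_id N) (mod_lunit M)) (mod_assoc D N (mod_unit (mod_tgt M)) M)) \<bullet> ?e
    = mc_cell (mod_ccomp D (mod_runit N) (mod_id M)) \<bullet> ?e"
    using as by (simp add: as' H.comp_tail[OF c1] H.comp_tail[OF c2] H.comp_tail[OF whisker_left_eq[OF l]]
       whisker_right_eq[OF r] mod_quot_balanced)
qed (use a in simp_all)

text \<open>Restricted along three successive quotients to ((m \<odot> n) \<odot> p) \<odot> q, the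
  equation becomes the pentagon of \<open>D\<close>.\<close>

lemma mod_pentagon:
  assumes a: "is_bimodule D M" "is_bimodule D N" "is_bimodule D P" "is_bimodule D Q"
    "mod_src M = mod_tgt N" "mod_src N = mod_tgt P" "mod_src P = mod_tgt Q"
  shows "Comp (bimodule_cat D) (mod_ccomp D (mod_id M) (mod_assoc D N P Q))
     (Comp (bimodule_cat D) (mod_assoc D M (mod_hcomp D N P) Q) (mod_ccomp D (mod_assoc D M N P) (mod_id Q)))
    = Comp (bimodule_cat D) (mod_assoc D M N (mod_hcomp D P Q)) (mod_assoc D (mod_hcomp D M N) P Q)"
proof (rule mod_ccomp_eqI)
  let ?m = "mod_hor M" and ?n = "mod_hor N" and ?p = "mod_hor P" and ?q = "mod_hor Q"
  let ?MN = "mod_hcomp D M N" and ?NP = "mod_hcomp D N P" and ?PQ = "mod_hcomp D P Q"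
  let ?Q = "mod_quot D"
  let ?e = "?Q (mod_hcomp D ?MN P) Q \<bullet> ((?Q ?MN P \<star> cell_id D ?q) \<bullet> ((?Q M N \<star> cell_id D ?p) \<star> cell_id D ?q))"
  have "H.epi ((?Q ?MN P \<star> cell_id D ?q) \<bullet> ((?Q M N \<star> cell_id D ?p) \<star> cell_id D ?q))"
    by (rule H.epi_comp[OF quot_right2_epi quot_right(2)]) (use a in simp_all)
  then show "H.epi ?e"
    by (rule H.epi_comp[OF _ mod_quot_simps(8)]) (use a in simp_all)
  have c1: "mc_cell (mod_ccomp D (mod_id M) (mod_assoc D N P Q)) \<bullet> ?Q M (mod_hcomp D ?NP Q)
    = ?Q M (mod_hcomp D N ?PQ) \<bullet> (cell_id D ?m \<star> mc_cell (mod_assoc D N P Q))"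
    using mod_ccomp_cell(6)[of "mod_id M" "mod_assoc D N P Q"] a by simp
  have c2: "mc_cell (mod_ccomp D (mod_assoc D M N P) (mod_id Q)) \<bullet> ?Q (mod_hcomp D ?MN P) Q
    = ?Q (mod_hcomp D M ?NP) Q \<bullet> (mc_cell (mod_assoc D M N P) \<star> cell_id D ?q)"
    using mod_ccomp_cell(6)[of "mod_assoc D M N P" "mod_id Q"] a by simp
  have a1: "mc_cell (mod_assoc D M ?NP Q) \<bullet> (?Q (mod_hcomp D M ?NP) Q \<bullet> (?Q M ?NP \<star> cell_id D ?q))
    = ?Q M (mod_hcomp D ?NP Q) \<bullet> ((cell_id D ?m \<star> ?Q ?NP Q) \<bullet> Assoc D ?m (Cod (HCat D) (?Q N P)) ?q)"
    using mod_assoc_cell(6)[of M ?NP Q] a by simp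
  have a2: "mc_cell (mod_assoc D ?MN P Q) \<bullet> (?Q (mod_hcomp D ?MN P) Q \<bullet> (?Q ?MN P \<star> cell_id D ?q))
    = ?Q ?MN ?PQ \<bullet> ((cell_id D (Cod (HCat D) (?Q M N)) \<star> ?Q P Q) \<bullet> Assoc D (Cod (HCat D) (?Q M N)) ?p ?q)"
    using mod_assoc_cell(6)[of ?MN P Q] a by simp
  have a3: "mc_cell (mod_assoc D M N ?PQ) \<bullet> (?Q ?MN ?PQ \<bullet> (?Q M N \<star> cell_id D (Cod (HCat D) (?Q P Q))))
    = ?Q M (mod_hcomp D N ?PQ) \<bullet> ((cell_id D ?m \<star> ?Q N ?PQ) \<bullet> Assoc D ?m ?n (Cod (HCat D) (?Q P Q)))"
    using mod_assoc_cell(6)[of M N ?PQ] a by simp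
  have "mc_cell (Comp (bimodule_cat D) (mod_ccomp D (mod_id M) (mod_assoc D N P Q))
     (Comp (bimodule_cat D) (mod_assoc D M ?NP Q) (mod_ccomp D (mod_assoc D M N P) (mod_id Q)))) \<bullet> ?e
    = mc_cell (mod_ccomp D (mod_id M) (mod_assoc D N P Q)) \<bullet> (mc_cell (mod_assoc D M ?NP Q) \<bullet>
       (?Q (mod_hcomp D M ?NP) Q \<bullet> ((?Q M ?NP \<star> cell_id D ?q) \<bullet>
         (((cell_id D ?m \<star> ?Q N P) \<star> cell_id D ?q) \<bullet> (Assoc D ?m ?n ?p \<star> cell_id D ?q)))))"
    using a by (simp add: H.comp_tail[OF c2] whisker assoc_norm)
  also have "\<dots> = ?Q M (mod_hcomp D N ?PQ) \<bullet> ((cell_id D ?m \<star> ?Q N ?PQ) \<bullet> ((cell_id D ?m \<star> (cell_id D ?n \<star> ?Q P Q)) \<bullet>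
      (Assoc D ?m ?n (?p \<odot> ?q) \<bullet> Assoc D (?m \<odot> ?n) ?p ?q)))"
    using a by (simp add: comp_tail3[OF a1] H.comp_tail[OF c1] Assoc_norm whisker assoc_norm pentagon')
  also have "\<dots> = mc_cell (Comp (bimodule_cat D) (mod_assoc D M N ?PQ) (mod_assoc D ?MN P Q)) \<bullet> ?e"
    using a by (simp add: comp_tail3[OF a2] comp_tail3[OF a3] Assoc_norm exchange_LR(1) exchange_LR_tail)
  finally show "mc_cell (Comp (bimodule_cat D) (mod_ccomp D (mod_id M) (mod_assoc D N P Q))
     (Comp (bimodule_cat D) (mod_assoc D M ?NP Q) (mod_ccomp D (mod_assoc D M N P) (mod_id Q)))) \<bullet> ?e
     = mc_cell (Comp (bimodule_cat D) (mod_assoc D M N ?PQ) (mod_assoc D ?MN P Q)) \<bullet> ?e" .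
qed (use a in simp_all)

theorem double_category_Mod_dbl: "double_category (Mod_dbl D)"
proof -
  have S: "cat_functor (HCat (Mod_dbl D)) (VCat (Mod_dbl D)) (Src (Mod_dbl D))"
    by (rule cat_functorI) (auto simp: MC.category_axioms BC.category_axioms)
  have T: "cat_functor (HCat (Mod_dbl D)) (VCat (Mod_dbl D)) (Tgt (Mod_dbl D))"
    by (rule cat_functorI) (auto simp: MC.category_axioms BC.category_axioms)
  show ?thesis
  proof (rule double_category.intro)
    show "cat_functor (VCat (Mod_dbl D)) (HCat (Mod_dbl D)) (Unt (Mod_dbl D))"
      by (rule cat_functorI) (auto simp: MC.category_axioms BC.category_axioms intro!: mod_cell_eqI)
    show "cat_functor (composable_cat (Mod_dbl D)) (HCat (Mod_dbl D)) (hcomp_fct (Mod_dbl D))"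
      by (rule cat_functorI)
        (auto simp: composable_cat_category[OF S T] BC.category_axioms mod_ccomp_idt mod_ccomp_comp
           mod_cells_composable)
  next
    fix M N P assume "(M, N) \<in> Ob (composable_cat (Mod_dbl D))" "(N, P) \<in> Ob (composable_cat (Mod_dbl D))"
    then show "Assoc (Mod_dbl D) M N P \<in> globular (Mod_dbl D) (HComp (Mod_dbl D) (HComp (Mod_dbl D) M N) P)
        (HComp (Mod_dbl D) M (HComp (Mod_dbl D) N P))"
      and "is_iso (HCat (Mod_dbl D)) (Assoc (Mod_dbl D) M N P)"
      by (simp_all add: globular_Mod_dbl mod_assoc_iso)
  next
    fix M assume M: "M \<in> HOb (Mod_dbl D)"
    then show "LUnit (Mod_dbl D) M \<in> globular (Mod_dbl D) (HComp (Mod_dbl D) (hunit (Mod_dbl D) (htgt (Mod_dbl D) M)) M) M"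
      and "RUnit (Mod_dbl D) M \<in> globular (Mod_dbl D) (HComp (Mod_dbl D) M (hunit (Mod_dbl D) (hsrc (Mod_dbl D) M))) M"
      by (simp_all add: globular_Mod_dbl)
    show "is_iso (HCat (Mod_dbl D)) (LUnit (Mod_dbl D) M)" "is_iso (HCat (Mod_dbl D)) (RUnit (Mod_dbl D) M)"
      using M mod_cell_isoI[OF _ mod_lunit_cell(7)[of M], of "mod_hcomp D (mod_unit (mod_tgt M)) M" M]
        mod_cell_isoI[OF _ mod_runit_cell(7)[of M], of "mod_hcomp D M (mod_unit (mod_src M))" M]
        is_mod_cell_lunit[of M] is_mod_cell_runit[of M]
      by (simp_all add: mod_lunit_def mod_runit_def)
  qed (use S T in \<open>auto simp: MC.category_axioms BC.category_axioms mod_assoc_natural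
      mod_lunit_natural mod_runit_natural mod_triangle mod_pentagon\<close>)
qed

end

section \<open>Products of double categories\<close>

lemma prod_cat_simps [simp]:
  "(A, B) \<in> Ob (prod_cat C D) \<longleftrightarrow> A \<in> Ob C \<and> B \<in> Ob D"
  "(f, g) \<in> Ar (prod_cat C D) \<longleftrightarrow> f \<in> Ar C \<and> g \<in> Ar D"
  "Dom (prod_cat C D) (f, g) = (Dom C f, Dom D g)"
  "Cod (prod_cat C D) (f, g) = (Cod C f, Cod D g)"
  "Idt (prod_cat C D) (A, B) = (Idt C A, Idt D B)"
  "Comp (prod_cat C D) (f', g') (f, g) = (f' \<cdot>\<^bsub>C\<^esub> f, g' \<cdot>\<^bsub>D\<^esub> g)"
  by (auto simp: prod_cat_def)

lemma fct_simps [simp]: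
  "onO id_fct A = A" "onA id_fct f = f"
  "onO (comp_fct G F) A = onO G (onO F A)" "onA (comp_fct G F) f = onA G (onA F f)"
  "onO (prod_fct F F') (A, B) = (onO F A, onO F' B)" "onA (prod_fct F F') (f, g) = (onA F f, onA F' g)"
  "onO diag_fct A = (A, A)" "onA diag_fct f = (f, f)" "onO unit_fct A = ()" "onA unit_fct f = ()"
  by (simp_all add: id_fct_def comp_fct_def prod_fct_def diag_fct_def unit_fct_def)

lemma unit_cat_simps [simp]:
  "A \<in> Ob unit_cat" "f \<in> Ar unit_cat"
  by (simp_all add: unit_cat_def)

lemma category_unit_cat [simp]: "category unit_cat"
  by (auto simp: category_def)

lemma category_prod_cat [simp]:
  assumes "category C" and "category D"
  shows "category (prod_cat C D)"
proof -
  interpret C: category C by (rule assms(1))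
  interpret D: category D by (rule assms(2))
  show ?thesis by unfold_locales auto
qed

lemma is_iso_prod_cat:
  assumes "category C" "category D" "is_iso C f" "is_iso D g"
  shows "is_iso (prod_cat C D) (f, g)"
proof -
  interpret C: category C by (rule assms(1))
  interpret D: category D by (rule assms(2))
  interpret P: category "prod_cat C D" using assms by simp
  obtain f' where f: "f \<in> Ar C" "f' \<in> Ar C" "Dom C f' = Cod C f" "Cod C f' = Dom C f"
    "f' \<cdot>\<^bsub>C\<^esub> f = Idt C (Dom C f)" "f \<cdot>\<^bsub>C\<^esub> f' = Idt C (Cod C f)" using C.is_isoE[OF assms(3)] by blast
  obtain g' where g: "g \<in> Ar D" "g' \<in> Ar D" "Dom D g' = Cod D g" "Cod D g' = Dom D g"
    "g' \<cdot>\<^bsub>D\<^esub> g = Idt D (Dom D g)" "g \<cdot>\<^bsub>D\<^esub> g' = Idt D (Cod D g)" using D.is_isoE[OF assms(4)] by blast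
  show ?thesis by (rule P.is_isoI[where g = "(f', g')"]) (use f g in simp_all)
qed

lemma cat_functor_prod_fct:
  assumes "cat_functor C C' F" and "cat_functor D D' G"
  shows "cat_functor (prod_cat C D) (prod_cat C' D') (prod_fct F G)"
proof -
  interpret F: cat_functor C C' F by (rule assms(1))
  interpret G: cat_functor D D' G by (rule assms(2))
  show ?thesis
    by (rule cat_functorI)
      (auto simp: F.C.category_axioms F.D.category_axioms G.C.category_axioms G.D.category_axioms)
qed

lemma prod_dblcat_simps [simp]:
  "VCat (prod_dblcat D E) = prod_cat (VCat D) (VCat E)" "HCat (prod_dblcat D E) = prod_cat (HCat D) (HCat E)"
  "Src (prod_dblcat D E) = prod_fct (Src D) (Src E)" "Tgt (prod_dblcat D E) = prod_fct (Tgt D) (Tgt E)"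
  "Unt (prod_dblcat D E) = prod_fct (Unt D) (Unt E)"
  "HComp (prod_dblcat D E) (M, M') (N, N') = (M \<odot>\<^bsub>D\<^esub> N, M' \<odot>\<^bsub>E\<^esub> N')"
  "CComp (prod_dblcat D E) (\<alpha>, \<alpha>') (\<beta>, \<beta>') = (\<alpha> \<star>\<^bsub>D\<^esub> \<beta>, \<alpha>' \<star>\<^bsub>E\<^esub> \<beta>')"
  "Assoc (prod_dblcat D E) (M, M') (N, N') (P, P') = (Assoc D M N P, Assoc E M' N' P')"
  "LUnit (prod_dblcat D E) (M, M') = (LUnit D M, LUnit E M')"
  "RUnit (prod_dblcat D E) (M, M') = (RUnit D M, RUnit E M')"
  by (simp_all add: prod_dblcat_def)

lemma globular_prod_dblcat [simp]:
  "(\<alpha>, \<alpha>') \<in> globular (prod_dblcat D E) (M, M') (N, N') \<longleftrightarrow> \<alpha> \<in> globular D M N \<and> \<alpha>' \<in> globular E M' N'"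
  by (auto simp: globular_def)

text \<open>The unit sits on \<open>htgt D N\<close>, to which the simplifier rewrites
  \<open>hsrc D M\<close> under the composability hypothesis.\<close>

lemma (in double_category) triangle':
  "\<lbrakk>M \<in> HOb D; N \<in> HOb D; hsrc D M = htgt D N\<rbrakk>
    \<Longrightarrow> (cell_id D M \<star> LUnit D N) \<bullet> Assoc D M (hunit D (htgt D N)) N = RUnit D M \<star> cell_id D N"
  using triangle[of M N] by simp

lemma double_category_prod_dblcat:
  assumes "double_category D" and "double_category E"
  shows "double_category (prod_dblcat D E)"
proof -
  interpret D: double_category D by (rule assms(1))
  interpret E: double_category E by (rule assms(2))
  have S: "cat_functor (HCat (prod_dblcat D E)) (VCat (prod_dblcat D E)) (Src (prod_dblcat D E))"
    and T: "cat_functor (HCat (prod_dblcat D E)) (VCat (prod_dblcat D E)) (Tgt (prod_dblcat D E))"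
    and U: "cat_functor (VCat (prod_dblcat D E)) (HCat (prod_dblcat D E)) (Unt (prod_dblcat D E))"
    using cat_functor_prod_fct[OF D.Src_functor E.Src_functor] cat_functor_prod_fct[OF D.Tgt_functor E.Tgt_functor]
      cat_functor_prod_fct[OF D.Unt_functor E.Unt_functor] by simp_all
  have c: "category (HCat (prod_dblcat D E))" "category (VCat (prod_dblcat D E))"
    by (simp_all add: D.VCat_category D.HCat_category E.VCat_category E.HCat_category)
  show ?thesis
  proof (rule double_category.intro)
    show "cat_functor (composable_cat (prod_dblcat D E)) (HCat (prod_dblcat D E)) (hcomp_fct (prod_dblcat D E))"
      by (rule cat_functorI) (auto simp: composable_cat_category[OF S T] c[simplified] D.interchange E.interchange)
  qed (use S T U c in \<open>auto simp: D.Assoc_globular E.Assoc_globular D.LUnit_globular E.LUnit_globular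
      D.RUnit_globular E.RUnit_globular is_iso_prod_cat D.VCat_category D.HCat_category E.VCat_category E.HCat_category
      D.Assoc_nat E.Assoc_nat D.LUnit_natural E.LUnit_natural D.RUnit_natural E.RUnit_natural
      D.pentagon' E.pentagon' D.triangle' E.triangle'\<close>)
qed

lemma unit_dblcat_simps [simp]:
  "VCat unit_dblcat = unit_cat" "HCat unit_dblcat = unit_cat"
  by (simp_all add: unit_dblcat_def)

lemma double_category_unit_dblcat: "double_category unit_dblcat"
proof -
  have f: "cat_functor C D F" if "category C" "category D" "\<forall>A. A \<in> Ob D" "\<forall>f. f \<in> Ar D"
    for C :: "('x, 'y) cat" and D :: "(unit, unit) cat" and F
    using that by (auto simp: cat_functor_def)
  have i: "is_iso unit_cat x" for x by (auto simp: is_iso_def)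
  have c: "category (composable_cat unit_dblcat)"
    by (rule composable_cat_category) (auto intro!: f)
  show ?thesis
    by (rule double_category.intro) (auto intro!: f c simp: i globular_def)
qed

section \<open>Double functors and vertical transformations\<close>

context lax_double_functor
begin

sublocale D: double_category D by (rule source_double_category)
sublocale E: double_category E by (rule target_double_category)
sublocale F0: cat_functor "VCat D" "VCat E" "F0 F" by (rule F0_functor)
sublocale F1: cat_functor "HCat D" "HCat E" "F1 F" by (rule F1_functor)

lemmas [simp] = hsrc_F1 htgt_F1 csrc_F1 ctgt_F1

lemma FComp_simps [simp]:
  assumes "M \<in> HOb D" "N \<in> HOb D" "hsrc D M = htgt D N"
  shows "FComp F M N \<in> Cells E" "Dom (HCat E) (FComp F M N) = onO (F1 F) M \<odot>\<^bsub>E\<^esub> onO (F1 F) N"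
    "Cod (HCat E) (FComp F M N) = onO (F1 F) (M \<odot>\<^bsub>D\<^esub> N)"
    "csrc E (FComp F M N) = Idt (VCat E) (onO (F0 F) (hsrc D N))"
    "ctgt E (FComp F M N) = Idt (VCat E) (onO (F0 F) (htgt D M))"
  using globular_simps[OF FComp_globular[of M N]] assms by simp_all

lemma FUnit_simps [simp]:
  assumes "A \<in> Ob (VCat D)"
  shows "FUnit F A \<in> Cells E" "Dom (HCat E) (FUnit F A) = hunit E (onO (F0 F) A)"
    "Cod (HCat E) (FUnit F A) = onO (F1 F) (hunit D A)"
    "csrc E (FUnit F A) = Idt (VCat E) (onO (F0 F) A)"
    "ctgt E (FUnit F A) = Idt (VCat E) (onO (F0 F) A)"
  using globular_simps[OF FUnit_globular[of A]] assms by simp_all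

lemma FComp_nat:
  assumes "\<alpha> \<in> Cells D" "\<beta> \<in> Cells D" "csrc D \<alpha> = ctgt D \<beta>" "Cod (HCat D) \<alpha> = M" "Cod (HCat D) \<beta> = N"
  shows "FComp F M N \<bullet>\<^bsub>E\<^esub> (onA (F1 F) \<alpha> \<star>\<^bsub>E\<^esub> onA (F1 F) \<beta>)
    = onA (F1 F) (\<alpha> \<star>\<^bsub>D\<^esub> \<beta>) \<bullet>\<^bsub>E\<^esub> FComp F (Dom (HCat D) \<alpha>) (Dom (HCat D) \<beta>)"
  using FComp_natural[of \<alpha> "Dom (HCat D) \<alpha>" M \<beta> "Dom (HCat D) \<beta>" N] assms by simp

end

lemma comp_dblfun_simps [simp]:
  "F0 (comp_dblfun E G F) = comp_fct (F0 G) (F0 F)" "F1 (comp_dblfun E G F) = comp_fct (F1 G) (F1 F)"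
  "FComp (comp_dblfun E G F) M N = onA (F1 G) (FComp F M N) \<bullet>\<^bsub>E\<^esub> FComp G (onO (F1 F) M) (onO (F1 F) N)"
  "FUnit (comp_dblfun E G F) A = onA (F1 G) (FUnit F A) \<bullet>\<^bsub>E\<^esub> FUnit G (onO (F0 F) A)"
  by (simp_all add: comp_dblfun_def)

lemma id_dblfun_simps [simp]:
  "F0 (id_dblfun D) = id_fct" "F1 (id_dblfun D) = id_fct"
  "FComp (id_dblfun D) M N = cell_id D (M \<odot>\<^bsub>D\<^esub> N)" "FUnit (id_dblfun D) A = cell_id D (hunit D A)"
  by (simp_all add: id_dblfun_def)

lemma diag_dblfun_simps [simp]:
  "F0 (diag_dblfun D) = diag_fct" "F1 (diag_dblfun D) = diag_fct"
  "FComp (diag_dblfun D) M N = (cell_id D (M \<odot>\<^bsub>D\<^esub> N), cell_id D (M \<odot>\<^bsub>D\<^esub> N))"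
  "FUnit (diag_dblfun D) A = (cell_id D (hunit D A), cell_id D (hunit D A))"
  by (simp_all add: diag_dblfun_def)

lemma unit_dblfun_simps [simp]:
  "F0 unit_dblfun = unit_fct" "F1 unit_dblfun = unit_fct"
  by (simp_all add: unit_dblfun_def)

text \<open>Each coherence equation is pasted from the one of \<open>F\<close> under
  \<open>F1 G\<close> and the one of \<open>G\<close> at the images under \<open>F\<close>.
  Naturality of \<open>FComp G\<close> moves the comparison cells of \<open>G\<close> past the
  images of those of \<open>F\<close>, so that the two equations apply one after the other.\<close>

lemma lax_comp_dblfun:
  assumes "lax_double_functor D E F" and "lax_double_functor E K G"
  shows "lax_double_functor D K (comp_dblfun K G F)"
proof -
  interpret F: lax_double_functor D E F by (rule assms(1))
  interpret G: lax_double_functor E K G by (rule assms(2))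
  show ?thesis
  proof (rule lax_double_functor.intro)
    show "double_category D" "double_category K" by unfold_locales
    show "cat_functor (VCat D) (VCat K) (F0 (comp_dblfun K G F))"
      by (rule cat_functorI) (auto simp: F.D.VCat_category G.E.VCat_category)
    show "cat_functor (HCat D) (HCat K) (F1 (comp_dblfun K G F))"
      by (rule cat_functorI) (auto simp: F.D.HCat_category G.E.HCat_category)
  next
    fix M N assume "(M, N) \<in> Ob (composable_cat D)"
    then show "FComp (comp_dblfun K G F) M N \<in> globular K (HComp K (onO (F1 (comp_dblfun K G F)) M) (onO (F1 (comp_dblfun K G F)) N))
       (onO (F1 (comp_dblfun K G F)) (HComp D M N))"
      by (intro globularI) simp_all
  next
    fix \<alpha> M M' \<beta> N N'
    assume "\<alpha> \<in> hom (HCat D) M M'" "\<beta> \<in> hom (HCat D) N N'" "(\<alpha>, \<beta>) \<in> Ar (composable_cat D)"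
    then have a: "\<alpha> \<in> Cells D" "Dom (HCat D) \<alpha> = M" "Cod (HCat D) \<alpha> = M'"
      "\<beta> \<in> Cells D" "Dom (HCat D) \<beta> = N" "Cod (HCat D) \<beta> = N'" "csrc D \<alpha> = ctgt D \<beta>" by auto
    have o: "M \<in> HOb D" "N \<in> HOb D" "M' \<in> HOb D" "N' \<in> HOb D" "hsrc D M = htgt D N" "hsrc D M' = htgt D N'"
      using F.D.cells_composable[OF a(1,4,7)] F.D.H.obs[of \<alpha>] F.D.H.obs[of \<beta>] a by simp_all
    have "FComp F M' N' \<bullet>\<^bsub>E\<^esub> (onA (F1 F) \<alpha> \<star>\<^bsub>E\<^esub> onA (F1 F) \<beta>) = onA (F1 F) (\<alpha> \<star>\<^bsub>D\<^esub> \<beta>) \<bullet>\<^bsub>E\<^esub> FComp F M N"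
      using F.FComp_nat[OF a(1,4,7,3,6)] a by simp
    then have "onA (F1 G) (FComp F M' N' \<bullet>\<^bsub>E\<^esub> (onA (F1 F) \<alpha> \<star>\<^bsub>E\<^esub> onA (F1 F) \<beta>))
       = onA (F1 G) (onA (F1 F) (\<alpha> \<star>\<^bsub>D\<^esub> \<beta>) \<bullet>\<^bsub>E\<^esub> FComp F M N)" by simp
    then have n: "onA (F1 G) (FComp F M' N') \<bullet>\<^bsub>K\<^esub> onA (F1 G) (onA (F1 F) \<alpha> \<star>\<^bsub>E\<^esub> onA (F1 F) \<beta>)
       = onA (F1 G) (onA (F1 F) (\<alpha> \<star>\<^bsub>D\<^esub> \<beta>)) \<bullet>\<^bsub>K\<^esub> onA (F1 G) (FComp F M N)" using a o by simp
    show "FComp (comp_dblfun K G F) M' N' \<bullet>\<^bsub>K\<^esub> CComp K (onA (F1 (comp_dblfun K G F)) \<alpha>) (onA (F1 (comp_dblfun K G F)) \<beta>)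
       = onA (F1 (comp_dblfun K G F)) (CComp D \<alpha> \<beta>) \<bullet>\<^bsub>K\<^esub> FComp (comp_dblfun K G F) M N"
      using a o G.E.H.comp_tail[OF n, of "FComp G (onO (F1 F) M) (onO (F1 F) N)"] by (simp add: G.FComp_nat)
  next
    fix A assume "A \<in> Ob (VCat D)"
    then show "FUnit (comp_dblfun K G F) A \<in> globular K (hunit K (onO (F0 (comp_dblfun K G F)) A)) (onO (F1 (comp_dblfun K G F)) (hunit D A))"
      by (intro globularI) simp_all
  next
    fix f A B assume f: "f \<in> hom (VCat D) A B"
    have "onA (F1 G) (FUnit F B \<bullet>\<^bsub>E\<^esub> cunit E (onA (F0 F) f)) = onA (F1 G) (onA (F1 F) (cunit D f) \<bullet>\<^bsub>E\<^esub> FUnit F A)"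
      using F.FUnit_natural[OF f] by simp
    then have n: "onA (F1 G) (FUnit F B) \<bullet>\<^bsub>K\<^esub> onA (F1 G) (cunit E (onA (F0 F) f))
      = onA (F1 G) (onA (F1 F) (cunit D f)) \<bullet>\<^bsub>K\<^esub> onA (F1 G) (FUnit F A)" using f by auto
    have m: "FUnit G (onO (F0 F) B) \<bullet>\<^bsub>K\<^esub> cunit K (onA (F0 G) (onA (F0 F) f)) =
      onA (F1 G) (cunit E (onA (F0 F) f)) \<bullet>\<^bsub>K\<^esub> FUnit G (onO (F0 F) A)"
      using G.FUnit_natural[of "onA (F0 F) f" "onO (F0 F) A" "onO (F0 F) B"] f by simp
    show "FUnit (comp_dblfun K G F) B \<bullet>\<^bsub>K\<^esub> cunit K (onA (F0 (comp_dblfun K G F)) f)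
      = onA (F1 (comp_dblfun K G F)) (cunit D f) \<bullet>\<^bsub>K\<^esub> FUnit (comp_dblfun K G F) A"
      using f m G.E.H.comp_tail[OF n, of "FUnit G (onO (F0 F) A)"] by auto
  next
    fix M N P assume "(M, N) \<in> Ob (composable_cat D)" "(N, P) \<in> Ob (composable_cat D)"
    then have o: "M \<in> HOb D" "N \<in> HOb D" "P \<in> HOb D" "hsrc D M = htgt D N" "hsrc D N = htgt D P" by auto
    let ?M = "onO (F1 F) M" and ?N = "onO (F1 F) N" and ?P = "onO (F1 F) P"
    have "onA (F1 G) (onA (F1 F) (Assoc D M N P) \<bullet>\<^bsub>E\<^esub> FComp F (M \<odot>\<^bsub>D\<^esub> N) P \<bullet>\<^bsub>E\<^esub> (FComp F M N \<star>\<^bsub>E\<^esub> cell_id E ?P))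
      = onA (F1 G) (FComp F M (N \<odot>\<^bsub>D\<^esub> P) \<bullet>\<^bsub>E\<^esub> (cell_id E ?M \<star>\<^bsub>E\<^esub> FComp F N P) \<bullet>\<^bsub>E\<^esub> Assoc E ?M ?N ?P)"
      using F.FComp_assoc[of M N P] o by simp
    then have 1: "onA (F1 G) (onA (F1 F) (Assoc D M N P)) \<bullet>\<^bsub>K\<^esub> (onA (F1 G) (FComp F (M \<odot>\<^bsub>D\<^esub> N) P) \<bullet>\<^bsub>K\<^esub> onA (F1 G) (FComp F M N \<star>\<^bsub>E\<^esub> cell_id E ?P))
      = onA (F1 G) (FComp F M (N \<odot>\<^bsub>D\<^esub> P)) \<bullet>\<^bsub>K\<^esub> (onA (F1 G) (cell_id E ?M \<star>\<^bsub>E\<^esub> FComp F N P) \<bullet>\<^bsub>K\<^esub> onA (F1 G) (Assoc E ?M ?N ?P))"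
      using o by simp
    have 2: "onA (F1 G) (Assoc E ?M ?N ?P) \<bullet>\<^bsub>K\<^esub> (FComp G (?M \<odot>\<^bsub>E\<^esub> ?N) ?P \<bullet>\<^bsub>K\<^esub> (FComp G ?M ?N \<star>\<^bsub>K\<^esub> cell_id K (onO (F1 G) ?P)))
      = FComp G ?M (?N \<odot>\<^bsub>E\<^esub> ?P) \<bullet>\<^bsub>K\<^esub> ((cell_id K (onO (F1 G) ?M) \<star>\<^bsub>K\<^esub> FComp G ?N ?P) \<bullet>\<^bsub>K\<^esub> Assoc K (onO (F1 G) ?M) (onO (F1 G) ?N) (onO (F1 G) ?P))"
      using G.FComp_assoc[of ?M ?N ?P] o by simp
    have 3: "FComp G (onO (F1 F) (M \<odot>\<^bsub>D\<^esub> N)) ?P \<bullet>\<^bsub>K\<^esub> (onA (F1 G) (FComp F M N) \<star>\<^bsub>K\<^esub> cell_id K (onO (F1 G) ?P))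
      = onA (F1 G) (FComp F M N \<star>\<^bsub>E\<^esub> cell_id E ?P) \<bullet>\<^bsub>K\<^esub> FComp G (?M \<odot>\<^bsub>E\<^esub> ?N) ?P"
      using G.FComp_nat[of "FComp F M N" "cell_id E ?P", OF _ _ _ refl refl] o by simp
    have 4: "onA (F1 G) (cell_id E ?M \<star>\<^bsub>E\<^esub> FComp F N P) \<bullet>\<^bsub>K\<^esub> FComp G ?M (?N \<odot>\<^bsub>E\<^esub> ?P)
      = FComp G ?M (onO (F1 F) (N \<odot>\<^bsub>D\<^esub> P)) \<bullet>\<^bsub>K\<^esub> (cell_id K (onO (F1 G) ?M) \<star>\<^bsub>K\<^esub> onA (F1 G) (FComp F N P))"
      using G.FComp_nat[of "cell_id E ?M" "FComp F N P", OF _ _ _ refl refl] o by simp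
    show "onA (F1 (comp_dblfun K G F)) (Assoc D M N P) \<bullet>\<^bsub>K\<^esub> FComp (comp_dblfun K G F) (M \<odot>\<^bsub>D\<^esub> N) P
        \<bullet>\<^bsub>K\<^esub> (FComp (comp_dblfun K G F) M N \<star>\<^bsub>K\<^esub> cell_id K (onO (F1 (comp_dblfun K G F)) P))
      = FComp (comp_dblfun K G F) M (N \<odot>\<^bsub>D\<^esub> P)
        \<bullet>\<^bsub>K\<^esub> (cell_id K (onO (F1 (comp_dblfun K G F)) M) \<star>\<^bsub>K\<^esub> FComp (comp_dblfun K G F) N P)
        \<bullet>\<^bsub>K\<^esub> Assoc K (onO (F1 (comp_dblfun K G F)) M) (onO (F1 (comp_dblfun K G F)) N) (onO (F1 (comp_dblfun K G F)) P)"
      (is "?L = ?R")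
    proof -
      have "?L = onA (F1 G) (onA (F1 F) (Assoc D M N P)) \<bullet>\<^bsub>K\<^esub> (onA (F1 G) (FComp F (M \<odot>\<^bsub>D\<^esub> N) P) \<bullet>\<^bsub>K\<^esub> (onA (F1 G) (FComp F M N \<star>\<^bsub>E\<^esub> cell_id E ?P)
         \<bullet>\<^bsub>K\<^esub> (FComp G (?M \<odot>\<^bsub>E\<^esub> ?N) ?P \<bullet>\<^bsub>K\<^esub> (FComp G ?M ?N \<star>\<^bsub>K\<^esub> cell_id K (onO (F1 G) ?P)))))"
        using o G.E.H.comp_tail[OF 3, of "FComp G ?M ?N \<star>\<^bsub>K\<^esub> cell_id K (onO (F1 G) ?P)"] by (simp add: G.E.whisker)
      also have "\<dots> = (onA (F1 G) (onA (F1 F) (Assoc D M N P)) \<bullet>\<^bsub>K\<^esub> (onA (F1 G) (FComp F (M \<odot>\<^bsub>D\<^esub> N) P) \<bullet>\<^bsub>K\<^esub> onA (F1 G) (FComp F M N \<star>\<^bsub>E\<^esub> cell_id E ?P)))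
         \<bullet>\<^bsub>K\<^esub> (FComp G (?M \<odot>\<^bsub>E\<^esub> ?N) ?P \<bullet>\<^bsub>K\<^esub> (FComp G ?M ?N \<star>\<^bsub>K\<^esub> cell_id K (onO (F1 G) ?P)))"
        using o by simp
      also have "\<dots> = onA (F1 G) (FComp F M (N \<odot>\<^bsub>D\<^esub> P)) \<bullet>\<^bsub>K\<^esub> (onA (F1 G) (cell_id E ?M \<star>\<^bsub>E\<^esub> FComp F N P) \<bullet>\<^bsub>K\<^esub> (onA (F1 G) (Assoc E ?M ?N ?P)
         \<bullet>\<^bsub>K\<^esub> (FComp G (?M \<odot>\<^bsub>E\<^esub> ?N) ?P \<bullet>\<^bsub>K\<^esub> (FComp G ?M ?N \<star>\<^bsub>K\<^esub> cell_id K (onO (F1 G) ?P)))))"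
        unfolding 1 using o by simp
      also have "\<dots> = ?R"
        unfolding 2 using o G.E.H.comp_tail[OF 4, of "(cell_id K (onO (F1 G) ?M) \<star>\<^bsub>K\<^esub> FComp G ?N ?P) \<bullet>\<^bsub>K\<^esub> Assoc K (onO (F1 G) ?M) (onO (F1 G) ?N) (onO (F1 G) ?P)"]
        by (simp add: G.E.whisker)
      finally show ?thesis .
    qed
  next
    fix M assume o: "M \<in> HOb D"
    let ?M = "onO (F1 F) M" and ?T = "htgt D M" and ?U = "hunit D (htgt D M)"
    have "onA (F1 G) (onA (F1 F) (LUnit D M) \<bullet>\<^bsub>E\<^esub> FComp F ?U M \<bullet>\<^bsub>E\<^esub> (FUnit F ?T \<star>\<^bsub>E\<^esub> cell_id E ?M)) = onA (F1 G) (LUnit E ?M)"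
      using F.FComp_LUnit[OF o] by simp
    then have 1: "onA (F1 G) (onA (F1 F) (LUnit D M)) \<bullet>\<^bsub>K\<^esub> (onA (F1 G) (FComp F ?U M) \<bullet>\<^bsub>K\<^esub> onA (F1 G) (FUnit F ?T \<star>\<^bsub>E\<^esub> cell_id E ?M)) = onA (F1 G) (LUnit E ?M)"
      using o by simp
    have 2: "onA (F1 G) (LUnit E ?M) \<bullet>\<^bsub>K\<^esub> (FComp G (hunit E (onO (F0 F) ?T)) ?M \<bullet>\<^bsub>K\<^esub> (FUnit G (onO (F0 F) ?T) \<star>\<^bsub>K\<^esub> cell_id K (onO (F1 G) ?M)))
      = LUnit K (onO (F1 G) ?M)"
      using G.FComp_LUnit[of ?M] o by simp
    have 3: "FComp G (onO (F1 F) ?U) ?M \<bullet>\<^bsub>K\<^esub> (onA (F1 G) (FUnit F ?T) \<star>\<^bsub>K\<^esub> cell_id K (onO (F1 G) ?M))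
      = onA (F1 G) (FUnit F ?T \<star>\<^bsub>E\<^esub> cell_id E ?M) \<bullet>\<^bsub>K\<^esub> FComp G (hunit E (onO (F0 F) ?T)) ?M"
      using G.FComp_nat[of "FUnit F ?T" "cell_id E ?M", OF _ _ _ refl refl] o by simp
    show "onA (F1 (comp_dblfun K G F)) (LUnit D M) \<bullet>\<^bsub>K\<^esub> FComp (comp_dblfun K G F) (hunit D (htgt D M)) M
       \<bullet>\<^bsub>K\<^esub> (FUnit (comp_dblfun K G F) (htgt D M) \<star>\<^bsub>K\<^esub> cell_id K (onO (F1 (comp_dblfun K G F)) M))
       = LUnit K (onO (F1 (comp_dblfun K G F)) M)" (is "?L = ?R")
    proof -
      have "?L = onA (F1 G) (onA (F1 F) (LUnit D M)) \<bullet>\<^bsub>K\<^esub> (onA (F1 G) (FComp F ?U M) \<bullet>\<^bsub>K\<^esub> (onA (F1 G) (FUnit F ?T \<star>\<^bsub>E\<^esub> cell_id E ?M)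
         \<bullet>\<^bsub>K\<^esub> (FComp G (hunit E (onO (F0 F) ?T)) ?M \<bullet>\<^bsub>K\<^esub> (FUnit G (onO (F0 F) ?T) \<star>\<^bsub>K\<^esub> cell_id K (onO (F1 G) ?M)))))"
        using o G.E.H.comp_tail[OF 3, of "FUnit G (onO (F0 F) ?T) \<star>\<^bsub>K\<^esub> cell_id K (onO (F1 G) ?M)"] by (simp add: G.E.whisker)
      also have "\<dots> = (onA (F1 G) (onA (F1 F) (LUnit D M)) \<bullet>\<^bsub>K\<^esub> (onA (F1 G) (FComp F ?U M) \<bullet>\<^bsub>K\<^esub> onA (F1 G) (FUnit F ?T \<star>\<^bsub>E\<^esub> cell_id E ?M)))
         \<bullet>\<^bsub>K\<^esub> (FComp G (hunit E (onO (F0 F) ?T)) ?M \<bullet>\<^bsub>K\<^esub> (FUnit G (onO (F0 F) ?T) \<star>\<^bsub>K\<^esub> cell_id K (onO (F1 G) ?M)))"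
        using o by simp
      also have "\<dots> = ?R" unfolding 1 2 by simp
      finally show ?thesis .
    qed
  next
    fix M assume o: "M \<in> HOb D"
    let ?M = "onO (F1 F) M" and ?T = "hsrc D M" and ?U = "hunit D (hsrc D M)"
    have "onA (F1 G) (onA (F1 F) (RUnit D M) \<bullet>\<^bsub>E\<^esub> FComp F M ?U \<bullet>\<^bsub>E\<^esub> (cell_id E ?M \<star>\<^bsub>E\<^esub> FUnit F ?T)) = onA (F1 G) (RUnit E ?M)"
      using F.FComp_RUnit[OF o] by simp
    then have 1: "onA (F1 G) (onA (F1 F) (RUnit D M)) \<bullet>\<^bsub>K\<^esub> (onA (F1 G) (FComp F M ?U) \<bullet>\<^bsub>K\<^esub> onA (F1 G) (cell_id E ?M \<star>\<^bsub>E\<^esub> FUnit F ?T)) = onA (F1 G) (RUnit E ?M)"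
      using o by simp
    have 2: "onA (F1 G) (RUnit E ?M) \<bullet>\<^bsub>K\<^esub> (FComp G ?M (hunit E (onO (F0 F) ?T)) \<bullet>\<^bsub>K\<^esub> (cell_id K (onO (F1 G) ?M) \<star>\<^bsub>K\<^esub> FUnit G (onO (F0 F) ?T)))
      = RUnit K (onO (F1 G) ?M)"
      using G.FComp_RUnit[of ?M] o by simp
    have 3: "FComp G ?M (onO (F1 F) ?U) \<bullet>\<^bsub>K\<^esub> (cell_id K (onO (F1 G) ?M) \<star>\<^bsub>K\<^esub> onA (F1 G) (FUnit F ?T))
      = onA (F1 G) (cell_id E ?M \<star>\<^bsub>E\<^esub> FUnit F ?T) \<bullet>\<^bsub>K\<^esub> FComp G ?M (hunit E (onO (F0 F) ?T))"
      using G.FComp_nat[of "cell_id E ?M" "FUnit F ?T", OF _ _ _ refl refl] o by simp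
    show "onA (F1 (comp_dblfun K G F)) (RUnit D M) \<bullet>\<^bsub>K\<^esub> FComp (comp_dblfun K G F) M (hunit D (hsrc D M))
       \<bullet>\<^bsub>K\<^esub> (cell_id K (onO (F1 (comp_dblfun K G F)) M) \<star>\<^bsub>K\<^esub> FUnit (comp_dblfun K G F) (hsrc D M))
       = RUnit K (onO (F1 (comp_dblfun K G F)) M)" (is "?L = ?R")
    proof -
      have "?L = onA (F1 G) (onA (F1 F) (RUnit D M)) \<bullet>\<^bsub>K\<^esub> (onA (F1 G) (FComp F M ?U) \<bullet>\<^bsub>K\<^esub> (onA (F1 G) (cell_id E ?M \<star>\<^bsub>E\<^esub> FUnit F ?T)
         \<bullet>\<^bsub>K\<^esub> (FComp G ?M (hunit E (onO (F0 F) ?T)) \<bullet>\<^bsub>K\<^esub> (cell_id K (onO (F1 G) ?M) \<star>\<^bsub>K\<^esub> FUnit G (onO (F0 F) ?T)))))"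
        using o G.E.H.comp_tail[OF 3, of "cell_id K (onO (F1 G) ?M) \<star>\<^bsub>K\<^esub> FUnit G (onO (F0 F) ?T)"] by (simp add: G.E.whisker)
      also have "\<dots> = (onA (F1 G) (onA (F1 F) (RUnit D M)) \<bullet>\<^bsub>K\<^esub> (onA (F1 G) (FComp F M ?U) \<bullet>\<^bsub>K\<^esub> onA (F1 G) (cell_id E ?M \<star>\<^bsub>E\<^esub> FUnit F ?T)))
         \<bullet>\<^bsub>K\<^esub> (FComp G ?M (hunit E (onO (F0 F) ?T)) \<bullet>\<^bsub>K\<^esub> (cell_id K (onO (F1 G) ?M) \<star>\<^bsub>K\<^esub> FUnit G (onO (F0 F) ?T)))"
        using o by simp
      also have "\<dots> = ?R" unfolding 1 2 by simp
      finally show ?thesis .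
    qed
  qed auto
qed

lemma lax_id_dblfun:
  assumes "double_category D"
  shows "lax_double_functor D D (id_dblfun D)"
proof -
  interpret double_category D by (rule assms)
  show ?thesis
  proof (rule lax_double_functor.intro)
    show "cat_functor (VCat D) (VCat D) (F0 (id_dblfun D))" "cat_functor (HCat D) (HCat D) (F1 (id_dblfun D))"
      by (rule cat_functorI; simp add: VCat_category HCat_category)+
  qed (auto simp: assms globular_def cells_composable)
qed

lemma double_functor_diag_dblfun:
  assumes "double_category D"
  shows "double_functor D (prod_dblcat D D) (diag_dblfun D)"
proof -
  interpret double_category D by (rule assms)
  have "lax_double_functor D (prod_dblcat D D) (diag_dblfun D)"
  proof (rule lax_double_functor.intro)
    show "cat_functor (VCat D) (VCat (prod_dblcat D D)) (F0 (diag_dblfun D))"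
      "cat_functor (HCat D) (HCat (prod_dblcat D D)) (F1 (diag_dblfun D))"
      by (rule cat_functorI; simp add: VCat_category HCat_category)+
  qed (auto simp: assms globular_def cells_composable intro!: double_category_prod_dblcat)
  then show ?thesis
    by (auto simp: double_functor_def double_functor_axioms_def is_iso_prod_cat H.is_iso_idt HCat_category)
qed

lemma double_functor_unit_dblfun:
  assumes "double_category D"
  shows "double_functor D unit_dblcat unit_dblfun"
proof -
  interpret double_category D by (rule assms)
  have f: "cat_functor C D F" if "category C" "category D" "\<forall>A. A \<in> Ob D" "\<forall>f. f \<in> Ar D"
    for C :: "('x, 'y) cat" and D :: "(unit, unit) cat" and F
    using that by (auto simp: cat_functor_def)
  have i: "is_iso unit_cat x" for x by (auto simp: is_iso_def)
  have "lax_double_functor D unit_dblcat unit_dblfun"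
    by (rule lax_double_functor.intro)
       (auto simp: assms double_category_unit_dblcat VCat_category HCat_category globular_def intro!: f)
  then show ?thesis
    by (auto simp: double_functor_def double_functor_axioms_def i)
qed

section \<open>Cartesian double categories\<close>

text \<open>The equations for sources and targets hold on the nose because a double functor commutes
  strictly with source and target. The condition \<open>prod_hunit\<close> makes the canonical
  comparison on units invertible. The corresponding condition on \<odot> is added only in
  \<open>cartesian_products\<close>, so that for modules the products can be constructed before it
  is proved.\<close>

locale double_category_products = double_category D
  for D :: "('o, 'v, 'h, 'c) dblcat" (structure) +
  fixes P0 :: "'o \<Rightarrow> 'o \<Rightarrow> 'o" and p0 p0' :: "'o \<Rightarrow> 'o \<Rightarrow> 'v"
    and P1 :: "'h \<Rightarrow> 'h \<Rightarrow> 'h" and p1 p1' :: "'h \<Rightarrow> 'h \<Rightarrow> 'c"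
  assumes prod0: "\<lbrakk>A \<in> Ob (VCat D); B \<in> Ob (VCat D)\<rbrakk> \<Longrightarrow> is_product (VCat D) A B (P0 A B) (p0 A B) (p0' A B)"
    and prod1: "\<lbrakk>M \<in> HOb D; N \<in> HOb D\<rbrakk> \<Longrightarrow> is_product (HCat D) M N (P1 M N) (p1 M N) (p1' M N)"
    and src_P1 [simp]: "\<lbrakk>M \<in> HOb D; N \<in> HOb D\<rbrakk> \<Longrightarrow> hsrc D (P1 M N) = P0 (hsrc D M) (hsrc D N)"
    and tgt_P1 [simp]: "\<lbrakk>M \<in> HOb D; N \<in> HOb D\<rbrakk> \<Longrightarrow> htgt D (P1 M N) = P0 (htgt D M) (htgt D N)"
    and src_p1 [simp]: "\<lbrakk>M \<in> HOb D; N \<in> HOb D\<rbrakk> \<Longrightarrow> csrc D (p1 M N) = p0 (hsrc D M) (hsrc D N)"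
    and tgt_p1 [simp]: "\<lbrakk>M \<in> HOb D; N \<in> HOb D\<rbrakk> \<Longrightarrow> ctgt D (p1 M N) = p0 (htgt D M) (htgt D N)"
    and src_p1' [simp]: "\<lbrakk>M \<in> HOb D; N \<in> HOb D\<rbrakk> \<Longrightarrow> csrc D (p1' M N) = p0' (hsrc D M) (hsrc D N)"
    and tgt_p1' [simp]: "\<lbrakk>M \<in> HOb D; N \<in> HOb D\<rbrakk> \<Longrightarrow> ctgt D (p1' M N) = p0' (htgt D M) (htgt D N)"
    and prod_hunit: "\<lbrakk>A \<in> Ob (VCat D); B \<in> Ob (VCat D)\<rbrakk>
      \<Longrightarrow> is_product (HCat D) (hunit D A) (hunit D B) (hunit D (P0 A B)) (cunit D (p0 A B)) (cunit D (p0' A B))"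

locale cartesian_products = double_category_products +
  assumes prod_hcomp: "\<lbrakk>M \<in> HOb D; N \<in> HOb D; M' \<in> HOb D; N' \<in> HOb D; hsrc D M = htgt D N; hsrc D M' = htgt D N'\<rbrakk>
      \<Longrightarrow> is_product (HCat D) (M \<odot> N) (M' \<odot> N') (P1 M M' \<odot> P1 N N') (p1 M M' \<star> p1 N N') (p1' M M' \<star> p1' N N')"

section \<open>The lax double functor given by chosen products\<close>

context double_category_products
begin

lemma p0_simps [simp]:
  assumes "A \<in> Ob (VCat D)" "B \<in> Ob (VCat D)"
  shows "P0 A B \<in> Ob (VCat D)" "p0 A B \<in> Ar (VCat D)" "Dom (VCat D) (p0 A B) = P0 A B" "Cod (VCat D) (p0 A B) = A"
    "p0' A B \<in> Ar (VCat D)" "Dom (VCat D) (p0' A B) = P0 A B" "Cod (VCat D) (p0' A B) = B"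
  using V.is_productD[OF prod0[OF assms]] by auto

lemma p1_simps [simp]:
  assumes "A \<in> HOb D" "B \<in> HOb D"
  shows "P1 A B \<in> HOb D" "p1 A B \<in> Cells D" "Dom (HCat D) (p1 A B) = P1 A B" "Cod (HCat D) (p1 A B) = A"
    "p1' A B \<in> Cells D" "Dom (HCat D) (p1' A B) = P1 A B" "Cod (HCat D) (p1' A B) = B"
  using H.is_productD[OF prod1[OF assms]] by auto

definition med0 where
  "med0 f g = prod_med (VCat D) (P0 (Cod (VCat D) f) (Cod (VCat D) g)) (p0 (Cod (VCat D) f) (Cod (VCat D) g))
     (p0' (Cod (VCat D) f) (Cod (VCat D) g)) f g"

definition med1 where
  "med1 f g = prod_med (HCat D) (P1 (Cod (HCat D) f) (Cod (HCat D) g)) (p1 (Cod (HCat D) f) (Cod (HCat D) g))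
     (p1' (Cod (HCat D) f) (Cod (HCat D) g)) f g"

lemma med0_simps [simp]:
  assumes "f \<in> Ar (VCat D)" "g \<in> Ar (VCat D)" "Dom (VCat D) f = Dom (VCat D) g"
  shows "med0 f g \<in> Ar (VCat D)" "Dom (VCat D) (med0 f g) = Dom (VCat D) g"
    "Cod (VCat D) (med0 f g) = P0 (Cod (VCat D) f) (Cod (VCat D) g)"
    "Cod (VCat D) f = A \<Longrightarrow> Cod (VCat D) g = B \<Longrightarrow> p0 A B \<cdot>\<^bsub>VCat D\<^esub> med0 f g = f"
    "Cod (VCat D) f = A \<Longrightarrow> Cod (VCat D) g = B \<Longrightarrow> p0' A B \<cdot>\<^bsub>VCat D\<^esub> med0 f g = g"
proof -
  have "Cod (VCat D) f \<in> Ob (VCat D)" "Cod (VCat D) g \<in> Ob (VCat D)" using assms by simp_all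
  note p = V.prod_med[OF prod0[OF this] assms refl refl, folded med0_def]
  then show "med0 f g \<in> Ar (VCat D)" "Dom (VCat D) (med0 f g) = Dom (VCat D) g"
    "Cod (VCat D) (med0 f g) = P0 (Cod (VCat D) f) (Cod (VCat D) g)" by simp_all
  show "p0 A B \<cdot>\<^bsub>VCat D\<^esub> med0 f g = f" "p0' A B \<cdot>\<^bsub>VCat D\<^esub> med0 f g = g"
    if "Cod (VCat D) f = A" "Cod (VCat D) g = B" using p(4,5) unfolding that by simp_all
qed

lemma med1_simps [simp]:
  assumes "f \<in> Cells D" "g \<in> Cells D" "Dom (HCat D) f = Dom (HCat D) g"
  shows "med1 f g \<in> Cells D" "Dom (HCat D) (med1 f g) = Dom (HCat D) g"
    "Cod (HCat D) (med1 f g) = P1 (Cod (HCat D) f) (Cod (HCat D) g)"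
    "Cod (HCat D) f = A \<Longrightarrow> Cod (HCat D) g = B \<Longrightarrow> p1 A B \<bullet> med1 f g = f"
    "Cod (HCat D) f = A \<Longrightarrow> Cod (HCat D) g = B \<Longrightarrow> p1' A B \<bullet> med1 f g = g"
proof -
  have "Cod (HCat D) f \<in> HOb D" "Cod (HCat D) g \<in> HOb D" using assms by simp_all
  note p = H.prod_med[OF prod1[OF this] assms refl refl, folded med1_def]
  then show "med1 f g \<in> Cells D" "Dom (HCat D) (med1 f g) = Dom (HCat D) g"
    "Cod (HCat D) (med1 f g) = P1 (Cod (HCat D) f) (Cod (HCat D) g)" by simp_all
  show "p1 A B \<bullet> med1 f g = f" "p1' A B \<bullet> med1 f g = g"
    if "Cod (HCat D) f = A" "Cod (HCat D) g = B" using p(4,5) unfolding that by simp_all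
qed

lemma eq0I:
  assumes "A \<in> Ob (VCat D)" "B \<in> Ob (VCat D)" "h \<in> Ar (VCat D)" "k \<in> Ar (VCat D)"
    "Cod (VCat D) h = P0 A B" "Cod (VCat D) k = P0 A B" "Dom (VCat D) h = Dom (VCat D) k"
    "p0 A B \<cdot>\<^bsub>VCat D\<^esub> h = p0 A B \<cdot>\<^bsub>VCat D\<^esub> k" "p0' A B \<cdot>\<^bsub>VCat D\<^esub> h = p0' A B \<cdot>\<^bsub>VCat D\<^esub> k"
  shows "h = k"
  by (rule V.prod_eqI[OF prod0[OF assms(1,2)]]) (use assms in auto)

lemma eq1I:
  assumes "A \<in> HOb D" "B \<in> HOb D" "h \<in> Cells D" "k \<in> Cells D"
    "Cod (HCat D) h = P1 A B" "Cod (HCat D) k = P1 A B" "Dom (HCat D) h = Dom (HCat D) k"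
    "p1 A B \<bullet> h = p1 A B \<bullet> k" "p1' A B \<bullet> h = p1' A B \<bullet> k"
  shows "h = k"
  by (rule H.prod_eqI[OF prod1[OF assms(1,2)]]) (use assms in auto)

lemma med0_tail [simp]:
  assumes "f \<in> Ar (VCat D)" "g \<in> Ar (VCat D)" "Dom (VCat D) f = Dom (VCat D) g"
    "Cod (VCat D) f = A" "Cod (VCat D) g = B" "x \<in> Ar (VCat D)" "Dom (VCat D) g = Cod (VCat D) x"
  shows "p0 A B \<cdot>\<^bsub>VCat D\<^esub> (med0 f g \<cdot>\<^bsub>VCat D\<^esub> x) = f \<cdot>\<^bsub>VCat D\<^esub> x"
    "p0' A B \<cdot>\<^bsub>VCat D\<^esub> (med0 f g \<cdot>\<^bsub>VCat D\<^esub> x) = g \<cdot>\<^bsub>VCat D\<^esub> x"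
proof -
  have "A \<in> Ob (VCat D)" "B \<in> Ob (VCat D)" using assms by auto
  then show "p0 A B \<cdot>\<^bsub>VCat D\<^esub> (med0 f g \<cdot>\<^bsub>VCat D\<^esub> x) = f \<cdot>\<^bsub>VCat D\<^esub> x"
    "p0' A B \<cdot>\<^bsub>VCat D\<^esub> (med0 f g \<cdot>\<^bsub>VCat D\<^esub> x) = g \<cdot>\<^bsub>VCat D\<^esub> x"
    using V.comp_tail[OF med0_simps(4)[OF assms(1-5)], of x] V.comp_tail[OF med0_simps(5)[OF assms(1-5)], of x] assms
    by simp_all
qed

lemma med1_tail [simp]:
  assumes "f \<in> Cells D" "g \<in> Cells D" "Dom (HCat D) f = Dom (HCat D) g"
    "Cod (HCat D) f = A" "Cod (HCat D) g = B" "x \<in> Cells D" "Dom (HCat D) g = Cod (HCat D) x"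
  shows "p1 A B \<bullet> (med1 f g \<bullet> x) = f \<bullet> x" "p1' A B \<bullet> (med1 f g \<bullet> x) = g \<bullet> x"
proof -
  have "A \<in> HOb D" "B \<in> HOb D" using assms by auto
  then show "p1 A B \<bullet> (med1 f g \<bullet> x) = f \<bullet> x" "p1' A B \<bullet> (med1 f g \<bullet> x) = g \<bullet> x"
    using H.comp_tail[OF med1_simps(4)[OF assms(1-5)], of x] H.comp_tail[OF med1_simps(5)[OF assms(1-5)], of x] assms
    by simp_all
qed

text \<open>Source and target carry the projections to projections, so the sides of a pairing have
  the components that characterize the pairing of the sides.\<close>

lemma med1_sides [simp]:
  assumes "f \<in> Cells D" "g \<in> Cells D" "Dom (HCat D) f = Dom (HCat D) g"
  shows "csrc D (med1 f g) = med0 (csrc D f) (csrc D g)" "ctgt D (med1 f g) = med0 (ctgt D f) (ctgt D g)"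
proof -
  have o: "Cod (HCat D) f \<in> HOb D" "Cod (HCat D) g \<in> HOb D" using assms by auto
  have "csrc D (p1 (Cod (HCat D) f) (Cod (HCat D) g) \<bullet> med1 f g) = csrc D f"
    "csrc D (p1' (Cod (HCat D) f) (Cod (HCat D) g) \<bullet> med1 f g) = csrc D g"
    "ctgt D (p1 (Cod (HCat D) f) (Cod (HCat D) g) \<bullet> med1 f g) = ctgt D f"
    "ctgt D (p1' (Cod (HCat D) f) (Cod (HCat D) g) \<bullet> med1 f g) = ctgt D g"
    using assms by simp_all
  then have e: "p0 (hsrc D (Cod (HCat D) f)) (hsrc D (Cod (HCat D) g)) \<cdot>\<^bsub>VCat D\<^esub> csrc D (med1 f g) = csrc D f"
    "p0' (hsrc D (Cod (HCat D) f)) (hsrc D (Cod (HCat D) g)) \<cdot>\<^bsub>VCat D\<^esub> csrc D (med1 f g) = csrc D g"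
    "p0 (htgt D (Cod (HCat D) f)) (htgt D (Cod (HCat D) g)) \<cdot>\<^bsub>VCat D\<^esub> ctgt D (med1 f g) = ctgt D f"
    "p0' (htgt D (Cod (HCat D) f)) (htgt D (Cod (HCat D) g)) \<cdot>\<^bsub>VCat D\<^esub> ctgt D (med1 f g) = ctgt D g"
    using S.onA_comp'[of "med1 f g" "p1 (Cod (HCat D) f) (Cod (HCat D) g)"]
      S.onA_comp'[of "med1 f g" "p1' (Cod (HCat D) f) (Cod (HCat D) g)"]
      T.onA_comp'[of "med1 f g" "p1 (Cod (HCat D) f) (Cod (HCat D) g)"]
      T.onA_comp'[of "med1 f g" "p1' (Cod (HCat D) f) (Cod (HCat D) g)"] assms o
    by (simp_all del: S.onA_comp' T.onA_comp')
  show "csrc D (med1 f g) = med0 (csrc D f) (csrc D g)"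
    by (rule eq0I[of "hsrc D (Cod (HCat D) f)" "hsrc D (Cod (HCat D) g)"]) (use assms o e in simp_all)
  show "ctgt D (med1 f g) = med0 (ctgt D f) (ctgt D g)"
    by (rule eq0I[of "htgt D (Cod (HCat D) f)" "htgt D (Cod (HCat D) g)"]) (use assms o e in simp_all)
qed

lemma med0_idt [simp]:
  "A \<in> Ob (VCat D) \<Longrightarrow> B \<in> Ob (VCat D) \<Longrightarrow> med0 (p0 A B) (p0' A B) = Idt (VCat D) (P0 A B)"
  by (rule eq0I[of A B]) simp_all

lemma cunit_med0 [simp]:
  assumes "f \<in> Ar (VCat D)" "g \<in> Ar (VCat D)" "Dom (VCat D) f = Dom (VCat D) g"
    "Cod (VCat D) f = A" "Cod (VCat D) g = B"
  shows "cunit D (p0 A B) \<bullet> cunit D (med0 f g) = cunit D f"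
    "cunit D (p0' A B) \<bullet> cunit D (med0 f g) = cunit D g"
proof -
  have "A \<in> Ob (VCat D)" "B \<in> Ob (VCat D)" using assms by auto
  then show "cunit D (p0 A B) \<bullet> cunit D (med0 f g) = cunit D f"
    "cunit D (p0' A B) \<bullet> cunit D (med0 f g) = cunit D g"
    using U.onA_comp'[of "med0 f g" "p0 A B"] U.onA_comp'[of "med0 f g" "p0' A B"] assms by simp_all
qed

text \<open>The canonical comparison from a composite of products to the product of the composites;
  together with \<open>prod_unit\<close> it becomes the structure of the product functor.\<close>

definition prod_comp where
  "prod_comp M M' N N' = med1 (p1 M M' \<star> p1 N N') (p1' M M' \<star> p1' N N')"

definition prod_unit where
  "prod_unit A B = med1 (cunit D (p0 A B)) (cunit D (p0' A B))"

lemma prod_comp_simps [simp]: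
  assumes "M \<in> HOb D" "N \<in> HOb D" "M' \<in> HOb D" "N' \<in> HOb D" "hsrc D M = htgt D N" "hsrc D M' = htgt D N'"
  shows "prod_comp M M' N N' \<in> Cells D" "Dom (HCat D) (prod_comp M M' N N') = P1 M M' \<odot> P1 N N'"
    "Cod (HCat D) (prod_comp M M' N N') = P1 (M \<odot> N) (M' \<odot> N')"
    "csrc D (prod_comp M M' N N') = Idt (VCat D) (P0 (hsrc D N) (hsrc D N'))"
    "ctgt D (prod_comp M M' N N') = Idt (VCat D) (P0 (htgt D M) (htgt D M'))"
    "p1 (M \<odot> N) (M' \<odot> N') \<bullet> prod_comp M M' N N' = p1 M M' \<star> p1 N N'"
    "p1' (M \<odot> N) (M' \<odot> N') \<bullet> prod_comp M M' N N' = p1' M M' \<star> p1' N N'"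
  using assms by (simp_all add: prod_comp_def)

lemma prod_comp_tail [simp]:
  assumes "M \<in> HOb D" "N \<in> HOb D" "M' \<in> HOb D" "N' \<in> HOb D" "hsrc D M = htgt D N" "hsrc D M' = htgt D N'"
    "x \<in> Cells D" "P1 M M' \<odot> P1 N N' = Cod (HCat D) x"
  shows "p1 (M \<odot> N) (M' \<odot> N') \<bullet> (prod_comp M M' N N' \<bullet> x) = (p1 M M' \<star> p1 N N') \<bullet> x"
    "p1' (M \<odot> N) (M' \<odot> N') \<bullet> (prod_comp M M' N N' \<bullet> x) = (p1' M M' \<star> p1' N N') \<bullet> x"
  using assms H.comp_tail[OF prod_comp_simps(6)[OF assms(1-6)], of x]
    H.comp_tail[OF prod_comp_simps(7)[OF assms(1-6)], of x] by simp_all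

lemma prod_unit_simps [simp]:
  assumes "A \<in> Ob (VCat D)" "B \<in> Ob (VCat D)"
  shows "prod_unit A B \<in> Cells D" "Dom (HCat D) (prod_unit A B) = hunit D (P0 A B)"
    "Cod (HCat D) (prod_unit A B) = P1 (hunit D A) (hunit D B)"
    "csrc D (prod_unit A B) = Idt (VCat D) (P0 A B)" "ctgt D (prod_unit A B) = Idt (VCat D) (P0 A B)"
    "p1 (hunit D A) (hunit D B) \<bullet> prod_unit A B = cunit D (p0 A B)"
    "p1' (hunit D A) (hunit D B) \<bullet> prod_unit A B = cunit D (p0' A B)"
  using assms by (simp_all add: prod_unit_def)

lemma prod_unit_tail [simp]:
  assumes "A \<in> Ob (VCat D)" "B \<in> Ob (VCat D)" "x \<in> Cells D" "hunit D (P0 A B) = Cod (HCat D) x"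
  shows "p1 (hunit D A) (hunit D B) \<bullet> (prod_unit A B \<bullet> x) = cunit D (p0 A B) \<bullet> x"
    "p1' (hunit D A) (hunit D B) \<bullet> (prod_unit A B \<bullet> x) = cunit D (p0' A B) \<bullet> x"
  using assms H.comp_tail[OF prod_unit_simps(6)[OF assms(1,2)], of x]
    H.comp_tail[OF prod_unit_simps(7)[OF assms(1,2)], of x] by simp_all

definition prod_functor where
  "prod_functor = \<lparr>F0 = \<lparr>onO = (\<lambda>(A, B). P0 A B),
       onA = (\<lambda>(f, g). med0 (f \<cdot>\<^bsub>VCat D\<^esub> p0 (Dom (VCat D) f) (Dom (VCat D) g)) (g \<cdot>\<^bsub>VCat D\<^esub> p0' (Dom (VCat D) f) (Dom (VCat D) g)))\<rparr>,
     F1 = \<lparr>onO = (\<lambda>(M, N). P1 M N),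
       onA = (\<lambda>(\<alpha>, \<beta>). med1 (\<alpha> \<bullet> p1 (Dom (HCat D) \<alpha>) (Dom (HCat D) \<beta>)) (\<beta> \<bullet> p1' (Dom (HCat D) \<alpha>) (Dom (HCat D) \<beta>)))\<rparr>,
     FComp = (\<lambda>(M, M') (N, N'). prod_comp M M' N N'),
     FUnit = (\<lambda>(A, B). prod_unit A B)\<rparr>"

lemma prod_functor_simps [simp]:
  "onO (F0 prod_functor) (A, B) = P0 A B"
  "onA (F0 prod_functor) (f, g) = med0 (f \<cdot>\<^bsub>VCat D\<^esub> p0 (Dom (VCat D) f) (Dom (VCat D) g)) (g \<cdot>\<^bsub>VCat D\<^esub> p0' (Dom (VCat D) f) (Dom (VCat D) g))"
  "onO (F1 prod_functor) (M, N) = P1 M N"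
  "onA (F1 prod_functor) (\<alpha>, \<beta>) = med1 (\<alpha> \<bullet> p1 (Dom (HCat D) \<alpha>) (Dom (HCat D) \<beta>)) (\<beta> \<bullet> p1' (Dom (HCat D) \<alpha>) (Dom (HCat D) \<beta>))"
  "FComp prod_functor (M, M') (N, N') = prod_comp M M' N N'"
  "FUnit prod_functor (A, B) = prod_unit A B"
  by (simp_all add: prod_functor_def)

text \<open>Every axiom is an equation between arrows into a product and is checked on the two
  projections, where it reduces to interchange and to naturality of the structure cells of
  \<open>D\<close>.\<close>

lemma lax_prod_functor: "lax_double_functor (prod_dblcat D D) D prod_functor"
proof (rule lax_double_functor.intro)
  show "double_category D" by unfold_locales
  then show "double_category (prod_dblcat D D)" by (intro double_category_prod_dblcat)
  show "cat_functor (VCat (prod_dblcat D D)) (VCat D) (F0 prod_functor)"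
  proof (rule cat_functorI)
    fix f g assume "f \<in> Ar (VCat (prod_dblcat D D))" "g \<in> Ar (VCat (prod_dblcat D D))"
      "Dom (VCat (prod_dblcat D D)) g = Cod (VCat (prod_dblcat D D)) f"
    then show "onA (F0 prod_functor) (Comp (VCat (prod_dblcat D D)) g f)
      = onA (F0 prod_functor) g \<cdot>\<^bsub>VCat D\<^esub> onA (F0 prod_functor) f"
      by (cases f; cases g)
         (auto intro: eq0I[of "Cod (VCat D) (fst g)" "Cod (VCat D) (snd g)"])
  qed (auto simp: VCat_category)
  show "cat_functor (HCat (prod_dblcat D D)) (HCat D) (F1 prod_functor)"
  proof (rule cat_functorI)
    fix f assume "f \<in> HOb (prod_dblcat D D)"
    then show "onA (F1 prod_functor) (cell_id (prod_dblcat D D) f) = cell_id D (onO (F1 prod_functor) f)"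
      by (cases f) (auto intro: eq1I[of "fst f" "snd f"])
  next
    fix f g assume "f \<in> Cells (prod_dblcat D D)" "g \<in> Cells (prod_dblcat D D)"
      "Dom (HCat (prod_dblcat D D)) g = Cod (HCat (prod_dblcat D D)) f"
    then show "onA (F1 prod_functor) (Comp (HCat (prod_dblcat D D)) g f)
      = onA (F1 prod_functor) g \<bullet> onA (F1 prod_functor) f"
      by (cases f; cases g)
         (auto intro: eq1I[of "Cod (HCat D) (fst g)" "Cod (HCat D) (snd g)"])
  qed (auto simp: HCat_category)
next
  fix M N assume "(M, N) \<in> Ob (composable_cat (prod_dblcat D D))"
  then show "FComp prod_functor M N \<in> globular D (HComp D (onO (F1 prod_functor) M) (onO (F1 prod_functor) N))
       (onO (F1 prod_functor) (HComp (prod_dblcat D D) M N))"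
    by (cases M; cases N) (auto intro!: globularI)
next
  fix \<alpha> M M' \<beta> N N'
  assume a: "\<alpha> \<in> hom (HCat (prod_dblcat D D)) M M'" "\<beta> \<in> hom (HCat (prod_dblcat D D)) N N'"
    "(\<alpha>, \<beta>) \<in> Ar (composable_cat (prod_dblcat D D))"
  obtain \<alpha>1 \<alpha>2 \<beta>1 \<beta>2 where e: "\<alpha> = (\<alpha>1, \<alpha>2)" "\<beta> = (\<beta>1, \<beta>2)" by (cases \<alpha>; cases \<beta>)
  show "FComp prod_functor M' N' \<bullet> (onA (F1 prod_functor) \<alpha> \<star> onA (F1 prod_functor) \<beta>)
    = onA (F1 prod_functor) (CComp (prod_dblcat D D) \<alpha> \<beta>) \<bullet> FComp prod_functor M N"
    by (rule eq1I[of "Cod (HCat D) \<alpha>1 \<odot> Cod (HCat D) \<beta>1" "Cod (HCat D) \<alpha>2 \<odot> Cod (HCat D) \<beta>2"])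
       (use a e in \<open>auto simp: interchange cells_composable\<close>)
next
  fix A assume "A \<in> Ob (VCat (prod_dblcat D D))"
  then show "FUnit prod_functor A \<in> globular D (hunit D (onO (F0 prod_functor) A)) (onO (F1 prod_functor) (hunit (prod_dblcat D D) A))"
    by (cases A) (auto intro!: globularI)
next
  fix f A B assume a: "f \<in> hom (VCat (prod_dblcat D D)) A B"
  obtain B1 B2 f1 f2 where e: "B = (B1, B2)" "f = (f1, f2)" by (cases B; cases f)
  show "FUnit prod_functor B \<bullet> cunit D (onA (F0 prod_functor) f)
    = onA (F1 prod_functor) (cunit (prod_dblcat D D) f) \<bullet> FUnit prod_functor A"
    by (rule eq1I[of "hunit D B1" "hunit D B2"]) (use a e in auto)
next
  fix M N P assume a: "(M, N) \<in> Ob (composable_cat (prod_dblcat D D))" "(N, P) \<in> Ob (composable_cat (prod_dblcat D D))"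
  obtain M1 M2 N1 N2 P1' P2' where e: "M = (M1, M2)" "N = (N1, N2)" "P = (P1', P2')" by (cases M; cases N; cases P)
  show "onA (F1 prod_functor) (Assoc (prod_dblcat D D) M N P) \<bullet> FComp prod_functor (HComp (prod_dblcat D D) M N) P
      \<bullet> (FComp prod_functor M N \<star> cell_id D (onO (F1 prod_functor) P))
    = FComp prod_functor M (HComp (prod_dblcat D D) N P) \<bullet> (cell_id D (onO (F1 prod_functor) M) \<star> FComp prod_functor N P)
      \<bullet> Assoc D (onO (F1 prod_functor) M) (onO (F1 prod_functor) N) (onO (F1 prod_functor) P)"
    by (rule eq1I[of "M1 \<odot> (N1 \<odot> P1')" "M2 \<odot> (N2 \<odot> P2')"])
       (use a e in \<open>auto simp: interchange Assoc_nat H.comp_tail[OF interchange]\<close>)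
next
  fix M assume a: "M \<in> HOb (prod_dblcat D D)"
  obtain M1 M2 where e: "M = (M1, M2)" by (cases M)
  show "onA (F1 prod_functor) (LUnit (prod_dblcat D D) M) \<bullet> FComp prod_functor (hunit (prod_dblcat D D) (htgt (prod_dblcat D D) M)) M
     \<bullet> (FUnit prod_functor (htgt (prod_dblcat D D) M) \<star> cell_id D (onO (F1 prod_functor) M)) = LUnit D (onO (F1 prod_functor) M)"
    by (rule eq1I[of M1 M2])
       (use a e LUnit_natural[of "p1 M1 M2" "P1 M1 M2" M1] LUnit_natural[of "p1' M1 M2" "P1 M1 M2" M2] in
         \<open>auto simp: interchange\<close>)
  show "onA (F1 prod_functor) (RUnit (prod_dblcat D D) M) \<bullet> FComp prod_functor M (hunit (prod_dblcat D D) (hsrc (prod_dblcat D D) M))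
     \<bullet> (cell_id D (onO (F1 prod_functor) M) \<star> FUnit prod_functor (hsrc (prod_dblcat D D) M)) = RUnit D (onO (F1 prod_functor) M)"
    by (rule eq1I[of M1 M2])
       (use a e RUnit_natural[of "p1 M1 M2" "P1 M1 M2" M1] RUnit_natural[of "p1' M1 M2" "P1 M1 M2" M2] in
         \<open>auto simp: interchange\<close>)
qed auto

end

section \<open>The right adjoint of the diagonal\<close>

context cartesian_products
begin

text \<open>Composites and units of products are products again, and the comparison cell is the
  mediating arrow between two products of the same pair, hence invertible.\<close>

lemma double_functor_prod_functor: "double_functor (prod_dblcat D D) D prod_functor"
proof -
  have "is_iso (HCat D) (FComp prod_functor M N)" if a: "(M, N) \<in> Ob (composable_cat (prod_dblcat D D))" for M N
  proof -
    obtain M1 M2 N1 N2 where e: "M = (M1, M2)" "N = (N1, N2)" by (cases M; cases N)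
    have o: "M1 \<in> HOb D" "N1 \<in> HOb D" "M2 \<in> HOb D" "N2 \<in> HOb D" "hsrc D M1 = htgt D N1" "hsrc D M2 = htgt D N2"
      using a by (auto simp: e)
    show ?thesis using H.product_unique_iso[OF prod1 prod_hcomp[OF o]] o by (simp add: e prod_comp_def prod_unit_def med1_def)
  qed
  moreover have "is_iso (HCat D) (FUnit prod_functor A)" if a: "A \<in> Ob (VCat (prod_dblcat D D))" for A
  proof -
    obtain A1 A2 where e: "A = (A1, A2)" by (cases A)
    have o: "A1 \<in> Ob (VCat D)" "A2 \<in> Ob (VCat D)" using a by (auto simp: e)
    show ?thesis using H.product_unique_iso[OF prod1 prod_hunit[OF o]] o by (simp add: e prod_comp_def prod_unit_def med1_def)
  qed
  ultimately show ?thesis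
    by (auto simp: double_functor_def double_functor_axioms_def lax_prod_functor)
qed

theorem has_right_adjoint_diag: "has_right_adjoint D (prod_dblcat D D) (diag_dblfun D)"
proof -
  \<comment> \<open>As for products in a category, the unit consists of diagonals and the counit of
    pairs of projections.\<close>
  define \<eta> where
    "\<eta> = \<lparr>vt0 = (\<lambda>A. med0 (Idt (VCat D) A) (Idt (VCat D) A)), vt1 = (\<lambda>M. med1 (cell_id D M) (cell_id D M))\<rparr>"
  define \<epsilon> where
    "\<epsilon> = \<lparr>vt0 = (\<lambda>(A, B). (p0 A B, p0' A B)), vt1 = (\<lambda>(M, N). (p1 M N, p1' M N))\<rparr>"
  have e [simp]: "vt0 \<eta> A = med0 (Idt (VCat D) A) (Idt (VCat D) A)" "vt1 \<eta> M = med1 (cell_id D M) (cell_id D M)"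
    "vt0 \<epsilon> (A, B) = (p0 A B, p0' A B)" "vt1 \<epsilon> (M, N) = (p1 M N, p1' M N)" for A M B N
    by (simp_all add: \<eta>_def \<epsilon>_def)
  have D: "double_category D" by unfold_locales
  have d: "double_functor D (prod_dblcat D D) (diag_dblfun D)" by (rule double_functor_diag_dblfun[OF D])
  then have ld: "lax_double_functor D (prod_dblcat D D) (diag_dblfun D)" by (simp add: double_functor_def)
  have "double_adjunction D (prod_dblcat D D) (diag_dblfun D) prod_functor \<eta> \<epsilon>"
  proof (rule double_adjunction.intro[OF d double_functor_prod_functor])
    show "vertical_transformation D D (id_dblfun D) (comp_dblfun D prod_functor (diag_dblfun D)) \<eta>"
    proof (rule vertical_transformation.intro[OF lax_id_dblfun[OF D] lax_comp_dblfun[OF ld lax_prod_functor]])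
      fix f A B assume a: "f \<in> hom (VCat D) A B"
      show "vt0 \<eta> B \<cdot>\<^bsub>VCat D\<^esub> onA (F0 (id_dblfun D)) f = onA (F0 (comp_dblfun D prod_functor (diag_dblfun D))) f \<cdot>\<^bsub>VCat D\<^esub> vt0 \<eta> A"
        by (rule eq0I[of B B]) (use a in auto)
    next
      fix f A B assume a: "f \<in> hom (HCat D) A B"
      show "vt1 \<eta> B \<bullet> onA (F1 (id_dblfun D)) f = onA (F1 (comp_dblfun D prod_functor (diag_dblfun D))) f \<bullet> vt1 \<eta> A"
        by (rule eq1I[of B B]) (use a in auto)
    next
      fix M N assume a: "(M, N) \<in> Ob (composable_cat D)"
      show "vt1 \<eta> (M \<odot> N) \<bullet> FComp (id_dblfun D) M N = FComp (comp_dblfun D prod_functor (diag_dblfun D)) M N \<bullet> (vt1 \<eta> M \<star> vt1 \<eta> N)"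
        by (rule eq1I[of "M \<odot> N" "M \<odot> N"]) (use a in \<open>auto simp: interchange\<close>)
    next
      fix A assume a: "A \<in> Ob (VCat D)"
      show "vt1 \<eta> (hunit D A) \<bullet> FUnit (id_dblfun D) A = FUnit (comp_dblfun D prod_functor (diag_dblfun D)) A \<bullet> cunit D (vt0 \<eta> A)"
        by (rule eq1I[of "hunit D A" "hunit D A"]) (use a in auto)
    qed auto
    show "vertical_transformation (prod_dblcat D D) (prod_dblcat D D) (comp_dblfun (prod_dblcat D D) (diag_dblfun D) prod_functor)
       (id_dblfun (prod_dblcat D D)) \<epsilon>"
    proof (rule vertical_transformation.intro[OF lax_comp_dblfun[OF lax_prod_functor ld] lax_id_dblfun[OF double_category_prod_dblcat[OF D D]]])
    qed (auto simp: cells_composable)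
  next
    fix B assume a: "B \<in> Ob (VCat (prod_dblcat D D))"
    show "onA (F0 prod_functor) (vt0 \<epsilon> B) \<cdot>\<^bsub>VCat D\<^esub> vt0 \<eta> (onO (F0 prod_functor) B) = Idt (VCat D) (onO (F0 prod_functor) B)"
      by (rule eq0I[of "fst B" "snd B"]; use a in \<open>cases B; auto\<close>)
  next
    fix B assume a: "B \<in> HOb (prod_dblcat D D)"
    show "onA (F1 prod_functor) (vt1 \<epsilon> B) \<bullet> vt1 \<eta> (onO (F1 prod_functor) B) = cell_id D (onO (F1 prod_functor) B)"
      by (rule eq1I[of "fst B" "snd B"]; use a in \<open>cases B; auto\<close>)
  qed auto
  then show ?thesis by (auto simp: has_right_adjoint_def)
qed

end

section \<open>The right adjoint of the functor to the terminal double category\<close>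

context double_category
begin

text \<open>The right adjoint selects \<open>t\<close> and its unit \<open>?U\<close>, with
  \<open>LUnit D ?U\<close> as comparison from ?U \<odot> ?U to \<open>?U\<close>, so that it is a
  double functor and not merely lax. All equations compare arrows into a terminal object.\<close>

theorem has_right_adjoint_unit:
  assumes t: "is_terminal (VCat D) t" and u: "is_terminal (HCat D) (hunit D t)"
  shows "has_right_adjoint D unit_dblcat unit_dblfun"
proof -
  note t1 = V.is_terminalD[OF t] and u1 = H.is_terminalD[OF u]
  let ?U = "hunit D t"
  define G where
    "G = \<lparr>F0 = \<lparr>onO = (\<lambda>_::unit. t), onA = (\<lambda>_::unit. Idt (VCat D) t)\<rparr>, F1 = \<lparr>onO = (\<lambda>_::unit. ?U), onA = (\<lambda>_::unit. cell_id D ?U)\<rparr>,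
      FComp = (\<lambda>(_::unit) (_::unit). LUnit D ?U), FUnit = (\<lambda>_::unit. cell_id D ?U)\<rparr>"
  define \<eta> where
    "\<eta> = \<lparr>vt0 = (\<lambda>A. SOME m. m \<in> hom (VCat D) A t), vt1 = (\<lambda>M. SOME m. m \<in> hom (HCat D) M ?U)\<rparr>"
  define \<epsilon> where "\<epsilon> = \<lparr>vt0 = (\<lambda>_::unit. ()), vt1 = (\<lambda>_::unit. ())\<rparr>"
  have G [simp]: "onO (F0 G) x = t" "onA (F0 G) x = Idt (VCat D) t" "onO (F1 G) x = ?U" "onA (F1 G) x = cell_id D ?U"
    "FComp G x y = LUnit D ?U" "FUnit G x = cell_id D ?U" for x y by (simp_all add: G_def)
  have e0 [simp]: "vt0 \<eta> A \<in> Ar (VCat D)" "Dom (VCat D) (vt0 \<eta> A) = A" "Cod (VCat D) (vt0 \<eta> A) = t"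
    if "A \<in> Ob (VCat D)" for A
  proof -
    have "\<exists>m. m \<in> hom (VCat D) A t" using t1(3)[OF that] by auto
    from someI_ex[OF this] show "vt0 \<eta> A \<in> Ar (VCat D)" "Dom (VCat D) (vt0 \<eta> A) = A" "Cod (VCat D) (vt0 \<eta> A) = t"
      by (simp_all add: \<eta>_def)
  qed
  have e1 [simp]: "vt1 \<eta> M \<in> Cells D" "Dom (HCat D) (vt1 \<eta> M) = M" "Cod (HCat D) (vt1 \<eta> M) = ?U"
    if "M \<in> HOb D" for M
  proof -
    have "\<exists>m. m \<in> hom (HCat D) M ?U" using u1(3)[OF that] by auto
    from someI_ex[OF this] show "vt1 \<eta> M \<in> Cells D" "Dom (HCat D) (vt1 \<eta> M) = M" "Cod (HCat D) (vt1 \<eta> M) = ?U"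
      by (simp_all add: \<eta>_def)
  qed
  note [simp] = t1(1) u1(1)
  have s [simp]: "csrc D (vt1 \<eta> M) = vt0 \<eta> (hsrc D M)" "ctgt D (vt1 \<eta> M) = vt0 \<eta> (htgt D M)" if "M \<in> HOb D" for M
    by (rule t1(2); use that in simp)+
  have D: "double_category D" by unfold_locales
  have i: "is_iso unit_cat x" for x by (auto simp: is_iso_def)
  have lG: "lax_double_functor unit_dblcat D G"
  proof (rule lax_double_functor.intro[OF double_category_unit_dblcat D])
    show "cat_functor (VCat unit_dblcat) (VCat D) (F0 G)" by (rule cat_functorI) (auto simp: VCat_category)
    show "cat_functor (HCat unit_dblcat) (HCat D) (F1 G)" by (rule cat_functorI) (auto simp: HCat_category)
  qed (auto intro!: globularI u1(2))
  then have dG: "double_functor unit_dblcat D G"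
    by (auto simp: double_functor_def double_functor_axioms_def H.is_iso_idt)
  have d: "double_functor D unit_dblcat unit_dblfun" by (rule double_functor_unit_dblfun[OF D])
  then have ld: "lax_double_functor D unit_dblcat unit_dblfun" by (simp add: double_functor_def)
  have "double_adjunction D unit_dblcat unit_dblfun G \<eta> \<epsilon>"
  proof (rule double_adjunction.intro[OF d dG])
    show "vertical_transformation D D (id_dblfun D) (comp_dblfun D G unit_dblfun) \<eta>"
    proof (rule vertical_transformation.intro[OF lax_id_dblfun[OF D] lax_comp_dblfun[OF ld lG]])
    qed (auto intro!: t1(2) u1(2))
    show "vertical_transformation unit_dblcat unit_dblcat (comp_dblfun unit_dblcat unit_dblfun G) (id_dblfun unit_dblcat) \<epsilon>"
      by (rule vertical_transformation.intro[OF lax_comp_dblfun[OF lG ld] lax_id_dblfun[OF double_category_unit_dblcat]]) auto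
  qed (auto intro!: t1(2) u1(2))
  then show ?thesis by (auto simp: has_right_adjoint_def)
qed

end

section \<open>Products of monads and modules\<close>

context double_category
begin

text \<open>The mediating morphism is formed on the underlying object and horizontal arrow. Its
  sides and its compatibility with units and multiplications are verified after the two projections,
  which are monad morphisms.\<close>

lemma monad_productI:
  assumes a: "is_monad_mor D a" "mor_cod a = X" "mor_dom a = P" and b: "is_monad_mor D b" "mor_cod b = Y" "mor_dom b = P"
    and p0: "is_product (VCat D) (mon_ob X) (mon_ob Y) (mon_ob P) (mor_side a) (mor_side b)"
    and p1: "is_product (HCat D) (mon_hor X) (mon_hor Y) (mon_hor P) (mor_cell a) (mor_cell b)"
  shows "is_product (monad_cat D) X Y P a b"
proof (rule MC.is_productI)
  fix f g assume fg: "f \<in> Ar (monad_cat D)" "g \<in> Ar (monad_cat D)" "Dom (monad_cat D) f = Dom (monad_cat D) g"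
    "Cod (monad_cat D) f = X" "Cod (monad_cat D) g = Y"
  have f: "is_monad_mor D f" "mor_cod f = X" and g: "is_monad_mor D g" "mor_cod g = Y" and d: "mor_dom f = mor_dom g"
    using fg by auto
  have P: "is_monad D P" "is_monad D X" "is_monad D Y"
    using is_monad_mor_simps(1,2)[OF a(1)] is_monad_mor_simps(2)[OF b(1)] a b by simp_all
  let ?Z = "mor_dom g"
  define h0 where "h0 = prod_med (VCat D) (mon_ob P) (mor_side a) (mor_side b) (mor_side f) (mor_side g)"
  define h1 where "h1 = prod_med (HCat D) (mon_hor P) (mor_cell a) (mor_cell b) (mor_cell f) (mor_cell g)"
  have h0: "h0 \<in> Ar (VCat D)" "Dom (VCat D) h0 = mon_ob ?Z" "Cod (VCat D) h0 = mon_ob P"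
    "mor_side a \<cdot>\<^bsub>VCat D\<^esub> h0 = mor_side f" "mor_side b \<cdot>\<^bsub>VCat D\<^esub> h0 = mor_side g"
    using V.prod_med[OF p0, of "mor_side f" "mor_side g"] f g d by (simp_all add: h0_def)
  have h1: "h1 \<in> Cells D" "Dom (HCat D) h1 = mon_hor ?Z" "Cod (HCat D) h1 = mon_hor P"
    "mor_cell a \<bullet> h1 = mor_cell f" "mor_cell b \<bullet> h1 = mor_cell g"
    using H.prod_med[OF p1, of "mor_cell f" "mor_cell g"] f g d by (simp_all add: h1_def)
  have s: "csrc D h1 = h0"
    by (rule V.prod_eqI[OF p0])
       (use h0 h1 a b f g d P S.onA_comp'[of h1 "mor_cell a"] S.onA_comp'[of h1 "mor_cell b"] in simp_all)
  have t: "ctgt D h1 = h0"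
    by (rule V.prod_eqI[OF p0])
       (use h0 h1 a b f g d P T.onA_comp'[of h1 "mor_cell a"] T.onA_comp'[of h1 "mor_cell b"] in simp_all)
  have u: "cunit D (mor_side a) \<bullet> cunit D h0 = cunit D (mor_side f)" "cunit D (mor_side b) \<bullet> cunit D h0 = cunit D (mor_side g)"
    using U.onA_comp'[of h0 "mor_side a"] U.onA_comp'[of h0 "mor_side b"] h0 a b by simp_all
  have un: "h1 \<bullet> mon_unit ?Z = mon_unit P \<bullet> cunit D h0"
  proof (rule H.prod_eqI[OF p1])
    show "mor_cell a \<bullet> (h1 \<bullet> mon_unit ?Z) = mor_cell a \<bullet> (mon_unit P \<bullet> cunit D h0)"
      using is_monad_mor_laws(1)[OF f(1)] H.comp_tail[OF is_monad_mor_laws(1)[OF a(1)], of "cunit D h0"]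
        H.comp_tail[OF h1(4), of "mon_unit ?Z"] h0 h1 a f g d u P by simp
    show "mor_cell b \<bullet> (h1 \<bullet> mon_unit ?Z) = mor_cell b \<bullet> (mon_unit P \<bullet> cunit D h0)"
      using is_monad_mor_laws(1)[OF g(1)] H.comp_tail[OF is_monad_mor_laws(1)[OF b(1)], of "cunit D h0"]
        H.comp_tail[OF h1(5), of "mon_unit ?Z"] h0 h1 b f g d u P by simp
  qed (use h0 h1 P g s t in auto)
  have mu: "h1 \<bullet> mon_mult ?Z = mon_mult P \<bullet> (h1 \<star> h1)"
  proof (rule H.prod_eqI[OF p1])
    show "mor_cell a \<bullet> (h1 \<bullet> mon_mult ?Z) = mor_cell a \<bullet> (mon_mult P \<bullet> (h1 \<star> h1))"
      using is_monad_mor_laws(2)[OF f(1)] H.comp_tail[OF is_monad_mor_laws(2)[OF a(1)], of "h1 \<star> h1"]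
        H.comp_tail[OF h1(4), of "mon_mult ?Z"] h0 h1 a f g d P s t by (simp add: interchange)
    show "mor_cell b \<bullet> (h1 \<bullet> mon_mult ?Z) = mor_cell b \<bullet> (mon_mult P \<bullet> (h1 \<star> h1))"
      using is_monad_mor_laws(2)[OF g(1)] H.comp_tail[OF is_monad_mor_laws(2)[OF b(1)], of "h1 \<star> h1"]
        H.comp_tail[OF h1(5), of "mon_mult ?Z"] h0 h1 b f g d P s t by (simp add: interchange)
  qed (use h0 h1 P g s t in auto)
  let ?h = "MonadMor ?Z P h0 h1"
  have h: "is_monad_mor D ?h" by (rule is_monad_morI) (use h0 h1 s t un mu g P in auto)
  show "\<exists>m\<in>Ar (monad_cat D). Dom (monad_cat D) m = Dom (monad_cat D) g \<and> Cod (monad_cat D) m = P \<and>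
      a \<cdot>\<^bsub>monad_cat D\<^esub> m = f \<and> b \<cdot>\<^bsub>monad_cat D\<^esub> m = g"
    by (rule bexI[of _ ?h]) (use h h0 h1 a b f g d in \<open>auto intro!: monad_mor_eqI\<close>)
next
  fix h k assume h: "h \<in> Ar (monad_cat D)" "k \<in> Ar (monad_cat D)" "Cod (monad_cat D) h = P" "Cod (monad_cat D) k = P"
    "Dom (monad_cat D) h = Dom (monad_cat D) k" "a \<cdot>\<^bsub>monad_cat D\<^esub> h = a \<cdot>\<^bsub>monad_cat D\<^esub> k" "b \<cdot>\<^bsub>monad_cat D\<^esub> h = b \<cdot>\<^bsub>monad_cat D\<^esub> k"
  have e: "mor_side a \<cdot>\<^bsub>VCat D\<^esub> mor_side h = mor_side a \<cdot>\<^bsub>VCat D\<^esub> mor_side k" "mor_side b \<cdot>\<^bsub>VCat D\<^esub> mor_side h = mor_side b \<cdot>\<^bsub>VCat D\<^esub> mor_side k"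
    "mor_cell a \<bullet> mor_cell h = mor_cell a \<bullet> mor_cell k" "mor_cell b \<bullet> mor_cell h = mor_cell b \<bullet> mor_cell k"
    using h(6,7) by (metis monad_cat_simps(8,9))+
  show "h = k"
  proof (rule monad_mor_eqI)
    show "mor_side h = mor_side k" by (rule V.prod_eqI[OF p0 e(1,2)]) (use h in simp_all)
    show "mor_cell h = mor_cell k" by (rule H.prod_eqI[OF p1 e(3,4)]) (use h in simp_all)
  qed (use h in auto)
qed (use a b in auto)

text \<open>The products of monads \<open>ps\<close> and \<open>pt\<close> supply the sides of the
  mediating cell as monad morphisms; the products of objects \<open>qs\<close> and \<open>qt\<close>
  serve to show that the sides of \<open>h1\<close> are the vertical arrows of those
  morphisms.\<close>

lemma module_productI:
  assumes a: "is_mod_cell D a" "mc_cod a = X" "mc_dom a = P" and b: "is_mod_cell D b" "mc_cod b = Y" "mc_dom b = P"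
    and ps: "is_product (monad_cat D) (mod_src X) (mod_src Y) (mod_src P) (mc_src a) (mc_src b)"
    and pt: "is_product (monad_cat D) (mod_tgt X) (mod_tgt Y) (mod_tgt P) (mc_tgt a) (mc_tgt b)"
    and qs: "is_product (VCat D) (mon_ob (mod_src X)) (mon_ob (mod_src Y)) (mon_ob (mod_src P)) (mor_side (mc_src a)) (mor_side (mc_src b))"
    and qt: "is_product (VCat D) (mon_ob (mod_tgt X)) (mon_ob (mod_tgt Y)) (mon_ob (mod_tgt P)) (mor_side (mc_tgt a)) (mor_side (mc_tgt b))"
    and p1: "is_product (HCat D) (mod_hor X) (mod_hor Y) (mod_hor P) (mc_cell a) (mc_cell b)"
  shows "is_product (bimodule_cat D) X Y P a b"
proof (rule BC.is_productI)
  fix f g assume fg: "f \<in> Ar (bimodule_cat D)" "g \<in> Ar (bimodule_cat D)" "Dom (bimodule_cat D) f = Dom (bimodule_cat D) g"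
    "Cod (bimodule_cat D) f = X" "Cod (bimodule_cat D) g = Y"
  have f: "is_mod_cell D f" "mc_cod f = X" and g: "is_mod_cell D g" "mc_cod g = Y" and d: "mc_dom f = mc_dom g"
    using fg by auto
  have P: "is_bimodule D P" "is_bimodule D X" "is_bimodule D Y"
    using is_mod_cell_simps(1,2)[OF a(1)] is_mod_cell_simps(2)[OF b(1)] a b by simp_all
  let ?Z = "mc_dom g"
  define hs where "hs = prod_med (monad_cat D) (mod_src P) (mc_src a) (mc_src b) (mc_src f) (mc_src g)"
  define ht where "ht = prod_med (monad_cat D) (mod_tgt P) (mc_tgt a) (mc_tgt b) (mc_tgt f) (mc_tgt g)"
  define h1 where "h1 = prod_med (HCat D) (mod_hor P) (mc_cell a) (mc_cell b) (mc_cell f) (mc_cell g)"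
  have hs: "is_monad_mor D hs" "mor_dom hs = mod_src ?Z" "mor_cod hs = mod_src P"
    "mc_src a \<cdot>\<^bsub>monad_cat D\<^esub> hs = mc_src f" "mc_src b \<cdot>\<^bsub>monad_cat D\<^esub> hs = mc_src g"
    using MC.prod_med[OF ps, of "mc_src f" "mc_src g"] f g d by (simp_all add: hs_def)
  have ht: "is_monad_mor D ht" "mor_dom ht = mod_tgt ?Z" "mor_cod ht = mod_tgt P"
    "mc_tgt a \<cdot>\<^bsub>monad_cat D\<^esub> ht = mc_tgt f" "mc_tgt b \<cdot>\<^bsub>monad_cat D\<^esub> ht = mc_tgt g"
    using MC.prod_med[OF pt, of "mc_tgt f" "mc_tgt g"] f g d by (simp_all add: ht_def)
  have h1: "h1 \<in> Cells D" "Dom (HCat D) h1 = mod_hor ?Z" "Cod (HCat D) h1 = mod_hor P"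
    "mc_cell a \<bullet> h1 = mc_cell f" "mc_cell b \<bullet> h1 = mc_cell g"
    using H.prod_med[OF p1, of "mc_cell f" "mc_cell g"] f g d by (simp_all add: h1_def)
  have hs': "mor_side (mc_src a) \<cdot>\<^bsub>VCat D\<^esub> mor_side hs = mor_side (mc_src f)" "mor_side (mc_src b) \<cdot>\<^bsub>VCat D\<^esub> mor_side hs = mor_side (mc_src g)"
    "mor_cell (mc_src a) \<bullet> mor_cell hs = mor_cell (mc_src f)" "mor_cell (mc_src b) \<bullet> mor_cell hs = mor_cell (mc_src g)"
    using hs(4,5) by (metis monad_cat_simps(8,9))+
  have ht': "mor_side (mc_tgt a) \<cdot>\<^bsub>VCat D\<^esub> mor_side ht = mor_side (mc_tgt f)" "mor_side (mc_tgt b) \<cdot>\<^bsub>VCat D\<^esub> mor_side ht = mor_side (mc_tgt g)"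
    "mor_cell (mc_tgt a) \<bullet> mor_cell ht = mor_cell (mc_tgt f)" "mor_cell (mc_tgt b) \<bullet> mor_cell ht = mor_cell (mc_tgt g)"
    using ht(4,5) by (metis monad_cat_simps(8,9))+
  note hh = is_monad_mor_simps(3-10)[OF hs(1), unfolded hs(2,3)] is_monad_mor_simps(3-10)[OF ht(1), unfolded ht(2,3)]
  have s: "csrc D h1 = mor_side hs"
    by (rule V.prod_eqI[OF qs])
       (use hs' h1 a b f g d P hh S.onA_comp'[of h1 "mc_cell a"] S.onA_comp'[of h1 "mc_cell b"] in simp_all)
  have t: "ctgt D h1 = mor_side ht"
    by (rule V.prod_eqI[OF qt])
       (use ht' h1 a b f g d P hh T.onA_comp'[of h1 "mc_cell a"] T.onA_comp'[of h1 "mc_cell b"] in simp_all)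
  have r: "h1 \<bullet> mod_ract ?Z = mod_ract P \<bullet> (h1 \<star> mor_cell hs)"
  proof (rule H.prod_eqI[OF p1])
    show "mc_cell a \<bullet> (h1 \<bullet> mod_ract ?Z) = mc_cell a \<bullet> (mod_ract P \<bullet> (h1 \<star> mor_cell hs))"
      using is_mod_cell_laws(1)[OF f(1)] H.comp_tail[OF is_mod_cell_laws(1)[OF a(1)], of "h1 \<star> mor_cell hs"]
        H.comp_tail[OF h1(4), of "mod_ract ?Z"] hh hs' h1 a f g d P s t by (simp add: interchange)
    show "mc_cell b \<bullet> (h1 \<bullet> mod_ract ?Z) = mc_cell b \<bullet> (mod_ract P \<bullet> (h1 \<star> mor_cell hs))"
      using is_mod_cell_laws(1)[OF g(1)] H.comp_tail[OF is_mod_cell_laws(1)[OF b(1)], of "h1 \<star> mor_cell hs"]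
        H.comp_tail[OF h1(5), of "mod_ract ?Z"] hh hs' h1 b f g d P s t by (simp add: interchange)
  qed (use h1 P g s t hh in auto)
  have l: "h1 \<bullet> mod_lact ?Z = mod_lact P \<bullet> (mor_cell ht \<star> h1)"
  proof (rule H.prod_eqI[OF p1])
    show "mc_cell a \<bullet> (h1 \<bullet> mod_lact ?Z) = mc_cell a \<bullet> (mod_lact P \<bullet> (mor_cell ht \<star> h1))"
      using is_mod_cell_laws(2)[OF f(1)] H.comp_tail[OF is_mod_cell_laws(2)[OF a(1)], of "mor_cell ht \<star> h1"]
        H.comp_tail[OF h1(4), of "mod_lact ?Z"] hh ht' h1 a f g d P s t by (simp add: interchange)
    show "mc_cell b \<bullet> (h1 \<bullet> mod_lact ?Z) = mc_cell b \<bullet> (mod_lact P \<bullet> (mor_cell ht \<star> h1))"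
      using is_mod_cell_laws(2)[OF g(1)] H.comp_tail[OF is_mod_cell_laws(2)[OF b(1)], of "mor_cell ht \<star> h1"]
        H.comp_tail[OF h1(5), of "mod_lact ?Z"] hh ht' h1 b f g d P s t by (simp add: interchange)
  qed (use h1 P g s t hh in auto)
  let ?h = "ModCell ?Z P hs ht h1"
  have h: "is_mod_cell D ?h" by (rule is_mod_cellI) (use hs ht h1 s t r l g P in auto)
  show "\<exists>m\<in>Ar (bimodule_cat D). Dom (bimodule_cat D) m = Dom (bimodule_cat D) g \<and> Cod (bimodule_cat D) m = P \<and>
      a \<cdot>\<^bsub>bimodule_cat D\<^esub> m = f \<and> b \<cdot>\<^bsub>bimodule_cat D\<^esub> m = g"
    by (rule bexI[of _ ?h]) (use h hs ht h1 a b f g d in \<open>auto intro!: mod_cell_eqI\<close>)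
next
  fix h k assume h: "h \<in> Ar (bimodule_cat D)" "k \<in> Ar (bimodule_cat D)" "Cod (bimodule_cat D) h = P" "Cod (bimodule_cat D) k = P"
    "Dom (bimodule_cat D) h = Dom (bimodule_cat D) k" "a \<cdot>\<^bsub>bimodule_cat D\<^esub> h = a \<cdot>\<^bsub>bimodule_cat D\<^esub> k" "b \<cdot>\<^bsub>bimodule_cat D\<^esub> h = b \<cdot>\<^bsub>bimodule_cat D\<^esub> k"
  have e: "mc_src a \<cdot>\<^bsub>monad_cat D\<^esub> mc_src h = mc_src a \<cdot>\<^bsub>monad_cat D\<^esub> mc_src k" "mc_src b \<cdot>\<^bsub>monad_cat D\<^esub> mc_src h = mc_src b \<cdot>\<^bsub>monad_cat D\<^esub> mc_src k"
    "mc_tgt a \<cdot>\<^bsub>monad_cat D\<^esub> mc_tgt h = mc_tgt a \<cdot>\<^bsub>monad_cat D\<^esub> mc_tgt k" "mc_tgt b \<cdot>\<^bsub>monad_cat D\<^esub> mc_tgt h = mc_tgt b \<cdot>\<^bsub>monad_cat D\<^esub> mc_tgt k"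
    "mc_cell a \<bullet> mc_cell h = mc_cell a \<bullet> mc_cell k" "mc_cell b \<bullet> mc_cell h = mc_cell b \<bullet> mc_cell k"
    using h(6,7) by (metis bimodule_cat_simps(8-10))+
  show "h = k"
  proof (rule mod_cell_eqI)
    show "mc_src h = mc_src k" by (rule MC.prod_eqI[OF ps e(1,2)]) (use h in simp_all)
    show "mc_tgt h = mc_tgt k" by (rule MC.prod_eqI[OF pt e(3,4)]) (use h in simp_all)
    show "mc_cell h = mc_cell k" by (rule H.prod_eqI[OF p1 e(5,6)]) (use h in simp_all)
  qed (use h in auto)
qed (use a b in auto)

end

section \<open>Construction of product monads and product modules\<close>

context double_category_products
begin

text \<open>Unit and multiplication are the only ones for which both projections are monad
  morphisms.\<close>

definition prod_monad where
  "prod_monad X Y = Monad (P0 (mon_ob X) (mon_ob Y)) (P1 (mon_hor X) (mon_hor Y))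
     (med1 (mon_unit X \<bullet> cunit D (p0 (mon_ob X) (mon_ob Y))) (mon_unit Y \<bullet> cunit D (p0' (mon_ob X) (mon_ob Y))))
     (med1 (mon_mult X \<bullet> (p1 (mon_hor X) (mon_hor Y) \<star> p1 (mon_hor X) (mon_hor Y)))
           (mon_mult Y \<bullet> (p1' (mon_hor X) (mon_hor Y) \<star> p1' (mon_hor X) (mon_hor Y))))"

lemma prod_monad_simps [simp]:
  "mon_ob (prod_monad X Y) = P0 (mon_ob X) (mon_ob Y)" "mon_hor (prod_monad X Y) = P1 (mon_hor X) (mon_hor Y)"
  by (simp_all add: prod_monad_def)

lemma prod_monad_cells:
  assumes "is_monad D X" "is_monad D Y"
  shows "mon_unit (prod_monad X Y) \<in> globular D (hunit D (P0 (mon_ob X) (mon_ob Y))) (P1 (mon_hor X) (mon_hor Y))"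
    "mon_mult (prod_monad X Y) \<in> globular D (P1 (mon_hor X) (mon_hor Y) \<odot> P1 (mon_hor X) (mon_hor Y)) (P1 (mon_hor X) (mon_hor Y))"
    "p1 (mon_hor X) (mon_hor Y) \<bullet> mon_unit (prod_monad X Y) = mon_unit X \<bullet> cunit D (p0 (mon_ob X) (mon_ob Y))"
    "p1' (mon_hor X) (mon_hor Y) \<bullet> mon_unit (prod_monad X Y) = mon_unit Y \<bullet> cunit D (p0' (mon_ob X) (mon_ob Y))"
    "p1 (mon_hor X) (mon_hor Y) \<bullet> mon_mult (prod_monad X Y) = mon_mult X \<bullet> (p1 (mon_hor X) (mon_hor Y) \<star> p1 (mon_hor X) (mon_hor Y))"
    "p1' (mon_hor X) (mon_hor Y) \<bullet> mon_mult (prod_monad X Y) = mon_mult Y \<bullet> (p1' (mon_hor X) (mon_hor Y) \<star> p1' (mon_hor X) (mon_hor Y))"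
  using assms by (auto simp: prod_monad_def intro!: globularI)

text \<open>The laws are equations into a product. After a projection each becomes the law of one
  factor, precomposed with projections and adjusted by naturality of the unitors or the
  associator.\<close>

lemma is_monad_prod [simp]:
  assumes "is_monad D X" "is_monad D Y"
  shows "is_monad D (prod_monad X Y)"
proof -
  let ?S = "mon_hor X" and ?T = "mon_hor Y" and ?e = "mon_unit (prod_monad X Y)" and ?m = "mon_mult (prod_monad X Y)"
  let ?P = "P1 (mon_hor X) (mon_hor Y)" and ?p = "p1 (mon_hor X) (mon_hor Y)" and ?p' = "p1' (mon_hor X) (mon_hor Y)"
  note g = globular_simps[OF prod_monad_cells(1)[OF assms]] globular_simps[OF prod_monad_cells(2)[OF assms]]
  note c = prod_monad_cells(3-6)[OF assms]
  note ct = H.comp_tail[OF c(1)] H.comp_tail[OF c(2)] H.comp_tail[OF c(3)] H.comp_tail[OF c(4)]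
  note l = is_monad_laws[OF assms(1)] is_monad_laws[OF assms(2)]
  have sp: "mon_mult X \<bullet> ((mon_unit X \<bullet> cunit D (p0 (mon_ob X) (mon_ob Y))) \<star> ?p) = LUnit D ?S \<bullet> (cunit D (p0 (mon_ob X) (mon_ob Y)) \<star> ?p)"
    "mon_mult Y \<bullet> ((mon_unit Y \<bullet> cunit D (p0' (mon_ob X) (mon_ob Y))) \<star> ?p') = LUnit D ?T \<bullet> (cunit D (p0' (mon_ob X) (mon_ob Y)) \<star> ?p')"
    "mon_mult X \<bullet> (?p \<star> (mon_unit X \<bullet> cunit D (p0 (mon_ob X) (mon_ob Y)))) = RUnit D ?S \<bullet> (?p \<star> cunit D (p0 (mon_ob X) (mon_ob Y)))"
    "mon_mult Y \<bullet> (?p' \<star> (mon_unit Y \<bullet> cunit D (p0' (mon_ob X) (mon_ob Y)))) = RUnit D ?T \<bullet> (?p' \<star> cunit D (p0' (mon_ob X) (mon_ob Y)))"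
    unfolding l(1,2,4,5)[symmetric] using assms by (simp_all add: interchange)
  have as: "mon_mult X \<bullet> ((mon_mult X \<bullet> (?p \<star> ?p)) \<star> ?p) = mon_mult X \<bullet> ((?p \<star> (mon_mult X \<bullet> (?p \<star> ?p))) \<bullet> Assoc D ?P ?P ?P)"
  proof -
    have "mon_mult X \<bullet> ((mon_mult X \<bullet> (?p \<star> ?p)) \<star> ?p) = (mon_mult X \<bullet> (mon_mult X \<star> cell_id D ?S)) \<bullet> ((?p \<star> ?p) \<star> ?p)"
      using assms by (simp add: interchange)
    also have "\<dots> = mon_mult X \<bullet> ((cell_id D ?S \<star> mon_mult X) \<bullet> ((?p \<star> (?p \<star> ?p)) \<bullet> Assoc D ?P ?P ?P))"
      unfolding l(3) using assms by (simp add: Assoc_nat)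
    finally show ?thesis using assms by (simp add: interchange_tail)
  qed
  have as': "mon_mult Y \<bullet> ((mon_mult Y \<bullet> (?p' \<star> ?p')) \<star> ?p') = mon_mult Y \<bullet> ((?p' \<star> (mon_mult Y \<bullet> (?p' \<star> ?p'))) \<bullet> Assoc D ?P ?P ?P)"
  proof -
    have "mon_mult Y \<bullet> ((mon_mult Y \<bullet> (?p' \<star> ?p')) \<star> ?p') = (mon_mult Y \<bullet> (mon_mult Y \<star> cell_id D ?T)) \<bullet> ((?p' \<star> ?p') \<star> ?p')"
      using assms by (simp add: interchange)
    also have "\<dots> = mon_mult Y \<bullet> ((cell_id D ?T \<star> mon_mult Y) \<bullet> ((?p' \<star> (?p' \<star> ?p')) \<bullet> Assoc D ?P ?P ?P))"
      unfolding l(6) using assms by (simp add: Assoc_nat)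
    finally show ?thesis using assms by (simp add: interchange_tail)
  qed
  have 1: "?m \<bullet> (?e \<star> cell_id D ?P) = LUnit D ?P"
    by (rule eq1I[of ?S ?T])
       (use assms g LUnit_natural[of ?p ?P ?S] LUnit_natural[of ?p' ?P ?T] in \<open>simp_all add: c ct interchange sp\<close>)
  have 2: "?m \<bullet> (cell_id D ?P \<star> ?e) = RUnit D ?P"
    by (rule eq1I[of ?S ?T])
       (use assms g RUnit_natural[of ?p ?P ?S] RUnit_natural[of ?p' ?P ?T] in \<open>simp_all add: c ct interchange sp\<close>)
  have 3: "?m \<bullet> (?m \<star> cell_id D ?P) = ?m \<bullet> (cell_id D ?P \<star> ?m) \<bullet> Assoc D ?P ?P ?P"
    by (rule eq1I[of ?S ?T])
       (use assms g in \<open>simp_all add: c ct interchange interchange_tail as as'\<close>)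
  show ?thesis unfolding is_monad_def Let_def
    using assms prod_monad_cells(1,2)[OF assms] 1 2 3 by simp
qed

definition mon_pr where
  "mon_pr X Y = MonadMor (prod_monad X Y) X (p0 (mon_ob X) (mon_ob Y)) (p1 (mon_hor X) (mon_hor Y))"

definition mon_pr' where
  "mon_pr' X Y = MonadMor (prod_monad X Y) Y (p0' (mon_ob X) (mon_ob Y)) (p1' (mon_hor X) (mon_hor Y))"

lemma mon_pr_simps [simp]:
  "mor_dom (mon_pr X Y) = prod_monad X Y" "mor_cod (mon_pr X Y) = X"
  "mor_side (mon_pr X Y) = p0 (mon_ob X) (mon_ob Y)" "mor_cell (mon_pr X Y) = p1 (mon_hor X) (mon_hor Y)"
  "mor_dom (mon_pr' X Y) = prod_monad X Y" "mor_cod (mon_pr' X Y) = Y"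
  "mor_side (mon_pr' X Y) = p0' (mon_ob X) (mon_ob Y)" "mor_cell (mon_pr' X Y) = p1' (mon_hor X) (mon_hor Y)"
  by (simp_all add: mon_pr_def mon_pr'_def)

lemma is_monad_mor_pr [simp]:
  assumes "is_monad D X" "is_monad D Y"
  shows "is_monad_mor D (mon_pr X Y)" "is_monad_mor D (mon_pr' X Y)"
  by (rule is_monad_morI; use assms prod_monad_cells[OF assms] in simp)+

lemma monad_product:
  assumes "is_monad D X" "is_monad D Y"
  shows "is_product (monad_cat D) X Y (prod_monad X Y) (mon_pr X Y) (mon_pr' X Y)"
  by (rule monad_productI) (use assms prod0 prod1 in simp_all)

definition prod_module where
  "prod_module M N = Bimodule (prod_monad (mod_src M) (mod_src N)) (prod_monad (mod_tgt M) (mod_tgt N)) (P1 (mod_hor M) (mod_hor N))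
     (med1 (mod_ract M \<bullet> (p1 (mod_hor M) (mod_hor N) \<star> p1 (mon_hor (mod_src M)) (mon_hor (mod_src N))))
           (mod_ract N \<bullet> (p1' (mod_hor M) (mod_hor N) \<star> p1' (mon_hor (mod_src M)) (mon_hor (mod_src N)))))
     (med1 (mod_lact M \<bullet> (p1 (mon_hor (mod_tgt M)) (mon_hor (mod_tgt N)) \<star> p1 (mod_hor M) (mod_hor N)))
           (mod_lact N \<bullet> (p1' (mon_hor (mod_tgt M)) (mon_hor (mod_tgt N)) \<star> p1' (mod_hor M) (mod_hor N))))"

lemma prod_module_simps [simp]:
  "mod_src (prod_module M N) = prod_monad (mod_src M) (mod_src N)" "mod_tgt (prod_module M N) = prod_monad (mod_tgt M) (mod_tgt N)"
  "mod_hor (prod_module M N) = P1 (mod_hor M) (mod_hor N)"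
  by (simp_all add: prod_module_def)

lemma prod_module_cells:
  fixes M N
  defines "p \<equiv> p1 (mod_hor M) (mod_hor N)" and "p' \<equiv> p1' (mod_hor M) (mod_hor N)"
  assumes "is_bimodule D M" "is_bimodule D N"
  shows "mod_ract (prod_module M N) \<in> globular D (P1 (mod_hor M) (mod_hor N) \<odot> P1 (mon_hor (mod_src M)) (mon_hor (mod_src N))) (P1 (mod_hor M) (mod_hor N))"
    "mod_lact (prod_module M N) \<in> globular D (P1 (mon_hor (mod_tgt M)) (mon_hor (mod_tgt N)) \<odot> P1 (mod_hor M) (mod_hor N)) (P1 (mod_hor M) (mod_hor N))"
    "p \<bullet> mod_ract (prod_module M N) = mod_ract M \<bullet> (p \<star> p1 (mon_hor (mod_src M)) (mon_hor (mod_src N)))"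
    "p' \<bullet> mod_ract (prod_module M N) = mod_ract N \<bullet> (p' \<star> p1' (mon_hor (mod_src M)) (mon_hor (mod_src N)))"
    "p \<bullet> mod_lact (prod_module M N) = mod_lact M \<bullet> (p1 (mon_hor (mod_tgt M)) (mon_hor (mod_tgt N)) \<star> p)"
    "p' \<bullet> mod_lact (prod_module M N) = mod_lact N \<bullet> (p1' (mon_hor (mod_tgt M)) (mon_hor (mod_tgt N)) \<star> p')"
  using assms by (auto simp: prod_module_def intro!: globularI)

text \<open>All module laws for a product follow from those of the two factors by pasting with the
  projections, which are compatible with the actions.\<close>

lemma module_laws_project:
  assumes Q: "is_bimodule D Q" and p: "p \<in> Cells D" "Dom (HCat D) p = M" "Cod (HCat D) p = mod_hor Q"
    and S: "is_monad_mor D s" "mor_cod s = mod_src Q" "csrc D p = mor_side s"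
    and T: "is_monad_mor D t" "mor_cod t = mod_tgt Q" "ctgt D p = mor_side t"
    and r: "r \<in> globular D (M \<odot> mon_hor (mor_dom s)) M" "p \<bullet> r = mod_ract Q \<bullet> (p \<star> mor_cell s)"
    and l: "l \<in> globular D (mon_hor (mor_dom t) \<odot> M) M" "p \<bullet> l = mod_lact Q \<bullet> (mor_cell t \<star> p)"
    and m: "M \<in> HOb D" "hsrc D M = mon_ob (mor_dom s)" "htgt D M = mon_ob (mor_dom t)"
  shows "p \<bullet> (r \<bullet> (cell_id D M \<star> mon_unit (mor_dom s))) = p \<bullet> RUnit D M"
    "p \<bullet> (l \<bullet> (mon_unit (mor_dom t) \<star> cell_id D M)) = p \<bullet> LUnit D M"
    "p \<bullet> (r \<bullet> (r \<star> cell_id D (mon_hor (mor_dom s))))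
      = p \<bullet> (r \<bullet> ((cell_id D M \<star> mon_mult (mor_dom s)) \<bullet> Assoc D M (mon_hor (mor_dom s)) (mon_hor (mor_dom s))))"
    "p \<bullet> (l \<bullet> (mon_mult (mor_dom t) \<star> cell_id D M))
      = p \<bullet> (l \<bullet> ((cell_id D (mon_hor (mor_dom t)) \<star> l) \<bullet> Assoc D (mon_hor (mor_dom t)) (mon_hor (mor_dom t)) M))"
    "p \<bullet> (r \<bullet> (l \<star> cell_id D (mon_hor (mor_dom s))))
      = p \<bullet> (l \<bullet> ((cell_id D (mon_hor (mor_dom t)) \<star> r) \<bullet> Assoc D (mon_hor (mor_dom t)) M (mon_hor (mor_dom s))))"
proof -
  let ?q = "mod_hor Q" and ?s = "mor_cell s" and ?t = "mor_cell t"
  let ?S = "mon_hor (mor_dom s)" and ?T = "mon_hor (mor_dom t)"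
  note g = globular_simps[OF r(1)] globular_simps[OF l(1)]
  note b = is_bimodule_laws[OF Q]
  note ms = is_monad_mor_laws[OF S(1)] and mt = is_monad_mor_laws[OF T(1)]
  note sm = is_monad_mor_simps(3-10)[OF S(1), unfolded S(2)] is_monad_mor_simps(3-10)[OF T(1), unfolded T(2)]
  note md = is_monad_mor_simps(1)[OF S(1)] is_monad_mor_simps(1)[OF T(1)]
  note all = Q p(1-3) S(3) T(3) g m sm md
  note rt = H.comp_tail[OF r(2)] and lt = H.comp_tail[OF l(2)]
  have "p \<bullet> (r \<bullet> (cell_id D M \<star> mon_unit (mor_dom s))) = mod_ract Q \<bullet> (p \<star> (?s \<bullet> mon_unit (mor_dom s)))"
    using all by (simp add: rt interchange)
  also have "\<dots> = (mod_ract Q \<bullet> (cell_id D ?q \<star> mon_unit (mod_src Q))) \<bullet> (p \<star> cunit D (mor_side s))"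
    unfolding ms(1) S(2) using all by (simp add: interchange)
  also have "\<dots> = p \<bullet> RUnit D M"
    unfolding b(1) using RUnit_natural[of p M ?q] all by simp
  finally show "p \<bullet> (r \<bullet> (cell_id D M \<star> mon_unit (mor_dom s))) = p \<bullet> RUnit D M" .
  have "p \<bullet> (l \<bullet> (mon_unit (mor_dom t) \<star> cell_id D M)) = mod_lact Q \<bullet> ((?t \<bullet> mon_unit (mor_dom t)) \<star> p)"
    using all by (simp add: lt interchange)
  also have "\<dots> = (mod_lact Q \<bullet> (mon_unit (mod_tgt Q) \<star> cell_id D ?q)) \<bullet> (cunit D (mor_side t) \<star> p)"
    unfolding mt(1) T(2) using all by (simp add: interchange)
  also have "\<dots> = p \<bullet> LUnit D M"
    unfolding b(2) using LUnit_natural[of p M ?q] all by simp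
  finally show "p \<bullet> (l \<bullet> (mon_unit (mor_dom t) \<star> cell_id D M)) = p \<bullet> LUnit D M" .
  have "p \<bullet> (r \<bullet> (r \<star> cell_id D ?S)) = mod_ract Q \<bullet> ((p \<bullet> r) \<star> ?s)"
    using all by (simp add: rt interchange)
  also have "\<dots> = (mod_ract Q \<bullet> (mod_ract Q \<star> cell_id D (mon_hor (mod_src Q)))) \<bullet> ((p \<star> ?s) \<star> ?s)"
    unfolding r(2) using all by (simp add: interchange)
  also have "\<dots> = mod_ract Q \<bullet> ((p \<star> (mon_mult (mod_src Q) \<bullet> (?s \<star> ?s))) \<bullet> Assoc D M ?S ?S)"
    unfolding b(3) using all by (simp add: Assoc_nat interchange_tail)
  also have "\<dots> = p \<bullet> (r \<bullet> ((cell_id D M \<star> mon_mult (mor_dom s)) \<bullet> Assoc D M ?S ?S))"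
    unfolding ms(2)[unfolded S(2), symmetric] using all by (simp add: rt interchange_tail)
  finally show "p \<bullet> (r \<bullet> (r \<star> cell_id D ?S)) = p \<bullet> (r \<bullet> ((cell_id D M \<star> mon_mult (mor_dom s)) \<bullet> Assoc D M ?S ?S))" .
  have "p \<bullet> (l \<bullet> (mon_mult (mor_dom t) \<star> cell_id D M)) = mod_lact Q \<bullet> ((mon_mult (mod_tgt Q) \<bullet> (?t \<star> ?t)) \<star> p)"
    unfolding mt(2)[unfolded T(2), symmetric] using all by (simp add: lt interchange)
  also have "\<dots> = (mod_lact Q \<bullet> (mon_mult (mod_tgt Q) \<star> cell_id D ?q)) \<bullet> ((?t \<star> ?t) \<star> p)"
    using all by (simp add: interchange)
  also have "\<dots> = mod_lact Q \<bullet> ((?t \<star> (p \<bullet> l)) \<bullet> Assoc D ?T ?T M)"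
    unfolding b(4) l(2) using all by (simp add: Assoc_nat interchange_tail)
  also have "\<dots> = p \<bullet> (l \<bullet> ((cell_id D ?T \<star> l) \<bullet> Assoc D ?T ?T M))"
    using all by (simp add: lt interchange_tail)
  finally show "p \<bullet> (l \<bullet> (mon_mult (mor_dom t) \<star> cell_id D M)) = p \<bullet> (l \<bullet> ((cell_id D ?T \<star> l) \<bullet> Assoc D ?T ?T M))" .
  have "p \<bullet> (r \<bullet> (l \<star> cell_id D ?S)) = mod_ract Q \<bullet> ((p \<bullet> l) \<star> ?s)"
    using all by (simp add: rt interchange)
  also have "\<dots> = (mod_ract Q \<bullet> (mod_lact Q \<star> cell_id D (mon_hor (mod_src Q)))) \<bullet> ((?t \<star> p) \<star> ?s)"
    unfolding l(2) using all by (simp add: interchange)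
  also have "\<dots> = mod_lact Q \<bullet> ((?t \<star> (p \<bullet> r)) \<bullet> Assoc D ?T M ?S)"
    unfolding b(5) r(2) using all by (simp add: Assoc_nat interchange_tail)
  also have "\<dots> = p \<bullet> (l \<bullet> ((cell_id D ?T \<star> r) \<bullet> Assoc D ?T M ?S))"
    using all by (simp add: lt interchange_tail)
  finally show "p \<bullet> (r \<bullet> (l \<star> cell_id D ?S)) = p \<bullet> (l \<bullet> ((cell_id D ?T \<star> r) \<bullet> Assoc D ?T M ?S))" .
qed

lemma is_bimodule_prod [simp]:
  assumes M: "is_bimodule D M" and N: "is_bimodule D N"
  shows "is_bimodule D (prod_module M N)"
proof -
  let ?r = "mod_ract (prod_module M N)" and ?l = "mod_lact (prod_module M N)" and ?P = "P1 (mod_hor M) (mod_hor N)"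
  note c = prod_module_cells[OF M N]
  note g = globular_simps[OF c(1)] globular_simps[OF c(2)]
  note L = module_laws_project[of M "p1 (mod_hor M) (mod_hor N)" ?P "mon_pr (mod_src M) (mod_src N)" "mon_pr (mod_tgt M) (mod_tgt N)" ?r ?l,
      simplified, OF M _ _ _ _ _ _ _ c(1,3,2,5)]
  note L' = module_laws_project[of N "p1' (mod_hor M) (mod_hor N)" ?P "mon_pr' (mod_src M) (mod_src N)" "mon_pr' (mod_tgt M) (mod_tgt N)" ?r ?l,
      simplified, OF N _ _ _ _ _ _ _ c(1,4,2,6)]
  show ?thesis
    by (rule is_bimoduleI; (rule eq1I[of "mod_hor M" "mod_hor N"])?) (use M N c(1,2) g L L' in simp_all)
qed

definition mod_pr where
  "mod_pr M N = ModCell (prod_module M N) M (mon_pr (mod_src M) (mod_src N)) (mon_pr (mod_tgt M) (mod_tgt N)) (p1 (mod_hor M) (mod_hor N))"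

definition mod_pr' where
  "mod_pr' M N = ModCell (prod_module M N) N (mon_pr' (mod_src M) (mod_src N)) (mon_pr' (mod_tgt M) (mod_tgt N)) (p1' (mod_hor M) (mod_hor N))"

lemma mod_pr_simps [simp]:
  "mc_dom (mod_pr M N) = prod_module M N" "mc_cod (mod_pr M N) = M" "mc_src (mod_pr M N) = mon_pr (mod_src M) (mod_src N)"
  "mc_tgt (mod_pr M N) = mon_pr (mod_tgt M) (mod_tgt N)" "mc_cell (mod_pr M N) = p1 (mod_hor M) (mod_hor N)"
  "mc_dom (mod_pr' M N) = prod_module M N" "mc_cod (mod_pr' M N) = N" "mc_src (mod_pr' M N) = mon_pr' (mod_src M) (mod_src N)"
  "mc_tgt (mod_pr' M N) = mon_pr' (mod_tgt M) (mod_tgt N)" "mc_cell (mod_pr' M N) = p1' (mod_hor M) (mod_hor N)"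
  by (simp_all add: mod_pr_def mod_pr'_def)

lemma is_mod_cell_pr [simp]:
  assumes "is_bimodule D M" "is_bimodule D N"
  shows "is_mod_cell D (mod_pr M N)" "is_mod_cell D (mod_pr' M N)"
  by (rule is_mod_cellI; use assms prod_module_cells[OF assms] in simp)+

lemma module_product:
  assumes "is_bimodule D M" "is_bimodule D N"
  shows "is_product (bimodule_cat D) M N (prod_module M N) (mod_pr M N) (mod_pr' M N)"
  by (rule module_productI) (use assms prod0 prod1 monad_product in simp_all)

end

text \<open>The cells formed with \<open>med1\<close> in \<open>coequalizer_product\<close> are the
  products of f with f', of g with g' and of q with q'.\<close>

locale cartesian_quotient_double_category =
  quotient_double_category D + cartesian_products D P0 p0 p0' P1 p1 p1'
  for D :: "('o, 'v, 'h, 'c) dblcat" (structure)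
    and P0 :: "'o \<Rightarrow> 'o \<Rightarrow> 'o" and p0 p0' :: "'o \<Rightarrow> 'o \<Rightarrow> 'v"
    and P1 :: "'h \<Rightarrow> 'h \<Rightarrow> 'h" and p1 p1' :: "'h \<Rightarrow> 'h \<Rightarrow> 'c" +
  fixes t :: 'o
  assumes coequalizer_product: "\<lbrakk>reflexive_globular_pair D R X f g; q \<in> globular D X Q;
        is_coequalizer (HCat D) f g q; reflexive_globular_pair D R' X' f' g'; q' \<in> globular D X' Q';
        is_coequalizer (HCat D) f' g' q'\<rbrakk>
      \<Longrightarrow> is_coequalizer (HCat D) (med1 (f \<bullet> p1 R R') (f' \<bullet> p1' R R')) (med1 (g \<bullet> p1 R R') (g' \<bullet> p1' R R'))
           (med1 (q \<bullet> p1 X X') (q' \<bullet> p1' X X'))"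
    and terminal0: "is_terminal (VCat D) t"
    and terminal1: "is_terminal (HCat D) (hunit D t)"
begin

text \<open>The product of the two quotients coequalizes the products of the two pairs by
  \<open>coequalizer_product\<close>. Since products commute with \<odot>, these are isomorphic to
  the pair that defines the composite of the product modules. Uniqueness of coequalizers then
  identifies that composite with the product of the composites.\<close>

lemma hcomp_module_product:
  assumes N: "is_bimodule D N" and M: "is_bimodule D M" and e: "mod_src N = mod_tgt M"
    and N': "is_bimodule D N'" and M': "is_bimodule D M'" and e': "mod_src N' = mod_tgt M'"
  shows "is_product (bimodule_cat D) (mod_hcomp D N M) (mod_hcomp D N' M')
    (mod_hcomp D (prod_module N N') (prod_module M M'))
    (mod_ccomp D (mod_pr N N') (mod_pr M M')) (mod_ccomp D (mod_pr' N N') (mod_pr' M M'))"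
proof (rule module_productI)
  note as = N M e N' M' e'
  let ?n = "mod_hor N" and ?m = "mod_hor M" and ?n' = "mod_hor N'" and ?m' = "mod_hor M'"
  let ?T = "mon_hor (mod_tgt M)" and ?T' = "mon_hor (mod_tgt M')"
  let ?q = "mod_quot D N M" and ?q' = "mod_quot D N' M'"
  let ?NN = "prod_module N N'" and ?MM = "prod_module M M'"
  let ?R = "(?n \<odot> ?T) \<odot> ?m" and ?R' = "(?n' \<odot> ?T') \<odot> ?m'" and ?X = "?n \<odot> ?m" and ?X' = "?n' \<odot> ?m'"
  let ?Q = "Cod (HCat D) ?q" and ?Q' = "Cod (HCat D) ?q'"
  let ?f = "med1 (lpair N M \<bullet> p1 ?R ?R') (lpair N' M' \<bullet> p1' ?R ?R')"
  let ?g = "med1 (rpair N M \<bullet> p1 ?R ?R') (rpair N' M' \<bullet> p1' ?R ?R')"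
  let ?K = "med1 (?q \<bullet> p1 ?X ?X') (?q' \<bullet> p1' ?X ?X')"
  let ?cX = "prod_comp ?n ?n' ?m ?m'"
  \<comment> \<open>The domain of the parallel pair is a threefold composite, so two comparison
    cells are needed to reach the product of the two domains.\<close>
  let ?cR = "prod_comp (?n \<odot> ?T) (?n' \<odot> ?T') ?m ?m' \<bullet> (prod_comp ?n ?n' ?T ?T' \<star> cell_id D (P1 ?m ?m'))"
  have lr: "lpair N M \<in> Cells D" "Dom (HCat D) (lpair N M) = ?R" "Cod (HCat D) (lpair N M) = ?X"
    "lpair N' M' \<in> Cells D" "Dom (HCat D) (lpair N' M') = ?R'" "Cod (HCat D) (lpair N' M') = ?X'"
    "rpair N M \<in> Cells D" "Dom (HCat D) (rpair N M) = ?R" "Cod (HCat D) (rpair N M) = ?X"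
    "rpair N' M' \<in> Cells D" "Dom (HCat D) (rpair N' M') = ?R'" "Cod (HCat D) (rpair N' M') = ?X'"
    using as by (simp_all add: lpair_def rpair_def)
  have NM: "is_bimodule D ?NN" "is_bimodule D ?MM" "mod_src ?NN = mod_tgt ?MM" using as by simp_all
  have LR: "lpair ?NN ?MM \<in> Cells D" "Dom (HCat D) (lpair ?NN ?MM) = (P1 ?n ?n' \<odot> P1 ?T ?T') \<odot> P1 ?m ?m'"
    "Cod (HCat D) (lpair ?NN ?MM) = P1 ?n ?n' \<odot> P1 ?m ?m'"
    "rpair ?NN ?MM \<in> Cells D" "Dom (HCat D) (rpair ?NN ?MM) = (P1 ?n ?n' \<odot> P1 ?T ?T') \<odot> P1 ?m ?m'"
    "Cod (HCat D) (rpair ?NN ?MM) = P1 ?n ?n' \<odot> P1 ?m ?m'"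
    using as NM globular_simps[OF prod_module_cells(1)[OF N N']] globular_simps[OF prod_module_cells(2)[OF M M']]
    by (simp_all add: lpair_def rpair_def)
  have co: "is_coequalizer (HCat D) ?f ?g ?K"
    by (rule coequalizer_product[OF lpair_rpair_reflexive[OF N M e] mod_quot[OF N M e]
        lpair_rpair_reflexive[OF N' M' e'] mod_quot[OF N' M' e']])
  have iso: "is_iso (HCat D) (prod_comp A A' B B')"
    if "A \<in> HOb D" "B \<in> HOb D" "A' \<in> HOb D" "B' \<in> HOb D" "hsrc D A = htgt D B" "hsrc D A' = htgt D B'" for A A' B B'
    using H.product_unique_iso[OF prod1 prod_hcomp[OF that]] that by (simp add: prod_comp_def med1_def)
  have iX: "is_iso (HCat D) ?cX" by (rule iso) (use as in simp_all)
  have iR: "is_iso (HCat D) ?cR"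
    by (rule H.is_iso_comp) (use as in \<open>auto intro!: iso whisker_iso H.is_iso_idt\<close>)
  have cK: "is_coequalizer (HCat D) (lpair ?NN ?MM) (rpair ?NN ?MM) (?K \<bullet> ?cX)"
  proof (rule H.coequalizer_transport[OF co iR _ iX])
    show "?cX \<bullet> lpair ?NN ?MM = ?f \<bullet> ?cR"
    proof (rule eq1I[of ?X ?X'])
      show "p1 ?X ?X' \<bullet> (?cX \<bullet> lpair ?NN ?MM) = p1 ?X ?X' \<bullet> (?f \<bullet> ?cR)"
        using as lr LR prod_module_cells[OF N N'] globular_simps[OF prod_module_cells(1)[OF N N']]
        by (simp add: interchange, simp add: lpair_def interchange)
      show "p1' ?X ?X' \<bullet> (?cX \<bullet> lpair ?NN ?MM) = p1' ?X ?X' \<bullet> (?f \<bullet> ?cR)"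
        using as lr LR prod_module_cells[OF N N'] globular_simps[OF prod_module_cells(1)[OF N N']]
        by (simp add: interchange, simp add: lpair_def interchange)
    qed (use as lr LR in simp_all)
    show "?cX \<bullet> rpair ?NN ?MM = ?g \<bullet> ?cR"
    proof (rule eq1I[of ?X ?X'])
      show "p1 ?X ?X' \<bullet> (?cX \<bullet> rpair ?NN ?MM) = p1 ?X ?X' \<bullet> (?g \<bullet> ?cR)"
        using as lr LR prod_module_cells[OF M M'] globular_simps[OF prod_module_cells(2)[OF M M']]
        by (simp add: interchange, simp add: rpair_def interchange interchange_tail Assoc_nat)
      show "p1' ?X ?X' \<bullet> (?cX \<bullet> rpair ?NN ?MM) = p1' ?X ?X' \<bullet> (?g \<bullet> ?cR)"
        using as lr LR prod_module_cells[OF M M'] globular_simps[OF prod_module_cells(2)[OF M M']]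
        by (simp add: interchange, simp add: rpair_def interchange interchange_tail Assoc_nat)
    qed (use as lr LR in simp_all)
  qed (use as lr LR in simp_all)
  let ?qq = "mod_quot D ?NN ?MM"
  \<comment> \<open>\<open>k\<close> compares the chosen quotient for the product modules with the
    product of the chosen quotients.\<close>
  define k where "k = factor (HCat D) ?qq (?K \<bullet> ?cX)"
  note q = mod_quot(2)[OF NM]
  have k: "is_iso (HCat D) k" "k \<bullet> ?qq = ?K \<bullet> ?cX" "Dom (HCat D) k = Cod (HCat D) ?qq" "Cod (HCat D) k = P1 ?Q ?Q'"
    using H.coequalizer_unique[OF q cK] as by (simp_all add: k_def)
  have kA: "k \<in> Cells D" by (rule H.is_iso_arr[OF k(1)])
  \<comment> \<open>The product is transported along \<open>k\<close>; the new projections are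
    recognized as the horizontal composites of the module projections by cancelling the
    quotient.\<close>
  have "is_product (HCat D) ?Q ?Q' (Cod (HCat D) ?qq) (p1 ?Q ?Q' \<bullet> k) (p1' ?Q ?Q' \<bullet> k)"
    using H.product_iso_pre[OF prod1 k(1,4)] as k(3) by simp
  moreover have "mc_cell (mod_ccomp D (mod_pr N N') (mod_pr M M')) = p1 ?Q ?Q' \<bullet> k"
    by (rule H.epiD[OF mod_quot_simps(8)[OF NM]])
       (use mod_ccomp_cell(6)[of "mod_pr N N'" "mod_pr M M'"] as k kA mod_quot_simps(1,2)[OF NM] in simp_all)
  moreover have "mc_cell (mod_ccomp D (mod_pr' N N') (mod_pr' M M')) = p1' ?Q ?Q' \<bullet> k"
    by (rule H.epiD[OF mod_quot_simps(8)[OF NM]])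
       (use mod_ccomp_cell(6)[of "mod_pr' N N'" "mod_pr' M M'"] as k kA mod_quot_simps(1,2)[OF NM] in simp_all)
  ultimately show "is_product (HCat D) (mod_hor (mod_hcomp D N M)) (mod_hor (mod_hcomp D N' M'))
     (mod_hor (mod_hcomp D ?NN ?MM)) (mc_cell (mod_ccomp D (mod_pr N N') (mod_pr M M')))
     (mc_cell (mod_ccomp D (mod_pr' N N') (mod_pr' M M')))" by simp
qed (use assms monad_product prod0 in simp_all)

lemma cartesian_products_Mod_dbl:
  "cartesian_products (Mod_dbl D) prod_monad mon_pr mon_pr' prod_module mod_pr mod_pr'"
proof -
  interpret M: double_category "Mod_dbl D" by (rule double_category_Mod_dbl)
  show ?thesis
  proof unfold_locales
    fix X Y assume "X \<in> Ob (VCat (Mod_dbl D))" "Y \<in> Ob (VCat (Mod_dbl D))"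
    then show "is_product (HCat (Mod_dbl D)) (hunit (Mod_dbl D) X) (hunit (Mod_dbl D) Y) (hunit (Mod_dbl D) (prod_monad X Y))
      (cunit (Mod_dbl D) (mon_pr X Y)) (cunit (Mod_dbl D) (mon_pr' X Y))"
      using prod0 prod1 monad_product by (auto intro!: module_productI)
  qed (auto simp: monad_product module_product hcomp_module_product)
qed

text \<open>The trivial monad on \<open>t\<close>. Its laws hold because the unit on
  \<open>t\<close> is terminal among horizontal arrows.\<close>

definition terminal_monad where
  "terminal_monad = Monad t (hunit D t) (cell_id D (hunit D t)) (LUnit D (hunit D t))"

lemma cartesian_double_category_Mod_dbl: "cartesian_double_category (Mod_dbl D)"
proof -
  interpret M: cartesian_products "Mod_dbl D" prod_monad mon_pr mon_pr' prod_module mod_pr mod_pr'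
    by (rule cartesian_products_Mod_dbl)
  note t0 = V.is_terminalD[OF terminal0] and t1 = H.is_terminalD[OF terminal1]
  let ?U = "hunit D t"
  note [simp] = t0(1) t1(1)
  have ts [simp]: "mon_ob terminal_monad = t" "mon_hor terminal_monad = ?U" "mon_unit terminal_monad = cell_id D ?U"
    "mon_mult terminal_monad = LUnit D ?U" by (simp_all add: terminal_monad_def)
  have T: "is_monad D terminal_monad"
    unfolding is_monad_def Let_def by (auto intro!: globularI t1(2))
  have "\<exists>!m. m \<in> hom (monad_cat D) X terminal_monad" if "X \<in> Ob (monad_cat D)" for X
  proof -
    have X: "is_monad D X" using that by simp
    obtain h0 where h0: "h0 \<in> Ar (VCat D)" "Dom (VCat D) h0 = mon_ob X" "Cod (VCat D) h0 = t"
      using t0(3)[of "mon_ob X"] X by auto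
    obtain h1 where h1: "h1 \<in> Cells D" "Dom (HCat D) h1 = mon_hor X" "Cod (HCat D) h1 = ?U"
      using t1(3)[of "mon_hor X"] X by auto
    have s: "csrc D h1 = h0" "ctgt D h1 = h0" by (rule t0(2); use h0 h1 X in simp)+
    have "is_monad_mor D (MonadMor X terminal_monad h0 h1)"
    proof (rule is_monad_morI)
      show "mor_cell (MonadMor X terminal_monad h0 h1) \<bullet> mon_unit (mor_dom (MonadMor X terminal_monad h0 h1))
        = mon_unit (mor_cod (MonadMor X terminal_monad h0 h1)) \<bullet> cunit D (mor_side (MonadMor X terminal_monad h0 h1))"
        "mor_cell (MonadMor X terminal_monad h0 h1) \<bullet> mon_mult (mor_dom (MonadMor X terminal_monad h0 h1))
        = mon_mult (mor_cod (MonadMor X terminal_monad h0 h1)) \<bullet> (mor_cell (MonadMor X terminal_monad h0 h1) \<star> mor_cell (MonadMor X terminal_monad h0 h1))"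
        by (rule t1(2); use X h0 h1 s in simp)+
    qed (use X T h0 h1 s in simp_all)
    moreover have "m = MonadMor X terminal_monad h0 h1" if m: "m \<in> hom (monad_cat D) X terminal_monad" for m
    proof (rule monad_mor_eqI)
      show "mor_side m = mor_side (MonadMor X terminal_monad h0 h1)" by (rule t0(2)) (use m h0 in simp_all)
      show "mor_cell m = mor_cell (MonadMor X terminal_monad h0 h1)" by (rule t1(2)) (use m h1 in simp_all)
    qed (use m in simp_all)
    ultimately show ?thesis by (intro ex1I[of _ "MonadMor X terminal_monad h0 h1"]) auto
  qed
  then have m0: "is_terminal (monad_cat D) terminal_monad" using T by (auto simp: is_terminal_def)
  note mt = MC.is_terminalD[OF m0]
  \<comment> \<open>The unit module of the trivial monad has the terminal horizontal arrow
    underneath, so the underlying cell exists uniquely and compatibility with the actions is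
    automatic; the sides come from the terminality of the monad.\<close>
  have "\<exists>!m. m \<in> hom (bimodule_cat D) X (mod_unit terminal_monad)" if "X \<in> Ob (bimodule_cat D)" for X
  proof -
    have X: "is_bimodule D X" using that by simp
    obtain hs where hs: "is_monad_mor D hs" "mor_dom hs = mod_src X" "mor_cod hs = terminal_monad"
      using mt(3)[of "mod_src X"] X by auto
    obtain ht where ht: "is_monad_mor D ht" "mor_dom ht = mod_tgt X" "mor_cod ht = terminal_monad"
      using mt(3)[of "mod_tgt X"] X by auto
    obtain h1 where h1: "h1 \<in> Cells D" "Dom (HCat D) h1 = mod_hor X" "Cod (HCat D) h1 = ?U"
      using t1(3)[of "mod_hor X"] X by auto
    note hh = is_monad_mor_simps(3-10)[OF hs(1), unfolded hs(2,3)] is_monad_mor_simps(3-10)[OF ht(1), unfolded ht(2,3)]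
    have s: "csrc D h1 = mor_side hs" "ctgt D h1 = mor_side ht" by (rule t0(2); use h1 X hh in simp)+
    let ?h = "ModCell X (mod_unit terminal_monad) hs ht h1"
    have "is_mod_cell D ?h"
    proof (rule is_mod_cellI)
      show "mc_cell ?h \<bullet> mod_ract (mc_dom ?h) = mod_ract (mc_cod ?h) \<bullet> (mc_cell ?h \<star> mor_cell (mc_src ?h))"
        "mc_cell ?h \<bullet> mod_lact (mc_dom ?h) = mod_lact (mc_cod ?h) \<bullet> (mor_cell (mc_tgt ?h) \<star> mc_cell ?h)"
        by (rule t1(2); use X h1 s hh in simp)+
    qed (use X T hs ht h1 s in simp_all)
    moreover have "m = ?h" if m: "m \<in> hom (bimodule_cat D) X (mod_unit terminal_monad)" for m
    proof (rule mod_cell_eqI)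
      show "mc_src m = mc_src ?h" "mc_tgt m = mc_tgt ?h" by (rule mt(2); use m hs ht in simp)+
      show "mc_cell m = mc_cell ?h" by (rule t1(2)) (use m h1 in simp_all)
    qed (use m in simp_all)
    ultimately show ?thesis by (intro ex1I[of _ ?h]) auto
  qed
  then have m1: "is_terminal (bimodule_cat D) (mod_unit terminal_monad)" using T by (auto simp: is_terminal_def)
  show ?thesis
    unfolding cartesian_double_category_def
    using double_category_Mod_dbl M.has_right_adjoint_diag M.has_right_adjoint_unit[of terminal_monad] m0 m1 by simp
qed

end

section \<open>Pullbacks and spans\<close>

locale pullback_category = category E for E :: "('o, 'a) cat" (structure) +
  assumes pullback_ex: "\<lbrakk>f \<in> Ar E; g \<in> Ar E; Cod E f = Cod E g\<rbrakk> \<Longrightarrow> \<exists>p q. is_pullback E f g p q"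
begin

lemma is_pullback_pb:
  assumes "f \<in> Ar E" "g \<in> Ar E" "Cod E f = Cod E g"
  shows "is_pullback E f g (pb1 E f g) (pb2 E f g)"
proof -
  have "\<exists>r. case r of (p, q) \<Rightarrow> is_pullback E f g p q" using pullback_ex[OF assms] by auto
  then have "case pb E f g of (p, q) \<Rightarrow> is_pullback E f g p q" unfolding pb_def by (rule someI_ex)
  then show ?thesis by (simp add: pb1_def pb2_def case_prod_beta)
qed

lemma pb_simps [simp]:
  assumes "f \<in> Ar E" "g \<in> Ar E" "Cod E f = Cod E g"
  shows "pb1 E f g \<in> Ar E" "Cod E (pb1 E f g) = Dom E f"
    "pb2 E f g \<in> Ar E" "Dom E (pb2 E f g) = Dom E (pb1 E f g)" "Cod E (pb2 E f g) = Dom E g"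
  using is_pullback_pb[OF assms] by (auto simp: is_pullback_def)

lemma pb_commutes:
  assumes "f \<in> Ar E" "g \<in> Ar E" "Cod E f = Cod E g"
  shows "f \<cdot> pb1 E f g = g \<cdot> pb2 E f g"
  using is_pullback_pb[OF assms] by (simp add: is_pullback_def)

lemma pb_med:
  assumes "f \<in> Ar E" "g \<in> Ar E" "Cod E f = Cod E g" "x \<in> Ar E" "y \<in> Ar E" "Dom E x = Dom E y"
    "Cod E x = Dom E f" "Cod E y = Dom E g" "f \<cdot> x = g \<cdot> y"
  shows "pb_med E f g x y \<in> Ar E" "Dom E (pb_med E f g x y) = Dom E y"
    "Cod E (pb_med E f g x y) = Dom E (pb1 E f g)"
    "pb1 E f g \<cdot> pb_med E f g x y = x" "pb2 E f g \<cdot> pb_med E f g x y = y"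
proof -
  have "\<exists>!m. m \<in> hom E (Dom E x) (Dom E (pb1 E f g)) \<and> pb1 E f g \<cdot> m = x \<and> pb2 E f g \<cdot> m = y"
    using is_pullback_pb[OF assms(1-3)] assms(4-) unfolding is_pullback_def by (metis in_hom_iff)
  from theI'[OF this] assms(6) show "pb_med E f g x y \<in> Ar E" "Dom E (pb_med E f g x y) = Dom E y"
    "Cod E (pb_med E f g x y) = Dom E (pb1 E f g)"
    "pb1 E f g \<cdot> pb_med E f g x y = x" "pb2 E f g \<cdot> pb_med E f g x y = y"
    unfolding pb_med_def by auto
qed

lemma pb_eqI:
  assumes "f \<in> Ar E" "g \<in> Ar E" "Cod E f = Cod E g" "h \<in> Ar E" "k \<in> Ar E" "Dom E h = Dom E k"
    "Cod E h = Dom E (pb1 E f g)" "Cod E k = Dom E (pb1 E f g)"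
    "pb1 E f g \<cdot> h = pb1 E f g \<cdot> k" "pb2 E f g \<cdot> h = pb2 E f g \<cdot> k"
  shows "h = k"
proof -
  let ?x = "pb1 E f g \<cdot> h" and ?y = "pb2 E f g \<cdot> h"
  have "f \<cdot> ?x = g \<cdot> ?y"
    using comp_tail[OF pb_commutes[OF assms(1-3)], of h] assms by simp
  moreover have "?x \<in> hom E (Dom E h) (Dom E f)" "?y \<in> hom E (Dom E h) (Dom E g)" using assms by simp_all
  ultimately have "\<exists>!m. m \<in> hom E (Dom E h) (Dom E (pb1 E f g)) \<and> pb1 E f g \<cdot> m = ?x \<and> pb2 E f g \<cdot> m = ?y"
    using is_pullback_pb[OF assms(1-3)] unfolding is_pullback_def by blast
  then show ?thesis using assms by (metis in_hom_iff)
qed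

lemma is_span_simps [simp]:
  assumes "is_span E R"
  shows "leg0 R \<in> Ar E" "leg1 R \<in> Ar E" "Dom E (leg0 R) = apex R" "Dom E (leg1 R) = apex R" "apex R \<in> Ob E"
  using assms dom_ob[of "leg0 R"] by (auto simp: is_span_def)

lemma is_span_cell_simps [simp]:
  assumes "is_span_cell E \<alpha>"
  shows "is_span E (sc_dom \<alpha>)" "is_span E (sc_cod \<alpha>)"
    "side0 \<alpha> \<in> Ar E" "Dom E (side0 \<alpha>) = Cod E (leg0 (sc_dom \<alpha>))" "Cod E (side0 \<alpha>) = Cod E (leg0 (sc_cod \<alpha>))"
    "side1 \<alpha> \<in> Ar E" "Dom E (side1 \<alpha>) = Cod E (leg1 (sc_dom \<alpha>))" "Cod E (side1 \<alpha>) = Cod E (leg1 (sc_cod \<alpha>))"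
    "sc_map \<alpha> \<in> Ar E" "Dom E (sc_map \<alpha>) = apex (sc_dom \<alpha>)" "Cod E (sc_map \<alpha>) = apex (sc_cod \<alpha>)"
  using assms unfolding is_span_cell_def Let_def in_hom_iff by blast+

lemma is_span_cell_laws:
  assumes "is_span_cell E \<alpha>"
  shows "leg0 (sc_cod \<alpha>) \<cdot> sc_map \<alpha> = side0 \<alpha> \<cdot> leg0 (sc_dom \<alpha>)" "leg1 (sc_cod \<alpha>) \<cdot> sc_map \<alpha> = side1 \<alpha> \<cdot> leg1 (sc_dom \<alpha>)"
  using assms unfolding is_span_cell_def Let_def by blast+

lemma is_span_cellI:
  assumes "is_span E (sc_dom \<alpha>)" "is_span E (sc_cod \<alpha>)"
    "side0 \<alpha> \<in> Ar E" "Dom E (side0 \<alpha>) = Cod E (leg0 (sc_dom \<alpha>))" "Cod E (side0 \<alpha>) = Cod E (leg0 (sc_cod \<alpha>))"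
    "side1 \<alpha> \<in> Ar E" "Dom E (side1 \<alpha>) = Cod E (leg1 (sc_dom \<alpha>))" "Cod E (side1 \<alpha>) = Cod E (leg1 (sc_cod \<alpha>))"
    "sc_map \<alpha> \<in> Ar E" "Dom E (sc_map \<alpha>) = apex (sc_dom \<alpha>)" "Cod E (sc_map \<alpha>) = apex (sc_cod \<alpha>)"
    "leg0 (sc_cod \<alpha>) \<cdot> sc_map \<alpha> = side0 \<alpha> \<cdot> leg0 (sc_dom \<alpha>)" "leg1 (sc_cod \<alpha>) \<cdot> sc_map \<alpha> = side1 \<alpha> \<cdot> leg1 (sc_dom \<alpha>)"
  shows "is_span_cell E \<alpha>"
  unfolding is_span_cell_def Let_def in_hom_iff using assms by blast

lemma span_cell_eqI:
  "sc_dom \<alpha> = sc_dom \<beta> \<Longrightarrow> sc_cod \<alpha> = sc_cod \<beta> \<Longrightarrow> side0 \<alpha> = side0 \<beta> \<Longrightarrow> side1 \<alpha> = side1 \<beta> \<Longrightarrow> sc_map \<alpha> = sc_map \<beta> \<Longrightarrow> \<alpha> = \<beta>"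
  by (cases \<alpha>; cases \<beta>) simp

lemma span_cat_simps [simp]:
  "R \<in> Ob (span_cat E) \<longleftrightarrow> is_span E R" "\<alpha> \<in> Ar (span_cat E) \<longleftrightarrow> is_span_cell E \<alpha>"
  "Dom (span_cat E) = sc_dom" "Cod (span_cat E) = sc_cod"
  "Idt (span_cat E) R = SpanCell R R (Idt E (Cod E (leg0 R))) (Idt E (Cod E (leg1 R))) (Idt E (apex R))"
  "sc_dom (\<beta> \<cdot>\<^bsub>span_cat E\<^esub> \<alpha>) = sc_dom \<alpha>" "sc_cod (\<beta> \<cdot>\<^bsub>span_cat E\<^esub> \<alpha>) = sc_cod \<beta>"
  "side0 (\<beta> \<cdot>\<^bsub>span_cat E\<^esub> \<alpha>) = side0 \<beta> \<cdot> side0 \<alpha>" "side1 (\<beta> \<cdot>\<^bsub>span_cat E\<^esub> \<alpha>) = side1 \<beta> \<cdot> side1 \<alpha>"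
  "sc_map (\<beta> \<cdot>\<^bsub>span_cat E\<^esub> \<alpha>) = sc_map \<beta> \<cdot> sc_map \<alpha>"
  by (auto simp: span_cat_def)

lemma is_span_cell_comp [simp]:
  assumes a: "is_span_cell E \<alpha>" and b: "is_span_cell E \<beta>" and e: "sc_dom \<beta> = sc_cod \<alpha>"
  shows "is_span_cell E (\<beta> \<cdot>\<^bsub>span_cat E\<^esub> \<alpha>)"
  by (rule is_span_cellI)
     (use a b e is_span_cell_laws[OF a] comp_tail[OF is_span_cell_laws(1)[OF b], of "sc_map \<alpha>"]
        comp_tail[OF is_span_cell_laws(2)[OF b], of "sc_map \<alpha>"] in simp_all)

lemma is_span_cell_id [simp]:
  "is_span E R \<Longrightarrow> Cod E (leg0 R) = A \<Longrightarrow> Cod E (leg1 R) = B \<Longrightarrow> apex R = C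
    \<Longrightarrow> is_span_cell E (SpanCell R R (Idt E A) (Idt E B) (Idt E C))"
  by (rule is_span_cellI) auto

sublocale SC: category "span_cat E"
proof
  fix A assume "A \<in> Ob (span_cat E)"
  then show "Idt (span_cat E) A \<in> hom (span_cat E) A A" by simp
next
  fix f X Y g Z assume "f \<in> hom (span_cat E) X Y" "g \<in> hom (span_cat E) Y Z"
  then show "g \<cdot>\<^bsub>span_cat E\<^esub> f \<in> hom (span_cat E) X Z" by simp
qed (auto intro!: span_cell_eqI)

abbreviation compos where
  "compos X Y \<equiv> is_span E X \<and> is_span E Y \<and> Cod E (leg0 X) = Cod E (leg1 Y)"

text \<open>The pullback square is used as a rewrite rule that eliminates \<open>leg0 X\<close> in
  favour of \<open>leg1 Y\<close>.\<close>

lemma span_pr_simps [simp]: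
  assumes "is_span E X" "is_span E Y" "Cod E (leg0 X) = Cod E (leg1 Y)"
  shows "span_pr2 E X Y \<in> Ar E" "Dom E (span_pr2 E X Y) = apex (span_hcomp E X Y)" "Cod E (span_pr2 E X Y) = apex Y"
    "span_pr1 E X Y \<in> Ar E" "Dom E (span_pr1 E X Y) = apex (span_hcomp E X Y)" "Cod E (span_pr1 E X Y) = apex X"
    "leg0 X \<cdot> span_pr1 E X Y = leg1 Y \<cdot> span_pr2 E X Y"
  using assms pb_commutes[of "leg1 Y" "leg0 X"] by (simp_all add: span_pr1_def span_pr2_def span_hcomp_def)

lemma span_pr_tail [simp]:
  assumes "is_span E X" "is_span E Y" "Cod E (leg0 X) = Cod E (leg1 Y)" "x \<in> Ar E" "apex (span_hcomp E X Y) = Cod E x"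
  shows "leg0 X \<cdot> (span_pr1 E X Y \<cdot> x) = leg1 Y \<cdot> (span_pr2 E X Y \<cdot> x)"
  using comp_tail[OF span_pr_simps(7)[OF assms(1-3)], of x] assms by simp

lemma span_pair_simps [simp]:
  assumes "is_span E X" "is_span E Y" "Cod E (leg0 X) = Cod E (leg1 Y)" "y \<in> Ar E" "x \<in> Ar E"
    "Dom E y = Dom E x" "Cod E y = apex Y" "Cod E x = apex X" "leg1 Y \<cdot> y = leg0 X \<cdot> x"
  shows "span_pair E X Y y x \<in> Ar E" "Dom E (span_pair E X Y y x) = Dom E x"
    "Cod E (span_pair E X Y y x) = apex (span_hcomp E X Y)"
    "span_pr2 E X Y \<cdot> span_pair E X Y y x = y" "span_pr1 E X Y \<cdot> span_pair E X Y y x = x"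
  using pb_med[of "leg1 Y" "leg0 X" y x] assms
  by (simp_all add: span_pr1_def span_pr2_def span_pair_def span_hcomp_def)

lemma span_pair_tail [simp]:
  assumes "is_span E X" "is_span E Y" "Cod E (leg0 X) = Cod E (leg1 Y)" "y \<in> Ar E" "x \<in> Ar E"
    "Dom E y = Dom E x" "Cod E y = apex Y" "Cod E x = apex X" "leg1 Y \<cdot> y = leg0 X \<cdot> x" "z \<in> Ar E" "Dom E x = Cod E z"
  shows "span_pr2 E X Y \<cdot> (span_pair E X Y y x \<cdot> z) = y \<cdot> z" "span_pr1 E X Y \<cdot> (span_pair E X Y y x \<cdot> z) = x \<cdot> z"
  using comp_tail[OF span_pair_simps(4)[OF assms(1-9)], of z] comp_tail[OF span_pair_simps(5)[OF assms(1-9)], of z] assms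
  by simp_all

lemma span_eqI:
  assumes "is_span E X" "is_span E Y" "Cod E (leg0 X) = Cod E (leg1 Y)" "h \<in> Ar E" "k \<in> Ar E"
    "Dom E h = Dom E k" "Cod E h = apex (span_hcomp E X Y)" "Cod E k = apex (span_hcomp E X Y)"
    "span_pr2 E X Y \<cdot> h = span_pr2 E X Y \<cdot> k" "span_pr1 E X Y \<cdot> h = span_pr1 E X Y \<cdot> k"
  shows "h = k"
  by (rule pb_eqI[of "leg1 Y" "leg0 X"]) (use assms in \<open>simp_all add: span_pr1_def span_pr2_def span_hcomp_def\<close>)

lemma span_hcomp_legs [simp]:
  "leg0 (span_hcomp E X Y) = leg0 Y \<cdot> span_pr2 E X Y" "leg1 (span_hcomp E X Y) = leg1 X \<cdot> span_pr1 E X Y"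
  by (simp_all add: span_hcomp_def)

lemma is_span_hcomp [simp]:
  assumes "is_span E X" "is_span E Y" "Cod E (leg0 X) = Cod E (leg1 Y)"
  shows "is_span E (span_hcomp E X Y)"
  unfolding is_span_def using assms by simp

lemma span_unit_simps [simp]:
  "apex (span_unit E A) = A" "leg0 (span_unit E A) = Idt E A" "leg1 (span_unit E A) = Idt E A"
  by (simp_all add: span_unit_def)

lemma is_span_unit [simp]: "A \<in> Ob E \<Longrightarrow> is_span E (span_unit E A)"
  by (simp add: is_span_def)

lemma span_ccomp_simps [simp]:
  "sc_dom (span_ccomp E \<alpha> \<beta>) = span_hcomp E (sc_dom \<alpha>) (sc_dom \<beta>)"
  "sc_cod (span_ccomp E \<alpha> \<beta>) = span_hcomp E (sc_cod \<alpha>) (sc_cod \<beta>)"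
  "side0 (span_ccomp E \<alpha> \<beta>) = side0 \<beta>" "side1 (span_ccomp E \<alpha> \<beta>) = side1 \<alpha>"
  by (simp_all add: span_ccomp_def Let_def)

lemma span_ccomp_map:
  assumes a: "is_span_cell E \<alpha>" and b: "is_span_cell E \<beta>" and e: "side0 \<alpha> = side1 \<beta>"
  shows "sc_map (span_ccomp E \<alpha> \<beta>) \<in> Ar E"
    "Dom E (sc_map (span_ccomp E \<alpha> \<beta>)) = apex (span_hcomp E (sc_dom \<alpha>) (sc_dom \<beta>))"
    "Cod E (sc_map (span_ccomp E \<alpha> \<beta>)) = apex (span_hcomp E (sc_cod \<alpha>) (sc_cod \<beta>))"
    "span_pr2 E (sc_cod \<alpha>) (sc_cod \<beta>) \<cdot> sc_map (span_ccomp E \<alpha> \<beta>) = sc_map \<beta> \<cdot> span_pr2 E (sc_dom \<alpha>) (sc_dom \<beta>)"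
    "span_pr1 E (sc_cod \<alpha>) (sc_cod \<beta>) \<cdot> sc_map (span_ccomp E \<alpha> \<beta>) = sc_map \<alpha> \<cdot> span_pr1 E (sc_dom \<alpha>) (sc_dom \<beta>)"
    "Cod E (leg0 (sc_dom \<alpha>)) = Cod E (leg1 (sc_dom \<beta>))" "Cod E (leg0 (sc_cod \<alpha>)) = Cod E (leg1 (sc_cod \<beta>))"
proof -
  show c: "Cod E (leg0 (sc_dom \<alpha>)) = Cod E (leg1 (sc_dom \<beta>))" "Cod E (leg0 (sc_cod \<alpha>)) = Cod E (leg1 (sc_cod \<beta>))"
    using is_span_cell_simps(4,5)[OF a] is_span_cell_simps(7,8)[OF b] e by simp_all
  have "leg1 (sc_cod \<beta>) \<cdot> (sc_map \<beta> \<cdot> span_pr2 E (sc_dom \<alpha>) (sc_dom \<beta>)) = leg0 (sc_cod \<alpha>) \<cdot> (sc_map \<alpha> \<cdot> span_pr1 E (sc_dom \<alpha>) (sc_dom \<beta>))"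
    using comp_tail[OF is_span_cell_laws(2)[OF b], of "span_pr2 E (sc_dom \<alpha>) (sc_dom \<beta>)"]
      comp_tail[OF is_span_cell_laws(1)[OF a], of "span_pr1 E (sc_dom \<alpha>) (sc_dom \<beta>)"] a b c e by simp
  then show "sc_map (span_ccomp E \<alpha> \<beta>) \<in> Ar E"
    "Dom E (sc_map (span_ccomp E \<alpha> \<beta>)) = apex (span_hcomp E (sc_dom \<alpha>) (sc_dom \<beta>))"
    "Cod E (sc_map (span_ccomp E \<alpha> \<beta>)) = apex (span_hcomp E (sc_cod \<alpha>) (sc_cod \<beta>))"
    "span_pr2 E (sc_cod \<alpha>) (sc_cod \<beta>) \<cdot> sc_map (span_ccomp E \<alpha> \<beta>) = sc_map \<beta> \<cdot> span_pr2 E (sc_dom \<alpha>) (sc_dom \<beta>)"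
    "span_pr1 E (sc_cod \<alpha>) (sc_cod \<beta>) \<cdot> sc_map (span_ccomp E \<alpha> \<beta>) = sc_map \<alpha> \<cdot> span_pr1 E (sc_dom \<alpha>) (sc_dom \<beta>)"
    using a b c by (simp_all add: span_ccomp_def Let_def)
qed

lemmas span_ccomp_map_simps [simp] = span_ccomp_map(1-3)

text \<open>The projections out of a composite whose factors are given by equations, so that the simplifier
  can use them after rewriting \<^term>\<open>sc_cod \<alpha>\<close>.\<close>

lemma span_ccomp_pr:
  assumes "is_span_cell E \<alpha>" "is_span_cell E \<beta>" "side0 \<alpha> = side1 \<beta>" "sc_cod \<alpha> = X" "sc_cod \<beta> = Y"
  shows "span_pr2 E X Y \<cdot> sc_map (span_ccomp E \<alpha> \<beta>) = sc_map \<beta> \<cdot> span_pr2 E (sc_dom \<alpha>) (sc_dom \<beta>)"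
    "span_pr1 E X Y \<cdot> sc_map (span_ccomp E \<alpha> \<beta>) = sc_map \<alpha> \<cdot> span_pr1 E (sc_dom \<alpha>) (sc_dom \<beta>)"
    "x \<in> Ar E \<Longrightarrow> Cod E x = apex (span_hcomp E (sc_dom \<alpha>) (sc_dom \<beta>)) \<Longrightarrow>
      span_pr2 E X Y \<cdot> (sc_map (span_ccomp E \<alpha> \<beta>) \<cdot> x) = sc_map \<beta> \<cdot> (span_pr2 E (sc_dom \<alpha>) (sc_dom \<beta>) \<cdot> x)"
    "x \<in> Ar E \<Longrightarrow> Cod E x = apex (span_hcomp E (sc_dom \<alpha>) (sc_dom \<beta>)) \<Longrightarrow>
      span_pr1 E X Y \<cdot> (sc_map (span_ccomp E \<alpha> \<beta>) \<cdot> x) = sc_map \<alpha> \<cdot> (span_pr1 E (sc_dom \<alpha>) (sc_dom \<beta>) \<cdot> x)"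
proof -
  note m = span_ccomp_map[OF assms(1-3)]
  show "span_pr2 E X Y \<cdot> sc_map (span_ccomp E \<alpha> \<beta>) = sc_map \<beta> \<cdot> span_pr2 E (sc_dom \<alpha>) (sc_dom \<beta>)"
    "span_pr1 E X Y \<cdot> sc_map (span_ccomp E \<alpha> \<beta>) = sc_map \<alpha> \<cdot> span_pr1 E (sc_dom \<alpha>) (sc_dom \<beta>)"
    using m assms by simp_all
  show "span_pr2 E X Y \<cdot> (sc_map (span_ccomp E \<alpha> \<beta>) \<cdot> x) = sc_map \<beta> \<cdot> (span_pr2 E (sc_dom \<alpha>) (sc_dom \<beta>) \<cdot> x)"
    "span_pr1 E X Y \<cdot> (sc_map (span_ccomp E \<alpha> \<beta>) \<cdot> x) = sc_map \<alpha> \<cdot> (span_pr1 E (sc_dom \<alpha>) (sc_dom \<beta>) \<cdot> x)"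
    if "x \<in> Ar E" "Cod E x = apex (span_hcomp E (sc_dom \<alpha>) (sc_dom \<beta>))"
    using comp_tail[OF m(4), of x] comp_tail[OF m(5), of x] assms(1,2) m(1-3,6,7) that
    unfolding assms(4,5)[symmetric] by simp_all
qed

lemma is_span_cell_ccomp [simp]:
  assumes a: "is_span_cell E \<alpha>" and b: "is_span_cell E \<beta>" and e: "side0 \<alpha> = side1 \<beta>"
  shows "is_span_cell E (span_ccomp E \<alpha> \<beta>)"
proof -
  note m = span_ccomp_map[OF assms]
  show ?thesis
    by (rule is_span_cellI)
      (use m a b comp_tail[OF is_span_cell_laws(1)[OF b], of "span_pr2 E (sc_dom \<alpha>) (sc_dom \<beta>)"]
        comp_tail[OF is_span_cell_laws(2)[OF a], of "span_pr1 E (sc_dom \<alpha>) (sc_dom \<beta>)"] in simp_all)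
qed

lemma span_globular_cell_simps [simp]:
  "sc_dom (span_globular_cell E R S k) = R" "sc_cod (span_globular_cell E R S k) = S"
  "side0 (span_globular_cell E R S k) = Idt E (Cod E (leg0 R))" "side1 (span_globular_cell E R S k) = Idt E (Cod E (leg1 R))"
  "sc_map (span_globular_cell E R S k) = k"
  by (simp_all add: span_globular_cell_def)

text \<open>The inverse arrows again form a cell: the leg equations of \<alpha>, composed on both
  sides with the inverses, give those of the inverse.\<close>

lemma span_iso:
  assumes a: "is_span_cell E \<alpha>" and i: "is_iso E (side0 \<alpha>)" "is_iso E (side1 \<alpha>)" "is_iso E (sc_map \<alpha>)"
  shows "is_iso (span_cat E) \<alpha>"
proof -
  let ?R = "sc_dom \<alpha>" and ?S = "sc_cod \<alpha>"
  obtain f where f: "f \<in> Ar E" "Dom E f = Cod E (leg0 ?S)" "Cod E f = Cod E (leg0 ?R)"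
    "f \<cdot> side0 \<alpha> = Idt E (Cod E (leg0 ?R))" "side0 \<alpha> \<cdot> f = Idt E (Cod E (leg0 ?S))" using is_isoE[OF i(1)] a by auto
  obtain g where g: "g \<in> Ar E" "Dom E g = Cod E (leg1 ?S)" "Cod E g = Cod E (leg1 ?R)"
    "g \<cdot> side1 \<alpha> = Idt E (Cod E (leg1 ?R))" "side1 \<alpha> \<cdot> g = Idt E (Cod E (leg1 ?S))" using is_isoE[OF i(2)] a by auto
  obtain m where m: "m \<in> Ar E" "Dom E m = apex ?S" "Cod E m = apex ?R"
    "m \<cdot> sc_map \<alpha> = Idt E (apex ?R)" "sc_map \<alpha> \<cdot> m = Idt E (apex ?S)" using is_isoE[OF i(3)] a by auto
  note l = is_span_cell_laws[OF a]
  have "leg0 ?R \<cdot> m = f \<cdot> (leg0 ?S \<cdot> (sc_map \<alpha> \<cdot> m))"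
    using comp_tail[OF l(1), of m] comp_tail[OF f(4), of "leg0 ?R \<cdot> m"] f(1-3) m(1-3) a by simp
  then have 1: "leg0 ?R \<cdot> m = f \<cdot> leg0 ?S" using m a f(1-3) by simp
  have "leg1 ?R \<cdot> m = g \<cdot> (leg1 ?S \<cdot> (sc_map \<alpha> \<cdot> m))"
    using comp_tail[OF l(2), of m] comp_tail[OF g(4), of "leg1 ?R \<cdot> m"] g(1-3) m(1-3) a by simp
  then have 2: "leg1 ?R \<cdot> m = g \<cdot> leg1 ?S" using m a g(1-3) by simp
  have c: "is_span_cell E (SpanCell ?S ?R f g m)"
    by (rule is_span_cellI) (use a f g m 1 2 in simp_all)
  show ?thesis
    by (rule SC.is_isoI[where g = "SpanCell ?S ?R f g m"]) (use a c f g m in \<open>auto intro!: span_cell_eqI\<close>)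
qed

lemma Span_dbl_simps [simp]:
  "VCat (Span_dbl E) = E" "HCat (Span_dbl E) = span_cat E"
  "onO (Src (Span_dbl E)) R = Cod E (leg0 R)" "onA (Src (Span_dbl E)) = side0"
  "onO (Tgt (Span_dbl E)) R = Cod E (leg1 R)" "onA (Tgt (Span_dbl E)) = side1"
  "onO (Unt (Span_dbl E)) = span_unit E"
  "onA (Unt (Span_dbl E)) f = SpanCell (span_unit E (Dom E f)) (span_unit E (Cod E f)) f f f"
  "HComp (Span_dbl E) = span_hcomp E" "CComp (Span_dbl E) = span_ccomp E" "Assoc (Span_dbl E) = span_assoc E"
  "LUnit (Span_dbl E) R = span_globular_cell E (span_hcomp E (span_unit E (Cod E (leg1 R))) R) R (span_pr2 E (span_unit E (Cod E (leg1 R))) R)"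
  "RUnit (Span_dbl E) R = span_globular_cell E (span_hcomp E R (span_unit E (Cod E (leg0 R)))) R (span_pr1 E R (span_unit E (Cod E (leg0 R))))"
  by (simp_all add: Span_dbl_def Let_def)

lemma globular_Span_dbl:
  "\<alpha> \<in> globular (Span_dbl E) R S \<longleftrightarrow> is_span_cell E \<alpha> \<and> sc_dom \<alpha> = R \<and> sc_cod \<alpha> = S \<and>
    side0 \<alpha> = Idt E (Cod E (leg0 R)) \<and> side1 \<alpha> = Idt E (Cod E (leg1 R))"
  by (auto simp: globular_def)

lemma span_assoc_simps [simp]:
  "sc_dom (span_assoc E X Y Z) = span_hcomp E (span_hcomp E X Y) Z"
  "sc_cod (span_assoc E X Y Z) = span_hcomp E X (span_hcomp E Y Z)"
  "side0 (span_assoc E X Y Z) = Idt E (Cod E (leg0 Z \<cdot> span_pr2 E (span_hcomp E X Y) Z))"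
  "side1 (span_assoc E X Y Z) = Idt E (Cod E (leg1 X \<cdot> span_pr1 E X Y \<cdot> span_pr1 E (span_hcomp E X Y) Z))"
  by (simp_all add: span_assoc_def Let_def)

text \<open>An arrow into the apex of X \<odot> (Y \<odot> Z) is determined by its three projections
  to the apexes of Z, Y and X. The associator is handled only through these projections, in bare
  form here and in tail form in \<open>span_assoc_tail\<close>.\<close>

lemma span_assoc_map:
  assumes "is_span E X" "is_span E Y" "is_span E Z" "Cod E (leg0 X) = Cod E (leg1 Y)" "Cod E (leg0 Y) = Cod E (leg1 Z)"
  shows "sc_map (span_assoc E X Y Z) \<in> Ar E"
    "Dom E (sc_map (span_assoc E X Y Z)) = apex (span_hcomp E (span_hcomp E X Y) Z)"
    "Cod E (sc_map (span_assoc E X Y Z)) = apex (span_hcomp E X (span_hcomp E Y Z))"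
    "span_pr2 E Y Z \<cdot> (span_pr2 E X (span_hcomp E Y Z) \<cdot> sc_map (span_assoc E X Y Z)) = span_pr2 E (span_hcomp E X Y) Z"
    "span_pr1 E Y Z \<cdot> (span_pr2 E X (span_hcomp E Y Z) \<cdot> sc_map (span_assoc E X Y Z)) = span_pr2 E X Y \<cdot> span_pr1 E (span_hcomp E X Y) Z"
    "span_pr1 E X (span_hcomp E Y Z) \<cdot> sc_map (span_assoc E X Y Z) = span_pr1 E X Y \<cdot> span_pr1 E (span_hcomp E X Y) Z"
proof -
  let ?u = "span_pair E Y Z (span_pr2 E (span_hcomp E X Y) Z) (span_pr2 E X Y \<cdot> span_pr1 E (span_hcomp E X Y) Z)"
  have k: "leg0 Y \<cdot> (span_pr2 E X Y \<cdot> span_pr1 E (span_hcomp E X Y) Z) = leg1 Z \<cdot> span_pr2 E (span_hcomp E X Y) Z"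
    using span_pr_simps(7)[of "span_hcomp E X Y" Z] assms by simp
  have u: "?u \<in> Ar E" "Dom E ?u = apex (span_hcomp E (span_hcomp E X Y) Z)" "Cod E ?u = apex (span_hcomp E Y Z)"
    "span_pr2 E Y Z \<cdot> ?u = span_pr2 E (span_hcomp E X Y) Z"
    "span_pr1 E Y Z \<cdot> ?u = span_pr2 E X Y \<cdot> span_pr1 E (span_hcomp E X Y) Z"
    using assms k by simp_all
  show "sc_map (span_assoc E X Y Z) \<in> Ar E"
    "Dom E (sc_map (span_assoc E X Y Z)) = apex (span_hcomp E (span_hcomp E X Y) Z)"
    "Cod E (sc_map (span_assoc E X Y Z)) = apex (span_hcomp E X (span_hcomp E Y Z))"
    "span_pr2 E Y Z \<cdot> (span_pr2 E X (span_hcomp E Y Z) \<cdot> sc_map (span_assoc E X Y Z)) = span_pr2 E (span_hcomp E X Y) Z"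
    "span_pr1 E Y Z \<cdot> (span_pr2 E X (span_hcomp E Y Z) \<cdot> sc_map (span_assoc E X Y Z)) = span_pr2 E X Y \<cdot> span_pr1 E (span_hcomp E X Y) Z"
    "span_pr1 E X (span_hcomp E Y Z) \<cdot> sc_map (span_assoc E X Y Z) = span_pr1 E X Y \<cdot> span_pr1 E (span_hcomp E X Y) Z"
    unfolding span_assoc_def Let_def span_globular_cell_simps using assms u by simp_all
qed

lemma span_assoc_tail:
  assumes "is_span E X" "is_span E Y" "is_span E Z" "Cod E (leg0 X) = Cod E (leg1 Y)" "Cod E (leg0 Y) = Cod E (leg1 Z)"
    "x \<in> Ar E" "Cod E x = apex (span_hcomp E (span_hcomp E X Y) Z)"
  shows "span_pr2 E Y Z \<cdot> (span_pr2 E X (span_hcomp E Y Z) \<cdot> (sc_map (span_assoc E X Y Z) \<cdot> x)) = span_pr2 E (span_hcomp E X Y) Z \<cdot> x"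
    "span_pr1 E Y Z \<cdot> (span_pr2 E X (span_hcomp E Y Z) \<cdot> (sc_map (span_assoc E X Y Z) \<cdot> x)) = span_pr2 E X Y \<cdot> (span_pr1 E (span_hcomp E X Y) Z \<cdot> x)"
    "span_pr1 E X (span_hcomp E Y Z) \<cdot> (sc_map (span_assoc E X Y Z) \<cdot> x) = span_pr1 E X Y \<cdot> (span_pr1 E (span_hcomp E X Y) Z \<cdot> x)"
proof -
  note m = span_assoc_map[OF assms(1-5)]
  have "(span_pr2 E Y Z \<cdot> (span_pr2 E X (span_hcomp E Y Z) \<cdot> sc_map (span_assoc E X Y Z))) \<cdot> x = span_pr2 E (span_hcomp E X Y) Z \<cdot> x"
    "(span_pr1 E Y Z \<cdot> (span_pr2 E X (span_hcomp E Y Z) \<cdot> sc_map (span_assoc E X Y Z))) \<cdot> x = (span_pr2 E X Y \<cdot> span_pr1 E (span_hcomp E X Y) Z) \<cdot> x"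
    "(span_pr1 E X (span_hcomp E Y Z) \<cdot> sc_map (span_assoc E X Y Z)) \<cdot> x = (span_pr1 E X Y \<cdot> span_pr1 E (span_hcomp E X Y) Z) \<cdot> x"
    unfolding m(4-6) by simp_all
  then show "span_pr2 E Y Z \<cdot> (span_pr2 E X (span_hcomp E Y Z) \<cdot> (sc_map (span_assoc E X Y Z) \<cdot> x)) = span_pr2 E (span_hcomp E X Y) Z \<cdot> x"
    "span_pr1 E Y Z \<cdot> (span_pr2 E X (span_hcomp E Y Z) \<cdot> (sc_map (span_assoc E X Y Z) \<cdot> x)) = span_pr2 E X Y \<cdot> (span_pr1 E (span_hcomp E X Y) Z \<cdot> x)"
    "span_pr1 E X (span_hcomp E Y Z) \<cdot> (sc_map (span_assoc E X Y Z) \<cdot> x) = span_pr1 E X Y \<cdot> (span_pr1 E (span_hcomp E X Y) Z \<cdot> x)"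
    using assms m(1-3) by simp_all
qed

lemmas span_assoc_norm = span_assoc_map span_assoc_tail

lemma is_span_cell_assoc [simp]:
  assumes "is_span E X" "is_span E Y" "is_span E Z" "Cod E (leg0 X) = Cod E (leg1 Y)" "Cod E (leg0 Y) = Cod E (leg1 Z)"
  shows "is_span_cell E (span_assoc E X Y Z)"
  by (rule is_span_cellI) (use assms in \<open>simp_all add: span_assoc_norm\<close>)

text \<open>The inverse \<open>?w\<close> regroups the three projections the other way, and both
  composites are compared with the identity projection by projection.\<close>

lemma span_assoc_iso:
  assumes "is_span E X" "is_span E Y" "is_span E Z" "Cod E (leg0 X) = Cod E (leg1 Y)" "Cod E (leg0 Y) = Cod E (leg1 Z)"
  shows "is_iso (span_cat E) (span_assoc E X Y Z)"
proof (rule span_iso)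
  let ?XY = "span_hcomp E X Y" and ?YZ = "span_hcomp E Y Z"
  let ?v = "span_pair E X Y (span_pr1 E Y Z \<cdot> span_pr2 E X ?YZ) (span_pr1 E X ?YZ)"
  let ?w = "span_pair E ?XY Z (span_pr2 E Y Z \<cdot> span_pr2 E X ?YZ) ?v"
  let ?a = "sc_map (span_assoc E X Y Z)"
  have k: "leg0 X \<cdot> span_pr1 E X ?YZ = leg1 Y \<cdot> (span_pr1 E Y Z \<cdot> span_pr2 E X ?YZ)"
    using span_pr_simps(7)[of X ?YZ] assms by simp
  have v: "?v \<in> Ar E" "Dom E ?v = apex (span_hcomp E X ?YZ)" "Cod E ?v = apex ?XY"
    "span_pr2 E X Y \<cdot> ?v = span_pr1 E Y Z \<cdot> span_pr2 E X ?YZ" "span_pr1 E X Y \<cdot> ?v = span_pr1 E X ?YZ"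
    using assms k by simp_all
  have w: "?w \<in> Ar E" "Dom E ?w = apex (span_hcomp E X ?YZ)" "Cod E ?w = apex (span_hcomp E ?XY Z)"
    "span_pr2 E ?XY Z \<cdot> ?w = span_pr2 E Y Z \<cdot> span_pr2 E X ?YZ" "span_pr1 E ?XY Z \<cdot> ?w = ?v"
    using assms v by simp_all
  note a = span_assoc_norm[OF assms]
  have 1: "?w \<cdot> ?a = Idt E (apex (span_hcomp E ?XY Z))"
  proof (rule span_eqI[of ?XY Z])
    show "span_pr2 E ?XY Z \<cdot> (?w \<cdot> ?a) = span_pr2 E ?XY Z \<cdot> Idt E (apex (span_hcomp E ?XY Z))"
      using comp_tail[OF w(4), of ?a] assms w(1-3) a by simp
    show "span_pr1 E ?XY Z \<cdot> (?w \<cdot> ?a) = span_pr1 E ?XY Z \<cdot> Idt E (apex (span_hcomp E ?XY Z))"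
    proof (rule span_eqI[of X Y])
      show "span_pr2 E X Y \<cdot> (span_pr1 E ?XY Z \<cdot> (?w \<cdot> ?a)) = span_pr2 E X Y \<cdot> (span_pr1 E ?XY Z \<cdot> Idt E (apex (span_hcomp E ?XY Z)))"
        "span_pr1 E X Y \<cdot> (span_pr1 E ?XY Z \<cdot> (?w \<cdot> ?a)) = span_pr1 E X Y \<cdot> (span_pr1 E ?XY Z \<cdot> Idt E (apex (span_hcomp E ?XY Z)))"
        using comp_tail[OF w(5), of ?a] comp_tail[OF v(4), of ?a] comp_tail[OF v(5), of ?a] assms w(1-3) v(1-3) a by simp_all
    qed (use assms w a in simp_all)
  qed (use assms w a in simp_all)
  have 2: "?a \<cdot> ?w = Idt E (apex (span_hcomp E X ?YZ))"
  proof (rule span_eqI[of X ?YZ])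
    show "span_pr1 E X ?YZ \<cdot> (?a \<cdot> ?w) = span_pr1 E X ?YZ \<cdot> Idt E (apex (span_hcomp E X ?YZ))"
      using assms w v a by simp
    show "span_pr2 E X ?YZ \<cdot> (?a \<cdot> ?w) = span_pr2 E X ?YZ \<cdot> Idt E (apex (span_hcomp E X ?YZ))"
      by (rule span_eqI[of Y Z]) (use assms w v a in simp_all)
  qed (use assms w a in simp_all)
  show "is_iso E ?a" by (rule is_isoI[where g = ?w]) (use w a 1 2 in simp_all)
qed (use assms in \<open>auto intro!: is_iso_idt\<close>)

text \<open>These are the pullback squares in which one leg is an identity.\<close>

lemma unit_pr:
  assumes "is_span E R"
  shows "span_pr1 E (span_unit E (Cod E (leg1 R))) R = leg1 R \<cdot> span_pr2 E (span_unit E (Cod E (leg1 R))) R"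
    "leg0 R \<cdot> span_pr1 E R (span_unit E (Cod E (leg0 R))) = span_pr2 E R (span_unit E (Cod E (leg0 R)))"
  using span_pr_simps(7)[of "span_unit E (Cod E (leg1 R))" R] span_pr_simps(7)[of R "span_unit E (Cod E (leg0 R))"] assms
  by simp_all

lemma span_lunit_iso:
  assumes R: "is_span E R"
  shows "is_span_cell E (LUnit (Span_dbl E) R)" "is_iso (span_cat E) (LUnit (Span_dbl E) R)"
proof -
  let ?U = "span_unit E (Cod E (leg1 R))"
  show c: "is_span_cell E (LUnit (Span_dbl E) R)"
    by (rule is_span_cellI) (use R unit_pr[OF R] in simp_all)
  \<comment> \<open>The inverse of the projection pairs the identity with the leg, since pulling
    back along an identity changes nothing.\<close>
  let ?m = "span_pair E ?U R (Idt E (apex R)) (leg1 R)"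
  have m: "?m \<in> Ar E" "Dom E ?m = apex R" "Cod E ?m = apex (span_hcomp E ?U R)" "span_pr2 E ?U R \<cdot> ?m = Idt E (apex R)"
    "span_pr1 E ?U R \<cdot> ?m = leg1 R"
    using R by simp_all
  have 1: "?m \<cdot> span_pr2 E ?U R = Idt E (apex (span_hcomp E ?U R))"
    by (rule span_eqI[of ?U R])
       (use R m(1-3) comp_tail[OF m(4), of "span_pr2 E ?U R"] comp_tail[OF m(5), of "span_pr2 E ?U R"] unit_pr(1)[OF R] in simp_all)
  have "is_iso E (span_pr2 E ?U R)" by (rule is_isoI[where g = ?m]) (use R m 1 in simp_all)
  then show "is_iso (span_cat E) (LUnit (Span_dbl E) R)" using R unit_pr(1)[OF R] by (intro span_iso c) (auto intro!: is_iso_idt)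
qed

lemma span_runit_iso:
  assumes R: "is_span E R"
  shows "is_span_cell E (RUnit (Span_dbl E) R)" "is_iso (span_cat E) (RUnit (Span_dbl E) R)"
proof -
  let ?U = "span_unit E (Cod E (leg0 R))"
  show c: "is_span_cell E (RUnit (Span_dbl E) R)"
    by (rule is_span_cellI) (use R unit_pr[OF R] in simp_all)
  let ?m = "span_pair E R ?U (leg0 R) (Idt E (apex R))"
  have m: "?m \<in> Ar E" "Dom E ?m = apex R" "Cod E ?m = apex (span_hcomp E R ?U)" "span_pr1 E R ?U \<cdot> ?m = Idt E (apex R)"
    "span_pr2 E R ?U \<cdot> ?m = leg0 R"
    using R by simp_all
  have 1: "?m \<cdot> span_pr1 E R ?U = Idt E (apex (span_hcomp E R ?U))"
    by (rule span_eqI[of R ?U])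
       (use R m(1-3) comp_tail[OF m(4), of "span_pr1 E R ?U"] comp_tail[OF m(5), of "span_pr1 E R ?U"] unit_pr(2)[OF R] in simp_all)
  have "is_iso E (span_pr1 E R ?U)" by (rule is_isoI[where g = ?m]) (use R m 1 in simp_all)
  then show "is_iso (span_cat E) (RUnit (Span_dbl E) R)" using R unit_pr(2)[OF R] by (intro span_iso c) (auto intro!: is_iso_idt)
qed

end

section \<open>The double category of spans\<close>

context pullback_category
begin

lemma span_hunit_functor: "cat_functor E (span_cat E) (Unt (Span_dbl E))"
proof (rule cat_functorI)
  fix f assume f: "f \<in> Ar E"
  have "is_span_cell E (SpanCell (span_unit E (Dom E f)) (span_unit E (Cod E f)) f f f)"
    by (rule is_span_cellI) (use f in simp_all)
  then show "onA (Unt (Span_dbl E)) f \<in> Ar (span_cat E) \<and>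
      Dom (span_cat E) (onA (Unt (Span_dbl E)) f) = onO (Unt (Span_dbl E)) (Dom E f) \<and>
      Cod (span_cat E) (onA (Unt (Span_dbl E)) f) = onO (Unt (Span_dbl E)) (Cod E f)"
    by simp
qed (auto simp: category_axioms SC.category_axioms intro!: span_cell_eqI)

lemma span_unit_cell [simp]:
  "f \<in> Ar E \<Longrightarrow> is_span_cell E (SpanCell (span_unit E (Dom E f)) (span_unit E (Cod E f)) f f f)"
  by (rule is_span_cellI) simp_all

lemma span_ccomp_eqI:
  assumes "is_span_cell E \<alpha>" "is_span_cell E \<beta>" "sc_dom \<alpha> = sc_dom \<beta>" "sc_cod \<alpha> = span_hcomp E X Y" "sc_cod \<beta> = span_hcomp E X Y"
    "is_span E X" "is_span E Y" "Cod E (leg0 X) = Cod E (leg1 Y)"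
    "side0 \<alpha> = side0 \<beta>" "side1 \<alpha> = side1 \<beta>"
    "span_pr2 E X Y \<cdot> sc_map \<alpha> = span_pr2 E X Y \<cdot> sc_map \<beta>" "span_pr1 E X Y \<cdot> sc_map \<alpha> = span_pr1 E X Y \<cdot> sc_map \<beta>"
  shows "\<alpha> = \<beta>"
proof (rule span_cell_eqI)
  show "sc_map \<alpha> = sc_map \<beta>" by (rule span_eqI[of X Y]) (use assms in simp_all)
qed (use assms in simp_all)

lemma span_ccomp_comp:
  assumes "is_span_cell E \<alpha>" "is_span_cell E \<beta>" "side0 \<alpha> = side1 \<beta>"
    "is_span_cell E \<alpha>'" "is_span_cell E \<beta>'" "side0 \<alpha>' = side1 \<beta>'" "sc_dom \<alpha>' = sc_cod \<alpha>" "sc_dom \<beta>' = sc_cod \<beta>"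
  shows "span_ccomp E (\<alpha>' \<cdot>\<^bsub>span_cat E\<^esub> \<alpha>) (\<beta>' \<cdot>\<^bsub>span_cat E\<^esub> \<beta>) = span_ccomp E \<alpha>' \<beta>' \<cdot>\<^bsub>span_cat E\<^esub> span_ccomp E \<alpha> \<beta>"
proof (rule span_ccomp_eqI[of _ _ "sc_cod \<alpha>'" "sc_cod \<beta>'"])
  note m = span_ccomp_map(6,7)[OF assms(1-3)] span_ccomp_map(6,7)[OF assms(4-6)]
  show "span_pr2 E (sc_cod \<alpha>') (sc_cod \<beta>') \<cdot> sc_map (span_ccomp E (\<alpha>' \<cdot>\<^bsub>span_cat E\<^esub> \<alpha>) (\<beta>' \<cdot>\<^bsub>span_cat E\<^esub> \<beta>))
    = span_pr2 E (sc_cod \<alpha>') (sc_cod \<beta>') \<cdot> sc_map (span_ccomp E \<alpha>' \<beta>' \<cdot>\<^bsub>span_cat E\<^esub> span_ccomp E \<alpha> \<beta>)"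
    "span_pr1 E (sc_cod \<alpha>') (sc_cod \<beta>') \<cdot> sc_map (span_ccomp E (\<alpha>' \<cdot>\<^bsub>span_cat E\<^esub> \<alpha>) (\<beta>' \<cdot>\<^bsub>span_cat E\<^esub> \<beta>))
    = span_pr1 E (sc_cod \<alpha>') (sc_cod \<beta>') \<cdot> sc_map (span_ccomp E \<alpha>' \<beta>' \<cdot>\<^bsub>span_cat E\<^esub> span_ccomp E \<alpha> \<beta>)"
    using assms m by (simp_all add: span_ccomp_pr)
qed (use assms span_ccomp_map(6,7)[OF assms(1-3)] span_ccomp_map(6,7)[OF assms(4-6)] in simp_all)

abbreviation span_id where "span_id R \<equiv> SpanCell R R (Idt E (Cod E (leg0 R))) (Idt E (Cod E (leg1 R))) (Idt E (apex R))"

lemma span_ccomp_id: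
  assumes "is_span E X" "is_span E Y" "Cod E (leg0 X) = Cod E (leg1 Y)"
  shows "span_ccomp E (span_id X) (span_id Y) = span_id (span_hcomp E X Y)"
  by (rule span_ccomp_eqI[of _ _ X Y])
    (use assms in \<open>simp_all add: span_ccomp_pr\<close>)

lemma span_assoc_eqI:
  assumes "is_span_cell E \<alpha>" "is_span_cell E \<beta>" "sc_dom \<alpha> = sc_dom \<beta>" "sc_cod \<alpha> = span_hcomp E X (span_hcomp E Y Z)"
    "sc_cod \<beta> = span_hcomp E X (span_hcomp E Y Z)"
    "is_span E X" "is_span E Y" "is_span E Z" "Cod E (leg0 X) = Cod E (leg1 Y)" "Cod E (leg0 Y) = Cod E (leg1 Z)"
    "side0 \<alpha> = side0 \<beta>" "side1 \<alpha> = side1 \<beta>"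
    "span_pr2 E Y Z \<cdot> (span_pr2 E X (span_hcomp E Y Z) \<cdot> sc_map \<alpha>) = span_pr2 E Y Z \<cdot> (span_pr2 E X (span_hcomp E Y Z) \<cdot> sc_map \<beta>)"
    "span_pr1 E Y Z \<cdot> (span_pr2 E X (span_hcomp E Y Z) \<cdot> sc_map \<alpha>) = span_pr1 E Y Z \<cdot> (span_pr2 E X (span_hcomp E Y Z) \<cdot> sc_map \<beta>)"
    "span_pr1 E X (span_hcomp E Y Z) \<cdot> sc_map \<alpha> = span_pr1 E X (span_hcomp E Y Z) \<cdot> sc_map \<beta>"
  shows "\<alpha> = \<beta>"
proof (rule span_ccomp_eqI[of _ _ X "span_hcomp E Y Z"])
  show "span_pr2 E X (span_hcomp E Y Z) \<cdot> sc_map \<alpha> = span_pr2 E X (span_hcomp E Y Z) \<cdot> sc_map \<beta>"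
    by (rule span_eqI[of Y Z]) (use assms in simp_all)
qed (use assms in simp_all)

lemma span_assoc_natural:
  assumes "is_span_cell E \<alpha>" "is_span_cell E \<beta>" "is_span_cell E \<gamma>" "side0 \<alpha> = side1 \<beta>" "side0 \<beta> = side1 \<gamma>"
  shows "span_assoc E (sc_cod \<alpha>) (sc_cod \<beta>) (sc_cod \<gamma>) \<cdot>\<^bsub>span_cat E\<^esub> span_ccomp E (span_ccomp E \<alpha> \<beta>) \<gamma>
    = span_ccomp E \<alpha> (span_ccomp E \<beta> \<gamma>) \<cdot>\<^bsub>span_cat E\<^esub> span_assoc E (sc_dom \<alpha>) (sc_dom \<beta>) (sc_dom \<gamma>)"
  by (rule span_assoc_eqI[of _ _ "sc_cod \<alpha>" "sc_cod \<beta>" "sc_cod \<gamma>"])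
     (use assms span_ccomp_map(6,7)[OF assms(1,2,4)] span_ccomp_map(6,7)[OF assms(2,3,5)] in
       \<open>simp_all add: span_ccomp_pr span_assoc_norm\<close>)

text \<open>Both sides are arrows into an iterated pullback and agree because their four
  projections, to the apexes of W, Z, Y and X, agree.\<close>

lemma span_pentagon:
  assumes "is_span E X" "is_span E Y" "is_span E Z" "is_span E W" "Cod E (leg0 X) = Cod E (leg1 Y)"
    "Cod E (leg0 Y) = Cod E (leg1 Z)" "Cod E (leg0 Z) = Cod E (leg1 W)"
  shows "span_ccomp E (span_id X) (span_assoc E Y Z W) \<cdot>\<^bsub>span_cat E\<^esub> (span_assoc E X (span_hcomp E Y Z) W
      \<cdot>\<^bsub>span_cat E\<^esub> span_ccomp E (span_assoc E X Y Z) (span_id W))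
    = span_assoc E X Y (span_hcomp E Z W) \<cdot>\<^bsub>span_cat E\<^esub> span_assoc E (span_hcomp E X Y) Z W" (is "?L = ?R")
proof (rule span_ccomp_eqI[of _ _ X "span_hcomp E Y (span_hcomp E Z W)"])
  let ?ZW = "span_hcomp E Z W"
  let ?YZW = "span_hcomp E Y (span_hcomp E Z W)"
  show 1: "is_span_cell E ?L" "is_span_cell E ?R" using assms by simp_all
  show "span_pr2 E X ?YZW \<cdot> sc_map ?L = span_pr2 E X ?YZW \<cdot> sc_map ?R"
  proof (rule span_eqI[of Y ?ZW])
    show "span_pr2 E Y ?ZW \<cdot> (span_pr2 E X ?YZW \<cdot> sc_map ?L) = span_pr2 E Y ?ZW \<cdot> (span_pr2 E X ?YZW \<cdot> sc_map ?R)"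
      by (rule span_eqI[of Z W])
        (use assms in \<open>simp_all add: span_ccomp_pr span_assoc_norm\<close>)
  qed (use assms in \<open>simp_all add: span_ccomp_pr span_assoc_norm\<close>)
qed (use assms in \<open>simp_all add: span_ccomp_pr span_assoc_norm\<close>)

theorem double_category_Span_dbl: "double_category (Span_dbl E)"
proof -
  have S: "cat_functor (HCat (Span_dbl E)) (VCat (Span_dbl E)) (Src (Span_dbl E))"
    and T: "cat_functor (HCat (Span_dbl E)) (VCat (Span_dbl E)) (Tgt (Span_dbl E))"
    by (rule cat_functorI; simp add: category_axioms SC.category_axioms)+
  show ?thesis
  proof (rule double_category.intro)
    show "cat_functor (composable_cat (Span_dbl E)) (HCat (Span_dbl E)) (hcomp_fct (Span_dbl E))"
    proof (rule cat_functorI)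
      fix f g assume "f \<in> Ar (composable_cat (Span_dbl E))" "g \<in> Ar (composable_cat (Span_dbl E))"
        "Dom (composable_cat (Span_dbl E)) g = Cod (composable_cat (Span_dbl E)) f"
      then show "onA (hcomp_fct (Span_dbl E)) (g \<cdot>\<^bsub>composable_cat (Span_dbl E)\<^esub> f)
        = onA (hcomp_fct (Span_dbl E)) g \<cdot>\<^bsub>HCat (Span_dbl E)\<^esub> onA (hcomp_fct (Span_dbl E)) f"
        by (cases f; cases g) (simp add: span_ccomp_comp)
    next
      fix A assume "A \<in> Ob (composable_cat (Span_dbl E))"
      then show "onA (hcomp_fct (Span_dbl E)) (Idt (composable_cat (Span_dbl E)) A) = cell_id (Span_dbl E) (onO (hcomp_fct (Span_dbl E)) A)"
        using span_ccomp_id[of "fst A" "snd A"] by (cases A) simp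
    qed (auto simp: composable_cat_category[OF S T] SC.category_axioms)
  next
    fix M N P assume "(M, N) \<in> Ob (composable_cat (Span_dbl E))" "(N, P) \<in> Ob (composable_cat (Span_dbl E))"
    then show "Assoc (Span_dbl E) M N P \<in> globular (Span_dbl E) (HComp (Span_dbl E) (HComp (Span_dbl E) M N) P)
        (HComp (Span_dbl E) M (HComp (Span_dbl E) N P))"
      and "is_iso (HCat (Span_dbl E)) (Assoc (Span_dbl E) M N P)"
      by (simp_all add: globular_Span_dbl span_assoc_iso)
  next
    fix M assume M: "M \<in> HOb (Span_dbl E)"
    show "LUnit (Span_dbl E) M \<in> globular (Span_dbl E) (HComp (Span_dbl E) (hunit (Span_dbl E) (htgt (Span_dbl E) M)) M) M"
      and "RUnit (Span_dbl E) M \<in> globular (Span_dbl E) (HComp (Span_dbl E) M (hunit (Span_dbl E) (hsrc (Span_dbl E) M))) M"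
      using M span_lunit_iso(1)[of M] span_runit_iso(1)[of M] unit_pr[of M] by (simp_all add: globular_Span_dbl)
    \<comment> \<open>The unit cells stay folded here, so that the facts stated for
      \<open>LUnit (Span_dbl E)\<close> and \<open>RUnit (Span_dbl E)\<close> match.\<close>
    show "is_iso (HCat (Span_dbl E)) (LUnit (Span_dbl E) M)" "is_iso (HCat (Span_dbl E)) (RUnit (Span_dbl E) M)"
      using M span_lunit_iso(2)[of M] span_runit_iso(2)[of M] by (simp_all del: Span_dbl_simps(12,13))
  next
    fix \<alpha> M M' assume "\<alpha> \<in> hom (HCat (Span_dbl E)) M M'"
    then have a: "is_span_cell E \<alpha>" "sc_dom \<alpha> = M" "sc_cod \<alpha> = M'" "is_span E M" "is_span E M'" by auto
    note u = span_unit_cell[of "side1 \<alpha>"] span_unit_cell[of "side0 \<alpha>"]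
    show "LUnit (Span_dbl E) M' \<bullet>\<^bsub>Span_dbl E\<^esub> CComp (Span_dbl E) (cunit (Span_dbl E) (ctgt (Span_dbl E) \<alpha>)) \<alpha>
      = \<alpha> \<bullet>\<^bsub>Span_dbl E\<^esub> LUnit (Span_dbl E) M"
      "RUnit (Span_dbl E) M' \<bullet>\<^bsub>Span_dbl E\<^esub> CComp (Span_dbl E) \<alpha> (cunit (Span_dbl E) (csrc (Span_dbl E) \<alpha>))
      = \<alpha> \<bullet>\<^bsub>Span_dbl E\<^esub> RUnit (Span_dbl E) M"
      by (rule span_cell_eqI; use a u unit_pr[of M] in \<open>simp add: span_ccomp_pr\<close>)+
  next
    fix M N P Q assume "(M, N) \<in> Ob (composable_cat (Span_dbl E))" "(N, P) \<in> Ob (composable_cat (Span_dbl E))"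
      "(P, Q) \<in> Ob (composable_cat (Span_dbl E))"
    then show "CComp (Span_dbl E) (cell_id (Span_dbl E) M) (Assoc (Span_dbl E) N P Q) \<bullet>\<^bsub>Span_dbl E\<^esub> Assoc (Span_dbl E) M (HComp (Span_dbl E) N P) Q \<bullet>\<^bsub>Span_dbl E\<^esub>
        CComp (Span_dbl E) (Assoc (Span_dbl E) M N P) (cell_id (Span_dbl E) Q)
      = Assoc (Span_dbl E) M N (HComp (Span_dbl E) P Q) \<bullet>\<^bsub>Span_dbl E\<^esub> Assoc (Span_dbl E) (HComp (Span_dbl E) M N) P Q"
      using span_pentagon[of M N P Q] by simp
  next
    fix M N assume "(M, N) \<in> Ob (composable_cat (Span_dbl E))"
    then have a: "is_span E M" "is_span E N" "Cod E (leg0 M) = Cod E (leg1 N)" by auto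
    let ?U = "span_unit E (Cod E (leg1 N))"
    have l: "is_span_cell E (span_globular_cell E (span_hcomp E ?U N) N (span_pr2 E ?U N))"
      "is_span_cell E (span_globular_cell E (span_hcomp E M ?U) M (span_pr1 E M ?U))"
      using span_lunit_iso(1)[of N] span_runit_iso(1)[of M] a by simp_all
    have p: "leg0 M \<cdot> span_pr1 E M ?U = span_pr2 E M ?U" using unit_pr(2)[of M] a by simp
    note q = unit_pr(1)[of N]
    show "CComp (Span_dbl E) (cell_id (Span_dbl E) M) (LUnit (Span_dbl E) N) \<bullet>\<^bsub>Span_dbl E\<^esub> Assoc (Span_dbl E) M (hunit (Span_dbl E) (hsrc (Span_dbl E) M)) N
      = CComp (Span_dbl E) (RUnit (Span_dbl E) M) (cell_id (Span_dbl E) N)"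
      by (rule span_ccomp_eqI[of _ _ M N])
        (use a l p q in \<open>simp_all add: span_ccomp_pr span_assoc_norm\<close>)
  qed (use S T in \<open>auto simp: category_axioms SC.category_axioms span_hunit_functor span_assoc_natural simp del: Span_dbl_simps(12,13)\<close>)
qed

lemma span_LUnit_hcomp:
  assumes "is_span E M" "is_span E N" "Cod E (leg0 M) = Cod E (leg1 N)"
  shows "LUnit (Span_dbl E) (span_hcomp E M N) \<cdot>\<^bsub>span_cat E\<^esub> span_assoc E (span_unit E (Cod E (leg1 M))) M N
    = span_ccomp E (LUnit (Span_dbl E) M) (span_id N)"
  by (rule span_ccomp_eqI[of _ _ M N])
    (use assms span_lunit_iso(1)[of M] span_lunit_iso(1)[of "span_hcomp E M N"] unit_pr[of M] unit_pr[of "span_hcomp E M N"]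
       in \<open>simp_all add: span_ccomp_pr span_assoc_norm\<close>)

lemma span_RUnit_hcomp:
  assumes "is_span E M" "is_span E N" "Cod E (leg0 M) = Cod E (leg1 N)"
  shows "span_ccomp E (span_id M) (RUnit (Span_dbl E) N) \<cdot>\<^bsub>span_cat E\<^esub> span_assoc E M N (span_unit E (Cod E (leg0 N)))
    = RUnit (Span_dbl E) (span_hcomp E M N)"
  by (rule span_ccomp_eqI[of _ _ M N])
    (use assms span_runit_iso(1)[of N] span_runit_iso(1)[of "span_hcomp E M N"] unit_pr[of N] unit_pr[of "span_hcomp E M N"]
       in \<open>simp_all add: span_ccomp_pr span_assoc_norm\<close>)

end

section \<open>Slices and stable reflexive coequalizers\<close>

context category
begin

lemma slice_simps [simp]:
  "p \<in> Ob (slice C B) \<longleftrightarrow> p \<in> Ar C \<and> Cod C p = B"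
  "(p, p', k) \<in> Ar (slice C B) \<longleftrightarrow> p \<in> Ar C \<and> Cod C p = B \<and> p' \<in> Ar C \<and> Cod C p' = B \<and>
     k \<in> Ar C \<and> Dom C k = Dom C p \<and> Cod C k = Dom C p' \<and> p' \<cdot> k = p"
  "Dom (slice C B) (p, p', k) = p" "Cod (slice C B) (p, p', k) = p'"
  "Idt (slice C B) p = (p, p, Idt C (Dom C p))"
  "Comp (slice C B) (p1, p2, l) (p, p', k) = (p, p2, l \<cdot> k)"
  by (auto simp: slice_def)

lemma category_slice: "category (slice C B)"
proof
  fix f X Y g Z assume "f \<in> hom (slice C B) X Y" "g \<in> hom (slice C B) Y Z"
  then show "Comp (slice C B) g f \<in> hom (slice C B) X Z"
    by (cases f; cases g) (auto simp flip: assoc)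
qed (auto simp: split_paired_all)

lemma slice_iso:
  assumes "is_iso (slice C B) (p, p', k)"
  shows "is_iso C k"
proof -
  interpret S: category "slice C B" by (rule category_slice)
  obtain g where g: "(p, p', k) \<in> Ar (slice C B)" "g \<in> Ar (slice C B)" "Dom (slice C B) g = p'" "Cod (slice C B) g = p"
    "Comp (slice C B) g (p, p', k) = Idt (slice C B) p" "Comp (slice C B) (p, p', k) g = Idt (slice C B) p'"
    using S.is_isoE[OF assms] by auto
  obtain l where l: "g = (p', p, l)" using g(3,4) by (cases g) simp
  show ?thesis by (rule is_isoI[where g = l]) (use g l in auto)
qed

text \<open>A factorization in the base category is automatically an arrow of the slice: its
  triangle with the structure arrows commutes because \<open>q\<close> is epi.\<close>

lemma slice_coequalizer:
  assumes q: "is_coequalizer C f g q" and l: "l \<in> Ar C" "Dom C l = Cod C q" "Cod C l = B"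
    and p: "p = l \<cdot> q" and r: "r = p \<cdot> f"
  shows "is_coequalizer (slice C B) (r, p, f) (r, p, g) (p, l, q)"
proof -
  interpret S: category "slice C B" by (rule category_slice)
  note D = is_coequalizerD[OF q]
  have pA: "p \<in> Ar C" "Dom C p = Cod C f" "Cod C p = B" using D l p by simp_all
  have rA: "r \<in> Ar C" "Dom C r = Dom C f" "Cod C r = B" using D pA r by simp_all
  have pg: "p \<cdot> g = r" using D l by (simp add: p r)
  show ?thesis
  proof (rule S.is_coequalizerI)
    have "h = k" if hk: "h \<in> Ar (slice C B)" "k \<in> Ar (slice C B)" "Dom (slice C B) h = l" "Dom (slice C B) k = l"
      "Comp (slice C B) h (p, l, q) = Comp (slice C B) k (p, l, q)" for h k
    proof -
      obtain z h' where h: "h = (l, z, h')" using hk(3) by (cases h) simp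
      obtain z' k' where k: "k = (l, z', k')" using hk(4) by (cases k) simp
      have "h' = k'" by (rule epiD[OF coequalizer_epi[OF q]]) (use hk h k l in auto)
      then show ?thesis using hk h k by auto
    qed
    then show "S.epi (p, l, q)" using pA l D p by (auto simp: S.epi_def)
    fix h assume h: "h \<in> Ar (slice C B)" "Dom (slice C B) h = Cod (slice C B) (r, p, f)"
      "Comp (slice C B) h (r, p, f) = Comp (slice C B) h (r, p, g)"
    obtain z h' where e: "h = (p, z, h')" using h(2) by (cases h) simp
    have h': "h' \<in> Ar C" "Dom C h' = Cod C f" "h' \<cdot> f = h' \<cdot> g" "z \<in> Ar C" "Cod C z = B" "Cod C h' = Dom C z" "z \<cdot> h' = p"
      using h e pA by auto
    note k = coequalizer_factor[OF q h'(1-3)]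
    have "z \<cdot> factor C q h' = l"
      by (rule epiD[OF coequalizer_epi[OF q]]) (use k h' l D p in simp_all)
    then show "\<exists>k\<in>Ar (slice C B). Dom (slice C B) k = Cod (slice C B) (p, l, q) \<and> Comp (slice C B) k (p, l, q) = h"
      using k h' l D e by (intro bexI[of _ "(l, z, factor C q h')"]) auto
  qed (use D l pA rA pg p r in auto)
qed

text \<open>Reflexivity provides a coequalizer in the base category, which lifts to the slice. The
  given slice coequalizer is isomorphic to the lift, and an isomorphism of the slice is one of the
  base.\<close>

lemma slice_coequalizerD:
  assumes rc: "has_reflexive_coequalizers C" and fg: "reflexive_pair C f g"
    and c: "is_coequalizer (slice C B) (r, p, f) (r, p, g) (p, l, q)"
  shows "is_coequalizer C f g q"
proof -
  interpret S: category "slice C B" by (rule category_slice)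
  note D = S.is_coequalizerD[OF c, simplified]
  obtain q0 where q0: "is_coequalizer C f g q0" using rc fg by (auto simp: has_reflexive_coequalizers_def)
  note D0 = is_coequalizerD[OF q0]
  have pf: "p \<cdot> f = p \<cdot> g" "p \<in> Ar C" "Dom C p = Cod C f" "Cod C p = B" using D by auto
  note k = coequalizer_factor[OF q0 pf(2,3,1)]
  have "is_coequalizer (slice C B) (r, p, f) (r, p, g) (p, factor C q0 p, q0)"
    by (rule slice_coequalizer[OF q0]) (use k pf D in auto)
  note u = S.coequalizer_unique[OF this c]
  obtain a b m where m: "factor (slice C B) (p, factor C q0 p, q0) (p, l, q) = (a, b, m)" by (cases "factor (slice C B) (p, factor C q0 p, q0) (p, l, q)")
  have i: "is_iso C m" using u(1) unfolding m by (rule slice_iso)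
  have e: "m \<cdot> q0 = q" using u(2) unfolding m by simp
  have d: "Dom C m = Cod C q0" using u(1,3) k S.is_iso_arr[OF u(1)] unfolding m by simp
  show ?thesis using coequalizer_iso_post[OF q0 i d] e by simp
qed

end

section \<open>Reflexive coequalizers under pullback, and their form for spans\<close>

locale stable_category = pullback_category +
  assumes reflexive_coequalizers: "has_reflexive_coequalizers E"
    and stable: "h \<in> Ar E \<Longrightarrow> preserves_reflexive_coequalizers (slice E (Cod E h)) (slice E (Dom E h)) (pullback_functor E h)"
begin

text \<open>The structure arrows \<open>l\<close>, \<open>p\<close> and \<open>r\<close> place the
  fork in the slice over the codomain of \<open>h\<close>. The pullback functor takes it to a
  coequalizer over the domain of \<open>h\<close>, and \<open>slice_coequalizerD\<close> returns it
  to \<open>E\<close>, which is possible because the pulled back pair is still reflexive.\<close>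

lemma pullback_coequalizer_right:
  assumes fg: "reflexive_pair E f g" and q: "is_coequalizer E f g q" and h: "h \<in> Ar E"
    and l: "l \<in> Ar E" "Dom E l = Cod E q" "Cod E l = Cod E h" and p: "p = l \<cdot> q" and r: "r = p \<cdot> f"
  shows "is_coequalizer E (pb_med E h p (pb1 E h r) (f \<cdot> pb2 E h r)) (pb_med E h p (pb1 E h r) (g \<cdot> pb2 E h r))
    (pb_med E h l (pb1 E h p) (q \<cdot> pb2 E h p))"
proof -
  note D = is_coequalizerD[OF q]
  obtain s where s: "s \<in> Ar E" "Dom E s = Cod E f" "Cod E s = Dom E f" "f \<cdot> s = Idt E (Cod E f)" "g \<cdot> s = Idt E (Cod E f)"
    using fg by (auto simp: reflexive_pair_def)
  have pA: "p \<in> Ar E" "Dom E p = Cod E f" "Cod E p = Cod E h" using D l p by simp_all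
  have rA: "r \<in> Ar E" "Dom E r = Dom E f" "Cod E r = Cod E h" using D pA r by simp_all
  have pg: "p \<cdot> g = r" using D l by (simp add: p r)
  have sl: "(p, r, s) \<in> Ar (slice E (Cod E h))" using pA rA s D by (simp add: r)
  have "reflexive_pair (slice E (Cod E h)) (r, p, f) (r, p, g)"
    unfolding reflexive_pair_def using pA rA r pg D s by (auto simp: r intro!: bexI[of _ "(p, r, s)"])
  then have c: "is_coequalizer (slice E (Dom E h)) (onA (pullback_functor E h) (r, p, f)) (onA (pullback_functor E h) (r, p, g))
    (onA (pullback_functor E h) (p, l, q))"
    using stable[OF h] slice_coequalizer[OF q l p r] unfolding preserves_reflexive_coequalizers_def by blast
  have pf: "p \<cdot> f = r" by (simp add: r)
  note pc = pb_commutes[of h r] pb_commutes[of h p]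
  have m: "pb_med E h p (pb1 E h r) (x \<cdot> pb2 E h r) \<in> Ar E"
    "Dom E (pb_med E h p (pb1 E h r) (x \<cdot> pb2 E h r)) = Dom E (pb1 E h r)"
    "Cod E (pb_med E h p (pb1 E h r) (x \<cdot> pb2 E h r)) = Dom E (pb1 E h p)"
    "pb1 E h p \<cdot> pb_med E h p (pb1 E h r) (x \<cdot> pb2 E h r) = pb1 E h r"
    "pb2 E h p \<cdot> pb_med E h p (pb1 E h r) (x \<cdot> pb2 E h r) = x \<cdot> pb2 E h r"
    if "x \<in> Ar E" "Dom E x = Dom E f" "Cod E x = Cod E f" "p \<cdot> x = r" for x
    using pb_med[of h p "pb1 E h r" "x \<cdot> pb2 E h r"] that h pA rA pc comp_tail[OF that(4), of "pb2 E h r"] by simp_all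
  note mf = m[OF D(1) refl refl pf] and mg = m[OF D(2-4) pg]
  \<comment> \<open>The common section, pulled back along \<open>h\<close>.\<close>
  let ?s = "pb_med E h r (pb1 E h p) (s \<cdot> pb2 E h p)"
  have rs: "r \<cdot> s = p" using pA s D by (simp add: r)
  have ms: "?s \<in> Ar E" "Dom E ?s = Dom E (pb1 E h p)" "Cod E ?s = Dom E (pb1 E h r)" "pb1 E h r \<cdot> ?s = pb1 E h p"
    "pb2 E h r \<cdot> ?s = s \<cdot> pb2 E h p"
    using pb_med[of h r "pb1 E h p" "s \<cdot> pb2 E h p"] h pA rA s pc comp_tail[OF rs, of "pb2 E h p"] D by simp_all
  have id: "pb_med E h p (pb1 E h r) (x \<cdot> pb2 E h r) \<cdot> ?s = Idt E (Dom E (pb1 E h p))"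
    if x: "x \<in> Ar E" "Dom E x = Dom E f" "Cod E x = Cod E f" "p \<cdot> x = r" "x \<cdot> s = Idt E (Cod E f)" for x
    by (rule pb_eqI[of h p])
      (use h pA rA x(1-3) m(1-3)[OF x(1-4)] ms(1-3) s(1-3) comp_tail[OF m(4)[OF x(1-4)], of ?s] comp_tail[OF m(5)[OF x(1-4)], of ?s]
         ms(4,5) comp_tail[OF x(5), of "pb2 E h p"] in simp_all)
  have sh: "?s \<in> hom E (Dom E (pb1 E h p)) (Dom E (pb1 E h r))"
    unfolding in_hom_iff by (intro conjI ms(1-3))
  have "reflexive_pair E (pb_med E h p (pb1 E h r) (f \<cdot> pb2 E h r)) (pb_med E h p (pb1 E h r) (g \<cdot> pb2 E h r))"
    unfolding reflexive_pair_def in_hom_iff mf(2,3) mg(2,3)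
    by (intro conjI bexI[OF _ sh] mf(1) mg(1) refl id[OF D(1) refl refl pf s(4)] id[OF D(2-4) pg s(5)])
  moreover have "is_coequalizer (slice E (Dom E h)) (pb1 E h r, pb1 E h p, pb_med E h p (pb1 E h r) (f \<cdot> pb2 E h r))
    (pb1 E h r, pb1 E h p, pb_med E h p (pb1 E h r) (g \<cdot> pb2 E h r)) (pb1 E h p, pb1 E h l, pb_med E h l (pb1 E h p) (q \<cdot> pb2 E h p))"
    using c by (simp only: pullback_functor_def fct.simps prod.case)
  ultimately show ?thesis by (rule slice_coequalizerD[OF reflexive_coequalizers])
qed

text \<open>Chosen pullbacks are symmetric only up to isomorphism. The pullback functor keeps its
  fixed arrow in the first argument, whereas whiskering of spans on the left keeps it in the
  second.\<close>

definition pb_swap where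
  "pb_swap f g = pb_med E g f (pb2 E f g) (pb1 E f g)"

lemma pb_swap_simps:
  assumes "f \<in> Ar E" "g \<in> Ar E" "Cod E f = Cod E g"
  shows "pb_swap f g \<in> Ar E" "Dom E (pb_swap f g) = Dom E (pb1 E f g)" "Cod E (pb_swap f g) = Dom E (pb1 E g f)"
    "pb1 E g f \<cdot> pb_swap f g = pb2 E f g" "pb2 E g f \<cdot> pb_swap f g = pb1 E f g"
  using pb_med[of g f "pb2 E f g" "pb1 E f g"] pb_commutes[OF assms] assms by (simp_all add: pb_swap_def)

lemma pb_swap_inv:
  assumes "f \<in> Ar E" "g \<in> Ar E" "Cod E f = Cod E g"
  shows "pb_swap g f \<cdot> pb_swap f g = Idt E (Dom E (pb1 E f g))"
proof (rule pb_eqI[of f g])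
  note s = pb_swap_simps[OF assms] and s' = pb_swap_simps[OF assms(2,1) assms(3)[symmetric]]
  show "pb1 E f g \<cdot> (pb_swap g f \<cdot> pb_swap f g) = pb1 E f g \<cdot> Idt E (Dom E (pb1 E f g))"
    "pb2 E f g \<cdot> (pb_swap g f \<cdot> pb_swap f g) = pb2 E f g \<cdot> Idt E (Dom E (pb1 E f g))"
    using comp_tail[OF s'(4), of "pb_swap f g"] comp_tail[OF s'(5), of "pb_swap f g"] s s'(1-3) assms by simp_all
qed (use assms pb_swap_simps[OF assms] pb_swap_simps[OF assms(2,1) assms(3)[symmetric]] in simp_all)

lemma pb_swap_iso:
  assumes "f \<in> Ar E" "g \<in> Ar E" "Cod E f = Cod E g"
  shows "is_iso E (pb_swap f g)"
  by (rule is_isoI[where g = "pb_swap g f"])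
     (use pb_swap_simps[OF assms] pb_swap_simps[OF assms(2,1) assms(3)[symmetric]]
        pb_swap_inv[OF assms] pb_swap_inv[OF assms(2,1) assms(3)[symmetric]] in simp_all)

text \<open>The last equation is naturality of the swap with respect to arrows \<open>x\<close> over
  the common codomain.\<close>

lemma pb_swap_med:
  assumes h: "h \<in> Ar E" and p: "p \<in> Ar E" "Cod E p = Cod E h" and r: "r \<in> Ar E" "Cod E r = Cod E h"
    and x: "x \<in> Ar E" "Dom E x = Dom E r" "Cod E x = Dom E p" "p \<cdot> x = r"
  shows "pb_med E p h (x \<cdot> pb1 E r h) (pb2 E r h) \<in> Ar E"
    "Dom E (pb_med E p h (x \<cdot> pb1 E r h) (pb2 E r h)) = Dom E (pb1 E r h)"
    "Cod E (pb_med E p h (x \<cdot> pb1 E r h) (pb2 E r h)) = Dom E (pb1 E p h)"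
    "pb_med E h p (pb1 E h r) (x \<cdot> pb2 E h r) \<in> Ar E"
    "Dom E (pb_med E h p (pb1 E h r) (x \<cdot> pb2 E h r)) = Dom E (pb1 E h r)"
    "Cod E (pb_med E h p (pb1 E h r) (x \<cdot> pb2 E h r)) = Dom E (pb1 E h p)"
    "pb_swap p h \<cdot> pb_med E p h (x \<cdot> pb1 E r h) (pb2 E r h) = pb_med E h p (pb1 E h r) (x \<cdot> pb2 E h r) \<cdot> pb_swap r h"
proof -
  let ?m = "pb_med E p h (x \<cdot> pb1 E r h) (pb2 E r h)" and ?m' = "pb_med E h p (pb1 E h r) (x \<cdot> pb2 E h r)"
  have "p \<cdot> (x \<cdot> pb1 E r h) = h \<cdot> pb2 E r h" "h \<cdot> pb1 E h r = p \<cdot> (x \<cdot> pb2 E h r)"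
    using comp_tail[OF x(4), of "pb1 E r h"] comp_tail[OF x(4), of "pb2 E h r"] pb_commutes[of r h] pb_commutes[of h r] h p r x by simp_all
  then have m: "?m \<in> Ar E" "Dom E ?m = Dom E (pb1 E r h)" "Cod E ?m = Dom E (pb1 E p h)" "pb1 E p h \<cdot> ?m = x \<cdot> pb1 E r h" "pb2 E p h \<cdot> ?m = pb2 E r h"
    "?m' \<in> Ar E" "Dom E ?m' = Dom E (pb1 E h r)" "Cod E ?m' = Dom E (pb1 E h p)" "pb1 E h p \<cdot> ?m' = pb1 E h r" "pb2 E h p \<cdot> ?m' = x \<cdot> pb2 E h r"
    using pb_med[of p h "x \<cdot> pb1 E r h" "pb2 E r h"] pb_med[of h p "pb1 E h r" "x \<cdot> pb2 E h r"] h p r x by simp_all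
  then show "?m \<in> Ar E" "Dom E ?m = Dom E (pb1 E r h)" "Cod E ?m = Dom E (pb1 E p h)"
    "?m' \<in> Ar E" "Dom E ?m' = Dom E (pb1 E h r)" "Cod E ?m' = Dom E (pb1 E h p)" by simp_all
  note s = pb_swap_simps[OF p(1) h p(2)] and s' = pb_swap_simps[OF r(1) h r(2)]
  show "pb_swap p h \<cdot> ?m = ?m' \<cdot> pb_swap r h"
  proof (rule pb_eqI[of h p])
    show "pb1 E h p \<cdot> (pb_swap p h \<cdot> ?m) = pb1 E h p \<cdot> (?m' \<cdot> pb_swap r h)"
      using comp_tail[OF s(4), of ?m] comp_tail[OF m(9), of "pb_swap r h"] s s' m h p r by simp
    show "pb2 E h p \<cdot> (pb_swap p h \<cdot> ?m) = pb2 E h p \<cdot> (?m' \<cdot> pb_swap r h)"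
      using comp_tail[OF s(5), of ?m] comp_tail[OF m(10), of "pb_swap r h"] s s' m h p r x by simp
  qed (use s s' m h p r in simp_all)
qed

text \<open>Obtained from the other side by conjugating with swaps:
  \<open>coequalizer_transport\<close> treats the parallel pair and
  \<open>coequalizer_iso_post\<close> the codomain of the quotient.\<close>

lemma pullback_coequalizer_left:
  assumes fg: "reflexive_pair E f g" and q: "is_coequalizer E f g q" and h: "h \<in> Ar E"
    and l: "l \<in> Ar E" "Dom E l = Cod E q" "Cod E l = Cod E h" and p: "p = l \<cdot> q" and r: "r = p \<cdot> f"
  shows "is_coequalizer E (pb_med E p h (f \<cdot> pb1 E r h) (pb2 E r h)) (pb_med E p h (g \<cdot> pb1 E r h) (pb2 E r h))
    (pb_med E l h (q \<cdot> pb1 E p h) (pb2 E p h))"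
proof -
  note D = is_coequalizerD[OF q]
  have pA: "p \<in> Ar E" "Dom E p = Cod E f" "Cod E p = Cod E h" using D l p by simp_all
  have rA: "r \<in> Ar E" "Dom E r = Dom E f" "Cod E r = Cod E h" using D pA r by simp_all
  have pg: "p \<cdot> g = r" using D l by (simp add: p r)
  have pf: "p \<cdot> f = r" by (simp add: r)
  note sf = pb_swap_med[OF h pA(1,3) rA(1,3), of f] and sg = pb_swap_med[OF h pA(1,3) rA(1,3), of g]
    and sq = pb_swap_med[OF h l(1,3) pA(1,3), of q]
  note s1 = pb_swap_simps[OF rA(1) h rA(3)] and s2 = pb_swap_simps[OF pA(1) h pA(3)] and s3 = pb_swap_simps[OF l(1) h l(3)]
    and s4 = pb_swap_simps[OF h l(1) l(3)[symmetric]]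
  let ?q = "pb_med E h l (pb1 E h p) (q \<cdot> pb2 E h p)" and ?q' = "pb_med E l h (q \<cdot> pb1 E p h) (pb2 E p h)"
  have c: "is_coequalizer E (pb_med E p h (f \<cdot> pb1 E r h) (pb2 E r h)) (pb_med E p h (g \<cdot> pb1 E r h) (pb2 E r h)) (?q \<cdot> pb_swap p h)"
    by (rule coequalizer_transport[OF pullback_coequalizer_right[OF fg q h l p r] pb_swap_iso[OF rA(1) h rA(3)] _ pb_swap_iso[OF pA(1) h pA(3)]])
      (use sf[OF D(1) _ _ pf] sg[OF D(2) _ _ pg] D(1-6) rA pA s1 s2 in simp_all)
  have "is_coequalizer E (pb_med E p h (f \<cdot> pb1 E r h) (pb2 E r h)) (pb_med E p h (g \<cdot> pb1 E r h) (pb2 E r h)) (pb_swap h l \<cdot> (?q \<cdot> pb_swap p h))"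
    by (rule coequalizer_iso_post[OF c pb_swap_iso]) (use h l s4 sq[OF D(5) _ _ p[symmetric]] D(1-6) pA s2 in simp_all)
  also have "pb_swap h l \<cdot> (?q \<cdot> pb_swap p h) = ?q'"
    using sq[OF D(5) _ _ p[symmetric]] D(1-6) pA l comp_tail[OF pb_swap_inv[OF l(1) h l(3)], of ?q'] s3 s4 by simp
  finally show ?thesis .
qed

lemma span_globularD:
  assumes "q \<in> globular (Span_dbl E) X Q"
  shows "is_span_cell E q" "sc_dom q = X" "sc_cod q = Q" "side0 q = Idt E (Cod E (leg0 X))" "side1 q = Idt E (Cod E (leg1 X))"
    "is_span E X" "is_span E Q" "Cod E (leg0 Q) = Cod E (leg0 X)" "Cod E (leg1 Q) = Cod E (leg1 X)"
    "sc_map q \<in> Ar E" "Dom E (sc_map q) = apex X" "Cod E (sc_map q) = apex Q"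
    "leg0 Q \<cdot> sc_map q = leg0 X" "leg1 Q \<cdot> sc_map q = leg1 X"
proof -
  show q: "is_span_cell E q" "sc_dom q = X" "sc_cod q = Q" "side0 q = Idt E (Cod E (leg0 X))" "side1 q = Idt E (Cod E (leg1 X))"
    using assms by (auto simp: globular_Span_dbl)
  note s = is_span_cell_simps[OF q(1)] is_span_cell_laws[OF q(1)]
  show X: "is_span E X" "is_span E Q" using s q by auto
  show "Cod E (leg0 Q) = Cod E (leg0 X)" "Cod E (leg1 Q) = Cod E (leg1 X)"
    using s(5,8) unfolding q(3-5) using X by simp_all
  show "sc_map q \<in> Ar E" "Dom E (sc_map q) = apex X" "Cod E (sc_map q) = apex Q"
    "leg0 Q \<cdot> sc_map q = leg0 X" "leg1 Q \<cdot> sc_map q = leg1 X"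
    using s unfolding q(2-5) using X by simp_all
qed

text \<open>Since \<open>q\<close> has identity sides, a cell factored through it keeps its own
  sides and only the map between apexes must be factored. The universal property therefore holds for
  cells with arbitrary sides; the leg equations of the factorization follow by cancelling
  \<open>q\<close>.\<close>

lemma span_coequalizerI:
  assumes f: "f \<in> globular (Span_dbl E) R X" and g: "g \<in> globular (Span_dbl E) R X" and q: "q \<in> globular (Span_dbl E) X Q"
    and c: "is_coequalizer E (sc_map f) (sc_map g) (sc_map q)"
  shows "is_coequalizer (span_cat E) f g q"
proof (rule SC.is_coequalizerI)
  note F = span_globularD[OF f] and G = span_globularD[OF g] and Q = span_globularD[OF q]
  note D = is_coequalizerD[OF c]
  show "SC.epi q"
    unfolding SC.epi_def
  proof (intro conjI ballI impI)
    fix h k assume a: "h \<in> Ar (span_cat E)" "k \<in> Ar (span_cat E)" "Dom (span_cat E) h = Cod (span_cat E) q"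
      "Dom (span_cat E) k = Cod (span_cat E) q" "Cod (span_cat E) h = Cod (span_cat E) k" "h \<cdot>\<^bsub>span_cat E\<^esub> q = k \<cdot>\<^bsub>span_cat E\<^esub> q"
    have e: "side0 h \<cdot> side0 q = side0 k \<cdot> side0 q" "side1 h \<cdot> side1 q = side1 k \<cdot> side1 q" "sc_map h \<cdot> sc_map q = sc_map k \<cdot> sc_map q"
      using a(6) by (metis span_cat_simps(8-10))+
    show "h = k"
    proof (rule span_cell_eqI)
      show "side0 h = side0 k" "side1 h = side1 k" using e(1,2) a(1-4) Q by simp_all
      show "sc_map h = sc_map k" by (rule epiD[OF coequalizer_epi[OF c] e(3)]) (use a Q in simp_all)
    qed (use a in simp_all)
  qed (use Q in simp)
  show "q \<cdot>\<^bsub>span_cat E\<^esub> f = q \<cdot>\<^bsub>span_cat E\<^esub> g"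
    by (rule span_cell_eqI) (use F G Q D in simp_all)
  fix h assume a: "h \<in> Ar (span_cat E)" "Dom (span_cat E) h = Cod (span_cat E) f" "h \<cdot>\<^bsub>span_cat E\<^esub> f = h \<cdot>\<^bsub>span_cat E\<^esub> g"
  have h: "is_span_cell E h" "sc_dom h = X" using a F by auto
  have e: "sc_map h \<cdot> sc_map f = sc_map h \<cdot> sc_map g" using a(3) by (metis span_cat_simps(10))
  note k = coequalizer_factor[OF c is_span_cell_simps(9)[OF h(1)] _ e]
  let ?k = "factor E (sc_map q) (sc_map h)" and ?Z = "sc_cod h"
  have k': "?k \<in> Ar E" "Dom E ?k = apex Q" "Cod E ?k = apex ?Z" "?k \<cdot> sc_map q = sc_map h"
    using k h F Q by simp_all
  note l = is_span_cell_laws[OF h(1)]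
  have 0: "leg0 ?Z \<cdot> ?k = side0 h \<cdot> leg0 Q"
    by (rule epiD[OF coequalizer_epi[OF c]]) (use k' h Q l in simp_all)
  have 1: "leg1 ?Z \<cdot> ?k = side1 h \<cdot> leg1 Q"
    by (rule epiD[OF coequalizer_epi[OF c]]) (use k' h Q l in simp_all)
  have cell: "is_span_cell E (SpanCell Q ?Z (side0 h) (side1 h) ?k)"
    by (rule is_span_cellI) (use k' h Q 0 1 in simp_all)
  have "SpanCell Q ?Z (side0 h) (side1 h) ?k \<cdot>\<^bsub>span_cat E\<^esub> q = h"
    by (rule span_cell_eqI) (use h Q k' in simp_all)
  then show "\<exists>k\<in>Ar (span_cat E). Dom (span_cat E) k = Cod (span_cat E) q \<and> k \<cdot>\<^bsub>span_cat E\<^esub> q = h"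
    using cell Q by (intro bexI[of _ "SpanCell Q ?Z (side0 h) (side1 h) ?k"]) simp_all
qed (use span_globularD[OF f] span_globularD[OF g] span_globularD[OF q] in simp_all)

lemma span_reflexive_pair:
  assumes "reflexive_globular_pair (Span_dbl E) R X f g"
  shows "f \<in> globular (Span_dbl E) R X" "g \<in> globular (Span_dbl E) R X" "reflexive_pair E (sc_map f) (sc_map g)"
proof -
  show f: "f \<in> globular (Span_dbl E) R X" and g: "g \<in> globular (Span_dbl E) R X"
    using assms by (auto simp: reflexive_globular_pair_def)
  obtain s where s: "s \<in> globular (Span_dbl E) X R" "f \<cdot>\<^bsub>span_cat E\<^esub> s = Idt (span_cat E) X" "g \<cdot>\<^bsub>span_cat E\<^esub> s = Idt (span_cat E) X"
    using assms by (auto simp: reflexive_globular_pair_def)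
  have "sc_map f \<cdot> sc_map s = Idt E (apex X)" "sc_map g \<cdot> sc_map s = Idt E (apex X)"
    using arg_cong[OF s(2), of sc_map] arg_cong[OF s(3), of sc_map] by simp_all
  then show "reflexive_pair E (sc_map f) (sc_map g)"
    using span_globularD(10-12)[OF f] span_globularD(10-12)[OF g] span_globularD(10-12)[OF s(1)]
    by (auto simp: reflexive_pair_def intro!: bexI[of _ "sc_map s"])
qed

text \<open>The legs of \<open>X\<close> coequalize the two apex maps because the cells are
  globular; they therefore descend to the coequalizer of the apex maps and turn it into a
  span.\<close>

lemma span_coequalizer_ex:
  assumes "reflexive_globular_pair (Span_dbl E) R X f g"
  obtains q Q where "q \<in> globular (Span_dbl E) X Q" "is_coequalizer E (sc_map f) (sc_map g) (sc_map q)"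
    "is_coequalizer (span_cat E) f g q"
proof -
  note r = span_reflexive_pair[OF assms]
  note F = span_globularD[OF r(1)] and G = span_globularD[OF r(2)]
  obtain q where q: "is_coequalizer E (sc_map f) (sc_map g) q"
    using reflexive_coequalizers r(3) by (auto simp: has_reflexive_coequalizers_def)
  note D = is_coequalizerD[OF q]
  have e: "leg0 X \<cdot> sc_map f = leg0 X \<cdot> sc_map g" "leg1 X \<cdot> sc_map f = leg1 X \<cdot> sc_map g" using F G by simp_all
  have X: "leg0 X \<in> Ar E" "leg1 X \<in> Ar E" "Dom E (leg0 X) = Cod E (sc_map f)" "Dom E (leg1 X) = Cod E (sc_map f)"
    using F by simp_all
  note k0 = coequalizer_factor[OF q X(1,3) e(1)] and k1 = coequalizer_factor[OF q X(2,4) e(2)]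
  let ?Q = "Span (Cod E q) (factor E q (leg0 X)) (factor E q (leg1 X))"
  have Q: "is_span E ?Q" using k0 k1 by (simp add: is_span_def)
  let ?q = "SpanCell X ?Q (Idt E (Cod E (leg0 X))) (Idt E (Cod E (leg1 X))) q"
  have "is_span_cell E ?q" by (rule is_span_cellI) (use Q F D k0 k1 in simp_all)
  then have g: "?q \<in> globular (Span_dbl E) X ?Q" by (simp add: globular_Span_dbl)
  show thesis by (rule that[OF g]) (use q span_coequalizerI[OF r(1,2) g] in simp_all)
qed

text \<open>A coequalizer lifted from \<open>E\<close> differs from \<open>q\<close> by an
  invertible cell, whose apex map is invertible in \<open>E\<close> and carries the coequalizer
  property over to \<open>sc_map q\<close>.\<close>

lemma span_coequalizerD:
  assumes r: "reflexive_globular_pair (Span_dbl E) R X f g" and q: "q \<in> globular (Span_dbl E) X Q"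
    and c: "is_coequalizer (span_cat E) f g q"
  shows "is_coequalizer E (sc_map f) (sc_map g) (sc_map q)"
proof -
  obtain q0 Q0 where q0: "q0 \<in> globular (Span_dbl E) X Q0" "is_coequalizer E (sc_map f) (sc_map g) (sc_map q0)"
    "is_coequalizer (span_cat E) f g q0" using span_coequalizer_ex[OF r] by blast
  note u = SC.coequalizer_unique[OF q0(3) c]
  let ?k = "factor (span_cat E) q0 q"
  obtain l where l: "is_span_cell E ?k" "is_span_cell E l" "sc_dom l = sc_cod ?k" "sc_cod l = sc_dom ?k"
    "l \<cdot>\<^bsub>span_cat E\<^esub> ?k = Idt (span_cat E) (sc_dom ?k)" "?k \<cdot>\<^bsub>span_cat E\<^esub> l = Idt (span_cat E) (sc_cod ?k)"
    using SC.is_isoE[OF u(1)] by auto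
  have "is_iso E (sc_map ?k)"
  proof (rule is_isoI[where g = "sc_map l"])
    show "sc_map l \<cdot> sc_map ?k = Idt E (Dom E (sc_map ?k))" "sc_map ?k \<cdot> sc_map l = Idt E (Cod E (sc_map ?k))"
      using arg_cong[OF l(5), of sc_map] arg_cong[OF l(6), of sc_map] l(1) by simp_all
  qed (use l(1-4) in simp_all)
  moreover have "sc_map ?k \<cdot> sc_map q0 = sc_map q" using arg_cong[OF u(2), of sc_map] by simp
  moreover have "Dom E (sc_map ?k) = Cod E (sc_map q0)" using u(3) l(1) span_globularD[OF q0(1)] by simp
  ultimately show ?thesis using coequalizer_iso_post[OF q0(2), of "sc_map ?k"] by simp
qed

lemma quotient_Span_dbl: "quotient_double_category (Span_dbl E)"
proof -
  interpret Sp: double_category "Span_dbl E" by (rule double_category_Span_dbl)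
  show ?thesis
  proof unfold_locales
    fix M N assume "M \<in> HOb (Span_dbl E)" "N \<in> HOb (Span_dbl E)" "hsrc (Span_dbl E) M = htgt (Span_dbl E) N"
    then show "LUnit (Span_dbl E) (HComp (Span_dbl E) M N) \<bullet>\<^bsub>Span_dbl E\<^esub> Assoc (Span_dbl E) (hunit (Span_dbl E) (htgt (Span_dbl E) M)) M N
      = CComp (Span_dbl E) (LUnit (Span_dbl E) M) (cell_id (Span_dbl E) N)"
      "CComp (Span_dbl E) (cell_id (Span_dbl E) M) (RUnit (Span_dbl E) N) \<bullet>\<^bsub>Span_dbl E\<^esub> Assoc (Span_dbl E) M N (hunit (Span_dbl E) (hsrc (Span_dbl E) N))
      = RUnit (Span_dbl E) (HComp (Span_dbl E) M N)"
      using span_LUnit_hcomp[of M N] span_RUnit_hcomp[of M N] by simp_all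
  next
    fix R X f g assume "reflexive_globular_pair (Span_dbl E) R X f g"
    then obtain q Q where "q \<in> globular (Span_dbl E) X Q" "is_coequalizer (span_cat E) f g q"
      by (rule span_coequalizer_ex)
    moreover from this have "Q = Cod (HCat (Span_dbl E)) q" by (simp add: globular_Span_dbl)
    ultimately show "\<exists>q. q \<in> globular (Span_dbl E) X (Cod (HCat (Span_dbl E)) q) \<and> is_coequalizer (HCat (Span_dbl E)) f g q"
      by auto
  next
    fix R X f g q Q Y
    assume r: "reflexive_globular_pair (Span_dbl E) R X f g" and q: "q \<in> globular (Span_dbl E) X Q"
      and c: "is_coequalizer (HCat (Span_dbl E)) f g q" and Y: "Y \<in> HOb (Span_dbl E)"
    note rr = span_reflexive_pair[OF r]
    note F = span_globularD[OF rr(1)] and G = span_globularD[OF rr(2)] and Q = span_globularD[OF q]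
    have ce: "is_coequalizer E (sc_map f) (sc_map g) (sc_map q)" using span_coequalizerD[OF r q] c by simp
    have Ys: "is_span E Y" using Y by simp
    {
      \<comment> \<open>Whiskering with \<open>Y\<close> on the left pulls \<open>leg1\<close> of
        the varying span back along \<open>leg0 Y\<close>, and the varying leg is the first argument
        of the pullback.\<close>
      assume h: "hsrc (Span_dbl E) Y = htgt (Span_dbl E) X"
      have g1: "span_ccomp E (span_id Y) x \<in> globular (Span_dbl E) (span_hcomp E Y A) (span_hcomp E Y B)"
        if "x \<in> globular (Span_dbl E) A B" "Cod E (leg1 A) = Cod E (leg1 X)" for x A B
        using span_globularD[OF that(1)] that Ys h by (simp add: globular_Span_dbl)
      have m: "sc_map (span_ccomp E (span_id Y) x) = pb_med E (leg1 B) (leg0 Y) (sc_map x \<cdot> pb1 E (leg1 A) (leg0 Y)) (pb2 E (leg1 A) (leg0 Y))"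
        if "x \<in> globular (Span_dbl E) A B" "Cod E (leg1 A) = Cod E (leg1 X)" for x A B
        using span_globularD(2,3,6)[OF that(1)] that(2) Ys h
        by (simp add: span_ccomp_def Let_def span_pair_def span_pr1_def span_pr2_def)
      have "is_coequalizer E (pb_med E (leg1 X) (leg0 Y) (sc_map f \<cdot> pb1 E (leg1 R) (leg0 Y)) (pb2 E (leg1 R) (leg0 Y)))
        (pb_med E (leg1 X) (leg0 Y) (sc_map g \<cdot> pb1 E (leg1 R) (leg0 Y)) (pb2 E (leg1 R) (leg0 Y)))
        (pb_med E (leg1 Q) (leg0 Y) (sc_map q \<cdot> pb1 E (leg1 X) (leg0 Y)) (pb2 E (leg1 X) (leg0 Y)))"
        by (rule pullback_coequalizer_left[OF rr(3) ce]) (use F(14) Q(7,9,12,14) Ys h in simp_all)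
      then have "is_coequalizer E (sc_map (span_ccomp E (span_id Y) f)) (sc_map (span_ccomp E (span_id Y) g)) (sc_map (span_ccomp E (span_id Y) q))"
        by (simp add: m[OF rr(1) F(9)[symmetric]] m[OF rr(2) F(9)[symmetric]] m[OF q refl])
      then show "is_coequalizer (HCat (Span_dbl E)) (CComp (Span_dbl E) (cell_id (Span_dbl E) Y) f)
        (CComp (Span_dbl E) (cell_id (Span_dbl E) Y) g) (CComp (Span_dbl E) (cell_id (Span_dbl E) Y) q)"
        using span_coequalizerI[OF g1[OF rr(1) F(9)[symmetric]] g1[OF rr(2) F(9)[symmetric]] g1[OF q refl]] by simp
    }
    {
      \<comment> \<open>Whiskering on the right pulls \<open>leg0\<close> of the varying span back
        along \<open>leg1 Y\<close>; now the varying leg is the second argument.\<close>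
      assume h: "hsrc (Span_dbl E) X = htgt (Span_dbl E) Y"
      have g1: "span_ccomp E x (span_id Y) \<in> globular (Span_dbl E) (span_hcomp E A Y) (span_hcomp E B Y)"
        if "x \<in> globular (Span_dbl E) A B" "Cod E (leg0 A) = Cod E (leg0 X)" for x A B
        using span_globularD[OF that(1)] that Ys h by (simp add: globular_Span_dbl)
      have m: "sc_map (span_ccomp E x (span_id Y)) = pb_med E (leg1 Y) (leg0 B) (pb1 E (leg1 Y) (leg0 A)) (sc_map x \<cdot> pb2 E (leg1 Y) (leg0 A))"
        if "x \<in> globular (Span_dbl E) A B" "Cod E (leg0 A) = Cod E (leg0 X)" for x A B
        using span_globularD(2,3,6)[OF that(1)] that(2) Ys h
        by (simp add: span_ccomp_def Let_def span_pair_def span_pr1_def span_pr2_def)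
      have "is_coequalizer E (pb_med E (leg1 Y) (leg0 X) (pb1 E (leg1 Y) (leg0 R)) (sc_map f \<cdot> pb2 E (leg1 Y) (leg0 R)))
        (pb_med E (leg1 Y) (leg0 X) (pb1 E (leg1 Y) (leg0 R)) (sc_map g \<cdot> pb2 E (leg1 Y) (leg0 R)))
        (pb_med E (leg1 Y) (leg0 Q) (pb1 E (leg1 Y) (leg0 X)) (sc_map q \<cdot> pb2 E (leg1 Y) (leg0 X)))"
        by (rule pullback_coequalizer_right[OF rr(3) ce]) (use F(13) Q(7,8,12,13) Ys h in simp_all)
      then have "is_coequalizer E (sc_map (span_ccomp E f (span_id Y))) (sc_map (span_ccomp E g (span_id Y))) (sc_map (span_ccomp E q (span_id Y)))"
        by (simp add: m[OF rr(1) F(8)[symmetric]] m[OF rr(2) F(8)[symmetric]] m[OF q refl])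
      then show "is_coequalizer (HCat (Span_dbl E)) (CComp (Span_dbl E) f (cell_id (Span_dbl E) Y))
        (CComp (Span_dbl E) g (cell_id (Span_dbl E) Y)) (CComp (Span_dbl E) q (cell_id (Span_dbl E) Y))"
        using span_coequalizerI[OF g1[OF rr(1) F(8)[symmetric]] g1[OF rr(2) F(8)[symmetric]] g1[OF q refl]] by simp
    }
  qed
qed

end

section \<open>Products and reflexive coequalizers\<close>

locale finitely_complete_stable_category = stable_category +
  fixes t assumes terminal: "is_terminal E t"
begin

definition bang where "bang A = (SOME m. m \<in> hom E A t)"
text \<open>Products are taken as pullbacks over the terminal object, so that stability of
  coequalizers under pullback applies to them directly.\<close>

definition pr where "pr A B = pb1 E (bang A) (bang B)"
definition pr' where "pr' A B = pb2 E (bang A) (bang B)"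
definition obj where "obj A B = Dom E (pr A B)"
definition pair where "pair u v = pb_med E (bang (Cod E u)) (bang (Cod E v)) u v"

lemma bang_simps [simp]:
  assumes "A \<in> Ob E" shows "bang A \<in> Ar E" "Dom E (bang A) = A" "Cod E (bang A) = t"
proof -
  have "\<exists>m. m \<in> hom E A t" using is_terminalD(3)[OF terminal assms] by auto
  from someI_ex[OF this] show "bang A \<in> Ar E" "Dom E (bang A) = A" "Cod E (bang A) = t" by (simp_all add: bang_def)
qed

lemma bang_unique:
  assumes "x \<in> Ar E" "Cod E x = A" "Dom E x = B"
  shows "bang A \<cdot> x = bang B"
proof -
  have "A \<in> Ob E" "B \<in> Ob E" using assms by auto
  then show ?thesis by (intro is_terminalD(2)[OF terminal]) (use assms in simp_all)
qed

lemma pr_simps [simp]: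
  assumes "A \<in> Ob E" "B \<in> Ob E"
  shows "pr A B \<in> Ar E" "Dom E (pr A B) = obj A B" "Cod E (pr A B) = A"
    "pr' A B \<in> Ar E" "Dom E (pr' A B) = obj A B" "Cod E (pr' A B) = B" "obj A B \<in> Ob E"
  using assms dom_ob[of "pr A B"] by (simp_all add: pr_def pr'_def obj_def)

lemma pair_simps [simp]:
  assumes "u \<in> Ar E" "v \<in> Ar E" "Dom E u = Dom E v"
  shows "pair u v \<in> Ar E" "Dom E (pair u v) = Dom E v" "Cod E (pair u v) = obj (Cod E u) (Cod E v)"
    "Cod E u = A \<Longrightarrow> Cod E v = B \<Longrightarrow> pr A B \<cdot> pair u v = u"
    "Cod E u = A \<Longrightarrow> Cod E v = B \<Longrightarrow> pr' A B \<cdot> pair u v = v"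
  using pb_med[of "bang (Cod E u)" "bang (Cod E v)" u v] assms bang_unique[of u] bang_unique[of v]
  by (auto simp: pair_def pr_def pr'_def obj_def)

lemma pair_tail [simp]:
  assumes "u \<in> Ar E" "v \<in> Ar E" "Dom E u = Dom E v" "Cod E u = A" "Cod E v = B" "x \<in> Ar E" "Dom E v = Cod E x"
  shows "pr A B \<cdot> (pair u v \<cdot> x) = u \<cdot> x" "pr' A B \<cdot> (pair u v \<cdot> x) = v \<cdot> x"
proof -
  have o: "A \<in> Ob E" "B \<in> Ob E" using assms by auto
  show "pr A B \<cdot> (pair u v \<cdot> x) = u \<cdot> x" "pr' A B \<cdot> (pair u v \<cdot> x) = v \<cdot> x"
    using comp_tail[OF pair_simps(4)[OF assms(1-5)], of x] comp_tail[OF pair_simps(5)[OF assms(1-5)], of x] assms o by simp_all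
qed

lemma pair_eqI:
  assumes "A \<in> Ob E" "B \<in> Ob E" "h \<in> Ar E" "k \<in> Ar E" "Cod E h = obj A B" "Cod E k = obj A B" "Dom E h = Dom E k"
    "pr A B \<cdot> h = pr A B \<cdot> k" "pr' A B \<cdot> h = pr' A B \<cdot> k"
  shows "h = k"
  by (rule pb_eqI[of "bang A" "bang B"]) (use assms in \<open>simp_all add: pr_def pr'_def obj_def\<close>)

lemma is_product_obj:
  assumes "A \<in> Ob E" "B \<in> Ob E"
  shows "is_product E A B (obj A B) (pr A B) (pr' A B)"
proof (rule is_productI)
  fix f g assume "f \<in> Ar E" "g \<in> Ar E" "Dom E f = Dom E g" "Cod E f = A" "Cod E g = B"
  then show "\<exists>m\<in>Ar E. Dom E m = Dom E g \<and> Cod E m = obj A B \<and> pr A B \<cdot> m = f \<and> pr' A B \<cdot> m = g"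
    by (intro bexI[of _ "pair f g"]) auto
qed (use assms pair_eqI in auto)

definition times where "times u v = pair (u \<cdot> pr (Dom E u) (Dom E v)) (v \<cdot> pr' (Dom E u) (Dom E v))"

lemma times_simps [simp]:
  assumes "u \<in> Ar E" "v \<in> Ar E"
  shows "times u v \<in> Ar E" "Dom E (times u v) = obj (Dom E u) (Dom E v)" "Cod E (times u v) = obj (Cod E u) (Cod E v)"
    "Cod E u = A \<Longrightarrow> Cod E v = B \<Longrightarrow> pr A B \<cdot> times u v = u \<cdot> pr (Dom E u) (Dom E v)"
    "Cod E u = A \<Longrightarrow> Cod E v = B \<Longrightarrow> pr' A B \<cdot> times u v = v \<cdot> pr' (Dom E u) (Dom E v)"
  using assms by (simp_all add: times_def)

lemma times_comp:
  assumes "u \<in> Ar E" "v \<in> Ar E" "u' \<in> Ar E" "v' \<in> Ar E" "Dom E u' = Cod E u" "Dom E v' = Cod E v"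
  shows "times u' v' \<cdot> times u v = times (u' \<cdot> u) (v' \<cdot> v)"
  by (rule pair_eqI[of "Cod E u'" "Cod E v'"]) (use assms in \<open>simp_all add: times_def\<close>)

text \<open>The product with a fixed \<open>W\<close> is pullback along \<open>bang W\<close>, with
  the arrows to the terminal object as structure arrows of the fork.\<close>

lemma times_coequalizer_right:
  assumes fg: "reflexive_pair E f g" and q: "is_coequalizer E f g q" and W: "W \<in> Ob E"
  shows "is_coequalizer E (times (Idt E W) f) (times (Idt E W) g) (times (Idt E W) q)"
proof -
  note D = is_coequalizerD[OF q]
  have b: "bang (Cod E f) = bang (Cod E q) \<cdot> q" "bang (Dom E f) = bang (Cod E f) \<cdot> f"
    using bang_unique[of q] bang_unique[of f] D by simp_all
  show ?thesis
    using pullback_coequalizer_right[OF fg q, of "bang W" "bang (Cod E q)" "bang (Cod E f)" "bang (Dom E f)", OF _ _ _ _ b] D W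
    by (simp add: times_def pair_def pr_def pr'_def)
qed

lemma times_coequalizer_left:
  assumes fg: "reflexive_pair E f g" and q: "is_coequalizer E f g q" and W: "W \<in> Ob E"
  shows "is_coequalizer E (times f (Idt E W)) (times g (Idt E W)) (times q (Idt E W))"
proof -
  note D = is_coequalizerD[OF q]
  have b: "bang (Cod E f) = bang (Cod E q) \<cdot> q" "bang (Dom E f) = bang (Cod E f) \<cdot> f"
    using bang_unique[of q] bang_unique[of f] D by simp_all
  show ?thesis
    using pullback_coequalizer_left[OF fg q, of "bang W" "bang (Cod E q)" "bang (Cod E f)" "bang (Dom E f)", OF _ _ _ _ b] D W
    by (simp add: times_def pair_def pr_def pr'_def)
qed

text \<open>The sections make a map that coequalizes \<^term>\<open>times f f'\<close> and \<^term>\<open>times g g'\<close> coequalize each of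
  the two pairs separately, so that it can be factored in one variable after the other.\<close>

lemma times_coequalizer:
  assumes fg: "reflexive_pair E f g" and q: "is_coequalizer E f g q"
    and fg': "reflexive_pair E f' g'" and q': "is_coequalizer E f' g' q'"
  shows "is_coequalizer E (times f f') (times g g') (times q q')"
proof -
  note D = is_coequalizerD[OF q] and D' = is_coequalizerD[OF q']
  let ?X = "Cod E f" and ?R = "Dom E f" and ?X' = "Cod E f'" and ?R' = "Dom E f'" and ?Q = "Cod E q"
  obtain s where s: "s \<in> Ar E" "Dom E s = ?X" "Cod E s = ?R" "f \<cdot> s = Idt E ?X" "g \<cdot> s = Idt E ?X"
    using fg by (auto simp: reflexive_pair_def)
  obtain s' where s': "s' \<in> Ar E" "Dom E s' = ?X'" "Cod E s' = ?R'" "f' \<cdot> s' = Idt E ?X'" "g' \<cdot> s' = Idt E ?X'"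
    using fg' by (auto simp: reflexive_pair_def)
  have o: "?X' \<in> Ob E" "?R' \<in> Ob E" "?Q \<in> Ob E" using D D' by auto
  note c1 = times_coequalizer_left[OF fg q o(1)] and c2 = times_coequalizer_left[OF fg q o(2)]
    and c3 = times_coequalizer_right[OF fg' q' o(3)]
  have qq: "times q q' = times (Idt E ?Q) q' \<cdot> times q (Idt E ?X')"
    using D D' by (simp add: times_comp)
  show ?thesis
  proof (rule is_coequalizerI)
    show "epi (times q q')"
      unfolding qq by (rule epi_comp[OF coequalizer_epi[OF c1] coequalizer_epi[OF c3]]) (use D D' in simp_all)
    show "times q q' \<cdot> times f f' = times q q' \<cdot> times g g'" using D D' by (simp add: times_comp)
    fix h assume h: "h \<in> Ar E" "Dom E h = Cod E (times f f')" "h \<cdot> times f f' = h \<cdot> times g g'"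
    have hd: "Dom E h = obj ?X ?X'" using h D D' by simp
    have t1: "times f (Idt E ?X') = times f f' \<cdot> times (Idt E ?R) s'" "times g (Idt E ?X') = times g g' \<cdot> times (Idt E ?R) s'"
      "times (Idt E ?X) f' = times f f' \<cdot> times s (Idt E ?R')" "times (Idt E ?X) g' = times g g' \<cdot> times s (Idt E ?R')"
      using D D' s s' by (simp_all add: times_comp)
    have e1: "h \<cdot> times f (Idt E ?X') = h \<cdot> times g (Idt E ?X')"
      unfolding t1 using comp_tail[OF h(3), of "times (Idt E ?R) s'"] D D' s s' h(1) hd by simp
    have e2: "h \<cdot> times (Idt E ?X) f' = h \<cdot> times (Idt E ?X) g'"
      unfolding t1 using comp_tail[OF h(3), of "times s (Idt E ?R')"] D D' s s' h(1) hd by simp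
    obtain k where k: "k \<in> Ar E" "Dom E k = obj ?Q ?X'" "k \<cdot> times q (Idt E ?X') = h"
      using coequalizer_factor[OF c1 h(1) _ e1] hd D D' by simp
    have "k \<cdot> times (Idt E ?Q) f' = k \<cdot> times (Idt E ?Q) g'"
    proof (rule epiD[OF coequalizer_epi[OF c2]])
      have "(k \<cdot> times (Idt E ?Q) x) \<cdot> times q (Idt E ?R') = h \<cdot> times (Idt E ?X) x"
        if "x \<in> Ar E" "Dom E x = ?R'" "Cod E x = ?X'" for x
        using comp_tail[OF k(3), of "times (Idt E ?X) x"] that k(1,2) D D' by (simp add: times_comp)
      then show "(k \<cdot> times (Idt E ?Q) f') \<cdot> times q (Idt E ?R') = (k \<cdot> times (Idt E ?Q) g') \<cdot> times q (Idt E ?R')"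
        using e2 D D' by simp
    qed (use k D D' in simp_all)
    then obtain l where l: "l \<in> Ar E" "Dom E l = obj ?Q (Cod E q')" "l \<cdot> times (Idt E ?Q) q' = k"
      using coequalizer_factor[OF c3 k(1)] k(2) D D' by simp
    have "l \<cdot> times q q' = h" unfolding qq using comp_tail[OF l(3), of "times q (Idt E ?X')"] k l(1,2) D D' by simp
    then show "\<exists>k\<in>Ar E. Dom E k = Cod E (times q q') \<and> k \<cdot> times q q' = h"
      using l D D' by (intro bexI[of _ l]) simp_all
  qed (use D D' in simp_all)
qed

end

section \<open>Products of spans\<close>

context finitely_complete_stable_category
begin

text \<open>Spans are diagrams and cells are natural transformations between them, so products are
  computed separately at both ends and at the apex.\<close>

lemma span_productI:
  assumes a: "is_span_cell E a" "sc_dom a = P" "sc_cod a = X" and b: "is_span_cell E b" "sc_dom b = P" "sc_cod b = Y"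
    and p0: "is_product E (Cod E (leg0 X)) (Cod E (leg0 Y)) (Cod E (leg0 P)) (side0 a) (side0 b)"
    and p1: "is_product E (Cod E (leg1 X)) (Cod E (leg1 Y)) (Cod E (leg1 P)) (side1 a) (side1 b)"
    and pm: "is_product E (apex X) (apex Y) (apex P) (sc_map a) (sc_map b)"
  shows "is_product (span_cat E) X Y P a b"
proof (rule SC.is_productI)
  have s: "is_span E P" "is_span E X" "is_span E Y" using is_span_cell_simps(1,2)[OF a(1)] is_span_cell_simps(2)[OF b(1)] a b by simp_all
  note la = is_span_cell_laws[OF a(1), unfolded a(2,3)] and lb = is_span_cell_laws[OF b(1), unfolded b(2,3)]
  fix f g assume fg: "f \<in> Ar (span_cat E)" "g \<in> Ar (span_cat E)" "Dom (span_cat E) f = Dom (span_cat E) g"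
    "Cod (span_cat E) f = X" "Cod (span_cat E) g = Y"
  let ?Z = "sc_dom g"
  have f: "is_span_cell E f" "sc_cod f = X" "sc_dom f = ?Z" and g: "is_span_cell E g" "sc_cod g = Y" using fg by auto
  have Z: "is_span E ?Z" using g by simp
  note lf = is_span_cell_laws[OF f(1), unfolded f(2,3)] and lg = is_span_cell_laws[OF g(1), unfolded g(2)]
  define h0 where "h0 = prod_med E (Cod E (leg0 P)) (side0 a) (side0 b) (side0 f) (side0 g)"
  define h1 where "h1 = prod_med E (Cod E (leg1 P)) (side1 a) (side1 b) (side1 f) (side1 g)"
  define hm where "hm = prod_med E (apex P) (sc_map a) (sc_map b) (sc_map f) (sc_map g)"
  have h0: "h0 \<in> Ar E" "Dom E h0 = Cod E (leg0 ?Z)" "Cod E h0 = Cod E (leg0 P)" "side0 a \<cdot> h0 = side0 f" "side0 b \<cdot> h0 = side0 g"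
    using prod_med[OF p0, of "side0 f" "side0 g"] f g by (simp_all add: h0_def)
  have h1: "h1 \<in> Ar E" "Dom E h1 = Cod E (leg1 ?Z)" "Cod E h1 = Cod E (leg1 P)" "side1 a \<cdot> h1 = side1 f" "side1 b \<cdot> h1 = side1 g"
    using prod_med[OF p1, of "side1 f" "side1 g"] f g by (simp_all add: h1_def)
  have hm: "hm \<in> Ar E" "Dom E hm = apex ?Z" "Cod E hm = apex P" "sc_map a \<cdot> hm = sc_map f" "sc_map b \<cdot> hm = sc_map g"
    using prod_med[OF pm, of "sc_map f" "sc_map g"] f g by (simp_all add: hm_def)
  have e0: "leg0 P \<cdot> hm = h0 \<cdot> leg0 ?Z"
    by (rule prod_eqI[OF p0])
       (use s Z a b f h0 h1 hm lf lg comp_tail[OF la(1)[symmetric], of hm] comp_tail[OF lb(1)[symmetric], of hm]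
          comp_tail[OF h0(4), of "leg0 ?Z"] comp_tail[OF h0(5), of "leg0 ?Z"] in simp_all)
  have e1: "leg1 P \<cdot> hm = h1 \<cdot> leg1 ?Z"
    by (rule prod_eqI[OF p1])
       (use s Z a b f h0 h1 hm lf lg comp_tail[OF la(2)[symmetric], of hm] comp_tail[OF lb(2)[symmetric], of hm]
          comp_tail[OF h1(4), of "leg1 ?Z"] comp_tail[OF h1(5), of "leg1 ?Z"] in simp_all)
  let ?h = "SpanCell ?Z P h0 h1 hm"
  have h: "is_span_cell E ?h" by (rule is_span_cellI) (use s Z h0 h1 hm e0 e1 in simp_all)
  have "a \<cdot>\<^bsub>span_cat E\<^esub> ?h = f" "b \<cdot>\<^bsub>span_cat E\<^esub> ?h = g"
    by (rule span_cell_eqI; use a b f g h0 h1 hm in simp)+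
  then show "\<exists>m\<in>Ar (span_cat E). Dom (span_cat E) m = Dom (span_cat E) g \<and> Cod (span_cat E) m = P \<and>
      a \<cdot>\<^bsub>span_cat E\<^esub> m = f \<and> b \<cdot>\<^bsub>span_cat E\<^esub> m = g"
    using h by (intro bexI[of _ ?h]) simp_all
next
  fix h k assume h: "h \<in> Ar (span_cat E)" "k \<in> Ar (span_cat E)" "Cod (span_cat E) h = P" "Cod (span_cat E) k = P"
    "Dom (span_cat E) h = Dom (span_cat E) k" "a \<cdot>\<^bsub>span_cat E\<^esub> h = a \<cdot>\<^bsub>span_cat E\<^esub> k" "b \<cdot>\<^bsub>span_cat E\<^esub> h = b \<cdot>\<^bsub>span_cat E\<^esub> k"
  have e: "side0 a \<cdot> side0 h = side0 a \<cdot> side0 k" "side0 b \<cdot> side0 h = side0 b \<cdot> side0 k"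
    "side1 a \<cdot> side1 h = side1 a \<cdot> side1 k" "side1 b \<cdot> side1 h = side1 b \<cdot> side1 k"
    "sc_map a \<cdot> sc_map h = sc_map a \<cdot> sc_map k" "sc_map b \<cdot> sc_map h = sc_map b \<cdot> sc_map k"
    using h(6,7) by (metis span_cat_simps(8-10))+
  show "h = k"
  proof (rule span_cell_eqI)
    show "side0 h = side0 k" by (rule prod_eqI[OF p0 e(1,2)]) (use h in simp_all)
    show "side1 h = side1 k" by (rule prod_eqI[OF p1 e(3,4)]) (use h in simp_all)
    show "sc_map h = sc_map k" by (rule prod_eqI[OF pm e(5,6)]) (use h in simp_all)
  qed (use h in auto)
qed (use a b in auto)

definition span_prod where
  "span_prod R S = Span (obj (apex R) (apex S)) (times (leg0 R) (leg0 S)) (times (leg1 R) (leg1 S))"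

definition span_fst where
  "span_fst R S = SpanCell (span_prod R S) R (pr (Cod E (leg0 R)) (Cod E (leg0 S))) (pr (Cod E (leg1 R)) (Cod E (leg1 S))) (pr (apex R) (apex S))"

definition span_snd where
  "span_snd R S = SpanCell (span_prod R S) S (pr' (Cod E (leg0 R)) (Cod E (leg0 S))) (pr' (Cod E (leg1 R)) (Cod E (leg1 S))) (pr' (apex R) (apex S))"

lemma span_prod_simps [simp]:
  "apex (span_prod R S) = obj (apex R) (apex S)" "leg0 (span_prod R S) = times (leg0 R) (leg0 S)"
  "leg1 (span_prod R S) = times (leg1 R) (leg1 S)"
  "sc_dom (span_fst R S) = span_prod R S" "sc_cod (span_fst R S) = R"
  "side0 (span_fst R S) = pr (Cod E (leg0 R)) (Cod E (leg0 S))" "side1 (span_fst R S) = pr (Cod E (leg1 R)) (Cod E (leg1 S))"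
  "sc_map (span_fst R S) = pr (apex R) (apex S)"
  "sc_dom (span_snd R S) = span_prod R S" "sc_cod (span_snd R S) = S"
  "side0 (span_snd R S) = pr' (Cod E (leg0 R)) (Cod E (leg0 S))" "side1 (span_snd R S) = pr' (Cod E (leg1 R)) (Cod E (leg1 S))"
  "sc_map (span_snd R S) = pr' (apex R) (apex S)"
  by (simp_all add: span_prod_def span_fst_def span_snd_def)

lemma is_span_prod [simp]: "is_span E R \<Longrightarrow> is_span E S \<Longrightarrow> is_span E (span_prod R S)"
  unfolding is_span_def[of E "span_prod R S"] by simp

lemma is_span_cell_proj [simp]:
  assumes "is_span E R" "is_span E S"
  shows "is_span_cell E (span_fst R S)" "is_span_cell E (span_snd R S)"
  by (rule is_span_cellI; use assms in simp)+

lemma span_product: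
  assumes "is_span E R" "is_span E S"
  shows "is_product (span_cat E) R S (span_prod R S) (span_fst R S) (span_snd R S)"
  by (rule span_productI) (use assms is_product_obj in simp_all)

text \<open>Products commute with pullbacks: a pair of arrows into the two pullbacks is rearranged
  into a pair of arrows into products over the product of the middle objects. Taking
  \<open>P\<close> and \<open>Q\<close> as variables with equations keeps the product spans folded
  except where they have to be computed.\<close>

lemma span_hcomp_apex_product:
  assumes s: "is_span E M" "is_span E N" "is_span E M'" "is_span E N'"
    and cs: "Cod E (leg0 M) = Cod E (leg1 N)" "Cod E (leg0 M') = Cod E (leg1 N')"
    and P: "P = span_prod M M'" and Q: "Q = span_prod N N'"
    and a: "a \<in> Ar E" "Dom E a = apex (span_hcomp E P Q)" "Cod E a = apex (span_hcomp E M N)"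
    and b: "b \<in> Ar E" "Dom E b = apex (span_hcomp E P Q)" "Cod E b = apex (span_hcomp E M' N')"
    and pa: "span_pr2 E M N \<cdot> a = pr (apex N) (apex N') \<cdot> span_pr2 E P Q"
      "span_pr1 E M N \<cdot> a = pr (apex M) (apex M') \<cdot> span_pr1 E P Q"
    and pb: "span_pr2 E M' N' \<cdot> b = pr' (apex N) (apex N') \<cdot> span_pr2 E P Q"
      "span_pr1 E M' N' \<cdot> b = pr' (apex M) (apex M') \<cdot> span_pr1 E P Q"
  shows "is_product E (apex (span_hcomp E M N)) (apex (span_hcomp E M' N')) (apex (span_hcomp E P Q)) a b"
proof (rule is_productI)
  have PQ: "is_span E P" "is_span E Q" "Cod E (leg0 P) = Cod E (leg1 Q)" using s cs by (simp_all add: P Q)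
  have ap: "apex P = obj (apex M) (apex M')" "apex Q = obj (apex N) (apex N')" by (simp_all add: P Q)
  have o: "apex M \<in> Ob E" "apex N \<in> Ob E" "apex M' \<in> Ob E" "apex N' \<in> Ob E" using s by auto
  have e: "span_pr2 E M N \<cdot> (a \<cdot> h) = pr (apex N) (apex N') \<cdot> (span_pr2 E P Q \<cdot> h)"
    "span_pr1 E M N \<cdot> (a \<cdot> h) = pr (apex M) (apex M') \<cdot> (span_pr1 E P Q \<cdot> h)"
    "span_pr2 E M' N' \<cdot> (b \<cdot> h) = pr' (apex N) (apex N') \<cdot> (span_pr2 E P Q \<cdot> h)"
    "span_pr1 E M' N' \<cdot> (b \<cdot> h) = pr' (apex M) (apex M') \<cdot> (span_pr1 E P Q \<cdot> h)"
    if h: "h \<in> Ar E" "Cod E h = apex (span_hcomp E P Q)" for h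
    using comp_tail[OF pa(1), of h] comp_tail[OF pa(2), of h] comp_tail[OF pb(1), of h] comp_tail[OF pb(2), of h]
      a b s cs PQ h o by (simp_all add: ap)
  {
    fix f g assume fg: "f \<in> Ar E" "g \<in> Ar E" "Dom E f = Dom E g" "Cod E f = apex (span_hcomp E M N)" "Cod E g = apex (span_hcomp E M' N')"
    define x where "x = pair (span_pr1 E M N \<cdot> f) (span_pr1 E M' N' \<cdot> g)"
    define y where "y = pair (span_pr2 E M N \<cdot> f) (span_pr2 E M' N' \<cdot> g)"
    have x: "x \<in> Ar E" "Dom E x = Dom E g" "Cod E x = apex P" "pr (apex M) (apex M') \<cdot> x = span_pr1 E M N \<cdot> f"
        "pr' (apex M) (apex M') \<cdot> x = span_pr1 E M' N' \<cdot> g"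
      and y: "y \<in> Ar E" "Dom E y = Dom E g" "Cod E y = apex Q" "pr (apex N) (apex N') \<cdot> y = span_pr2 E M N \<cdot> f"
        "pr' (apex N) (apex N') \<cdot> y = span_pr2 E M' N' \<cdot> g"
      using s cs fg by (simp_all add: x_def y_def ap)
    \<comment> \<open>The legs of product spans are products of legs, so the pairings match over the
      middle object because both of their components do.\<close>
    have c: "leg1 Q \<cdot> y = leg0 P \<cdot> x"
      by (rule pair_eqI[of "Cod E (leg1 N)" "Cod E (leg1 N')"]) (use s cs fg in \<open>simp_all add: times_def P Q x_def y_def\<close>)
    note m = span_pair_simps[OF PQ y(1) x(1) trans[OF y(2) x(2)[symmetric]] y(3) x(3) c]
    define m where "m = span_pair E P Q y x"
    note m = m[folded m_def, unfolded x(2)]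
    have "a \<cdot> m = f"
      by (rule span_eqI[OF s(1,2) cs(1)]) (use a m fg x(4) y(4) e(1,2)[OF m(1,3)] in simp_all)
    moreover have "b \<cdot> m = g"
      by (rule span_eqI[OF s(3,4) cs(2)]) (use b m fg x(5) y(5) e(3,4)[OF m(1,3)] in simp_all)
    ultimately show "\<exists>m\<in>Ar E. Dom E m = Dom E g \<and> Cod E m = apex (span_hcomp E P Q) \<and> a \<cdot> m = f \<and> b \<cdot> m = g"
      using m(1-3) by blast
  next
    fix h k assume h: "h \<in> Ar E" "k \<in> Ar E" "Cod E h = apex (span_hcomp E P Q)" "Cod E k = apex (span_hcomp E P Q)"
      "Dom E h = Dom E k" "a \<cdot> h = a \<cdot> k" "b \<cdot> h = b \<cdot> k"
    note eh = e[OF h(1,3), unfolded h(6,7)] and ek = e[OF h(2,4)]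
    show "h = k"
    proof (rule span_eqI[OF PQ h(1,2,5,3,4)])
      show "span_pr2 E P Q \<cdot> h = span_pr2 E P Q \<cdot> k"
        by (rule pair_eqI[OF o(2,4) _ _ _ _ _ trans[OF eh(1)[symmetric] ek(1)] trans[OF eh(3)[symmetric] ek(3)]])
           (use h PQ ap in simp_all)
      show "span_pr1 E P Q \<cdot> h = span_pr1 E P Q \<cdot> k"
        by (rule pair_eqI[OF o(1,3) _ _ _ _ _ trans[OF eh(2)[symmetric] ek(2)] trans[OF eh(4)[symmetric] ek(4)]])
           (use h PQ ap in simp_all)
    qed
  }
qed (use a b in simp_all)

lemma span_hcomp_product:
  assumes "is_span E M" "is_span E N" "is_span E M'" "is_span E N'"
    "Cod E (leg0 M) = Cod E (leg1 N)" "Cod E (leg0 M') = Cod E (leg1 N')"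
  shows "is_product (span_cat E) (span_hcomp E M N) (span_hcomp E M' N') (span_hcomp E (span_prod M M') (span_prod N N'))
    (span_ccomp E (span_fst M M') (span_fst N N')) (span_ccomp E (span_snd M M') (span_snd N N'))"
proof (rule span_productI)
  let ?P = "span_prod M M'" and ?Q = "span_prod N N'"
  let ?a = "span_ccomp E (span_fst M M') (span_fst N N')" and ?b = "span_ccomp E (span_snd M M') (span_snd N N')"
  show a: "is_span_cell E ?a" and b: "is_span_cell E ?b" using assms by simp_all
  have pa: "span_pr2 E M N \<cdot> sc_map ?a = pr (apex N) (apex N') \<cdot> span_pr2 E ?P ?Q"
    "span_pr1 E M N \<cdot> sc_map ?a = pr (apex M) (apex M') \<cdot> span_pr1 E ?P ?Q"
    "span_pr2 E M' N' \<cdot> sc_map ?b = pr' (apex N) (apex N') \<cdot> span_pr2 E ?P ?Q"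
    "span_pr1 E M' N' \<cdot> sc_map ?b = pr' (apex M) (apex M') \<cdot> span_pr1 E ?P ?Q"
    using assms by (simp_all add: span_ccomp_pr)
  have ms: "sc_map ?a \<in> Ar E" "Dom E (sc_map ?a) = apex (span_hcomp E ?P ?Q)" "Cod E (sc_map ?a) = apex (span_hcomp E M N)"
    "sc_map ?b \<in> Ar E" "Dom E (sc_map ?b) = apex (span_hcomp E ?P ?Q)" "Cod E (sc_map ?b) = apex (span_hcomp E M' N')"
    using a b by simp_all
  show "is_product E (apex (span_hcomp E M N)) (apex (span_hcomp E M' N')) (apex (span_hcomp E ?P ?Q)) (sc_map ?a) (sc_map ?b)"
    by (rule span_hcomp_apex_product[OF assms refl refl ms pa])
qed (use assms is_product_obj in simp_all)

lemma cartesian_products_Span_dbl: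
  "cartesian_products (Span_dbl E) obj pr pr' span_prod span_fst span_snd"
proof -
  interpret Sp: double_category "Span_dbl E" by (rule double_category_Span_dbl)
  show ?thesis
  proof unfold_locales
    fix A B assume "A \<in> Ob (VCat (Span_dbl E))" "B \<in> Ob (VCat (Span_dbl E))"
    then have o: "A \<in> Ob E" "B \<in> Ob E" by auto
    have "is_product (span_cat E) (span_unit E A) (span_unit E B) (span_unit E (obj A B))
      (SpanCell (span_unit E (Dom E (pr A B))) (span_unit E (Cod E (pr A B))) (pr A B) (pr A B) (pr A B))
      (SpanCell (span_unit E (Dom E (pr' A B))) (span_unit E (Cod E (pr' A B))) (pr' A B) (pr' A B) (pr' A B))"
      by (rule span_productI[OF span_unit_cell _ _ span_unit_cell]) (use o is_product_obj[OF o] in simp_all)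
    then show "is_product (HCat (Span_dbl E)) (hunit (Span_dbl E) A) (hunit (Span_dbl E) B) (hunit (Span_dbl E) (obj A B))
      (cunit (Span_dbl E) (pr A B)) (cunit (Span_dbl E) (pr' A B))" by simp
  qed (simp_all add: is_product_obj span_product span_hcomp_product)
qed

lemma cartesian_quotient_Span_dbl:
  "cartesian_quotient_double_category (Span_dbl E) obj pr pr' span_prod span_fst span_snd t"
proof -
  interpret Q: quotient_double_category "Span_dbl E" by (rule quotient_Span_dbl)
  interpret P: cartesian_products "Span_dbl E" obj pr pr' span_prod span_fst span_snd
    by (rule cartesian_products_Span_dbl)
  show ?thesis
  proof unfold_locales
    fix R X f g q Q R' X' f' g' q' Q'
    assume r: "reflexive_globular_pair (Span_dbl E) R X f g" and q: "q \<in> globular (Span_dbl E) X Q"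
      and c: "is_coequalizer (HCat (Span_dbl E)) f g q"
      and r': "reflexive_globular_pair (Span_dbl E) R' X' f' g'" and q': "q' \<in> globular (Span_dbl E) X' Q'"
      and c': "is_coequalizer (HCat (Span_dbl E)) f' g' q'"
    note rr = span_reflexive_pair[OF r] and rr' = span_reflexive_pair[OF r']
    have ce: "is_coequalizer E (sc_map f) (sc_map g) (sc_map q)" using span_coequalizerD[OF r q] c by simp
    have ce': "is_coequalizer E (sc_map f') (sc_map g') (sc_map q')" using span_coequalizerD[OF r' q'] c' by simp
    \<comment> \<open>\<open>?t x y A A'\<close> is the product of the cells \<open>x\<close> and
      \<open>y\<close>. Its apex map is the product of their apex maps, which reduces the claim to
      \<open>times_coequalizer\<close>.\<close>
    let ?t = "\<lambda>x y A A'. P.med1 (x \<bullet>\<^bsub>Span_dbl E\<^esub> span_fst A A') (y \<bullet>\<^bsub>Span_dbl E\<^esub> span_snd A A')"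
    have t: "?t x y A A' \<in> globular (Span_dbl E) (span_prod A A') (span_prod B B')"
      "sc_map (?t x y A A') = times (sc_map x) (sc_map y)"
      if x: "x \<in> globular (Span_dbl E) A B" and y: "y \<in> globular (Span_dbl E) A' B'" for x y A A' B B'
    proof -
      note X = span_globularD[OF x] and Y = span_globularD[OF y]
      have xy: "x \<bullet>\<^bsub>Span_dbl E\<^esub> span_fst A A' \<in> Cells (Span_dbl E)" "y \<bullet>\<^bsub>Span_dbl E\<^esub> span_snd A A' \<in> Cells (Span_dbl E)"
        "Dom (HCat (Span_dbl E)) (x \<bullet>\<^bsub>Span_dbl E\<^esub> span_fst A A') = Dom (HCat (Span_dbl E)) (y \<bullet>\<^bsub>Span_dbl E\<^esub> span_snd A A')"
        using X(1-3,6) Y(1-3,6) by simp_all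
      note m = P.med1_simps(1-3)[OF xy] P.med1_simps(4,5)[OF xy refl refl] P.med1_sides[OF xy]
      have o: "Cod E (leg0 A) \<in> Ob E" "Cod E (leg1 A) \<in> Ob E" "Cod E (leg0 A') \<in> Ob E" "Cod E (leg1 A') \<in> Ob E" using X Y by auto
      have cell: "is_span_cell E (?t x y A A')" "sc_dom (?t x y A A') = span_prod A A'" "sc_cod (?t x y A A') = span_prod B B'"
        using m(1-3) X(3) Y(3) by simp_all
      have s: "side0 (?t x y A A') = Idt E (obj (Cod E (leg0 A)) (Cod E (leg0 A')))"
        "side1 (?t x y A A') = Idt E (obj (Cod E (leg1 A)) (Cod E (leg1 A')))"
        using m(6,7) X(4,5) Y(4,5) o P.med0_idt[of "Cod E (leg0 A)" "Cod E (leg0 A')"] P.med0_idt[of "Cod E (leg1 A)" "Cod E (leg1 A')"]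
        by simp_all
      show "?t x y A A' \<in> globular (Span_dbl E) (span_prod A A') (span_prod B B')"
        using cell s X(6) Y(6) by (simp add: globular_Span_dbl)
      show "sc_map (?t x y A A') = times (sc_map x) (sc_map y)"
      proof (rule pair_eqI[of "apex B" "apex B'"])
        show "pr (apex B) (apex B') \<cdot> sc_map (?t x y A A') = pr (apex B) (apex B') \<cdot> times (sc_map x) (sc_map y)"
          using arg_cong[OF m(4), of sc_map] X(3,10-12) Y(3,10-12) by simp
        show "pr' (apex B) (apex B') \<cdot> sc_map (?t x y A A') = pr' (apex B) (apex B') \<cdot> times (sc_map x) (sc_map y)"
          using arg_cong[OF m(5), of sc_map] X(3,10-12) Y(3,10-12) by simp
      qed (use cell is_span_cell_simps(9-11)[OF cell(1)] X(7,10-12) Y(7,10-12) in simp_all)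
    qed
    show "is_coequalizer (HCat (Span_dbl E)) (?t f f' R R') (?t g g' R R') (?t q q' X X')"
    proof -
      have "is_coequalizer E (sc_map (?t f f' R R')) (sc_map (?t g g' R R')) (sc_map (?t q q' X X'))"
        unfolding t(2)[OF rr(1) rr'(1)] t(2)[OF rr(2) rr'(2)] t(2)[OF q q'] by (rule times_coequalizer[OF rr(3) ce rr'(3) ce'])
      from span_coequalizerI[OF t(1)[OF rr(1) rr'(1)] t(1)[OF rr(2) rr'(2)] t(1)[OF q q'] this] show ?thesis by simp
    qed
  next
    show "is_terminal (VCat (Span_dbl E)) t" using terminal by simp
    note tt = is_terminalD[OF terminal]
    \<comment> \<open>Both ends and the apex of the unit span on \<open>t\<close> are the terminal
      object, so the two sides and the apex map of a cell into it are forced.\<close>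
    have "\<exists>!m. m \<in> hom (span_cat E) R (span_unit E t)" if "R \<in> Ob (span_cat E)" for R
    proof -
      have R: "is_span E R" using that by simp
      have o: "Cod E (leg0 R) \<in> Ob E" "Cod E (leg1 R) \<in> Ob E" using R by auto
      let ?m = "SpanCell R (span_unit E t) (bang (Cod E (leg0 R))) (bang (Cod E (leg1 R))) (bang (apex R))"
      have "is_span_cell E ?m"
        by (rule is_span_cellI) (use R o tt(1) bang_unique[of "leg0 R"] bang_unique[of "leg1 R"] in simp_all)
      moreover have "m = ?m" if m: "m \<in> hom (span_cat E) R (span_unit E t)" for m
      proof (rule span_cell_eqI)
        show "side0 m = side0 ?m" "side1 m = side1 ?m" "sc_map m = sc_map ?m"
          by (rule tt(2); use m R o tt(1) is_span_cell_simps[of m] in auto)+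
      qed (use m in simp_all)
      ultimately show ?thesis by (intro ex1I[of _ ?m]) simp_all
    qed
    then show "is_terminal (HCat (Span_dbl E)) (hunit (Span_dbl E) t)" using tt(1) by (simp add: is_terminal_def)
  qed
qed

theorem cartesian_Prof_dbl: "cartesian_double_category (Prof_dbl E)"
  unfolding Prof_dbl_def
  by (rule cartesian_quotient_double_category.cartesian_double_category_Mod_dbl[OF cartesian_quotient_Span_dbl])

end

section \<open>Pullbacks and terminal objects from finite limits\<close>

text \<open>The arrows 0, 1 and 2 are the identities of the objects with the same numbers; 3 goes
  from 0 to 2 and 4 from 1 to 2. In a composable pair at least one arrow is an identity, so the test
  \<open>g < 3\<close> decides which arrow is returned.\<close>

definition cospan_cat :: "(nat, nat) cat" where
  "cospan_cat = \<lparr>Ob = {0, 1, 2}, Ar = {0, 1, 2, 3, 4}, Dom = (\<lambda>k. if k = 3 then 0 else if k = 4 then 1 else k),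
     Cod = (\<lambda>k. if k = 3 \<or> k = 4 then 2 else k), Idt = (\<lambda>k. k), Comp = (\<lambda>g f. if g < 3 then f else g)\<rparr>"

lemma category_cospan_cat: "category cospan_cat"
  by unfold_locales (auto simp: cospan_cat_def hom_def split: if_splits)

text \<open>A cone over the cospan is a commutative square, its component at the object 2 being
  determined by the other two.\<close>

lemma (in category) pullback_of_finite_limits:
  assumes lim: "has_finite_limits C" and fg: "f \<in> Ar C" "g \<in> Ar C" "Cod C f = Cod C g"
  shows "\<exists>p q. is_pullback C f g p q"
proof -
  define F where "F = \<lparr>onO = (\<lambda>k::nat. if k = 0 then Dom C f else if k = 1 then Dom C g else Cod C f),
    onA = (\<lambda>k::nat. if k = 0 then Idt C (Dom C f) else if k = 1 then Idt C (Dom C g) else if k = 2 then Idt C (Cod C f)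
      else if k = 3 then f else g)\<rparr>"
  have F: "onO F 0 = Dom C f" "onO F 1 = Dom C g" "onO F 2 = Cod C f" "onA F 0 = Idt C (Dom C f)" "onA F 1 = Idt C (Dom C g)"
    "onA F 2 = Idt C (Cod C f)" "onA F 3 = f" "onA F 4 = g"
    by (simp_all add: F_def)
  have "cat_functor cospan_cat C F"
  proof (rule cat_functor.intro[OF category_cospan_cat category_axioms])
    fix u v X Y Z assume u: "u \<in> hom cospan_cat X Y" and v: "v \<in> hom cospan_cat Y Z"
    then have uv: "u \<in> {0, 1, 2, 3, 4}" "v \<in> {0, 1, 2, 3, 4}" "Dom cospan_cat v = Cod cospan_cat u" by (auto simp: cospan_cat_def)
    \<comment> \<open>The composable pairs are two equal identities or a leg with the identity at
      one of its ends; the two legs do not compose with each other.\<close>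
    have "(u, v) \<in> {(0, 0), (1, 1), (2, 2), (0, 3), (3, 2), (1, 4), (4, 2)}"
      using uv by (auto simp: cospan_cat_def)
    then show "onA F (v \<cdot>\<^bsub>cospan_cat\<^esub> u) = onA F v \<cdot> onA F u"
      using fg by (elim insertE emptyE) (simp_all add: cospan_cat_def F del: One_nat_def)
  next
    fix u X Y assume "u \<in> hom cospan_cat X Y"
    then have u: "u \<in> {0, 1, 2, 3, 4}" "X = Dom cospan_cat u" "Y = Cod cospan_cat u" by (auto simp: cospan_cat_def)
    from u(1) show "onA F u \<in> hom C (onO F X) (onO F Y)"
      unfolding u(2,3) using fg by (elim insertE emptyE) (simp_all add: cospan_cat_def F del: One_nat_def)
  next
    fix X assume "X \<in> Ob cospan_cat"
    then have "X \<in> {0, 1, 2}" by (simp add: cospan_cat_def)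
    then show "onO F X \<in> Ob C" "onA F (Idt cospan_cat X) = Idt C (onO F X)"
      using fg by (elim insertE emptyE; simp add: cospan_cat_def F del: One_nat_def)+
  qed
  moreover have "finite (Ob cospan_cat)" "finite (Ar cospan_cat)" by (simp_all add: cospan_cat_def)
  ultimately obtain L p where L: "is_limit cospan_cat C F L p"
    using lim unfolding has_finite_limits_def by blast
  have co: "is_cone cospan_cat C F X x \<longleftrightarrow> X \<in> Ob C \<and> x 0 \<in> hom C X (Dom C f) \<and> x 1 \<in> hom C X (Dom C g) \<and>
    x 2 \<in> hom C X (Cod C f) \<and> f \<cdot> x 0 = x 2 \<and> g \<cdot> x 1 = x 2" for X x
  proof -
    have "is_cone cospan_cat C F X x \<longleftrightarrow> X \<in> Ob C \<and> x 0 \<in> hom C X (Dom C f) \<and> x 1 \<in> hom C X (Dom C g) \<and>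
      x 2 \<in> hom C X (Cod C f) \<and> Idt C (Dom C f) \<cdot> x 0 = x 0 \<and> Idt C (Dom C g) \<cdot> x 1 = x 1 \<and>
      Idt C (Cod C f) \<cdot> x 2 = x 2 \<and> f \<cdot> x 0 = x 2 \<and> g \<cdot> x 1 = x 2"
      by (simp add: is_cone_def cospan_cat_def F conj_assoc del: One_nat_def in_hom_iff)
    then show ?thesis using comp_idt_left by blast
  qed
  have p: "p 0 \<in> hom C L (Dom C f)" "p 1 \<in> hom C L (Dom C g)" "f \<cdot> p 0 = p 2" "g \<cdot> p 1 = p 2"
    using L unfolding is_limit_def co by blast+
  have "is_pullback C f g (p 0) (p 1)"
    unfolding is_pullback_def
  proof (intro conjI allI ballI impI)
    fix X x y assume x: "x \<in> hom C X (Dom C f)" and y: "y \<in> hom C X (Dom C g)" and e: "f \<cdot> x = g \<cdot> y"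
    \<comment> \<open>The third component is the common composite of the square, as commutation with
      the two legs demands.\<close>
    let ?x = "\<lambda>k::nat. if k = 0 then x else if k = 1 then y else f \<cdot> x"
    have "is_cone cospan_cat C F X ?x" unfolding co using x y e fg dom_ob[of x] by auto
    then have "\<exists>!m. m \<in> hom C X L \<and> (\<forall>j \<in> Ob cospan_cat. p j \<cdot> m = ?x j)" using L unfolding is_limit_def by blast
    moreover have "(\<forall>j \<in> Ob cospan_cat. p j \<cdot> m = ?x j) \<longleftrightarrow> p 0 \<cdot> m = x \<and> p 1 \<cdot> m = y" if m: "m \<in> hom C X L" for m
    proof -
      have "p 2 \<cdot> m = f \<cdot> (p 0 \<cdot> m)" unfolding p(3)[symmetric] using p(1) m fg by simp
      then show ?thesis by (auto simp: cospan_cat_def)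
    qed
    moreover have "Dom C (p 0) = L" using p by simp
    ultimately show "\<exists>!m. m \<in> hom C X (Dom C (p 0)) \<and> p 0 \<cdot> m = x \<and> p 1 \<cdot> m = y" by metis
  qed (use p fg in auto)
  then show ?thesis by blast
qed

text \<open>A terminal object is a limit of the empty diagram. The empty shape has no objects or
  arrows, so the values \<open>undefined\<close> are never evaluated and every object is a
  cone.\<close>

lemma (in category) terminal_of_finite_limits:
  assumes lim: "has_finite_limits C"
  shows "\<exists>t. is_terminal C t"
proof -
  define J :: "(nat, nat) cat" where "J = \<lparr>Ob = {}, Ar = {}, Dom = id, Cod = id, Idt = id, Comp = (\<lambda>g f. f)\<rparr>"
  have J: "category J" by unfold_locales (simp_all add: J_def)
  define F :: "(nat, nat, 'o, 'a) fct" where "F = \<lparr>onO = (\<lambda>_. undefined), onA = (\<lambda>_. undefined)\<rparr>"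
  have "cat_functor J C F" by (rule cat_functorI[OF J category_axioms]) (simp_all add: J_def)
  then obtain L p where L: "is_limit J C F L p"
    using lim unfolding has_finite_limits_def by (metis J_def cat.select_convs(1,2) finite.emptyI)
  have "is_cone J C F X x \<longleftrightarrow> X \<in> Ob C" for X x by (auto simp: is_cone_def J_def)
  then have "is_terminal C L" using L by (auto simp: is_limit_def is_terminal_def J_def)
  then show ?thesis by blast
qed

theorem proposition6p2p3:
  fixes E :: "('o, 'a) cat"
  assumes "category E"
    and "has_finite_limits E"
    and "has_reflexive_coequalizers E"
    and "\<And>h. h \<in> Ar E \<Longrightarrow>
      preserves_reflexive_coequalizers (slice E (Cod E h)) (slice E (Dom E h)) (pullback_functor E h)"
  shows "cartesian_double_category (Prof_dbl E)"
proof -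
  interpret category E by (rule assms(1))
  obtain t where "is_terminal E t" using terminal_of_finite_limits[OF assms(2)] by blast
  then interpret finitely_complete_stable_category E t
    by unfold_locales (use assms pullback_of_finite_limits in auto)
  show ?thesis by (rule cartesian_Prof_dbl)
qed

end
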